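(* Let $V$ be a finite dimensional vector space over a field $k$, let $G$ be a finite group of linear automorphisms of $V$, and let $M$ be a finite dimensional $kG$-module, of dimension $m$, with a fixed basis $v_1,\dots,v_m$. Let $\lambda:G\to k^\times$ be the linear character associated to the one-dimensional $kG$-module $(\wedge^m M)^*$. (i) For any linear subspace $U\subset V$ of codimension one we have $$J_M^{G_U}=k[V]^{G_U}\cdot x_U^{e_U(M)}\subseteq k[V]^{G_U}_{\lambda_U},$$ where $\lambda_U=\lambda|_{G_U}$ and $e_U(M)$ equals the $s$-invariant $s_{k[V]^{G_U}}(k[V]^{G_U}(M))$. (ii) $F_M$ is a greatest common divisor of all the elements in $J_M^G$, and $J_M^G\subseteq k[V]\cdot F_M$. (iii) (Jacobian criterion) Let $\omega_1,\ldots,\omega_m$ be an $m$-tuple of homogeneous elements of $k[V]^G(M)$. The following three statements are equivalent. (a) The module of covariants $k[V]^G(M)$ is free over $k[V]^G$ with basis $\omega_1,\ldots,\omega_m$; (b) There is a non-zero scalar $c\in k^\times$ such that $\mathrm{Jac}_M(\omega_1,\ldots,\omega_m)=cF_M$; (c) $\sum_{i=1}^m\deg \omega_i=s_{k[V]^G}(k[V]^G(M))$ and $\mathrm{Jac}_M(\omega_1,\ldots,\omega_m)\neq 0$.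
   Context: $k$ is a field of arbitrary characteristic; $k[V]$ is the coordinate ring of $V$ (polynomial algebra on a basis of $V^*$, standard grading) with the induced $G$-action. For a subgroup $H\leq G$, $k[V]^H$ is the invariant ring and $k[V]^H(M):=(k[V]\otimes_k M)^H$ (diagonal action) is the module of covariants of type $M$, a graded $k[V]^H$-module with $M$ placed in degree $0$. For a linear character $\chi:H\to k^\times$, $k[V]^H_\chi:=\{a\in k[V]:\ \sigma(a)=\chi(\sigma)a \text{ for all }\sigma\in H\}$. Jacobian determinant: for $\omega_j=\sum_{i=1}^m a_{ij}\otimes v_i\in k[V]\otimes_k M$, $1\le j\le m$, put $\mathrm{Jac}_M(\omega_1,\dots,\omega_m):=\det(a_{ij})_{1\le i,j\le m}\in k[V]$. For a subgroup $H\leq G$, $J_M^H$ denotes the $k[V]^H$-submodule of $k[V]$ spanned by all $\mathrm{Jac}_M(\omega_1,\dots,\omega_m)$ with $\omega_1,\dots,\omega_m$ homogeneous elements of $k[V]^H(M)$. For a linear hyperplane $U\subset V$, $x_U\in V^*$ is a fixed linear form with zero set $U$, and $G_U$ is the subgroup of all elements of $G$ fixing $U$ point-wise. The module $k[V]^{G_U}(M)$ is a free graded $k[V]^{G_U}$-module; $e_U(M)$ denotes the sum of the degrees of the elements of a homogeneous basis of it. Only finitely many $U$ have $G_U\ne1$ (and $e_U(M)=0$ if $G_U=1$), so one can define $$F_M:=\prod_{U\subset V,\ \mathrm{codim}_V U=1}x_U^{e_U(M)},$$ well-defined up to a non-zero scalar. The Hilbert series of a graded module $N$ is $\mathcal H(N;t)=\sum_i\dim_k(N_i)t^i$,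 viewed as a rational function. For a finitely generated graded $k$-algebra $B$ without zero-divisors with $B_0=k$ and a finitely generated graded $B$-module $N$, the rank $r_B(N)$ and the $s$-invariant $s_B(N)$ are defined by the expansion at $t=1$: $\mathcal H(N;t)/\mathcal H(B;t)=r_B(N)+s_B(N)(t-1)+O((t-1)^2)$. *)

theory Defs
  imports
    "HOL-Library.Poly_Mapping"
    "HOL-Library.Function_Algebras"
    "HOL-Computational_Algebra.Computational_Algebra"
    "Jordan_Normal_Form.Determinant"
begin

section \<open>Polynomials\<close>

text \<open>
  Polynomials in the variables \<open>X 0, X 1, \<dots>\<close>; the coordinate ring of an \<open>n\<close>-dimensional
  space is later cut out as the set of polynomials in the first \<open>n\<close> variables.
\<close>

type_synonym 'k mpoly = "(nat \<Rightarrow>\<^sub>0 nat) \<Rightarrow>\<^sub>0 'k"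

definition pconst :: "'k \<Rightarrow> 'k::field mpoly" where
  "pconst c = Poly_Mapping.single 0 c"

definition pvar :: "nat \<Rightarrow> 'k::field mpoly" where
  "pvar i = Poly_Mapping.single (Poly_Mapping.single i 1) 1"

definition pscale :: "'k \<Rightarrow> 'k mpoly \<Rightarrow> 'k::field mpoly" where
  "pscale c p = pconst c * p"

definition psubst :: "(nat \<Rightarrow> 'k mpoly) \<Rightarrow> 'k mpoly \<Rightarrow> 'k::field mpoly" where
  "psubst s p = (\<Sum>a\<in>Poly_Mapping.keys p.
     pconst (Poly_Mapping.lookup p a) *
       (\<Prod>i\<in>Poly_Mapping.keys a. s i ^ Poly_Mapping.lookup a i))"

definition homogeneous :: "nat \<Rightarrow> 'k::field mpoly \<Rightarrow> bool" where
  "homogeneous d p \<longleftrightarrow>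
     (\<forall>a\<in>Poly_Mapping.keys p. (\<Sum>i\<in>Poly_Mapping.keys a. Poly_Mapping.lookup a i) = d)"


section \<open>Hilbert series and the s-invariant\<close>

text \<open>
  A graded vector space is given by the family of its homogeneous components \<open>N 0, N 1, \<dots>\<close>,
  which are subspaces of one ambient vector space with scalar multiplication \<open>sc\<close>.
\<close>

definition hilbert_fps :: "('k::field \<Rightarrow> 'a \<Rightarrow> 'a) \<Rightarrow> (nat \<Rightarrow> 'a::ab_group_add set) \<Rightarrow> rat fps" where
  "hilbert_fps sc N = Abs_fps (\<lambda>d. of_nat (vector_space.dim sc (N d)))"

definition hilbert_series ::
  "('k::field \<Rightarrow> 'a \<Rightarrow> 'a) \<Rightarrow> (nat \<Rightarrow> 'a::ab_group_add set) \<Rightarrow> rat poly fract" where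
  "hilbert_series sc N =
     (THE f. \<exists>p q. q \<noteq> 0 \<and> f = Fract p q \<and> fps_of_poly q * hilbert_fps sc N = fps_of_poly p)"

text \<open>\<open>expansion_at_1 f r s\<close> says \<open>f(t) = r + s (t - 1) + O((t - 1)^2)\<close>: the remainder is
  \<open>(t - 1)^2\<close> times a rational function without pole at \<open>1\<close>.\<close>

definition expansion_at_1 :: "rat poly fract \<Rightarrow> rat \<Rightarrow> rat \<Rightarrow> bool" where
  "expansion_at_1 f r s \<longleftrightarrow>
     (\<exists>p q. poly q 1 \<noteq> 0 \<and>
        f = Fract [:r:] 1 + Fract [:s:] 1 * Fract [:-1, 1:] 1 + Fract [:-1, 1:] 1 ^ 2 * Fract p q)"

definition s_invariant ::
  "('k::field \<Rightarrow> 'b \<Rightarrow> 'b) \<Rightarrow> (nat \<Rightarrow> 'b::ab_group_add set) \<Rightarrow>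
   ('k \<Rightarrow> 'a \<Rightarrow> 'a) \<Rightarrow> (nat \<Rightarrow> 'a::ab_group_add set) \<Rightarrow> rat" where
  "s_invariant scB B scN N =
     (THE s. \<exists>r. expansion_at_1 (hilbert_series scN N / hilbert_series scB B) r s)"


section \<open>Modules of covariants\<close>

text \<open>
  \<open>bs\<close> is a basis of \<open>V\<close> whose dual basis provides the variables of \<open>k[V]\<close>, \<open>vs\<close> is the fixed
  basis of \<open>M\<close>, and \<open>\<rho>\<close> is the action of \<open>G\<close> on \<open>M\<close>.
\<close>

locale covariants =
  V: vector_space scV + M: vector_space scM
  for scV :: "'k::field \<Rightarrow> 'v::ab_group_add \<Rightarrow> 'v"
    and scM :: "'k \<Rightarrow> 'm::ab_group_add \<Rightarrow> 'm" +
  fixes bs :: "'v list"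
    and G :: "('v \<Rightarrow> 'v) set"
    and vs :: "'m list"
    and \<rho> :: "('v \<Rightarrow> 'v) \<Rightarrow> 'm \<Rightarrow> 'm"
  assumes V_basis: "distinct bs" "V.independent (set bs)" "V.span (set bs) = UNIV"
    and M_basis: "distinct vs" "M.independent (set vs)" "M.span (set vs) = UNIV"
    and G_finite: "finite G"
    and G_linear: "\<And>g. g \<in> G \<Longrightarrow> Vector_Spaces.linear scV scV g"
    and G_bij: "\<And>g. g \<in> G \<Longrightarrow> bij g"
    and G_id: "id \<in> G"
    and G_comp: "\<And>g h. g \<in> G \<Longrightarrow> h \<in> G \<Longrightarrow> g \<circ> h \<in> G"
    and G_inv: "\<And>g. g \<in> G \<Longrightarrow> inv_into UNIV g \<in> G"
    and \<rho>_linear: "\<And>g. g \<in> G \<Longrightarrow> Vector_Spaces.linear scM scM (\<rho> g)"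
    and \<rho>_id: "\<rho> id = id"
    and \<rho>_comp: "\<And>g h. g \<in> G \<Longrightarrow> h \<in> G \<Longrightarrow> \<rho> (g \<circ> h) = \<rho> g \<circ> \<rho> h"
begin

definition coord_ring :: "'k mpoly set" where
  "coord_ring = {p. \<forall>a\<in>Poly_Mapping.keys p. Poly_Mapping.keys a \<subseteq> {..<length bs}}"

definition form_poly :: "('v \<Rightarrow> 'k) \<Rightarrow> 'k mpoly" where
  "form_poly l = (\<Sum>i<length bs. pconst (l (bs ! i)) * pvar i)"

text \<open>The algebra automorphism of \<open>k[V]\<close> extending \<open>l \<mapsto> l \<circ> g\<inverse>\<close> on \<open>V\<^sup>*\<close>; the variable
  \<open>pvar i\<close> is the \<open>i\<close>-th coordinate function.\<close>

definition act :: "('v \<Rightarrow> 'v) \<Rightarrow> 'k mpoly \<Rightarrow> 'k mpoly" where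
  "act g = psubst (\<lambda>i. form_poly (\<lambda>u. V.representation (set bs) (inv_into UNIV g u) (bs ! i)))"

definition inv_ring :: "('v \<Rightarrow> 'v) set \<Rightarrow> 'k mpoly set" where
  "inv_ring H = {p \<in> coord_ring. \<forall>g\<in>H. act g p = p}"

definition semi_inv :: "('v \<Rightarrow> 'v) set \<Rightarrow> (('v \<Rightarrow> 'v) \<Rightarrow> 'k) \<Rightarrow> 'k mpoly set" where
  "semi_inv H \<chi> = {p \<in> coord_ring. \<forall>g\<in>H. act g p = pconst (\<chi> g) * p}"

text \<open>The element \<open>\<Sum>i<m. a i \<otimes> vs ! i\<close> of \<open>k[V] \<otimes> M\<close> is encoded by its coefficient
  function \<open>a\<close>, with the convention \<open>a i = 0\<close> for \<open>i \<ge> m\<close>.\<close>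

definition tensor_space :: "(nat \<Rightarrow> 'k mpoly) set" where
  "tensor_space = {a. (\<forall>i<length vs. a i \<in> coord_ring) \<and> (\<forall>i\<ge>length vs. a i = 0)}"

definition tensor_act :: "('v \<Rightarrow> 'v) \<Rightarrow> (nat \<Rightarrow> 'k mpoly) \<Rightarrow> nat \<Rightarrow> 'k mpoly" where
  "tensor_act g a = (\<lambda>i. if i < length vs
     then \<Sum>j<length vs. pconst (M.representation (set vs) (\<rho> g (vs ! j)) (vs ! i)) * act g (a j)
     else 0)"

definition tensor_scale :: "'k \<Rightarrow> (nat \<Rightarrow> 'k mpoly) \<Rightarrow> nat \<Rightarrow> 'k mpoly" where
  "tensor_scale c a = (\<lambda>i. pconst c * a i)"

definition cov :: "('v \<Rightarrow> 'v) set \<Rightarrow> (nat \<Rightarrow> 'k mpoly) set" where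
  "cov H = {a \<in> tensor_space. \<forall>g\<in>H. tensor_act g a = a}"

definition inv_ring_deg :: "('v \<Rightarrow> 'v) set \<Rightarrow> nat \<Rightarrow> 'k mpoly set" where
  "inv_ring_deg H d = {p \<in> inv_ring H. homogeneous d p}"

definition cov_deg :: "('v \<Rightarrow> 'v) set \<Rightarrow> nat \<Rightarrow> (nat \<Rightarrow> 'k mpoly) set" where
  "cov_deg H d = {a \<in> cov H. \<forall>i<length vs. homogeneous d (a i)}"

definition hom_cov :: "('v \<Rightarrow> 'v) set \<Rightarrow> (nat \<Rightarrow> 'k mpoly) set" where
  "hom_cov H = (\<Union>d. cov_deg H d)"

text \<open>The degree of a homogeneous element. The zero element, homogeneous of every degree, is
  given degree \<open>0\<close>.\<close>

definition cdeg :: "(nat \<Rightarrow> 'k mpoly) \<Rightarrow> nat" where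
  "cdeg a = (LEAST d. \<forall>i<length vs. homogeneous d (a i))"

definition s_cov :: "('v \<Rightarrow> 'v) set \<Rightarrow> rat" where
  "s_cov H = s_invariant pscale (inv_ring_deg H) tensor_scale (cov_deg H)"

definition free_basis :: "('v \<Rightarrow> 'v) set \<Rightarrow> nat \<Rightarrow> (nat \<Rightarrow> nat \<Rightarrow> 'k mpoly) \<Rightarrow> bool" where
  "free_basis H r \<omega> \<longleftrightarrow>
     (\<forall>j<r. \<omega> j \<in> cov H) \<and>
     (\<forall>a\<in>cov H. \<exists>c. (\<forall>j<r. c j \<in> inv_ring H) \<and> a = (\<lambda>i. \<Sum>j<r. c j * \<omega> j i)) \<and>
     (\<forall>c. (\<forall>j<r. c j \<in> inv_ring H) \<and> (\<lambda>i. \<Sum>j<r. c j * \<omega> j i) = (\<lambda>i. 0)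
        \<longrightarrow> (\<forall>j<r. c j = 0))"

definition jac :: "(nat \<Rightarrow> nat \<Rightarrow> 'k mpoly) \<Rightarrow> 'k mpoly" where
  "jac \<omega> = det (mat (length vs) (length vs) (\<lambda>(i, j). \<omega> j i))"

definition jac_module :: "('v \<Rightarrow> 'v) set \<Rightarrow> 'k mpoly set" where
  "jac_module H = {\<Sum>j<N. c j * jac (\<omega> j) | (N::nat) c \<omega>.
     (\<forall>j<N. c j \<in> inv_ring H \<and> (\<forall>l<length vs. \<omega> j l \<in> hom_cov H))}"

text \<open>Alternating \<open>m\<close>-linear forms on \<open>M\<close>, that is, the elements of the dual of the \<open>m\<close>-th
  exterior power of \<open>M\<close>; only the values on lists of length \<open>m\<close> matter. A group element \<open>g\<close> acts
  by precomposition with \<open>\<rho> (g\<inverse>)\<close>, and \<open>top_char g\<close> is the scalar by which it acts.\<close>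

definition alt_form :: "('m list \<Rightarrow> 'k) \<Rightarrow> bool" where
  "alt_form f \<longleftrightarrow>
     (\<forall>us i. length us = length vs \<and> i < length vs
        \<longrightarrow> Vector_Spaces.linear scM (*) (\<lambda>u. f (us[i := u]))) \<and>
     (\<forall>us. length us = length vs \<and> \<not> distinct us \<longrightarrow> f us = 0)"

definition top_char :: "('v \<Rightarrow> 'v) \<Rightarrow> 'k" where
  "top_char g = (THE c. \<forall>f. alt_form f \<longrightarrow>
     (\<forall>us. length us = length vs \<longrightarrow> f (map (\<rho> (inv_into UNIV g)) us) = c * f us))"

definition hyperplane :: "'v set \<Rightarrow> bool" where
  "hyperplane U \<longleftrightarrow> V.subspace U \<and> V.dim U + 1 = V.dim UNIV"

definition stab :: "'v set \<Rightarrow> ('v \<Rightarrow> 'v) set" where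
  "stab U = {g \<in> G. \<forall>u\<in>U. g u = u}"

definition hyperplane_form :: "'v set \<Rightarrow> ('v \<Rightarrow> 'k) \<Rightarrow> bool" where
  "hyperplane_form U l \<longleftrightarrow> Vector_Spaces.linear scV (*) l \<and> {u. l u = 0} = U"

definition e_inv :: "'v set \<Rightarrow> nat" where
  "e_inv U = (THE e. \<exists>r \<omega>. free_basis (stab U) r \<omega> \<and> (\<forall>j<r. \<omega> j \<in> hom_cov (stab U)) \<and>
     e = (\<Sum>j<r. cdeg (\<omega> j)))"

text \<open>The hyperplanes with trivial pointwise stabilizer, for which \<open>e_inv U = 0\<close>, are left out
  to make the index set finite.\<close>

definition F_poly :: "('v set \<Rightarrow> 'v \<Rightarrow> 'k) \<Rightarrow> 'k mpoly" where
  "F_poly x = (\<Prod>U\<in>{U. hyperplane U \<and> stab U \<noteq> {id}}. form_poly (x U) ^ e_inv U)"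

definition divides_in_ring :: "'k mpoly \<Rightarrow> 'k mpoly \<Rightarrow> bool" where
  "divides_in_ring p q \<longleftrightarrow> (\<exists>h\<in>coord_ring. q = p * h)"

definition is_gcd_of :: "'k mpoly \<Rightarrow> 'k mpoly set \<Rightarrow> bool" where
  "is_gcd_of d S \<longleftrightarrow> d \<in> coord_ring \<and> (\<forall>p\<in>S. divides_in_ring d p) \<and>
     (\<forall>d'\<in>coord_ring. (\<forall>p\<in>S. divides_in_ring d' p) \<longrightarrow> divides_in_ring d' d)"

end

end

theory Submission
  imports Defs "Jordan_Normal_Form.Char_Poly" "HOL-Library.Product_Lexorder"
begin

text \<open>
  Write \<open>B = k[V]\<^sup>G\<close> and \<open>N = k[V]\<^sup>G(M)\<close>. Cramer's rule, in the form
  \<open>Jac(\<omega>) a = \<Sum>\<^sub>j Jac(\<omega> with \<omega>\<^sub>j replaced by a) \<omega>\<^sub>j\<close>, reduces all questions on bases of modules of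
  covariants to the divisibility of Jacobians: since all Jacobians transform by the same character,
  quotients of Jacobians are invariant, and homogeneous covariants \<open>\<omega>\<close> with \<open>Jac(\<omega>) \<noteq> 0\<close> form a basis
  as soon as \<open>Jac(\<omega>)\<close> divides all Jacobians (\<open>free_basis_if_cramer_dvd\<close>,
  \<open>free_basis_if_jac_dvd\<close>). Divisibility is tested one prime \<open>\<pi>\<close> of \<open>k[V]\<close> at a time.

  Hyperplanes (\<open>hyperplane_basis\<close>). Among the tuples of homogeneous covariants of \<open>G\<^sub>U\<close> take
  those whose Jacobian vanishes to the smallest possible order \<open>e\<close> along \<open>U\<close>, and among them one of
  smallest total degree; let its Jacobian be \<open>x\<^sub>U\<^sup>e h\<close>. Translations by vectors of \<open>U\<close> commute
  with \<open>G\<^sub>U\<close>, so the Taylor coefficients of covariants in directions of \<open>U\<close> are again covariants, of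
  smaller degree. If \<open>h\<close> had positive degree, it would not be invariant modulo \<open>x\<^sub>U\<close> under these
  translations, and some Taylor coefficient of the Jacobian would yield a tuple with the same order
  \<open>e\<close> and smaller degree. So the Jacobian is \<open>x\<^sub>U\<^sup>e\<close> up to a scalar, it divides all other Jacobians,
  and the tuple is a basis with \<open>e = e\<^sub>U(M)\<close>.

  Greatest common divisor (\<open>jac_prime_powers\<close>). Let \<open>I\<close> be the group of all elements of \<open>G\<close> that act
  trivially modulo \<open>\<pi>\<close>. Outside \<open>I\<close>, invariants of \<open>I\<close> are moved modulo \<open>\<pi>\<close>, and interpolation over
  the cosets of \<open>I\<close> converts covariants of \<open>I\<close> to covariants of \<open>G\<close> without raising the order of
  the Jacobian at \<open>\<pi>\<close> (\<open>covariant_transfer\<close>). If \<open>I\<close> is trivial, this starts from the constant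
  covariants with Jacobian \<open>1\<close>; otherwise \<open>\<pi>\<close> divides the linear forms \<open>g X\<^sub>i - X\<^sub>i\<close>, hence is some
  \<open>x\<^sub>U\<close> up to a scalar, and \<open>I = G\<^sub>U\<close>. So the order of the greatest common divisor at \<open>\<pi>\<close> is that of \<open>F\<^sub>M\<close>. A tuple
  with Jacobian \<open>c F\<^sub>M\<close> is then a basis, and conversely the Jacobian of a basis divides all Jacobians.

  The \<open>s\<close>-invariant (\<open>s_cov_free_basis\<close>, \<open>free_basis_if_degree_sum\<close>). For a basis \<open>\<omega>\<close> the quotient of
  the Hilbert series is \<open>D(t) = \<Sum>\<^sub>j t ^ deg \<omega>\<^sub>j\<close>, so \<open>s = D'(1)\<close>. If \<open>Jac(\<omega>) \<noteq> 0\<close> but \<open>\<omega>\<close> is not a basis,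
  then there are a homogeneous covariant \<open>a\<close> and a prime \<open>\<pi>\<close> such that \<open>p a\<close>, for \<open>p \<in> B\<close>, lies in the
  span of \<open>\<omega>\<close> only if \<open>\<pi>\<close> divides \<open>p\<close>. The span has Hilbert series \<open>D H(B)\<close>, and the multiples
  of \<open>a\<close> enlarge it by a shifted copy of the Hilbert series of \<open>B\<close> modulo \<open>\<pi>\<close>. As \<open>k[V]\<close> is finite
  over \<open>B\<close>, the latter is at least a positive multiple of \<open>(1 - t) H(B)\<close> near \<open>t = 1\<close>, whence
  \<open>s < D'(1)\<close>. The expansions at \<open>1\<close> exist because Hilbert series are rational: leading exponents form
  upward closed sets, and those are tame by Dickson's lemma (\<open>hilbert_fps_rational\<close>).
\<close>

section \<open>Evaluation of polynomials\<close>

text \<open>The homomorphism that is \<open>c\<close> on constants and \<open>s\<close> on variables. Substitutions, the grading, the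
  expansion in one variable and Taylor expansions are all of this form.\<close>

definition mev :: "('k::field \<Rightarrow> 'r::comm_ring_1) \<Rightarrow> (nat \<Rightarrow> 'r) \<Rightarrow> 'k mpoly \<Rightarrow> 'r" where
  "mev c s p = (\<Sum>a\<in>Poly_Mapping.keys p. c (Poly_Mapping.lookup p a) *
     (\<Prod>i\<in>Poly_Mapping.keys a. s i ^ Poly_Mapping.lookup a i))"

lemma psubst_mev: "psubst s = mev pconst s"
  by (rule ext) (simp add: psubst_def mev_def)

lemma monomial_value_add:
  fixes s :: "nat \<Rightarrow> 'r::comm_ring_1" and a b :: "nat \<Rightarrow>\<^sub>0 nat"
  shows "(\<Prod>i\<in>Poly_Mapping.keys (a + b). s i ^ Poly_Mapping.lookup (a + b) i) =
    (\<Prod>i\<in>Poly_Mapping.keys a. s i ^ Poly_Mapping.lookup a i) *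
    (\<Prod>i\<in>Poly_Mapping.keys b. s i ^ Poly_Mapping.lookup b i)"
proof -
  define A where "A = Poly_Mapping.keys a \<union> Poly_Mapping.keys b"
  have fA: "finite A" by (simp add: A_def)
  have ext: "(\<Prod>i\<in>Poly_Mapping.keys c. s i ^ Poly_Mapping.lookup c i) =
      (\<Prod>i\<in>A. s i ^ Poly_Mapping.lookup c i)" if "Poly_Mapping.keys c \<subseteq> A" for c :: "nat \<Rightarrow>\<^sub>0 nat"
    by (rule prod.mono_neutral_left) (use that fA in \<open>auto simp: in_keys_iff\<close>)
  have sub: "Poly_Mapping.keys (a + b) \<subseteq> A" "Poly_Mapping.keys a \<subseteq> A" "Poly_Mapping.keys b \<subseteq> A"
    unfolding A_def by (rule keys_add) auto
  show ?thesis
    unfolding ext[OF sub(1)] ext[OF sub(2)] ext[OF sub(3)]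
    by (simp add: lookup_add power_add prod.distrib)
qed

lemma mpoly_sum_monomials:
  "p = (\<Sum>a\<in>Poly_Mapping.keys p. Poly_Mapping.single a (Poly_Mapping.lookup p a))"
proof (rule poly_mapping_eqI)
  fix b
  have "Poly_Mapping.lookup (\<Sum>a\<in>Poly_Mapping.keys p. Poly_Mapping.single a (Poly_Mapping.lookup p a)) b =
     (\<Sum>a\<in>Poly_Mapping.keys p. if a = b then Poly_Mapping.lookup p a else 0)"
    unfolding lookup_sum by (rule sum.cong) (auto simp: lookup_single when_def)
  also have "\<dots> = Poly_Mapping.lookup p b"
    by (simp add: in_keys_iff)
  finally show "Poly_Mapping.lookup p b =
    Poly_Mapping.lookup (\<Sum>a\<in>Poly_Mapping.keys p. Poly_Mapping.single a (Poly_Mapping.lookup p a)) b" ..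
qed

locale coeff_hom = comm_ring_hom hom for hom :: "'k::field \<Rightarrow> 'r::comm_ring_1"
begin

lemma mev_superset:
  assumes "finite A" "Poly_Mapping.keys p \<subseteq> A"
  shows "mev hom s p = (\<Sum>a\<in>A. hom (Poly_Mapping.lookup p a) *
     (\<Prod>i\<in>Poly_Mapping.keys a. s i ^ Poly_Mapping.lookup a i))"
  unfolding mev_def
  by (rule sum.mono_neutral_left) (use assms in \<open>auto simp: in_keys_iff\<close>)

lemma mev_add: "mev hom s (p + q) = mev hom s p + mev hom s q"
proof -
  define A where "A = Poly_Mapping.keys p \<union> Poly_Mapping.keys q"
  have "finite A" "Poly_Mapping.keys (p + q) \<subseteq> A" "Poly_Mapping.keys p \<subseteq> A"
      "Poly_Mapping.keys q \<subseteq> A"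
    by (auto simp: A_def dest: subsetD[OF keys_add])
  then show ?thesis
    by (simp add: mev_superset[of A] lookup_add hom_add algebra_simps sum.distrib)
qed

lemma mev_single: "mev hom s (Poly_Mapping.single a c) =
    hom c * (\<Prod>i\<in>Poly_Mapping.keys a. s i ^ Poly_Mapping.lookup a i)"
  by (subst mev_superset[of "{a}"]) auto

lemma mev_zero: "mev hom s 0 = 0"
  by (simp add: mev_def)

lemma mev_sum: "mev hom s (\<Sum>x\<in>X. f x) = (\<Sum>x\<in>X. mev hom s (f x))"
  by (induction X rule: infinite_finite_induct) (auto simp: mev_zero mev_add)

lemma mev_mult: "mev hom s (p * q) = mev hom s p * mev hom s q"
proof -
  have "p * q = (\<Sum>a\<in>Poly_Mapping.keys p. \<Sum>b\<in>Poly_Mapping.keys q.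
     Poly_Mapping.single (a + b) (Poly_Mapping.lookup p a * Poly_Mapping.lookup q b))"
    using arg_cong2[OF mpoly_sum_monomials[of p] mpoly_sum_monomials[of q], of "(*)"]
    by (simp only: sum_product mult_single)
  then have "mev hom s (p * q) = (\<Sum>a\<in>Poly_Mapping.keys p. \<Sum>b\<in>Poly_Mapping.keys q.
     hom (Poly_Mapping.lookup p a * Poly_Mapping.lookup q b) *
       (\<Prod>i\<in>Poly_Mapping.keys (a + b). s i ^ Poly_Mapping.lookup (a + b) i))"
    by (simp add: mev_sum mev_single)
  also have "\<dots> = mev hom s p * mev hom s q"
    unfolding mev_def sum_product
    by (intro sum.cong refl) (simp add: monomial_value_add hom_mult mult_ac)
  finally show ?thesis .
qed

lemma mev_hom: "comm_ring_hom (mev hom s)"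
proof
  show "mev hom s 1 = 1"
    using mev_single[of s 0 1] by simp
qed (simp_all add: mev_add mev_mult mev_zero)

lemma mev_pconst: "mev hom s (pconst c) = hom c"
  by (simp add: pconst_def mev_single)

lemma mev_pvar: "mev hom s (pvar i) = s i"
  by (simp add: pvar_def mev_single)

end

lemma pconst_hom: "comm_ring_hom pconst"
  by unfold_locales (simp_all add: pconst_def single_add mult_single)

interpretation pconst: coeff_hom pconst
  unfolding coeff_hom_def by (rule pconst_hom)

lemma pconst_eq_iff [simp]: "pconst a = pconst b \<longleftrightarrow> a = b"
  by (simp add: pconst_def) (metis lookup_single_eq)

lemma pconst_eq_0_iff [simp]: "pconst a = 0 \<longleftrightarrow> a = 0"
  using pconst_eq_iff[of a 0] by simp

lemma psubst_hom: "comm_ring_hom (psubst s)"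
  unfolding psubst_mev by (rule pconst.mev_hom)

lemma psubst_pconst [simp]: "psubst s (pconst c) = pconst c"
  by (simp add: psubst_mev pconst.mev_pconst)

lemma psubst_pvar [simp]: "psubst s (pvar i) = s i"
  by (simp add: psubst_mev pconst.mev_pvar)

lemma pvar_power: "pvar i ^ k = Poly_Mapping.single (Poly_Mapping.single i k) 1"
  by (induction k) (auto simp: pvar_def mult_single single_add[symmetric])

lemma monomial_eq_prod_pvar:
  "Poly_Mapping.single a (1::'k::field) = (\<Prod>i\<in>Poly_Mapping.keys a. pvar i ^ Poly_Mapping.lookup a i)"
proof -
  have "a = (\<Sum>i\<in>Poly_Mapping.keys a. Poly_Mapping.single i (Poly_Mapping.lookup a i))"
    by (rule mpoly_sum_monomials)
  moreover have "Poly_Mapping.single (\<Sum>i\<in>I. f i) (1::'k) = (\<Prod>i\<in>I. Poly_Mapping.single (f i) 1)"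
    if "finite I" for I and f :: "nat \<Rightarrow> nat \<Rightarrow>\<^sub>0 nat"
    using that
  proof (induction I)
    case (insert x F)
    have "Poly_Mapping.single (f x + sum f F) (1::'k) = Poly_Mapping.single (f x) 1 * Poly_Mapping.single (sum f F) 1"
      by (simp add: mult_single)
    with insert show ?case by simp
  qed auto
  ultimately show ?thesis
    unfolding pvar_power by (metis finite_keys)
qed

text \<open>A ring homomorphism out of a polynomial ring is determined by the images of the constants
  and of the variables that occur.\<close>

lemma hom_eq_mev:
  fixes \<phi> :: "'k::field mpoly \<Rightarrow> 'r::comm_ring_1"
  assumes "comm_ring_hom \<phi>"
  shows "\<phi> p = mev (\<lambda>c. \<phi> (pconst c)) (\<lambda>i. \<phi> (pvar i)) p"
proof -
  interpret comm_ring_hom \<phi> by fact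
  have "\<phi> p = (\<Sum>a\<in>Poly_Mapping.keys p. \<phi> (Poly_Mapping.single a (Poly_Mapping.lookup p a)))"
    by (subst mpoly_sum_monomials[of p]) (simp add: hom_sum)
  also have "\<dots> = (\<Sum>a\<in>Poly_Mapping.keys p. \<phi> (pconst (Poly_Mapping.lookup p a) *
      (\<Prod>i\<in>Poly_Mapping.keys a. pvar i ^ Poly_Mapping.lookup a i)))"
    by (intro sum.cong refl arg_cong[where f = \<phi>])
       (simp add: monomial_eq_prod_pvar[symmetric] pconst_def mult_single)
  also have "\<dots> = mev (\<lambda>c. \<phi> (pconst c)) (\<lambda>i. \<phi> (pvar i)) p"
    unfolding mev_def by (simp add: hom_mult hom_prod hom_power)
  finally show ?thesis .
qed

text \<open>The ring \<open>k[V]\<close> is \<open>polyR (length bs)\<close>. The number of variables is a parameter because unique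
  factorization is proved by induction on it.\<close>

definition polyR :: "nat \<Rightarrow> 'k::field mpoly set" where
  "polyR n = {p. \<forall>a\<in>Poly_Mapping.keys p. Poly_Mapping.keys a \<subseteq> {..<n}}"

lemma polyR_lessD: "p \<in> polyR n \<Longrightarrow> a \<in> Poly_Mapping.keys p \<Longrightarrow> i \<in> Poly_Mapping.keys a \<Longrightarrow> i < n"
  unfolding polyR_def by blast

lemma polyRI: "(\<And>a i. a \<in> Poly_Mapping.keys p \<Longrightarrow> i \<in> Poly_Mapping.keys a \<Longrightarrow> i < n) \<Longrightarrow> p \<in> polyR n"
  unfolding polyR_def by blast

lemma hom_eqI:
  fixes \<phi> \<psi> :: "'k::field mpoly \<Rightarrow> 'r::comm_ring_1"
  assumes "comm_ring_hom \<phi>" "comm_ring_hom \<psi>"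
    and "\<And>c. \<phi> (pconst c) = \<psi> (pconst c)" "\<And>i. i < n \<Longrightarrow> \<phi> (pvar i) = \<psi> (pvar i)"
    and "p \<in> polyR n"
  shows "\<phi> p = \<psi> p"
proof -
  have eq: "\<phi> (pvar i) = \<psi> (pvar i)" if "a \<in> Poly_Mapping.keys p" "i \<in> Poly_Mapping.keys a" for a i
    using polyR_lessD[OF assms(5) that] by (rule assms(4))
  have "mev (\<lambda>c. \<psi> (pconst c)) (\<lambda>i. \<phi> (pvar i)) p = mev (\<lambda>c. \<psi> (pconst c)) (\<lambda>i. \<psi> (pvar i)) p"
    unfolding mev_def using assms(4,5)
    by (intro sum.cong prod.cong arg_cong2[where f = "(*)"] refl)
       (simp add: eq)
  then show ?thesis
    using hom_eq_mev[OF assms(1), of p] hom_eq_mev[OF assms(2), of p] assms(3) by simp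
qed

lemma hom_eqI_all:
  fixes \<phi> \<psi> :: "'k::field mpoly \<Rightarrow> 'r::comm_ring_1"
  assumes "comm_ring_hom \<phi>" "comm_ring_hom \<psi>"
    and "\<And>c. \<phi> (pconst c) = \<psi> (pconst c)" "\<And>i. \<phi> (pvar i) = \<psi> (pvar i)"
  shows "\<phi> p = \<psi> p"
  using hom_eq_mev[OF assms(1), of p] hom_eq_mev[OF assms(2), of p] assms(3,4) by simp

lemma comm_ring_hom_comp:
  assumes "comm_ring_hom f" "comm_ring_hom g"
  shows "comm_ring_hom (\<lambda>x. f (g x))"
proof -
  interpret f: comm_ring_hom f by fact
  interpret g: comm_ring_hom g by fact
  show ?thesis by unfold_locales (simp_all add: f.hom_add g.hom_add f.hom_mult g.hom_mult)
qed

lemma comm_ring_hom_id: "comm_ring_hom (\<lambda>x. x)"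
  by unfold_locales simp_all

subsection \<open>Polynomials in finitely many variables\<close>

lemma polyR_0 [simp]: "0 \<in> polyR n" and polyR_1 [simp]: "1 \<in> polyR n"
  and polyR_pconst [simp]: "pconst c \<in> polyR n"
  and polyR_pvar: "i < n \<Longrightarrow> pvar i \<in> polyR n"
  by (auto simp: polyR_def pconst_def pvar_def split: if_splits)

lemma polyR_add [intro]: "p \<in> polyR n \<Longrightarrow> q \<in> polyR n \<Longrightarrow> p + q \<in> polyR n"
  by (rule polyRI) (use keys_add[of p q] in \<open>auto dest: polyR_lessD\<close>)

lemma polyR_mult [intro]:
  assumes "p \<in> polyR n" "q \<in> polyR n"
  shows "p * q \<in> polyR n"
proof (rule polyRI)
  fix a i
  assume "a \<in> Poly_Mapping.keys (p * q)" "i \<in> Poly_Mapping.keys a"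
  then obtain b c where "a = b + c" "b \<in> Poly_Mapping.keys p" "c \<in> Poly_Mapping.keys q"
    using keys_mult[of p q] by blast
  with \<open>i \<in> _\<close> keys_add[of b c] have "i \<in> Poly_Mapping.keys b \<or> i \<in> Poly_Mapping.keys c" by auto
  then show "i < n"
    using polyR_lessD[OF assms(1) \<open>b \<in> _\<close>] polyR_lessD[OF assms(2) \<open>c \<in> _\<close>] by auto
qed

lemma polyR_uminus [intro]: "p \<in> polyR n \<Longrightarrow> - p \<in> polyR n"
  by (auto simp: polyR_def in_keys_iff)

lemma polyR_diff [intro]: "p \<in> polyR n \<Longrightarrow> q \<in> polyR n \<Longrightarrow> p - q \<in> polyR n"
  using polyR_add[of p n "- q"] by auto

lemma polyR_sum: "(\<And>x. x \<in> X \<Longrightarrow> f x \<in> polyR n) \<Longrightarrow> (\<Sum>x\<in>X. f x) \<in> polyR n"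
  by (induction X rule: infinite_finite_induct) auto

lemma polyR_prod: "(\<And>x. x \<in> X \<Longrightarrow> f x \<in> polyR n) \<Longrightarrow> (\<Prod>x\<in>X. f x) \<in> polyR n"
  by (induction X rule: infinite_finite_induct) auto

lemma polyR_power: "p \<in> polyR n \<Longrightarrow> p ^ k \<in> polyR n"
  by (induction k) auto

lemma psubst_polyR:
  assumes "p \<in> polyR n" "\<And>i. i < n \<Longrightarrow> s i \<in> polyR m"
  shows "psubst s p \<in> polyR m"
  unfolding psubst_def
  by (intro polyR_sum polyR_mult polyR_pconst polyR_prod polyR_power assms(2))
     (use assms(1) in \<open>auto simp: polyR_def\<close>)

lemma polyR_mono: "n \<le> m \<Longrightarrow> polyR n \<subseteq> polyR m"
  by (fastforce simp: polyR_def)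

lemma polyR_cover: "\<exists>n. p \<in> polyR n"
proof -
  have "finite (\<Union>a\<in>Poly_Mapping.keys p. Poly_Mapping.keys a)" by auto
  then obtain n where "(\<Union>a\<in>Poly_Mapping.keys p. Poly_Mapping.keys a) \<subseteq> {..<n}"
    using finite_nat_bounded by blast
  then show ?thesis by (auto simp: polyR_def)
qed

lemma polyR_zero_const:
  assumes "p \<in> polyR 0" obtains c where "p = pconst c"
proof -
  have "Poly_Mapping.keys p \<subseteq> {0}"
    using assms by (auto simp: polyR_def)
  then have "p = pconst (Poly_Mapping.lookup p 0)"
    by (intro poly_mapping_eqI) (auto simp: pconst_def lookup_single when_def in_keys_iff)
  then show ?thesis by (rule that)
qed

lemma pconst_dvd_1: "c \<noteq> 0 \<Longrightarrow> pconst c dvd 1"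
proof -
  assume "c \<noteq> 0"
  then have "1 = pconst c * pconst (inverse c)"
    by (simp flip: pconst.hom_mult)
  then show ?thesis ..
qed

text \<open>Setting the superfluous variables to zero turns divisibility in the big ring into
  divisibility in \<open>polyR n\<close>.\<close>

lemma dvd_polyR:
  assumes "p dvd q" "p \<in> polyR n" "q \<in> polyR n"
  obtains h where "h \<in> polyR n" "q = p * h"
proof -
  define \<rho> where "\<rho> = psubst (\<lambda>i. if i < n then pvar i else 0 :: 'a mpoly)"
  have h: "comm_ring_hom \<rho>" unfolding \<rho>_def by (rule psubst_hom)
  then interpret \<rho>: comm_ring_hom \<rho> .
  have \<rho>_id: "\<rho> f = f" if "f \<in> polyR n" for f
    by (rule hom_eqI[OF h comm_ring_hom_id _ _ that]) (auto simp: \<rho>_def)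
  have \<rho>_in: "\<rho> f \<in> polyR n" for f
  proof -
    obtain m where "f \<in> polyR m" using polyR_cover by blast
    then show ?thesis unfolding \<rho>_def by (rule psubst_polyR) (auto intro: polyR_pvar)
  qed
  from assms(1) obtain h where "q = p * h" ..
  then have "q = p * \<rho> h"
    using \<rho>.hom_mult[of p h] \<rho>_id assms(2,3) by simp
  with \<rho>_in show ?thesis by (rule that[of "\<rho> h"])
qed

section \<open>The grading\<close>

definition mdeg :: "(nat \<Rightarrow>\<^sub>0 nat) \<Rightarrow> nat" where
  "mdeg a = (\<Sum>i\<in>Poly_Mapping.keys a. Poly_Mapping.lookup a i)"

text \<open>The polynomial \<open>p(z X)\<close> in \<open>z\<close>, whose coefficients are the homogeneous components of \<open>p\<close>. As \<open>grade\<close>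
  is a ring homomorphism, statements on degrees become statements on univariate polynomials.\<close>

definition grade :: "'k::field mpoly \<Rightarrow> 'k mpoly poly" where
  "grade = mev (\<lambda>c. [:pconst c:]) (\<lambda>i. monom (pvar i) 1)"

lemma const_poly_hom: "comm_ring_hom (\<lambda>c. [:c::'a::comm_ring_1:])"
  by unfold_locales (simp_all add: one_pCons)

lemma pconst_poly_hom: "comm_ring_hom (\<lambda>c. [:pconst c:])"
  by (rule comm_ring_hom_comp[OF const_poly_hom pconst_hom])

interpretation pconst_poly: coeff_hom "\<lambda>c. [:pconst c:]"
  unfolding coeff_hom_def by (rule pconst_poly_hom)

lemma grade_hom: "comm_ring_hom grade"
  unfolding grade_def by (rule pconst_poly.mev_hom)

interpretation grade: comm_ring_hom grade
  by (rule grade_hom)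

lemma grade_eq: "grade p = (\<Sum>a\<in>Poly_Mapping.keys p.
    monom (Poly_Mapping.single a (Poly_Mapping.lookup p a)) (mdeg a))"
proof -
  have 1: "(\<Prod>i\<in>I. monom (pvar i :: 'a mpoly) (Suc 0) ^ f i) = monom (\<Prod>i\<in>I. pvar i ^ f i) (\<Sum>i\<in>I. f i)"
    if "finite I" for I f
    using that by (induction I) (auto simp: monom_power mult_monom)
  show ?thesis
    unfolding grade_def mev_def
    by (intro sum.cong refl)
       (simp add: 1 mdeg_def monomial_eq_prod_pvar[symmetric] pconst_def smult_monom mult_single)
qed

lemma lookup_coeff_grade:
  "Poly_Mapping.lookup (coeff (grade p) d) a = (if mdeg a = d then Poly_Mapping.lookup p a else 0)"
proof -
  have "Poly_Mapping.lookup (coeff (grade p) d) a =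
      (\<Sum>b\<in>Poly_Mapping.keys p. if b = a then (if mdeg a = d then Poly_Mapping.lookup p a else 0) else 0)"
    unfolding grade_eq coeff_sum lookup_sum
    by (intro sum.cong refl) (auto simp: lookup_single when_def)
  then show ?thesis by (auto simp: in_keys_iff)
qed

lemma homogeneous_iff_mdeg: "homogeneous d p \<longleftrightarrow> (\<forall>a\<in>Poly_Mapping.keys p. mdeg a = d)"
  by (simp add: homogeneous_def mdeg_def)

lemma homogeneous_iff_grade: "homogeneous d p \<longleftrightarrow> grade p = monom p d"
proof
  assume "homogeneous d p"
  then show "grade p = monom p d"
    by (intro poly_eqI poly_mapping_eqI)
       (auto simp: lookup_coeff_grade homogeneous_iff_mdeg in_keys_iff)
next
  assume "grade p = monom p d"
  then have "Poly_Mapping.lookup p a = (if mdeg a = d then Poly_Mapping.lookup p a else 0)" for a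
    using lookup_coeff_grade[of p d a] by simp
  then show "homogeneous d p"
    by (metis homogeneous_iff_mdeg in_keys_iff)
qed

lemma homogeneous_coeff_grade: "homogeneous d (coeff (grade p) d)"
  unfolding homogeneous_iff_mdeg by (auto simp: in_keys_iff lookup_coeff_grade split: if_splits)

lemma poly_grade_1: "poly (grade p) 1 = p"
proof (rule hom_eqI_all[of "\<lambda>p. poly (grade p) 1" "\<lambda>p. p"])
  show "comm_ring_hom (\<lambda>p. poly (grade p) (1 :: 'a mpoly))"
    by unfold_locales (simp_all add: grade.hom_add grade.hom_mult)
qed (auto simp: comm_ring_hom_id grade_def pconst_poly.mev_pconst
      pconst_poly.mev_pvar poly_monom)

lemma sum_coeff_grade: "p = (\<Sum>d\<le>degree (grade p). coeff (grade p) d)"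
  using poly_grade_1[of p] by (simp add: poly_altdef)

lemma grade_eq_0_iff [simp]: "grade p = 0 \<longleftrightarrow> p = 0"
  using poly_grade_1[of p] by auto

lemma coeff_grade_homogeneous:
  "homogeneous d p \<Longrightarrow> coeff (grade p) e = (if e = d then p else 0)"
  by (auto simp: homogeneous_iff_grade)

lemma homogeneous_0 [simp]: "homogeneous d 0"
  by (simp add: homogeneous_def)

lemma homogeneous_pconst [simp]: "homogeneous 0 (pconst c)"
  by (auto simp: homogeneous_def pconst_def split: if_splits)

lemma homogeneous_1 [simp]: "homogeneous 0 1"
  by (auto simp: homogeneous_def)

lemma homogeneous_pvar: "homogeneous 1 (pvar i)"
  by (auto simp: homogeneous_def pvar_def)

lemma homogeneous_add: "homogeneous d p \<Longrightarrow> homogeneous d q \<Longrightarrow> homogeneous d (p + q)"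
  by (simp add: homogeneous_iff_grade grade.hom_add add_monom)

lemma homogeneous_uminus: "homogeneous d p \<Longrightarrow> homogeneous d (- p)"
  by (auto simp: homogeneous_def in_keys_iff)

lemma homogeneous_mult: "homogeneous d p \<Longrightarrow> homogeneous e q \<Longrightarrow> homogeneous (d + e) (p * q)"
  by (simp add: homogeneous_iff_grade grade.hom_mult mult_monom)

lemma homogeneous_sum: "(\<And>x. x \<in> X \<Longrightarrow> homogeneous d (f x)) \<Longrightarrow> homogeneous d (\<Sum>x\<in>X. f x)"
  by (induction X rule: infinite_finite_induct) (auto intro: homogeneous_add)

lemma homogeneous_prod:
  "(\<And>x. x \<in> X \<Longrightarrow> homogeneous (e x) (f x)) \<Longrightarrow> homogeneous (\<Sum>x\<in>X. e x) (\<Prod>x\<in>X. f x)"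
  by (induction X rule: infinite_finite_induct) (auto intro: homogeneous_mult)

lemma homogeneous_power: "homogeneous d p \<Longrightarrow> homogeneous (k * d) (p ^ k)"
  by (induction k) (auto intro: homogeneous_mult)

lemma homogeneous_pconst_mult: "homogeneous d p \<Longrightarrow> homogeneous d (pconst c * p)"
  using homogeneous_mult[of 0 "pconst c" d p] by simp

lemma homogeneous_degree_unique: "homogeneous d p \<Longrightarrow> homogeneous e p \<Longrightarrow> p \<noteq> 0 \<Longrightarrow> d = e"
  by (metis homogeneous_iff_grade monom_eq_iff' )

lemma degree_grade_homogeneous: "homogeneous d p \<Longrightarrow> p \<noteq> 0 \<Longrightarrow> degree (grade p) = d"
  by (simp add: homogeneous_iff_grade degree_monom_eq)

lemma degree_grade_mult: "p \<noteq> 0 \<Longrightarrow> q \<noteq> 0 \<Longrightarrow> degree (grade (p * q)) = degree (grade p) + degree (grade q)"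
  by (simp add: grade.hom_mult degree_mult_eq)

lemma homogeneous_0_const:
  assumes "homogeneous 0 p" obtains c where "p = pconst c"
proof -
  have "Poly_Mapping.keys p \<subseteq> {0}"
  proof
    fix a assume "a \<in> Poly_Mapping.keys p"
    then have "\<forall>i\<in>Poly_Mapping.keys a. Poly_Mapping.lookup a i = 0"
      using assms by (auto simp: homogeneous_def)
    then show "a \<in> {0}" by (auto simp: in_keys_iff intro!: poly_mapping_eqI)
  qed
  then have "p = pconst (Poly_Mapping.lookup p 0)"
    by (intro poly_mapping_eqI) (auto simp: pconst_def lookup_single when_def in_keys_iff)
  then show ?thesis by (rule that)
qed

lemma degree_grade_0_const:
  assumes "degree (grade p) = 0" obtains c where "p = pconst c"
proof -
  have "homogeneous 0 p"
    using sum_coeff_grade[of p] assms homogeneous_coeff_grade[of 0 p] by simp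
  then show ?thesis using homogeneous_0_const that by blast
qed

lemma unit_const:
  assumes "p dvd (1 :: 'k::field mpoly)" obtains c where "c \<noteq> 0" "p = pconst c"
proof -
  from assms obtain q where q: "1 = p * q" ..
  then have "p \<noteq> 0" "q \<noteq> 0" by auto
  then have "degree (grade p) + degree (grade q) = degree (grade (1 :: 'k mpoly))"
    using degree_grade_mult q by metis
  then have "degree (grade p) = 0" by simp
  then obtain c where "p = pconst c" using degree_grade_0_const by blast
  with \<open>p \<noteq> 0\<close> show ?thesis by (intro that) auto
qed

lemma monom_factor:
  fixes P Q :: "'a::idom poly"
  assumes "P * Q = monom c d" "c \<noteq> 0"
  shows "P = monom (coeff P (degree P)) (degree P)"
proof -
  have nz: "P \<noteq> 0" "Q \<noteq> 0" using assms by auto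
  obtain P1 where P: "P = [:-0,1:] ^ order 0 P * P1"
    using order_decomp[OF nz(1)] by blast
  obtain Q1 where Q: "Q = [:-0,1:] ^ order 0 Q * Q1"
    using order_decomp[OF nz(2)] by blast
  have mon: "[:0,1:] ^ k = monom (1::'a) k" for k
    by (metis x_as_monom x_pow_n)
  have "order 0 P + order 0 Q = order 0 (monom c d)"
    using order_mult[of P Q 0] assms by (simp add: nz)
  also have "\<dots> = d"
  proof -
    have "monom c d = monom 1 d * [:c:]" by (simp add: smult_monom)
    moreover have "order 0 (monom 1 d :: 'a poly) = d"
      using order_power_n_n[of 0 d] by (simp add: mon)
    moreover have "order 0 [:c:] = 0"
      using \<open>c \<noteq> 0\<close> by (simp add: order_0I)
    ultimately show ?thesis
      using order_mult[of "monom 1 d" "[:c:]" 0] \<open>c \<noteq> 0\<close> by simp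
  qed
  finally have o: "order 0 P + order 0 Q = d" .
  have d: "degree P + degree Q = d"
    using degree_mult_eq[OF nz] assms by (simp add: degree_monom_eq)
  have "order 0 P \<le> degree P" "order 0 Q \<le> degree Q"
    using order_degree nz by blast+
  with o d have eq: "order 0 P = degree P" by linarith
  have "P1 \<noteq> 0" using P nz by auto
  then have "degree P = order 0 P + degree P1"
    by (subst P) (simp add: mon degree_mult_eq degree_monom_eq)
  then have "degree P1 = 0" using eq by simp
  then obtain b where "P1 = [:b:]" by (metis degree_eq_zeroE)
  then have "P = monom b (degree P)" using P eq by (simp add: mon smult_monom)
  then show ?thesis by (metis coeff_monom)
qed

text \<open>In a graded domain the divisors of a non-zero homogeneous element are homogeneous: the
  product of the top components and the product of the bottom components cannot both vanish.\<close>

lemma homogeneous_factor: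
  assumes "homogeneous d (p * q)" "p * q \<noteq> 0"
  shows "homogeneous (degree (grade p)) p"
proof -
  have "grade p * grade q = monom (p * q) d"
    using assms(1) by (simp add: homogeneous_iff_grade grade.hom_mult)
  from monom_factor[OF this assms(2)]
  have m: "grade p = monom (coeff (grade p) (degree (grade p))) (degree (grade p))" .
  then have "p = coeff (grade p) (degree (grade p))"
    using poly_grade_1[of p] by (metis mult.right_neutral poly_monom power_one)
  with m show ?thesis unfolding homogeneous_iff_grade by simp
qed

section \<open>Determinants of families of columns\<close>

text \<open>The family index comes first and is the column index, in accordance with the matrix in \<open>jac\<close>.\<close>

definition dt :: "nat \<Rightarrow> (nat \<Rightarrow> nat \<Rightarrow> 'a) \<Rightarrow> 'a::comm_ring_1" where
  "dt m w = det (mat m m (\<lambda>(i, j). w j i))"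

lemma dt_leibniz:
  "dt m w = (\<Sum>p\<in>{p. p permutes {0..<m}}. signof p * (\<Prod>j\<in>{..<m}. w j (p j)))"
proof -
  let ?A = "mat m m (\<lambda>(i, j). w j i)"
  have "dt m w = det (transpose_mat ?A)"
    unfolding dt_def by (rule det_transpose[symmetric, of _ m]) simp
  also have "\<dots> = (\<Sum>p\<in>{p. p permutes {0..<m}}. signof p * (\<Prod>j = 0..<m. transpose_mat ?A $$ (j, p j)))"
    by (rule det_def'[of _ m]) simp
  also have "\<dots> = (\<Sum>p\<in>{p. p permutes {0..<m}}. signof p * (\<Prod>j\<in>{..<m}. w j (p j)))"
  proof (intro sum.cong refl arg_cong2[where f = "(*)"] prod.cong)
    fix p j assume "p \<in> {p. p permutes {0..<m}}" "j \<in> {..<m}"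
    then have "p j < m" "j < m" using permutes_in_image[of p "{0..<m}" j] by auto
    then show "transpose_mat ?A $$ (j, p j) = w j (p j)" by simp
  qed auto
  finally show ?thesis .
qed

lemma dt_cong:
  assumes "\<And>j i. j < m \<Longrightarrow> i < m \<Longrightarrow> w j i = w' j i"
  shows "dt m w = dt m w'"
  unfolding dt_def by (rule arg_cong[where f = det]) (auto simp: assms intro!: eq_matI)

text \<open>Multilinearity in all columns at once.\<close>

lemma dt_sum_columns:
  assumes "finite K"
  shows "dt m (\<lambda>j i. \<Sum>k\<in>K. c j k * w j k i) =
    (\<Sum>\<kappa>\<in>{..<m} \<rightarrow>\<^sub>E K. (\<Prod>j<m. c j (\<kappa> j)) * dt m (\<lambda>j. w j (\<kappa> j)))"
proof -
  have "dt m (\<lambda>j i. \<Sum>k\<in>K. c j k * w j k i) = (\<Sum>p\<in>{p. p permutes {0..<m}}. signof p *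
      (\<Sum>\<kappa>\<in>{..<m} \<rightarrow>\<^sub>E K. \<Prod>j<m. c j (\<kappa> j) * w j (\<kappa> j) (p j)))"
    unfolding dt_leibniz using assms by (subst prod_sum_PiE) auto
  also have "\<dots> = (\<Sum>\<kappa>\<in>{..<m} \<rightarrow>\<^sub>E K. (\<Prod>j<m. c j (\<kappa> j)) * dt m (\<lambda>j. w j (\<kappa> j)))"
    unfolding dt_leibniz sum_distrib_left
    by (subst sum.swap) (simp add: prod.distrib mult_ac)
  finally show ?thesis .
qed

lemma dt_hom:
  assumes "comm_ring_hom f"
  shows "f (dt m w) = dt m (\<lambda>j i. f (w j i))"
proof -
  interpret comm_ring_hom f by fact
  show ?thesis
    unfolding dt_leibniz by (simp add: hom_sum hom_mult hom_prod)
qed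

lemma dt_mult:
  "dt m (\<lambda>j i. \<Sum>l<m. c j l * w l i) = dt m c * dt m w"
proof -
  have "mat m m (\<lambda>(i, j). \<Sum>l<m. c j l * w l i) =
      mat m m (\<lambda>(i, j). w j i) * mat m m (\<lambda>(i, j). c j i)"
    by (rule eq_matI) (auto simp: scalar_prod_def mult.commute lessThan_atLeast0)
  then show ?thesis
    unfolding dt_def by (subst mult.commute) (simp add: det_mult[of _ m])
qed

lemma dt_scale: "dt m (\<lambda>j i. d * w j i) = d ^ m * dt m w"
  unfolding dt_leibniz by (simp add: prod.distrib sum_distrib_left mult_ac)

lemma dt_one: "dt m (\<lambda>j i. if i = j then 1 else 0) = 1"
proof -
  have "mat m m (\<lambda>(i, j). if i = j then 1 else 0) = (1\<^sub>m m :: 'a mat)"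
    by (rule eq_matI) auto
  then show ?thesis unfolding dt_def by simp
qed

lemma dt_zero_column:
  assumes "j < m" "\<And>i. i < m \<Longrightarrow> w j i = 0"
  shows "dt m w = 0"
  unfolding dt_leibniz
proof (rule sum.neutral, safe)
  fix p assume "p permutes {0..<m}"
  then have "p j < m" using permutes_in_image[of p "{0..<m}" j] assms(1) by auto
  then show "signof p * (\<Prod>j<m. w j (p j)) = 0"
    using assms by (metis (no_types, lifting) finite_lessThan lessThan_iff mult_zero_right prod_zero)
qed

text \<open>Cramer's lemma, stated for families of columns.\<close>

lemma dt_coeff:
  assumes "j < m"
  shows "dt m (w(j := \<lambda>i. \<Sum>l<m. c l * w l i)) = c j * dt m w"
proof -
  let ?A = "mat m m (\<lambda>(i, j). w j i)"
  have "det (replace_col ?A (?A *\<^sub>v vec m c) j) = vec m c $ j * det ?A"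
    by (rule cramer_lemma_mat) (use assms in auto)
  moreover have "replace_col ?A (?A *\<^sub>v vec m c) j =
      mat m m (\<lambda>(i, l). (w(j := \<lambda>i. \<Sum>l<m. c l * w l i)) l i)"
    by (rule eq_matI) (auto simp: replace_col_def scalar_prod_def mult.commute lessThan_atLeast0)
  ultimately show ?thesis
    unfolding dt_def using assms by simp
qed

text \<open>Were the column \<open>j\<close> replaced by the vanishing combination, the determinant would be \<open>c j\<close> times the
  old one.\<close>

lemma dt_independent:
  fixes w :: "nat \<Rightarrow> nat \<Rightarrow> 'a::idom"
  assumes "dt m w \<noteq> 0" "\<And>i. i < m \<Longrightarrow> (\<Sum>l<m. c l * w l i) = 0" "j < m"
  shows "c j = 0"
proof -
  have "dt m (w(j := \<lambda>i. \<Sum>l<m. c l * w l i)) = 0"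
    by (rule dt_zero_column[OF assms(3)]) (simp add: assms(2))
  with dt_coeff[OF assms(3), of w c] assms(1) show ?thesis by simp
qed

text \<open>Cramer's rule without division.\<close>

lemma dt_cramer:
  fixes w :: "nat \<Rightarrow> nat \<Rightarrow> 'a::idom"
  assumes "dt m w \<noteq> 0" "i < m"
  shows "dt m w * a i = (\<Sum>j<m. dt m (w(j := a)) * w j i)"
proof -
  let ?A = "mat m m (\<lambda>(i, j). w j i)"
  define x where "x = adj_mat ?A *\<^sub>v vec m a"
  have A: "?A \<in> carrier_mat m m" by simp
  have x: "x \<in> carrier_vec m" using adj_mat(1)[OF A] by (simp add: x_def)
  have "?A *\<^sub>v x = (?A * adj_mat ?A) *\<^sub>v vec m a"
    unfolding x_def by (rule assoc_mult_mat_vec[symmetric, OF A adj_mat(1)[OF A]]) simp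
  also have "\<dots> = dt m w \<cdot>\<^sub>v vec m a"
    unfolding adj_mat(2)[OF A] dt_def by auto
  finally have Ax: "?A *\<^sub>v x = dt m w \<cdot>\<^sub>v vec m a" .
  have Axi: "(\<Sum>j<m. x $ j * w j k) = dt m w * a k" if "k < m" for k
  proof -
    have "(?A *\<^sub>v x) $ k = (\<Sum>j<m. x $ j * w j k)"
      using x that by (auto simp: scalar_prod_def mult.commute lessThan_atLeast0)
    with Ax that show ?thesis by simp
  qed
  have "x $ j = dt m (w(j := a))" if j: "j < m" for j
  proof -
    have "x $ j * dt m w = dt m (w(j := \<lambda>i. \<Sum>l<m. x $ l * w l i))"
      by (rule dt_coeff[OF j, symmetric])
    also have "\<dots> = dt m (w(j := \<lambda>i. dt m w * a i))"
      by (rule dt_cong) (auto simp: Axi)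
    also have "\<dots> = dt m w * dt m (w(j := a))"
    proof -
      have "dt m (w(j := \<lambda>i. dt m w * a i)) =
          dt m (\<lambda>l i. (if l = j then dt m w else 1) * (w(j := a)) l i)"
        by (rule dt_cong) auto
      also have "\<dots> = (\<Prod>l<m. if l = j then dt m w else 1) * dt m (w(j := a))"
        unfolding dt_leibniz by (simp add: prod.distrib sum_distrib_left mult_ac)
      finally show ?thesis using j by simp
    qed
    finally show ?thesis using assms(1) by simp
  qed
  with Axi[OF assms(2)] show ?thesis by simp
qed

section \<open>Unique factorization\<close>

text \<open>Divisibility refers to polynomials in all variables; between elements of \<open>polyR n\<close> this is the same
  as divisibility within \<open>polyR n\<close>, by \<open>dvd_polyR\<close>.\<close>

definition prime_in :: "nat \<Rightarrow> 'k::field mpoly \<Rightarrow> bool" where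
  "prime_in n p \<longleftrightarrow> p \<in> polyR n \<and> p \<noteq> 0 \<and> \<not> p dvd 1 \<and>
     (\<forall>a\<in>polyR n. \<forall>b\<in>polyR n. p dvd a * b \<longrightarrow> p dvd a \<or> p dvd b)"

lemma prime_inD:
  assumes "prime_in n p"
  shows "p \<in> polyR n" "p \<noteq> 0" "\<not> p dvd 1"
    "\<And>a b. a \<in> polyR n \<Longrightarrow> b \<in> polyR n \<Longrightarrow> p dvd a * b \<Longrightarrow> p dvd a \<or> p dvd b"
  using assms by (auto simp: prime_in_def)

lemma degree_grade_nonunit: "p \<noteq> 0 \<Longrightarrow> \<not> p dvd 1 \<Longrightarrow> degree (grade p) > 0"
  using degree_grade_0_const pconst_dvd_1 by (metis gr0I pconst_eq_0_iff)

lemma prime_in_power_dvd: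
  assumes "prime_in n q" "a \<in> polyR n" "b \<in> polyR n" "\<not> q dvd a" "q ^ k dvd a * b"
  shows "q ^ k dvd b"
  using assms(3,5)
proof (induction k arbitrary: b)
  case (Suc k)
  have "q dvd a * b" using Suc.prems(2) by (auto dest: dvd_mult_left)
  then have "q dvd b" using prime_inD(4)[OF assms(1)] assms(2,4) Suc.prems(1) by blast
  then obtain b' where b': "b' \<in> polyR n" "b = q * b'"
    using dvd_polyR[OF _ prime_inD(1)[OF assms(1)] Suc.prems(1)] by blast
  have "q * q ^ k dvd q * (a * b')" using Suc.prems(2) b' by (simp add: mult_ac)
  then have "q ^ k dvd a * b'" using prime_inD(2)[OF assms(1)] by simp
  from Suc.IH[OF b'(1) this] show ?case using b' by (simp add: mult_dvd_mono)
qed simp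

lemma prime_in_dvd_power:
  assumes "prime_in n q" "a \<in> polyR n" "q dvd a ^ k"
  shows "q dvd a"
  using assms(3)
proof (induction k)
  case 0 with prime_inD(3)[OF assms(1)] show ?case by simp
next
  case (Suc k)
  then show ?case using prime_inD(4)[OF assms(1,2) polyR_power[OF assms(2)], of k] by auto
qed

lemma prime_in_dvd_prod:
  assumes "prime_in n q" "\<And>x. x \<in> X \<Longrightarrow> f x \<in> polyR n" "q dvd (\<Prod>x\<in>X. f x)"
  shows "\<exists>x\<in>X. q dvd f x"
  using assms(2,3)
proof (induction X rule: infinite_finite_induct)
  case (insert x F)
  then have "q dvd f x \<or> q dvd prod f F"
    by (intro prime_inD(4)[OF assms(1)]) (auto intro: polyR_prod)
  with insert show ?case by auto
qed (use prime_inD(3)[OF assms(1)] in auto)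

text \<open>A prime that divides none of the other primes can be cancelled from their product.\<close>

lemma prod_prime_powers_dvd:
  assumes "finite X" "\<And>x. x \<in> X \<Longrightarrow> prime_in n (q x)"
    "\<And>x y. x \<in> X \<Longrightarrow> y \<in> X \<Longrightarrow> x \<noteq> y \<Longrightarrow> \<not> q x dvd q y"
    "D \<in> polyR n" "\<And>x. x \<in> X \<Longrightarrow> q x ^ e x dvd D"
  shows "(\<Prod>x\<in>X. q x ^ e x) dvd D"
  using assms
proof (induction X)
  case (insert x F)
  have pF: "(\<Prod>x\<in>F. q x ^ e x) \<in> polyR n"
    using insert.prems(1) prime_inD(1) by (intro polyR_prod polyR_power) auto
  have "(\<Prod>x\<in>F. q x ^ e x) dvd D"
    using insert by auto
  then obtain D' where D': "D' \<in> polyR n" "D = (\<Prod>x\<in>F. q x ^ e x) * D'"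
    using dvd_polyR[OF _ pF insert.prems(3)] by blast
  have px: "prime_in n (q x)" using insert.prems(1) by simp
  have "\<not> q x dvd (\<Prod>x\<in>F. q x ^ e x)"
  proof
    assume "q x dvd (\<Prod>x\<in>F. q x ^ e x)"
    then obtain y where y: "y \<in> F" "q x dvd q y ^ e y"
      using prime_in_dvd_prod[OF px, of F "\<lambda>x. q x ^ e x"] insert.prems(1)
      by (blast intro: polyR_power prime_inD(1))
    then have "q x dvd q y"
      using prime_in_dvd_power[OF px] insert.prems(1) prime_inD(1) by blast
    with y(1) insert.hyps insert.prems(2)[of x y] show False by auto
  qed
  then have "q x ^ e x dvd D'"
    using prime_in_power_dvd[OF px pF D'(1)] insert.prems(4)[of x] D'(2) by simp
  then show ?case
    using insert.hyps D'(2) by (simp add: mult.commute mult_dvd_mono)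
qed simp

text \<open>\<open>inX n\<close> reads a polynomial as a univariate polynomial in the variable \<open>n\<close>.\<close>

definition inX :: "nat \<Rightarrow> 'k::field mpoly \<Rightarrow> 'k mpoly poly" where
  "inX n = mev (\<lambda>c. [:pconst c:]) (\<lambda>i. if i = n then [:0, 1:] else [:pvar i:])"

lemma inX_hom: "comm_ring_hom (inX n)"
  unfolding inX_def by (rule pconst_poly.mev_hom)

interpretation inX: comm_ring_hom "inX n"
  by (rule inX_hom)

lemma inX_pconst [simp]: "inX n (pconst c) = [:pconst c:]"
  by (simp add: inX_def pconst_poly.mev_pconst)

lemma inX_pvar [simp]: "inX n (pvar i) = (if i = n then [:0, 1:] else [:pvar i:])"
  by (simp add: inX_def pconst_poly.mev_pvar)

lemma poly_inX: "poly (inX n p) (pvar n) = p"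
proof (rule hom_eqI_all[of "\<lambda>p. poly (inX n p) (pvar n)" "\<lambda>p. p"])
  show "comm_ring_hom (\<lambda>p. poly (inX n p) (pvar n))"
    by unfold_locales (simp_all add: inX.hom_add inX.hom_mult)
qed (auto simp: comm_ring_hom_id)

lemma inX_eq_0_iff [simp]: "inX n p = 0 \<longleftrightarrow> p = 0"
  using poly_inX[of n p] by auto

lemma inX_polyR:
  assumes "p \<in> polyR n"
  shows "inX n p = [:p:]"
  by (rule hom_eqI[OF inX_hom const_poly_hom _ _ assms]) auto

lemma coeff_inX_polyR:
  assumes "p \<in> polyR (Suc n)"
  shows "coeff (inX n p) k \<in> polyR n"
proof -
  define PR where "PR = {P :: 'a mpoly poly. \<forall>k. coeff P k \<in> polyR n}"
  have mult: "P * Q \<in> PR" if "P \<in> PR" "Q \<in> PR" for P Q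
    using that unfolding PR_def by (auto simp: coeff_mult intro!: polyR_sum polyR_mult)
  have one: "1 \<in> PR" unfolding PR_def by (auto simp: coeff_1)
  have pow: "P ^ k \<in> PR" if "P \<in> PR" for P k
    by (induction k) (auto simp: one mult that)
  have prd: "prod f X \<in> PR" if "\<And>x. x \<in> X \<Longrightarrow> f x \<in> PR" for f and X :: "nat set"
    using that by (induction X rule: infinite_finite_induct) (auto simp: one mult)
  have sm: "sum f X \<in> PR" if "\<And>x. x \<in> X \<Longrightarrow> f x \<in> PR" for f and X :: "(nat \<Rightarrow>\<^sub>0 nat) set"
    using that by (auto simp: PR_def coeff_sum intro: polyR_sum)
  have "inX n p \<in> PR"
    unfolding inX_def mev_def
  proof (intro sm mult prd pow)
    fix a i assume "a \<in> Poly_Mapping.keys p" "i \<in> Poly_Mapping.keys a"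
    then have "i < Suc n" using assms polyR_lessD by blast
    then show "(if i = n then [:0, 1:] else [:pvar i:]) \<in> PR"
      by (auto simp: PR_def coeff_pCons polyR_pvar split: nat.splits)
  qed (auto simp: PR_def coeff_pCons split: nat.splits)
  then show ?thesis by (auto simp: PR_def)
qed

text \<open>Polynomials in the first \<open>n\<close> variables are constants for \<open>inX n\<close>.\<close>

lemma dvd_iff_coeff_inX:
  assumes "\<pi> \<in> polyR n"
  shows "\<pi> dvd a \<longleftrightarrow> (\<forall>k. \<pi> dvd coeff (inX n a) k)"
proof
  assume "\<pi> dvd a"
  then obtain b where "a = \<pi> * b" ..
  then have "inX n a = Polynomial.smult \<pi> (inX n b)" by (simp add: inX.hom_mult inX_polyR[OF assms])
  then show "\<forall>k. \<pi> dvd coeff (inX n a) k" by simp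
next
  assume *: "\<forall>k. \<pi> dvd coeff (inX n a) k"
  have "a = (\<Sum>k\<le>degree (inX n a). coeff (inX n a) k * pvar n ^ k)"
    using poly_inX[of n a] by (simp add: poly_altdef)
  moreover have "\<pi> dvd (\<Sum>k\<le>degree (inX n a). coeff (inX n a) k * pvar n ^ k)"
    using * by (intro dvd_sum) auto
  ultimately show "\<pi> dvd a" by simp
qed

text \<open>Gauss's lemma: if \<open>\<pi>\<close> divides neither factor, then it does not divide the coefficient of the product
  in the degree that is the sum of the first degrees at which it fails to divide the factors.\<close>

lemma prime_in_Suc:
  assumes "prime_in n \<pi>"
  shows "prime_in (Suc n) \<pi>"
  unfolding prime_in_def
proof (intro conjI ballI impI)
  show "\<pi> \<in> polyR (Suc n)" using prime_inD(1)[OF assms] polyR_mono[of n "Suc n"] by auto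
  show "\<pi> \<noteq> 0" "\<not> \<pi> dvd 1" using prime_inD[OF assms] by auto
  fix a b assume ab: "a \<in> polyR (Suc n)" "b \<in> polyR (Suc n)" "\<pi> dvd a * b"
  note dvd_iff = dvd_iff_coeff_inX[OF prime_inD(1)[OF assms]]
  show "\<pi> dvd a \<or> \<pi> dvd b"
  proof (rule ccontr)
    assume "\<not> (\<pi> dvd a \<or> \<pi> dvd b)"
    then have ex: "\<exists>i. \<not> \<pi> dvd coeff (inX n a) i" "\<exists>j. \<not> \<pi> dvd coeff (inX n b) j"
      using dvd_iff[of a] dvd_iff[of b] by blast+
    define i where "i = (LEAST i. \<not> \<pi> dvd coeff (inX n a) i)"
    define j where "j = (LEAST j. \<not> \<pi> dvd coeff (inX n b) j)"
    have i: "\<not> \<pi> dvd coeff (inX n a) i" "\<And>k. k < i \<Longrightarrow> \<pi> dvd coeff (inX n a) k"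
      unfolding i_def using LeastI_ex[OF ex(1)] not_less_Least by blast+
    have j: "\<not> \<pi> dvd coeff (inX n b) j" "\<And>k. k < j \<Longrightarrow> \<pi> dvd coeff (inX n b) k"
      unfolding j_def using LeastI_ex[OF ex(2)] not_less_Least by blast+
    have "\<pi> dvd coeff (inX n (a * b)) (i + j)" using ab(3) dvd_iff by blast
    also have "coeff (inX n (a * b)) (i + j) = coeff (inX n a) i * coeff (inX n b) j +
        (\<Sum>k\<in>{..i+j} - {i}. coeff (inX n a) k * coeff (inX n b) (i + j - k))"
      unfolding inX.hom_mult coeff_mult by (subst sum.remove[of _ i]) auto
    finally have "\<pi> dvd coeff (inX n a) i * coeff (inX n b) j +
        (\<Sum>k\<in>{..i+j} - {i}. coeff (inX n a) k * coeff (inX n b) (i + j - k))" .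
    moreover have "\<pi> dvd (\<Sum>k\<in>{..i+j} - {i}. coeff (inX n a) k * coeff (inX n b) (i + j - k))"
    proof (rule dvd_sum)
      fix k assume "k \<in> {..i+j} - {i}"
      then have "k < i \<or> i + j - k < j" by auto
      then show "\<pi> dvd coeff (inX n a) k * coeff (inX n b) (i + j - k)" using i j by auto
    qed
    ultimately have "\<pi> dvd coeff (inX n a) i * coeff (inX n b) j"
      by (meson dvd_add_left_iff)
    with prime_inD(4)[OF assms coeff_inX_polyR[OF ab(1)] coeff_inX_polyR[OF ab(2)]] i(1) j(1)
    show False by blast
  qed
qed

definition factors_in :: "nat \<Rightarrow> 'k::field mpoly \<Rightarrow> bool" where
  "factors_in n p \<longleftrightarrow> (\<exists>c ps. c \<noteq> 0 \<and> p = pconst c * prod_list ps \<and> (\<forall>q\<in>set ps. prime_in n q))"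

lemma factors_in_mult:
  assumes "factors_in n p" "factors_in n q"
  shows "factors_in n (p * q)"
proof -
  obtain c ps where p: "c \<noteq> 0" "p = pconst c * prod_list ps" "\<forall>q\<in>set ps. prime_in n q"
    using assms(1) by (auto simp: factors_in_def)
  obtain d qs where q: "d \<noteq> 0" "q = pconst d * prod_list qs" "\<forall>q\<in>set qs. prime_in n q"
    using assms(2) by (auto simp: factors_in_def)
  show ?thesis unfolding factors_in_def
    by (rule exI[of _ "c * d"], rule exI[of _ "ps @ qs"])
       (use p q in \<open>auto simp: pconst.hom_mult mult_ac\<close>)
qed

lemma factors_in_Suc: "factors_in n p \<Longrightarrow> factors_in (Suc n) p"
  unfolding factors_in_def using prime_in_Suc by blast

text \<open>The prime factors of \<open>c\<close> stay prime after adjoining the variable, do not divide \<open>r\<close>, and so can be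
  cancelled against \<open>u\<close> one after the other.\<close>

lemma strip_content:
  assumes "factors_in n c" "r \<in> polyR (Suc n)" "u \<in> polyR (Suc n)" "p \<in> polyR (Suc n)"
    "r * u = c * p" "\<And>\<pi>. prime_in n \<pi> \<Longrightarrow> \<not> \<pi> dvd r"
  shows "r dvd p"
proof -
  obtain d ps where c: "d \<noteq> 0" "c = pconst d * prod_list ps" "\<forall>q\<in>set ps. prime_in n q"
    using assms(1) by (auto simp: factors_in_def)
  have "r * u = pconst d * prod_list ps * p" using assms(5) c by simp
  then show ?thesis using assms(3) c(3)
  proof (induction ps arbitrary: u)
    case Nil
    obtain e where "1 = pconst d * e" using pconst_dvd_1[OF c(1)] by (elim dvdE)
    then have "p = e * (pconst d * p)" by (metis mult.assoc mult.commute mult_1)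
    also have "\<dots> = r * (u * e)" using Nil by (simp add: mult_ac)
    finally show ?case by (rule dvdI)
  next
    case (Cons \<pi> ps)
    then have \<pi>: "prime_in n \<pi>" "prime_in (Suc n) \<pi>" by (auto intro: prime_in_Suc)
    have "\<pi> dvd r * u" using Cons.prems(1) by simp
    then have "\<pi> dvd u"
      using prime_inD(4)[OF \<pi>(2) assms(2) Cons.prems(2)] assms(6)[OF \<pi>(1)] by blast
    then obtain u' where u': "u' \<in> polyR (Suc n)" "u = \<pi> * u'"
      using dvd_polyR[OF _ prime_inD(1)[OF \<pi>(2)] Cons.prems(2)] by blast
    have "\<pi> * (r * u') = \<pi> * (pconst d * prod_list ps * p)"
      using Cons.prems(1) u' by (simp add: mult_ac)
    then have "r * u' = pconst d * prod_list ps * p" using prime_inD(2)[OF \<pi>(1)] by simp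
    from Cons.IH[OF this u'(1)] Cons.prems(3) show ?case by simp
  qed
qed

text \<open>Primes not involving the last variable are divided out until none is left; the degree drops
  each time.\<close>

lemma split_content:
  assumes "r \<in> polyR (Suc n)" "r \<noteq> 0"
  obtains c s where "c \<in> polyR n" "c \<noteq> 0" "s \<in> polyR (Suc n)" "r = c * s"
    "\<And>\<pi>. prime_in n \<pi> \<Longrightarrow> \<not> \<pi> dvd s"
proof -
  have "\<exists>c s. c \<in> polyR n \<and> c \<noteq> 0 \<and> s \<in> polyR (Suc n) \<and> r = c * s \<and> (\<forall>\<pi>. prime_in n \<pi> \<longrightarrow> \<not> \<pi> dvd s)"
    using assms
  proof (induction "degree (grade r)" arbitrary: r rule: less_induct)
    case less
    show ?case
    proof (cases "\<exists>\<pi>. prime_in n \<pi> \<and> \<pi> dvd r")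
      case False
      with less.prems show ?thesis by (intro exI[of _ 1] exI[of _ r]) auto
    next
      case True
      then obtain \<pi> where \<pi>: "prime_in n \<pi>" "\<pi> dvd r" by blast
      obtain r' where r': "r' \<in> polyR (Suc n)" "r = \<pi> * r'"
        using dvd_polyR[OF \<pi>(2)] less.prems(1) prime_inD(1)[OF prime_in_Suc[OF \<pi>(1)]] by blast
      have "r' \<noteq> 0" using r' less.prems by auto
      then have "degree (grade r') < degree (grade r)"
        using degree_grade_mult[of \<pi> r'] r'(2) degree_grade_nonunit[of \<pi>] prime_inD[OF \<pi>(1)] by simp
      from less.hyps[OF this r'(1) \<open>r' \<noteq> 0\<close>] obtain c s where
        "c \<in> polyR n" "c \<noteq> 0" "s \<in> polyR (Suc n)" "r' = c * s" "\<forall>\<pi>. prime_in n \<pi> \<longrightarrow> \<not> \<pi> dvd s"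
        by blast
      then show ?thesis
        using r'(2) prime_inD[OF \<pi>(1)] by (intro exI[of _ "\<pi> * c"] exI[of _ s]) (auto simp: mult_ac)
    qed
  qed
  then show ?thesis using that by blast
qed

text \<open>Division with remainder in the last variable, multiplied through by powers of the leading coefficient.\<close>

lemma pseudo_division:
  assumes g: "g \<in> polyR (Suc n)" "g \<noteq> 0" and f: "f \<in> polyR (Suc n)"
  obtains c q where "c \<in> polyR n" "c \<noteq> 0" "q \<in> polyR (Suc n)"
    "c * f - q * g = 0 \<or> degree (inX n (c * f - q * g)) < degree (inX n g)"
proof -
  have up: "h \<in> polyR (Suc n)" if "h \<in> polyR n" for h :: "'a mpoly"
    using that polyR_mono[of n "Suc n"] by auto
  have "\<exists>c q. c \<in> polyR n \<and> c \<noteq> 0 \<and> q \<in> polyR (Suc n) \<and>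
    (c * f - q * g = 0 \<or> degree (inX n (c * f - q * g)) < degree (inX n g))"
    using f
  proof (induction "degree (inX n f)" arbitrary: f rule: less_induct)
    case less
    show ?case
    proof (cases "f = 0 \<or> degree (inX n f) < degree (inX n g)")
      case True
      then show ?thesis by (intro exI[of _ 1] exI[of _ 0]) auto
    next
      case False
      define F G where "F = inX n f" and "G = inX n g"
      define k where "k = degree F - degree G"
      define f' where "f' = lead_coeff G * f - lead_coeff F * pvar n ^ k * g"
      have lF: "lead_coeff F \<in> polyR n" and lG: "lead_coeff G \<in> polyR n"
        unfolding F_def G_def using coeff_inX_polyR less.prems g by auto
      have f'R: "f' \<in> polyR (Suc n)"
        unfolding f'_def using lF lG up g less.prems
        by (intro polyR_diff polyR_mult polyR_power polyR_pvar) auto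
      have FG: "degree F = k + degree G" using False by (simp add: F_def G_def k_def)
      have "inX n f' = Polynomial.smult (lead_coeff G) F - Polynomial.smult (lead_coeff F) (monom 1 k * G)"
        unfolding f'_def
        by (simp add: inX.hom_minus inX.hom_mult inX.hom_power inX_polyR[OF lF] inX_polyR[OF lG]
            F_def[symmetric] G_def[symmetric] x_as_monom monom_power mult.assoc smult_monom)
      note f'X = this
      have c0: "coeff (inX n f') (degree F) = 0"
        unfolding f'X by (simp add: FG coeff_monom_mult)
      have "degree (monom 1 k * G) \<le> degree F"
        using FG degree_monom_le[of "1 :: 'a mpoly" k] degree_mult_le[of "monom 1 k" G] by linarith
      then have dle: "degree (inX n f') \<le> degree F"
        unfolding f'X by (intro degree_diff_le order_trans[OF degree_smult_le]) auto
      have G0: "lead_coeff G \<noteq> 0" using g by (simp add: G_def)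
      show ?thesis
      proof (cases "f' = 0")
        case True
        moreover have "lead_coeff F * pvar n ^ k \<in> polyR (Suc n)"
          using up[OF lF] by (intro polyR_mult polyR_power polyR_pvar) auto
        ultimately show ?thesis
          using lG G0 unfolding f'_def by blast
      next
        case False
        then have "degree (inX n f') \<noteq> degree F"
          using c0 by (metis inX_eq_0_iff leading_coeff_0_iff)
        then have "degree (inX n f') < degree (inX n f)" using dle by (simp add: F_def)
        from less.hyps[OF this f'R] obtain c q where cq: "c \<in> polyR n" "c \<noteq> 0" "q \<in> polyR (Suc n)"
          "c * f' - q * g = 0 \<or> degree (inX n (c * f' - q * g)) < degree (inX n g)" by blast
        have "c * f' - q * g = c * lead_coeff G * f - (c * lead_coeff F * pvar n ^ k + q) * g"
          by (simp add: f'_def algebra_simps)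
        then show ?thesis using cq lF lG G0 up
          by (intro exI[of _ "c * lead_coeff G"] exI[of _ "c * lead_coeff F * pvar n ^ k + q"])
             (auto intro!: polyR_mult polyR_add polyR_power polyR_pvar)
      qed
    qed
  qed
  then show ?thesis using that by blast
qed

text \<open>Euclid's argument over the fraction field of \<open>polyR n\<close>, with denominators cleared:
  an irreducible polynomial of positive degree in the last variable is prime.\<close>

lemma irreducible_prime_in:
  fixes p :: "'k::field mpoly"
  assumes fac: "\<And>c :: 'k mpoly. c \<in> polyR n \<Longrightarrow> c \<noteq> 0 \<Longrightarrow> factors_in n c"
    and p: "p \<in> polyR (Suc n)" "p \<noteq> 0" "\<not> p dvd 1"
    and irr: "\<And>a b. a \<in> polyR (Suc n) \<Longrightarrow> b \<in> polyR (Suc n) \<Longrightarrow> p = a * b \<Longrightarrow> a dvd 1 \<or> b dvd 1"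
    and deg: "degree (inX n p) > 0"
  shows "prime_in (Suc n) p"
proof -
  have up: "h \<in> polyR (Suc n)" if "h \<in> polyR n" for h :: "'k mpoly"
    using that polyR_mono[of n "Suc n"] by auto
  have prim: "\<not> \<pi> dvd p" if \<pi>: "prime_in n \<pi>" for \<pi>
  proof
    assume "\<pi> dvd p"
    then obtain h where h: "h \<in> polyR (Suc n)" "p = \<pi> * h"
      using dvd_polyR[OF _ up[OF prime_inD(1)[OF \<pi>]] p(1)] by blast
    then have "h dvd 1" using irr[of \<pi> h] up prime_inD[OF \<pi>] by blast
    then obtain c where "h = pconst c" using unit_const by blast
    with h have "inX n p = [:\<pi> * pconst c:]"
      by (simp add: inX.hom_mult inX_polyR[OF prime_inD(1)[OF \<pi>]] mult.commute)
    with deg show False by simp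
  qed
  have "p dvd a \<or> p dvd b" if ab: "a \<in> polyR (Suc n)" "b \<in> polyR (Suc n)" "p dvd a * b" for a b
  proof (rule ccontr)
    assume neg: "\<not> (p dvd a \<or> p dvd b)"
    \<comment> \<open>The ideal \<open>(p, a)\<close> becomes principal over the fraction field; \<open>r\<close> generates it there, and \<open>s\<close> is the primitive part of \<open>r\<close>.\<close>
    define I where "I = {\<alpha> * p + \<beta> * a | \<alpha> \<beta>. \<alpha> \<in> polyR (Suc n) \<and> \<beta> \<in> polyR (Suc n)}"
    have IR: "I \<subseteq> polyR (Suc n)" unfolding I_def using p(1) ab(1) by auto
    have pI: "p \<in> I" unfolding I_def
      by (rule CollectI, rule exI[of _ 1], rule exI[of _ 0]) auto
    have aI: "a \<in> I" unfolding I_def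
      by (rule CollectI, rule exI[of _ 0], rule exI[of _ 1]) auto
    have "\<exists>r. r \<in> I - {0} \<and> (\<forall>s\<in>I - {0}. degree (inX n r) \<le> degree (inX n s))"
      using ex_has_least_nat[of "\<lambda>r. r \<in> I - {0}" p "\<lambda>r. degree (inX n r)"] pI p(2) by blast
    then obtain r where r: "r \<in> I" "r \<noteq> 0" and
      rmin: "\<And>s. s \<in> I \<Longrightarrow> s \<noteq> 0 \<Longrightarrow> degree (inX n r) \<le> degree (inX n s)" by blast
    have rR: "r \<in> polyR (Suc n)" using r IR by auto
    have div: "\<exists>c q. c \<in> polyR n \<and> c \<noteq> 0 \<and> q \<in> polyR (Suc n) \<and> c * f = q * r" if f: "f \<in> I" for f
    proof -
      obtain c q where cq: "c \<in> polyR n" "c \<noteq> 0" "q \<in> polyR (Suc n)"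
        "c * f - q * r = 0 \<or> degree (inX n (c * f - q * r)) < degree (inX n r)"
        using pseudo_division[OF rR r(2)] f IR by blast
      obtain \<alpha> \<beta> where 1: "\<alpha> \<in> polyR (Suc n)" "\<beta> \<in> polyR (Suc n)" "f = \<alpha> * p + \<beta> * a"
        using f unfolding I_def by blast
      obtain \<gamma> \<delta> where 2: "\<gamma> \<in> polyR (Suc n)" "\<delta> \<in> polyR (Suc n)" "r = \<gamma> * p + \<delta> * a"
        using r(1) unfolding I_def by blast
      have "c * f - q * r = (c * \<alpha> - q * \<gamma>) * p + (c * \<beta> - q * \<delta>) * a"
        by (simp add: 1(3) 2(3) algebra_simps)
      moreover have "c * \<alpha> - q * \<gamma> \<in> polyR (Suc n)" "c * \<beta> - q * \<delta> \<in> polyR (Suc n)"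
        using cq 1 2 up by auto
      ultimately have "c * f - q * r \<in> I" unfolding I_def by blast
      with rmin cq(4) have "c * f - q * r = 0" using leD by blast
      with cq show ?thesis by (intro exI[of _ c] exI[of _ q]) simp
    qed
    obtain c s where cs: "c \<in> polyR n" "c \<noteq> 0" "s \<in> polyR (Suc n)" "r = c * s"
      "\<And>\<pi>. prime_in n \<pi> \<Longrightarrow> \<not> \<pi> dvd s"
      using split_content[OF rR r(2)] by blast
    have sdvd: "s dvd f" if f: "f \<in> I" for f
    proof -
      obtain d q where dq: "d \<in> polyR n" "d \<noteq> 0" "q \<in> polyR (Suc n)" "d * f = q * r"
        using div[OF f] by blast
      show ?thesis
      proof (rule strip_content[OF fac[OF dq(1,2)] cs(3) _ _ _ cs(5)])
        show "q * c \<in> polyR (Suc n)" using dq cs up by auto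
        show "f \<in> polyR (Suc n)" using f IR by auto
        show "s * (q * c) = d * f" using dq(4) cs(4) by (simp add: mult_ac)
      qed
    qed
    obtain h where h: "h \<in> polyR (Suc n)" "p = s * h"
      using dvd_polyR[OF sdvd[OF pI] cs(3) p(1)] by blast
    have "s dvd 1 \<or> h dvd 1" by (rule irr[OF cs(3) h])
    then show False
    proof
      assume "h dvd 1"
      then have "p dvd s" using h(2) by (simp add: mult_unit_dvd_iff)
      from this sdvd[OF aI] have "p dvd a" by (rule dvd_trans)
      with neg show False by simp
    next
      assume "s dvd 1"
      then obtain e where e: "s = pconst e" using unit_const by blast
      then have rn: "r \<in> polyR n" using cs by auto
      obtain \<gamma> \<delta> where 2: "r = \<gamma> * p + \<delta> * a"
        using r(1) unfolding I_def by blast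
      have "r * b = p * (\<gamma> * b) + \<delta> * (a * b)" by (simp add: 2 algebra_simps)
      then have "p dvd r * b" using ab(3) by simp
      then obtain u where u: "u \<in> polyR (Suc n)" "r * b = p * u"
        using dvd_polyR[of p "r * b"] p(1) rR ab(2) by blast
      have "p dvd b"
        by (rule strip_content[OF fac[OF rn r(2)] p(1) u(1) ab(2) u(2)[symmetric] prim])
      with neg show False by simp
    qed
  qed
  with p show ?thesis by (simp add: prime_in_def)
qed

text \<open>Induction on the number of variables, and on the degree for splitting off proper factors.\<close>

theorem factorization:
  "p \<in> polyR n \<Longrightarrow> p \<noteq> 0 \<Longrightarrow> factors_in n p"
proof (induction n arbitrary: p)
  case 0
  obtain c where "p = pconst c" using polyR_zero_const 0 by blast
  with 0 show ?case unfolding factors_in_def by (intro exI[of _ c] exI[of _ "[]"]) auto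
next
  case (Suc n)
  show ?case using Suc.prems
  proof (induction "degree (grade p)" arbitrary: p rule: less_induct)
    case less
    consider "p dvd 1" | a b where "a \<in> polyR (Suc n)" "b \<in> polyR (Suc n)" "p = a * b"
        "\<not> a dvd 1" "\<not> b dvd 1"
      | "\<not> p dvd 1" "\<And>a b. a \<in> polyR (Suc n) \<Longrightarrow> b \<in> polyR (Suc n) \<Longrightarrow> p = a * b \<Longrightarrow> a dvd 1 \<or> b dvd 1"
      by blast
    then show ?case
    proof cases
      case 1
      then obtain c where "c \<noteq> 0" "p = pconst c" using unit_const by blast
      then show ?thesis unfolding factors_in_def by (intro exI[of _ c] exI[of _ "[]"]) auto
    next
      case 2
      then have nz: "a \<noteq> 0" "b \<noteq> 0" using less.prems by auto
      have "degree (grade a) < degree (grade p)" "degree (grade b) < degree (grade p)"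
        using degree_grade_mult[OF nz] degree_grade_nonunit nz 2 by auto
      then show ?thesis unfolding 2(3) using less.hyps nz 2 by (intro factors_in_mult) auto
    next
      case 3
      show ?thesis
      proof (cases "degree (inX n p) = 0")
        case True
        then obtain h where h: "inX n p = [:h:]" by (metis degree_eq_zeroE)
        then have "p = h" using poly_inX[of n p] by simp
        moreover have "h \<in> polyR n" using coeff_inX_polyR[OF less.prems(1), of 0] h by simp
        ultimately show ?thesis using Suc.IH less.prems factors_in_Suc by blast
      next
        case False
        have "prime_in (Suc n) p"
          by (rule irreducible_prime_in[OF Suc.IH less.prems 3]) (use False in auto)
        then show ?thesis unfolding factors_in_def
          by (intro exI[of _ 1] exI[of _ "[p]"]) auto
      qed
    qed
  qed
qed

lemma prime_in_dvd_prime_in: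
  assumes "prime_in n p" "prime_in n q" "p dvd q"
  obtains c where "c \<noteq> 0" "q = p * pconst c"
proof -
  obtain u where u: "u \<in> polyR n" "q = p * u"
    using dvd_polyR[OF assms(3)] assms(1,2) prime_inD(1) by blast
  have "q dvd p \<or> q dvd u" using prime_inD(4)[OF assms(2) prime_inD(1)[OF assms(1)] u(1)] u(2) by simp
  moreover have "\<not> q dvd u"
  proof
    assume "q dvd u"
    then obtain v where "u = q * v" ..
    with u(2) have "q * (p * v) = q * 1" by (simp add: mult_ac)
    then have "p * v = 1" using prime_inD(2)[OF assms(2)] mult_left_cancel by blast
    then have "p dvd 1" by (metis dvdI)
    with prime_inD(3)[OF assms(1)] show False by simp
  qed
  ultimately obtain v where "p = q * v" by (auto elim: dvdE)
  with u(2) have "q * (u * v) = q * 1" by (simp add: mult_ac)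
  then have "u * v = 1" using prime_inD(2)[OF assms(2)] mult_left_cancel by blast
  then have "u dvd 1" by (metis dvdI)
  then show ?thesis using unit_const u(2) that by blast
qed

text \<open>The prime factors of \<open>d\<close> are divided out of \<open>d\<close> and \<open>f\<close> one after the other.\<close>

lemma dvd_if_prime_powers_dvd:
  assumes "d \<in> polyR n" "d \<noteq> 0" "f \<in> polyR n" "f \<noteq> 0"
    and "\<And>\<pi> k. prime_in n \<pi> \<Longrightarrow> \<pi> ^ k dvd d \<Longrightarrow> \<pi> ^ k dvd f"
  shows "d dvd f"
proof -
  obtain c ps where d: "c \<noteq> 0" "d = pconst c * prod_list ps" "\<forall>q\<in>set ps. prime_in n q"
    using factorization[OF assms(1,2)] by (auto simp: factors_in_def)
  show ?thesis unfolding d(2) using d(3) assms(3,4) assms(5)[unfolded d(2)]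
  proof (induction ps arbitrary: f)
    case Nil
    have "pconst c dvd 1" using d(1) by (rule pconst_dvd_1)
    then show ?case by (metis dvd_trans mult.right_neutral one_dvd prod_list.Nil)
  next
    case (Cons \<pi> ps)
    have \<pi>: "prime_in n \<pi>" using Cons.prems by simp
    have "\<pi> ^ 1 dvd f" by (rule Cons.prems(4)[OF \<pi>]) simp
    then obtain f1 where f1: "f1 \<in> polyR n" "f = \<pi> * f1"
      using dvd_polyR[of \<pi> f] Cons.prems(2) prime_inD(1)[OF \<pi>] by auto
    have f10: "f1 \<noteq> 0" using f1 Cons.prems by auto
    have "\<rho> ^ k dvd f1" if \<rho>: "prime_in n \<rho>" "\<rho> ^ k dvd pconst c * prod_list ps" for \<rho> k
    proof (cases "\<rho> dvd \<pi>")
      case True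
      then obtain e where e: "e \<noteq> 0" "\<pi> = \<rho> * pconst e"
        using prime_in_dvd_prime_in[OF \<rho>(1) \<pi>] by blast
      have "\<rho> ^ Suc k dvd \<pi> * (pconst c * prod_list ps)"
        unfolding e(2) using \<rho>(2) by (simp add: mult.assoc mult_dvd_mono)
      then have "\<rho> ^ Suc k dvd f" using Cons.prems(4)[OF \<rho>(1), of "Suc k"] by (simp add: mult_ac)
      then have "\<rho> * \<rho> ^ k dvd \<rho> * (f1 * pconst e)" using f1(2) e(2) by (simp add: mult_ac)
      then have "\<rho> ^ k dvd f1 * pconst e" using prime_inD(2)[OF \<rho>(1)] by simp
      then show ?thesis using pconst_dvd_1[OF e(1)] by (simp add: dvd_mult_unit_iff)
    next
      case False
      have "\<rho> ^ k dvd \<pi> * (pconst c * prod_list ps)" using \<rho>(2) by simp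
      then have "\<rho> ^ k dvd \<pi> * f1" using Cons.prems(4)[OF \<rho>(1), of k] f1(2) by (simp add: mult_ac)
      then show ?thesis by (rule prime_in_power_dvd[OF \<rho>(1) prime_inD(1)[OF \<pi>] f1(1) False])
    qed
    then have "pconst c * prod_list ps dvd f1"
      using Cons.IH[OF _ f1(1) f10] Cons.prems(1) by simp
    then show ?case using f1(2) by (simp add: mult.left_commute mult_dvd_mono)
  qed
qed

section \<open>The group action\<close>

context vector_space
begin

lemma linear_functional_expand:
  assumes "distinct es" "independent (set es)" "span (set es) = UNIV"
    and "Vector_Spaces.linear scale (*) l"
  shows "l u = (\<Sum>i<length es. representation (set es) u (es ! i) * l (es ! i))"
proof -
  interpret l: Vector_Spaces.linear scale "(*)" l by fact
  have "u = (\<Sum>b\<in>set es. representation (set es) u b *s b)"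
    using sum_representation_eq[of "set es" u "set es"] assms by simp
  also have "\<dots> = (\<Sum>i<length es. representation (set es) u (es ! i) *s (es ! i))"
    by (rule sum.reindex_bij_betw[symmetric, of "(!) es"])
       (simp add: bij_betw_nth assms(1))
  finally have "l u = l (\<Sum>i<length es. representation (set es) u (es ! i) *s (es ! i))"
    by (rule arg_cong)
  then show ?thesis by (simp add: l.sum l.scale)
qed

lemma representation_linear:
  assumes "independent (set es)" "span (set es) = UNIV"
  shows "Vector_Spaces.linear scale (*) (\<lambda>u. representation (set es) u b)"
proof -
  have "vector_space ((*) :: 'a \<Rightarrow> 'a \<Rightarrow> 'a)"
    by unfold_locales (auto simp: algebra_simps)
  then show ?thesis
    unfolding Vector_Spaces.linear_iff
    using vector_space_axioms assms
    by (auto simp: representation_add representation_scale)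
qed

lemma representation_nth:
  assumes "distinct es" "independent (set es)" "i < length es" "j < length es"
  shows "representation (set es) (es ! j) (es ! i) = (if i = j then 1 else 0)"
  using assms by (subst representation_basis) (auto simp: nth_eq_iff_index_eq)

end

context covariants
begin

abbreviation "xV u i \<equiv> V.representation (set bs) u (bs ! i)"
abbreviation "xM u i \<equiv> M.representation (set vs) u (vs ! i)"

lemma xV_linear: "Vector_Spaces.linear scV (*) (\<lambda>u. xV u i)"
  by (rule V.representation_linear[OF V_basis(2,3)])

lemma xM_linear: "Vector_Spaces.linear scM (*) (\<lambda>u. xM u i)"
  by (rule M.representation_linear[OF M_basis(2,3)])

lemmas functional_expand = V.linear_functional_expand[OF V_basis]
lemmas functional_expand_M = M.linear_functional_expand[OF M_basis]

lemma V_expand: "u = (\<Sum>i<length bs. scV (xV u i) (bs ! i))"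
proof -
  have "u = (\<Sum>b\<in>set bs. scV (V.representation (set bs) u b) b)"
    using V.sum_representation_eq[of "set bs" u "set bs"] V_basis by simp
  also have "\<dots> = (\<Sum>i<length bs. scV (xV u i) (bs ! i))"
    by (rule sum.reindex_bij_betw[symmetric, of "(!) bs"]) (simp add: bij_betw_nth V_basis(1))
  finally show ?thesis .
qed

lemma xV_nth: "i < length bs \<Longrightarrow> j < length bs \<Longrightarrow> xV (bs ! j) i = (if i = j then 1 else 0)"
  by (rule V.representation_nth[OF V_basis(1,2)])

lemma xM_nth: "i < length vs \<Longrightarrow> j < length vs \<Longrightarrow> xM (vs ! j) i = (if i = j then 1 else 0)"
  by (rule M.representation_nth[OF M_basis(1,2)])

lemma functional_comp:
  assumes "Vector_Spaces.linear scV (*) l" "Vector_Spaces.linear scV scV h"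
  shows "Vector_Spaces.linear scV (*) (\<lambda>u. l (h u))"
  using assms by (auto simp: Vector_Spaces.linear_iff)

lemma coord_ring_polyR: "coord_ring = polyR (length bs)"
  by (simp add: coord_ring_def polyR_def)

lemma form_poly_in: "form_poly l \<in> polyR (length bs)"
  unfolding form_poly_def by (intro polyR_sum polyR_mult polyR_pconst polyR_pvar) auto

lemma form_poly_homogeneous: "homogeneous 1 (form_poly l)"
  unfolding form_poly_def
  by (intro homogeneous_sum homogeneous_pconst_mult homogeneous_pvar)

lemma form_poly_xV: "i < length bs \<Longrightarrow> form_poly (\<lambda>u. xV u i) = pvar i"
proof -
  assume i: "i < length bs"
  have "form_poly (\<lambda>u. xV u i) = (\<Sum>j<length bs. if j = i then pvar i else 0)"
    unfolding form_poly_def by (intro sum.cong refl) (use i in \<open>auto simp: xV_nth\<close>)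
  with i show ?thesis by simp
qed

lemma form_poly_sum: "form_poly (\<lambda>u. \<Sum>x\<in>X. c x * l x u) = (\<Sum>x\<in>X. pconst (c x) * form_poly (l x))"
  unfolding form_poly_def
  by (simp add: pconst.hom_sum pconst.hom_mult sum_distrib_left sum_distrib_right mult.assoc)
     (rule sum.swap)

lemma single_1_eq_iff: "Poly_Mapping.single x (Suc 0) = Poly_Mapping.single j (Suc 0) \<longleftrightarrow> x = j"
  by (metis lookup_single_eq lookup_single_not_eq nat.distinct(1))

lemma lookup_form_poly:
  "j < length bs \<Longrightarrow> Poly_Mapping.lookup (form_poly l) (Poly_Mapping.single j 1) = l (bs ! j)"
proof -
  assume j: "j < length bs"
  have "Poly_Mapping.lookup (form_poly l) (Poly_Mapping.single j 1) =
     (\<Sum>i<length bs. if i = j then l (bs ! j) else 0)"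
    unfolding form_poly_def lookup_sum
    by (intro sum.cong refl) (auto simp: pconst_def pvar_def mult_single lookup_single when_def single_1_eq_iff)
  with j show ?thesis by simp
qed

lemma form_poly_eqD:
  assumes "form_poly l = form_poly l'" "j < length bs"
  shows "l (bs ! j) = l' (bs ! j)"
  using arg_cong[OF assms(1), of "\<lambda>p. Poly_Mapping.lookup p (Poly_Mapping.single j 1)"]
  by (simp add: lookup_form_poly[OF assms(2)] del: One_nat_def)

lemma form_poly_cong: "(\<And>j. j < length bs \<Longrightarrow> l (bs ! j) = l' (bs ! j)) \<Longrightarrow> form_poly l = form_poly l'"
  unfolding form_poly_def by (intro sum.cong) auto

lemma form_poly_scale: "form_poly (\<lambda>u. c * l u) = pconst c * form_poly l"
  using form_poly_sum[of "\<lambda>_. c" "\<lambda>_. l" "{()}"] by simp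

lemma form_poly_diff: "form_poly (\<lambda>u. l u - l' u) = form_poly l - form_poly l'"
  unfolding form_poly_def by (simp add: pconst.hom_minus left_diff_distrib sum_subtractf)

lemma act_hom: "comm_ring_hom (act g)"
  unfolding act_def by (rule psubst_hom)

lemma act_pconst [simp]: "act g (pconst c) = pconst c"
  by (simp add: act_def)

lemma act_pvar: "act g (pvar i) = form_poly (\<lambda>u. xV (inv_into UNIV g u) i)"
  by (simp add: act_def)

lemma act_polyR: "p \<in> polyR (length bs) \<Longrightarrow> act g p \<in> polyR (length bs)"
  unfolding act_def by (rule psubst_polyR) (auto intro: form_poly_in)

lemma act_simps:
  "act g (p + q) = act g p + act g q" "act g (p * q) = act g p * act g q"
  "act g (p - q) = act g p - act g q" "act g (- p) = - act g p"
  "act g 0 = 0" "act g 1 = 1" "act g (p ^ k) = act g p ^ k"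
proof -
  interpret h: comm_ring_hom "act g" by (rule act_hom)
  show "act g (p + q) = act g p + act g q" "act g (p * q) = act g p * act g q"
    "act g (p - q) = act g p - act g q" "act g (- p) = - act g p"
    "act g 0 = 0" "act g 1 = 1" "act g (p ^ k) = act g p ^ k"
    by (simp_all add: h.hom_add h.hom_mult h.hom_minus h.hom_uminus h.hom_power)
qed

lemma act_sum: "act g (\<Sum>x\<in>X. f x) = (\<Sum>x\<in>X. act g (f x))"
  by (rule comm_monoid_add_hom.hom_sum)
     (intro comm_monoid_add_hom.intro monoid_add_hom.intro zero_hom.intro semigroup_add_hom.intro
       plus_hom.intro act_simps)

lemma act_prod: "act g (\<Prod>x\<in>X. f x) = (\<Prod>x\<in>X. act g (f x))"
  by (induction X rule: infinite_finite_induct) (auto simp: act_simps)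

lemma inv_linear: "g \<in> G \<Longrightarrow> Vector_Spaces.linear scV scV (inv_into UNIV g)"
  using G_inv G_linear by blast

lemma act_form_poly:
  assumes "Vector_Spaces.linear scV (*) l" "g \<in> G"
  shows "act g (form_poly l) = form_poly (\<lambda>u. l (inv_into UNIV g u))"
proof -
  have "act g (form_poly l) = (\<Sum>i<length bs. pconst (l (bs ! i)) * form_poly (\<lambda>u. xV (inv_into UNIV g u) i))"
    unfolding form_poly_def[of l] by (simp add: act_sum act_simps act_pvar)
  also have "\<dots> = form_poly (\<lambda>u. \<Sum>i<length bs. l (bs ! i) * xV (inv_into UNIV g u) i)"
    by (rule form_poly_sum[symmetric])
  also have "\<dots> = form_poly (\<lambda>u. l (inv_into UNIV g u))"
    by (rule form_poly_cong) (subst (2) functional_expand[OF assms(1)], simp add: mult.commute)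
  finally show ?thesis .
qed

lemma act_comp:
  assumes "g \<in> G" "h \<in> G" "p \<in> polyR (length bs)"
  shows "act (g \<circ> h) p = act g (act h p)"
proof (rule hom_eqI[OF act_hom comm_ring_hom_comp[OF act_hom act_hom] _ _ assms(3)])
  fix i assume i: "i < length bs"
  have "act g (act h (pvar i)) = form_poly (\<lambda>u. xV (inv_into UNIV h (inv_into UNIV g u)) i)"
    unfolding act_pvar
    by (rule act_form_poly) (use assms in \<open>auto intro: functional_comp xV_linear inv_linear\<close>)
  also have "(\<lambda>u. xV (inv_into UNIV h (inv_into UNIV g u)) i) = (\<lambda>u. xV (inv_into UNIV (g \<circ> h) u) i)"
    using o_inv_distrib[OF G_bij G_bij] assms by simp
  finally show "act (g \<circ> h) (pvar i) = act g (act h (pvar i))" by (simp add: act_pvar)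
qed simp_all

lemma act_id: "p \<in> polyR (length bs) \<Longrightarrow> act id p = p"
  by (rule hom_eqI[OF act_hom comm_ring_hom_id]) (auto simp: act_pvar form_poly_xV)

lemma linear_eq_on_basis:
  assumes "g \<in> G" "\<And>j. j < length bs \<Longrightarrow> g (bs ! j) = bs ! j"
  shows "g = id"
proof
  fix u
  interpret g: Vector_Spaces.linear scV scV g using G_linear assms(1) by blast
  have "g u = g (\<Sum>i<length bs. scV (xV u i) (bs ! i))" using V_expand by (rule arg_cong)
  also have "\<dots> = (\<Sum>i<length bs. scV (xV u i) (bs ! i))" by (simp add: g.sum g.scale assms(2))
  also have "\<dots> = u" by (rule V_expand[symmetric])
  finally show "g u = id u" by simp
qed

text \<open>The variables are the coordinate functions, so they determine the inverse of \<open>g\<close>.\<close>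

lemma act_faithful:
  assumes "g \<in> G" "\<And>i. i < length bs \<Longrightarrow> act g (pvar i) = pvar i"
  shows "g = id"
proof (rule linear_eq_on_basis[OF assms(1)])
  fix j assume j: "j < length bs"
  have "xV (inv_into UNIV g (bs ! j)) i = xV (bs ! j) i" if "i < length bs" for i
    using form_poly_eqD[of "\<lambda>u. xV (inv_into UNIV g u) i" "\<lambda>u. xV u i" j] j assms(2)[OF that]
      that by (simp add: act_pvar form_poly_xV)
  then have "inv_into UNIV g (bs ! j) = bs ! j"
    using V_expand[of "inv_into UNIV g (bs ! j)"] V_expand[of "bs ! j"] by simp
  then show "g (bs ! j) = bs ! j"
    using G_bij[OF assms(1)] by (metis bij_is_surj surj_f_inv_f)
qed

lemma psubst_homogeneous:
  assumes "homogeneous d p" "\<And>i. homogeneous 1 (s i)"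
  shows "homogeneous d (psubst s p)"
  unfolding psubst_def
proof (intro homogeneous_sum homogeneous_pconst_mult)
  fix a assume "a \<in> Poly_Mapping.keys p"
  then have "d = (\<Sum>i\<in>Poly_Mapping.keys a. Poly_Mapping.lookup a i * 1)"
    using assms(1) by (simp add: homogeneous_def)
  then show "homogeneous d (\<Prod>i\<in>Poly_Mapping.keys a. s i ^ Poly_Mapping.lookup a i)"
    using homogeneous_prod[of "Poly_Mapping.keys a" "\<lambda>i. Poly_Mapping.lookup a i * 1"
       "\<lambda>i. s i ^ Poly_Mapping.lookup a i"]
      homogeneous_power[OF assms(2)] by (simp del: One_nat_def)
qed

lemma act_homogeneous: "homogeneous d p \<Longrightarrow> homogeneous d (act g p)"
  unfolding act_def by (rule psubst_homogeneous) (auto intro: form_poly_homogeneous simp del: One_nat_def)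

lemma grade_sum_homogeneous:
  assumes "\<And>d. homogeneous d (f d)" "p = (\<Sum>d\<le>N. f d)"
  shows "coeff (grade p) d = (if d \<le> N then f d else 0)"
proof -
  have "grade p = (\<Sum>d\<le>N. monom (f d) d)"
    unfolding assms(2) grade.hom_sum using assms(1) by (simp add: homogeneous_iff_grade)
  then show ?thesis by (simp add: coeff_sum)
qed

lemma coeff_grade_act: "coeff (grade (act g p)) d = act g (coeff (grade p) d)"
proof -
  have "act g p = (\<Sum>d\<le>degree (grade p). act g (coeff (grade p) d))"
    by (subst sum_coeff_grade[of p]) (simp add: act_sum)
  then have "coeff (grade (act g p)) d = (if d \<le> degree (grade p) then act g (coeff (grade p) d) else 0)"
    by (intro grade_sum_homogeneous act_homogeneous homogeneous_coeff_grade)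
  then show ?thesis by (auto simp: coeff_eq_0 act_simps)
qed

lemma coeff_grade_polyR: "p \<in> polyR n \<Longrightarrow> coeff (grade p) d \<in> polyR n"
  by (rule polyRI) (auto simp: in_keys_iff lookup_coeff_grade split: if_splits dest!: polyR_lessD)

section \<open>The module of covariants\<close>

abbreviation "\<rho>M g i j \<equiv> xM (\<rho> g (vs ! j)) i"

lemma \<rho>M_comp:
  assumes "g \<in> G" "h \<in> G"
  shows "\<rho>M (g \<circ> h) i j = (\<Sum>k<length vs. \<rho>M g i k * \<rho>M h k j)"
proof -
  have "Vector_Spaces.linear scM (*) (\<lambda>u. xM (\<rho> g u) i)"
    using xM_linear[of i] \<rho>_linear[OF assms(1)] by (auto simp: Vector_Spaces.linear_iff)
  from functional_expand_M[OF this, of "\<rho> h (vs ! j)"]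
  show ?thesis by (simp add: \<rho>_comp[OF assms] mult.commute)
qed

lemma tensor_act_eq: "i < length vs \<Longrightarrow>
    tensor_act g a i = (\<Sum>j<length vs. pconst (\<rho>M g i j) * act g (a j))"
  and tensor_act_0: "\<not> i < length vs \<Longrightarrow> tensor_act g a i = 0"
  by (simp_all add: tensor_act_def)

lemma tensor_act_comp:
  assumes "g \<in> G" "h \<in> G" "a \<in> tensor_space"
  shows "tensor_act (g \<circ> h) a = tensor_act g (tensor_act h a)"
proof
  fix i
  show "tensor_act (g \<circ> h) a i = tensor_act g (tensor_act h a) i"
  proof (cases "i < length vs")
    case True
    have a: "a j \<in> polyR (length bs)" if "j < length vs" for j
      using assms(3) that by (auto simp: tensor_space_def coord_ring_polyR)
    have "tensor_act g (tensor_act h a) i = (\<Sum>k<length vs. \<Sum>j<length vs.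
        pconst (\<rho>M g i k * \<rho>M h k j) * act g (act h (a j)))"
      using True by (simp add: tensor_act_eq act_sum act_simps sum_distrib_left pconst.hom_mult mult.assoc)
    also have "\<dots> = (\<Sum>j<length vs. \<Sum>k<length vs. pconst (\<rho>M g i k * \<rho>M h k j) * act g (act h (a j)))"
      by (rule sum.swap)
    also have "\<dots> = tensor_act (g \<circ> h) a i"
      using True a assms
      by (simp add: tensor_act_eq act_comp \<rho>M_comp pconst.hom_sum sum_distrib_right)
    finally show ?thesis ..
  qed (simp add: tensor_act_0)
qed

lemma tensor_act_id: "a \<in> tensor_space \<Longrightarrow> tensor_act id a = a"
proof
  fix i assume a: "a \<in> tensor_space"
  show "tensor_act id a i = a i"
  proof (cases "i < length vs")
    case True
    then have "tensor_act id a i = (\<Sum>j<length vs. pconst (\<rho>M id i j) * act id (a j))"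
      by (rule tensor_act_eq)
    also have "\<dots> = (\<Sum>j<length vs. if j = i then a i else 0)"
      by (rule sum.cong)
         (use a True in \<open>auto simp: \<rho>_id xM_nth act_id tensor_space_def coord_ring_polyR\<close>)
    finally have "tensor_act id a i = (\<Sum>j<length vs. if j = i then a i else 0)" .
    with True show ?thesis by simp
  next
    case False
    with a show ?thesis by (simp add: tensor_act_0 tensor_space_def)
  qed
qed

lemma tensor_act_sum:
  "tensor_act g (\<lambda>i. \<Sum>k\<in>K. c k * w k i) = (\<lambda>i. \<Sum>k\<in>K. act g (c k) * tensor_act g (w k) i)"
proof
  fix i
  show "tensor_act g (\<lambda>i. \<Sum>k\<in>K. c k * w k i) i = (\<Sum>k\<in>K. act g (c k) * tensor_act g (w k) i)"
  proof (cases "i < length vs")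
    case True
    have "tensor_act g (\<lambda>i. \<Sum>k\<in>K. c k * w k i) i =
       (\<Sum>j<length vs. \<Sum>k\<in>K. act g (c k) * (pconst (\<rho>M g i j) * act g (w k j)))"
      using True by (simp add: tensor_act_eq act_sum act_simps sum_distrib_left mult_ac)
    also have "\<dots> = (\<Sum>k\<in>K. \<Sum>j<length vs. act g (c k) * (pconst (\<rho>M g i j) * act g (w k j)))"
      by (rule sum.swap)
    also have "\<dots> = (\<Sum>k\<in>K. act g (c k) * tensor_act g (w k) i)"
      using True by (simp add: tensor_act_eq sum_distrib_left)
    finally show ?thesis .
  qed (simp add: tensor_act_0)
qed

lemma tensor_space_sum:
  assumes "\<And>k. k \<in> K \<Longrightarrow> c k \<in> polyR (length bs)" "\<And>k. k \<in> K \<Longrightarrow> w k \<in> tensor_space"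
  shows "(\<lambda>i. \<Sum>k\<in>K. c k * w k i) \<in> tensor_space"
  using assms by (auto simp: tensor_space_def coord_ring_polyR intro!: polyR_sum polyR_mult sum.neutral)

lemma tensor_act_in: "a \<in> tensor_space \<Longrightarrow> tensor_act g a \<in> tensor_space"
  by (auto simp: tensor_space_def coord_ring_polyR tensor_act_eq tensor_act_0
      intro!: polyR_sum polyR_mult act_polyR)

lemma tensor_spaceD: "a \<in> tensor_space \<Longrightarrow> a i \<in> polyR (length bs)"
  by (cases "i < length vs") (auto simp: tensor_space_def coord_ring_polyR)

lemma tensor_act_homogeneous:
  assumes "\<And>i. i < length vs \<Longrightarrow> homogeneous d (a i)" "i < length vs"
  shows "homogeneous d (tensor_act g a i)"
  using assms by (auto simp: tensor_act_eq intro!: homogeneous_sum homogeneous_pconst_mult act_homogeneous)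

text \<open>The group law is composition; the inverse of \<open>g\<close> is its inverse function.\<close>

definition subgrp :: "('v \<Rightarrow> 'v) set \<Rightarrow> bool" where
  "subgrp H \<longleftrightarrow> H \<subseteq> G \<and> id \<in> H \<and> (\<forall>g\<in>H. \<forall>h\<in>H. g \<circ> h \<in> H) \<and> (\<forall>g\<in>H. inv_into UNIV g \<in> H)"

lemma subgrp_G: "subgrp G"
  using G_id G_comp G_inv by (auto simp: subgrp_def)

lemma subgrp_id: "subgrp {id}"
  using G_id by (auto simp: subgrp_def inv_id)

lemma subgrpD:
  assumes "subgrp H"
  shows "H \<subseteq> G" "id \<in> H" "\<And>g h. g \<in> H \<Longrightarrow> h \<in> H \<Longrightarrow> g \<circ> h \<in> H"
    "\<And>g. g \<in> H \<Longrightarrow> inv_into UNIV g \<in> H" "finite H"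
  using assms G_finite finite_subset by (auto simp: subgrp_def)

lemma G_inv_comp:
  assumes "g \<in> G"
  shows "inv_into UNIV g \<circ> g = id" "g \<circ> inv_into UNIV g = id"
  using G_bij[OF assms] by (auto simp: bij_def surj_iff inv_o_cancel)

lemma inv_ringD: "p \<in> inv_ring H \<Longrightarrow> p \<in> polyR (length bs)" "p \<in> inv_ring H \<Longrightarrow> g \<in> H \<Longrightarrow> act g p = p"
  by (auto simp: inv_ring_def coord_ring_polyR)

lemma inv_ringI: "p \<in> polyR (length bs) \<Longrightarrow> (\<And>g. g \<in> H \<Longrightarrow> act g p = p) \<Longrightarrow> p \<in> inv_ring H"
  by (auto simp: inv_ring_def coord_ring_polyR)

lemma inv_ring_closed:
  "0 \<in> inv_ring H" "1 \<in> inv_ring H" "pconst c \<in> inv_ring H"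
  "p \<in> inv_ring H \<Longrightarrow> q \<in> inv_ring H \<Longrightarrow> p + q \<in> inv_ring H"
  "p \<in> inv_ring H \<Longrightarrow> q \<in> inv_ring H \<Longrightarrow> p - q \<in> inv_ring H"
  "p \<in> inv_ring H \<Longrightarrow> q \<in> inv_ring H \<Longrightarrow> p * q \<in> inv_ring H"
  by (auto simp: inv_ring_def coord_ring_polyR act_simps)

lemma inv_ring_sum: "(\<And>x. x \<in> X \<Longrightarrow> f x \<in> inv_ring H) \<Longrightarrow> (\<Sum>x\<in>X. f x) \<in> inv_ring H"
  by (induction X rule: infinite_finite_induct) (auto intro: inv_ring_closed)

lemma inv_ring_prod: "(\<And>x. x \<in> X \<Longrightarrow> f x \<in> inv_ring H) \<Longrightarrow> (\<Prod>x\<in>X. f x) \<in> inv_ring H"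
  by (induction X rule: infinite_finite_induct) (auto intro: inv_ring_closed)

lemma inv_ring_power: "p \<in> inv_ring H \<Longrightarrow> p ^ k \<in> inv_ring H"
  by (induction k) (auto intro: inv_ring_closed)

lemma covD: "a \<in> cov H \<Longrightarrow> a \<in> tensor_space" "a \<in> cov H \<Longrightarrow> g \<in> H \<Longrightarrow> tensor_act g a = a"
  by (auto simp: cov_def)

lemma cov_sum:
  assumes "\<And>k. k \<in> K \<Longrightarrow> c k \<in> inv_ring H" "\<And>k. k \<in> K \<Longrightarrow> w k \<in> cov H"
  shows "(\<lambda>i. \<Sum>k\<in>K. c k * w k i) \<in> cov H"
  unfolding cov_def
proof (intro CollectI conjI ballI)
  show "(\<lambda>i. \<Sum>k\<in>K. c k * w k i) \<in> tensor_space"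
    by (rule tensor_space_sum) (use assms inv_ringD covD in blast)+
  fix g assume "g \<in> H"
  then show "tensor_act g (\<lambda>i. \<Sum>k\<in>K. c k * w k i) = (\<lambda>i. \<Sum>k\<in>K. c k * w k i)"
    unfolding tensor_act_sum
    using inv_ringD(2)[OF assms(1)] covD(2)[OF assms(2)] by (intro ext sum.cong) auto
qed

lemma cov_mono: "H \<subseteq> K \<Longrightarrow> cov K \<subseteq> cov H"
  by (auto simp: cov_def)

lemma cov_degD: "a \<in> cov_deg H d \<Longrightarrow> a \<in> cov H" "a \<in> cov_deg H d \<Longrightarrow> homogeneous d (a i)"
  by (cases "i < length vs"; auto simp: cov_deg_def cov_def tensor_space_def)+

lemma cov_degI: "a \<in> cov H \<Longrightarrow> (\<And>i. i < length vs \<Longrightarrow> homogeneous d (a i)) \<Longrightarrow> a \<in> cov_deg H d"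
  by (auto simp: cov_deg_def)

lemma hom_cov_in: "a \<in> hom_cov H \<Longrightarrow> a \<in> cov H"
  by (auto simp: hom_cov_def cov_deg_def)

lemma cdeg_cov_deg:
  assumes "a \<in> hom_cov H"
  shows "a \<in> cov_deg H (cdeg a)"
proof -
  obtain d where d: "a \<in> cov_deg H d" using assms by (auto simp: hom_cov_def)
  then have "\<forall>i<length vs. homogeneous d (a i)" by (auto simp: cov_deg_def)
  then have "\<forall>i<length vs. homogeneous (cdeg a) (a i)" unfolding cdeg_def by (rule LeastI)
  with d show ?thesis by (auto simp: cov_deg_def)
qed

lemma jac_eq_dt: "jac \<omega> = dt (length vs) \<omega>"
  by (simp add: jac_def dt_def)

lemma jac_polyR: "(\<And>j i. j < length vs \<Longrightarrow> \<omega> j i \<in> polyR (length bs)) \<Longrightarrow> jac \<omega> \<in> polyR (length bs)"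
proof -
  assume *: "\<And>j i. j < length vs \<Longrightarrow> \<omega> j i \<in> polyR (length bs)"
  have "signof p \<in> polyR (length bs)" for p :: "nat \<Rightarrow> nat"
    by (auto simp: sign_def)
  with * show ?thesis unfolding jac_eq_dt dt_leibniz
    by (intro polyR_sum polyR_mult polyR_prod) auto
qed

lemma jac_homogeneous:
  assumes "\<And>j i. j < length vs \<Longrightarrow> homogeneous (d j) (\<omega> j i)"
  shows "homogeneous (\<Sum>j<length vs. d j) (jac \<omega>)"
proof -
  have sg: "homogeneous 0 (signof p :: 'k mpoly)" for p :: "nat \<Rightarrow> nat"
    by (auto simp: sign_def intro: homogeneous_uminus)
  have "homogeneous (0 + (\<Sum>j<length vs. d j)) (signof p * (\<Prod>j<length vs. \<omega> j (p j)))"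
    for p :: "nat \<Rightarrow> nat"
    by (intro homogeneous_mult sg homogeneous_prod assms) auto
  then show ?thesis unfolding jac_eq_dt dt_leibniz
    by (intro homogeneous_sum) simp
qed

definition rdet :: "('v \<Rightarrow> 'v) \<Rightarrow> 'k" where
  "rdet g = dt (length vs) (\<lambda>j i. \<rho>M g i j)"

lemma rdet_comp: "g \<in> G \<Longrightarrow> h \<in> G \<Longrightarrow> rdet (g \<circ> h) = rdet g * rdet h"
proof -
  assume gh: "g \<in> G" "h \<in> G"
  have "rdet (g \<circ> h) = dt (length vs) (\<lambda>j i. \<Sum>l<length vs. \<rho>M h l j * \<rho>M g i l)"
    unfolding rdet_def \<rho>M_comp[OF gh] by (simp add: mult.commute)
  also have "\<dots> = rdet h * rdet g"
    unfolding rdet_def by (rule dt_mult)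
  finally show ?thesis by simp
qed

lemma rdet_id: "rdet id = 1"
proof -
  have "rdet id = dt (length vs) (\<lambda>j i. if i = j then 1 else 0)"
    unfolding rdet_def by (rule dt_cong) (simp add: \<rho>_id xM_nth)
  then show ?thesis by (simp add: dt_one)
qed

lemma rdet_inv: "g \<in> G \<Longrightarrow> rdet (inv_into UNIV g) * rdet g = 1"
  using rdet_comp[of "inv_into UNIV g" g] G_inv[of g] G_inv_comp(1)[of g] rdet_id by simp

text \<open>Invariance of the \<open>\<omega> j\<close> says that the matrix of \<open>\<omega>\<close> is \<open>\<rho>(g)\<close> times its image under \<open>g\<close>; taking
  determinants gives the character.\<close>

lemma jac_semi_inv:
  assumes "\<And>j. j < length vs \<Longrightarrow> \<omega> j \<in> cov H" "g \<in> H" "H \<subseteq> G"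
  shows "act g (jac \<omega>) = pconst (rdet (inv_into UNIV g)) * jac \<omega>"
proof -
  have "jac \<omega> = dt (length vs) (\<lambda>j i. \<Sum>l<length vs. act g (\<omega> j l) * pconst (\<rho>M g i l))"
    unfolding jac_eq_dt
  proof (rule dt_cong)
    fix j i assume "j < length vs" "i < length vs"
    then show "\<omega> j i = (\<Sum>l<length vs. act g (\<omega> j l) * pconst (\<rho>M g i l))"
      using covD(2)[OF assms(1) assms(2), of j] tensor_act_eq[of i g "\<omega> j"] by (simp add: mult.commute)
  qed
  also have "\<dots> = dt (length vs) (\<lambda>j i. act g (\<omega> j i)) * dt (length vs) (\<lambda>j i. pconst (\<rho>M g i j))"
    by (rule dt_mult)
  also have "dt (length vs) (\<lambda>j i. pconst (\<rho>M g i j)) = pconst (rdet g)"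
    unfolding rdet_def by (rule dt_hom[OF pconst_hom, symmetric])
  also have "dt (length vs) (\<lambda>j i. act g (\<omega> j i)) = act g (jac \<omega>)"
    unfolding jac_eq_dt by (rule dt_hom[OF act_hom, symmetric])
  finally have "jac \<omega> = act g (jac \<omega>) * pconst (rdet g)" .
  then have "pconst (rdet (inv_into UNIV g)) * jac \<omega> =
      pconst (rdet (inv_into UNIV g)) * (act g (jac \<omega>) * pconst (rdet g))"
    by (rule arg_cong)
  also have "\<dots> = act g (jac \<omega>) * pconst (rdet (inv_into UNIV g) * rdet g)"
    by (simp only: pconst.hom_mult mult_ac)
  finally show ?thesis using rdet_inv[of g] assms(2,3) by auto
qed

section \<open>The character of the top exterior power\<close>

lemma alt_form_linear:
  assumes "alt_form f" "length us = length vs" "i < length vs"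
  shows "Vector_Spaces.linear scM (*) (\<lambda>u. f (us[i := u]))"
  using assms by (auto simp: alt_form_def)

text \<open>Expand \<open>f\<close> with \<open>x + y\<close> in both positions.\<close>

lemma alt_form_swap:
  assumes f: "alt_form f" and us: "length us = length vs" and ij: "i < length vs" "j < length vs" "i \<noteq> j"
  shows "f (us[i := us ! j, j := us ! i]) = - f us"
proof -
  define F where "F a b = f (us[i := a, j := b])" for a b
  interpret b: Vector_Spaces.linear scM "(*)" "\<lambda>b. F a b" for a
    unfolding F_def using alt_form_linear[OF f, of "us[i := a]" j] us ij by simp
  have F2: "F a b = f (us[j := b, i := a])" for a b
    unfolding F_def using ij by (simp add: list_update_swap)
  interpret a: Vector_Spaces.linear scM "(*)" "\<lambda>a. F a b" for b
    unfolding F2 using alt_form_linear[OF f, of "us[j := b]" i] us ij by simp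
  have F0: "F a a = 0" for a
  proof -
    have "\<not> distinct (us[i := a, j := a])"
      using ij us by (metis distinct_conv_nth length_list_update nth_list_update_eq nth_list_update_neq)
    then show ?thesis unfolding F_def using f us by (auto simp: alt_form_def)
  qed
  define x y where "x = us ! i" and "y = us ! j"
  have "F (x + y) (x + y) = F x x + F x y + F y x + F y y"
    by (simp add: a.add b.add)
  then have "F y x = - F x y" by (simp add: F0 eq_neg_iff_add_eq_0 add.commute)
  then show ?thesis unfolding F_def x_def y_def using us ij by simp
qed

text \<open>Transpositions move the basis vectors into place from the front; \<open>k\<close> counts the positions that
  remain.\<close>

lemma alt_form_permuted_basis:
  assumes f: "alt_form f" "f vs = 0"
  shows "distinct us \<Longrightarrow> set us = set vs \<Longrightarrow> length us = length vs \<Longrightarrow>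
    k \<le> length vs \<Longrightarrow> (\<And>i. i < length vs - k \<Longrightarrow> us ! i = vs ! i) \<Longrightarrow> f us = 0"
proof (induction k arbitrary: us)
  case 0
  then have "us = vs" by (intro nth_equalityI) auto
  with f show ?case by simp
next
  case (Suc k)
  define i where "i = length vs - Suc k"
  have i: "i < length vs" "length vs - k = Suc i" using Suc.prems by (auto simp: i_def)
  then have "vs ! i \<in> set us" using Suc.prems by auto
  then obtain j where j: "j < length vs" "us ! j = vs ! i"
    using Suc.prems by (metis in_set_conv_nth)
  have ji: "j \<ge> i"
  proof (rule ccontr)
    assume "\<not> j \<ge> i"
    then have "us ! j = vs ! j" "j \<noteq> i" using Suc.prems(5)[of j] by (auto simp: i_def)
    with j i M_basis(1) show False by (simp add: nth_eq_iff_index_eq)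
  qed
  show ?case
  proof (cases "j = i")
    case True
    show ?thesis
    proof (rule Suc.IH[OF Suc.prems(1,2,3)])
      fix l assume "l < length vs - k"
      then show "us ! l = vs ! l" using i(2) True j(2) Suc.prems(5)[of l] by (auto simp: i_def less_Suc_eq)
    qed (use Suc.prems in simp)
  next
    case False
    let ?us = "us[i := us ! j, j := us ! i]"
    have "f ?us = 0"
    proof (rule Suc.IH)
      show "distinct ?us" "set ?us = set vs"
        using Suc.prems i(1) j(1) by (simp_all add: distinct_swap)
      fix l assume "l < length vs - k"
      then show "?us ! l = vs ! l"
        using i j ji False Suc.prems(3) Suc.prems(5)[of l] by (auto simp: i_def nth_list_update less_Suc_eq)
    qed (use Suc.prems in auto)
    with alt_form_swap[OF f(1) Suc.prems(3) i(1) j(1)] False show ?thesis by auto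
  qed
qed

text \<open>The arguments are expanded in the basis one after the other; the last ones, from position \<open>k\<close> on, are
  basis vectors already.\<close>

lemma alt_form_eq_0:
  assumes f: "alt_form f" "f vs = 0"
  shows "k \<le> length vs \<Longrightarrow> length us = length vs \<Longrightarrow> (\<And>i. k \<le> i \<Longrightarrow> i < length vs \<Longrightarrow> us ! i \<in> set vs) \<Longrightarrow> f us = 0"
proof (induction k arbitrary: us)
  case 0
  then have sub: "set us \<subseteq> set vs" by (auto simp: in_set_conv_nth)
  show ?case
  proof (cases "distinct us")
    case True
    then have "set us = set vs"
      using sub 0 M_basis(1) by (intro card_subset_eq) (auto simp: distinct_card)
    then show ?thesis using alt_form_permuted_basis[OF f True _ 0(2), of "length vs"] by simp
  next
    case False
    with f 0 show ?thesis by (auto simp: alt_form_def)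
  qed
next
  case (Suc k)
  have lin: "Vector_Spaces.linear scM (*) (\<lambda>u. f (us[k := u]))"
    using alt_form_linear[OF f(1) Suc.prems(2)] Suc.prems(1) by simp
  have "f us = f (us[k := us ! k])" by simp
  also have "\<dots> = (\<Sum>i<length vs. xM (us ! k) i * f (us[k := vs ! i]))"
    by (rule functional_expand_M[OF lin])
  also have "\<dots> = 0"
  proof (rule sum.neutral, safe)
    fix i assume "i < length vs"
    then have "f (us[k := vs ! i]) = 0"
      using Suc.prems by (intro Suc.IH) (auto simp: nth_list_update)
    then show "xM (us ! k) i * f (us[k := vs ! i]) = 0" by simp
  qed
  finally show ?case .
qed

definition cdet :: "'m list \<Rightarrow> 'k" where
  "cdet us = dt (length vs) (\<lambda>j i. xM (us ! j) i)"

lemma cdet_vs: "cdet vs = 1"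
proof -
  have "cdet vs = dt (length vs) (\<lambda>j i. if i = j then 1 else 0)"
    unfolding cdet_def by (rule dt_cong) (simp add: xM_nth)
  then show ?thesis by (simp add: dt_one)
qed

lemma cdet_alt_form: "alt_form cdet"
  unfolding alt_form_def
proof (intro conjI allI impI)
  fix us :: "'m list" and i assume "length us = length vs \<and> i < length vs"
  then have i: "length us = length vs" "i < length vs" by auto
  have eq: "cdet (us[i := u]) = (\<Sum>p | p permutes {0..<length vs}. signof p *
      (\<Prod>j\<in>{..<length vs} - {i}. xM (us ! j) (p j)) * xM u (p i))" for u
  proof -
    have "(\<Prod>j<length vs. xM (us[i := u] ! j) (p j)) =
        xM u (p i) * (\<Prod>j\<in>{..<length vs} - {i}. xM (us ! j) (p j))" for p
      using i by (subst prod.remove[of _ i]) (auto intro!: prod.cong)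
    then show ?thesis unfolding cdet_def dt_leibniz by (simp add: mult_ac)
  qed
  have lin: "xM (u + v) j = xM u j + xM v j" "xM (scM c u) j = c * xM u j" for u v c j
    using xM_linear[of j] by (auto simp: Vector_Spaces.linear_iff)
  show "Vector_Spaces.linear scM (*) (\<lambda>u. cdet (us[i := u]))"
    unfolding Vector_Spaces.linear_iff eq
    using xM_linear[of i]
    by (auto simp: lin Vector_Spaces.linear_iff algebra_simps sum.distrib sum_distrib_left)
next
  fix us :: "'m list" assume us: "length us = length vs \<and> \<not> distinct us"
  then obtain i j where ij: "i < length vs" "j < length vs" "i \<noteq> j" "us ! i = us ! j"
    by (auto simp: distinct_conv_nth)
  have "det (mat (length vs) (length vs) (\<lambda>(k, l). xM (us ! l) k)) = 0"
    by (rule det_identical_columns[OF _ ij(3,1,2)]) (use ij in \<open>auto intro!: eq_vecI\<close>)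
  then show "cdet us = 0" by (simp add: cdet_def dt_def)
qed

text \<open>The difference of both sides is an alternating form that vanishes on the basis.\<close>

lemma alt_form_eq_cdet:
  assumes f: "alt_form f" and us: "length us = length vs"
  shows "f us = cdet us * f vs"
proof -
  define h where "h us = f us - cdet us * f vs" for us
  have "Vector_Spaces.linear scM (*) (\<lambda>u. h (us[i := u]))" if "length us = length vs" "i < length vs" for us i
    using alt_form_linear[OF f that] alt_form_linear[OF cdet_alt_form that]
    by (auto simp: h_def Vector_Spaces.linear_iff algebra_simps)
  moreover have "h us = 0" if "length us = length vs" "\<not> distinct us" for us
    using that f cdet_alt_form by (auto simp: h_def alt_form_def)
  ultimately have "alt_form h" by (auto simp: alt_form_def)
  moreover have "h vs = 0" by (simp add: h_def cdet_vs)
  ultimately have "h us = 0" by (rule alt_form_eq_0[of h "length vs"]) (use us in auto)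
  then show ?thesis by (simp add: h_def)
qed

text \<open>All alternating forms are multiples of \<open>cdet\<close>, and on \<open>cdet\<close> the group acts by the determinant.\<close>

lemma top_char_eq:
  assumes "g \<in> G"
  shows "top_char g = rdet (inv_into UNIV g)"
proof -
  let ?h = "inv_into UNIV g"
  have hG: "?h \<in> G" using G_inv assms by blast
  have cd: "cdet (map (\<rho> ?h) us) = rdet ?h * cdet us" if "length us = length vs" for us :: "'m list"
  proof -
    have "cdet (map (\<rho> ?h) us) = dt (length vs) (\<lambda>j i. \<Sum>l<length vs. xM (us ! j) l * \<rho>M ?h i l)"
      unfolding cdet_def
    proof (rule dt_cong)
      fix j i assume "j < length vs" "i < length vs"
      have "Vector_Spaces.linear scM (*) (\<lambda>u. xM (\<rho> ?h u) i)"
        using xM_linear[of i] \<rho>_linear[OF hG] by (auto simp: Vector_Spaces.linear_iff)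
      from functional_expand_M[OF this, of "us ! j"] \<open>j < _\<close> that
      show "xM (map (\<rho> ?h) us ! j) i = (\<Sum>l<length vs. xM (us ! j) l * \<rho>M ?h i l)" by simp
    qed
    also have "\<dots> = cdet us * rdet ?h" unfolding cdet_def rdet_def by (rule dt_mult)
    finally show ?thesis by (simp add: mult.commute)
  qed
  show ?thesis unfolding top_char_def
  proof (rule the_equality)
    show "\<forall>f. alt_form f \<longrightarrow> (\<forall>us. length us = length vs \<longrightarrow> f (map (\<rho> ?h) us) = rdet ?h * f us)"
    proof (intro allI impI)
      fix f :: "'m list \<Rightarrow> 'k" and us :: "'m list"
      assume f: "alt_form f" and us: "length us = length vs"
      show "f (map (\<rho> ?h) us) = rdet ?h * f us"
        using alt_form_eq_cdet[OF f, of "map (\<rho> ?h) us"] alt_form_eq_cdet[OF f us] cd[OF us] us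
        by (simp add: mult.assoc)
    qed
  next
    fix c assume "\<forall>f. alt_form f \<longrightarrow> (\<forall>us. length us = length vs \<longrightarrow> f (map (\<rho> ?h) us) = c * f us)"
    then have "cdet (map (\<rho> ?h) vs) = c * cdet vs" using cdet_alt_form by blast
    then show "c = rdet ?h" using cd[of vs] by (simp add: cdet_vs)
  qed
qed

lemma jac_module_semi_inv:
  assumes "subgrp H"
  shows "jac_module H \<subseteq> semi_inv H top_char"
proof
  fix p assume "p \<in> jac_module H"
  then obtain N :: nat and c \<omega> where p: "p = (\<Sum>j<N. c j * jac (\<omega> j))"
    and c: "\<And>j. j < N \<Longrightarrow> c j \<in> inv_ring H" and \<omega>: "\<And>j l. j < N \<Longrightarrow> l < length vs \<Longrightarrow> \<omega> j l \<in> hom_cov H"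
    by (auto simp: jac_module_def)
  have cv: "\<omega> j l \<in> cov H" if "j < N" "l < length vs" for j l using \<omega>[OF that] hom_cov_in by blast
  have "p \<in> polyR (length bs)" unfolding p
    using c cv by (intro polyR_sum polyR_mult jac_polyR) (auto intro: inv_ringD tensor_spaceD[OF covD(1)])
  moreover have "act g p = pconst (top_char g) * p" if g: "g \<in> H" for g
  proof -
    have gG: "g \<in> G" using subgrpD(1)[OF assms] g by auto
    have "act g (jac (\<omega> j)) = pconst (top_char g) * jac (\<omega> j)" if "j < N" for j
      unfolding top_char_eq[OF gG]
      by (rule jac_semi_inv[OF _ g subgrpD(1)[OF assms]]) (use cv that in auto)
    then show ?thesis
      unfolding p using inv_ringD(2)[OF c g]
      by (auto simp: act_sum act_simps sum_distrib_left mult_ac intro!: sum.cong)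
  qed
  ultimately show "p \<in> semi_inv H top_char" by (simp add: semi_inv_def coord_ring_polyR)
qed

end

section \<open>Congruences\<close>

lemma dvd_diff_prod:
  fixes f g :: "'i \<Rightarrow> 'a::comm_ring_1"
  assumes "\<And>x. x \<in> X \<Longrightarrow> d dvd f x - g x"
  shows "d dvd (\<Prod>x\<in>X. f x) - (\<Prod>x\<in>X. g x)"
  using assms
proof (induction X rule: infinite_finite_induct)
  case (insert x F)
  have "f x * prod f F - g x * prod g F = (f x - g x) * prod f F + g x * (prod f F - prod g F)"
    by (simp add: algebra_simps)
  moreover have "d dvd (f x - g x) * prod f F + g x * (prod f F - prod g F)"
    using insert by (intro dvd_add dvd_mult2[of d "f x - g x"] dvd_mult) auto
  ultimately show ?case using insert by simp
qed auto

lemma dvd_diff_power: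
  fixes a b :: "'a::comm_ring_1"
  assumes "d dvd a - b"
  shows "d dvd a ^ k - b ^ k"
  using dvd_diff_prod[of "{..<k}" d "\<lambda>_. a" "\<lambda>_. b"] assms by simp

text \<open>Modulo \<open>d\<close> the two homomorphisms agree on constants and variables.\<close>

lemma hom_cong_dvd:
  fixes \<phi> \<psi> :: "'k::field mpoly \<Rightarrow> 'r::comm_ring_1"
  assumes "comm_ring_hom \<phi>" "comm_ring_hom \<psi>"
    and "\<And>c. \<phi> (pconst c) = \<psi> (pconst c)" "\<And>i. i < n \<Longrightarrow> d dvd \<phi> (pvar i) - \<psi> (pvar i)"
    and "p \<in> polyR n"
  shows "d dvd \<phi> p - \<psi> p"
proof -
  have "d dvd (\<Sum>a\<in>Poly_Mapping.keys p. \<psi> (pconst (Poly_Mapping.lookup p a)) *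
     ((\<Prod>i\<in>Poly_Mapping.keys a. \<phi> (pvar i) ^ Poly_Mapping.lookup a i) -
      (\<Prod>i\<in>Poly_Mapping.keys a. \<psi> (pvar i) ^ Poly_Mapping.lookup a i)))"
    by (intro dvd_sum dvd_mult dvd_diff_prod dvd_diff_power assms(4) polyR_lessD[OF assms(5)])
  then show ?thesis
    using hom_eq_mev[OF assms(1), of p] hom_eq_mev[OF assms(2), of p]
    by (simp add: mev_def assms(3) sum_subtractf right_diff_distrib)
qed

text \<open>Zero is included: a Jacobian is not divisible by \<open>0\<close> iff it does not vanish, so the same transfer
  argument also produces non-zero Jacobians.\<close>

definition prime_or_zero :: "nat \<Rightarrow> 'k::field mpoly \<Rightarrow> bool" where
  "prime_or_zero n p \<longleftrightarrow> prime_in n p \<or> p = 0"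

lemma prime_or_zeroD:
  assumes "prime_or_zero n p"
  shows "p \<in> polyR n" "\<not> p dvd 1"
    "\<And>a b. a \<in> polyR n \<Longrightarrow> b \<in> polyR n \<Longrightarrow> p dvd a * b \<Longrightarrow> p dvd a \<or> p dvd b"
    "\<And>a k. a \<in> polyR n \<Longrightarrow> p dvd a ^ k \<Longrightarrow> p dvd a"
    "\<And>a b k. a \<in> polyR n \<Longrightarrow> b \<in> polyR n \<Longrightarrow> \<not> p dvd a \<Longrightarrow> p ^ k dvd a * b \<Longrightarrow> p ^ k dvd b"
proof -
  show "p \<in> polyR n" "\<not> p dvd 1"
    using assms prime_inD(1,3) by (auto simp: prime_or_zero_def)
  show "p dvd a \<or> p dvd b" if "a \<in> polyR n" "b \<in> polyR n" "p dvd a * b" for a b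
    using that assms prime_inD(4)[OF _ that] by (auto simp: prime_or_zero_def)
  show "p dvd a" if "a \<in> polyR n" "p dvd a ^ k" for a k
    using that(2) assms prime_in_dvd_power[OF _ that] by (auto simp: prime_or_zero_def)
  fix a b k assume *: "a \<in> polyR n" "b \<in> polyR n" "\<not> p dvd a" "p ^ k dvd a * b"
  show "p ^ k dvd b"
  proof (cases "p = 0")
    case True
    with * show ?thesis by (cases k) auto
  next
    case False
    with assms have "prime_in n p" by (simp add: prime_or_zero_def)
    from prime_in_power_dvd[OF this *] show ?thesis .
  qed
qed

lemma prime_or_zero_dvd_prod:
  assumes "prime_or_zero n p" "\<And>x. x \<in> X \<Longrightarrow> f x \<in> polyR n" "finite X" "p dvd prod f X"
  shows "\<exists>x\<in>X. p dvd f x"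
  using assms prime_in_dvd_prod[OF _ assms(2,4)] by (auto simp: prime_or_zero_def)

context covariants
begin

section \<open>Orbit polynomials\<close>

text \<open>Up to sign, the elementary symmetric functions of the orbit of \<open>f\<close>.\<close>

definition esym :: "('v \<Rightarrow> 'v) set \<Rightarrow> 'k mpoly \<Rightarrow> nat \<Rightarrow> 'k mpoly" where
  "esym H f c = (\<Sum>A\<in>{A. A \<subseteq> H \<and> card A = c}. \<Prod>h\<in>A. - act h f)"

lemma esym_expand:
  assumes "finite H"
  shows "(\<Prod>h\<in>H. x - act h f) = (\<Sum>c\<le>card H. x ^ (card H - c) * esym H f c)"
proof -
  have "(\<Prod>h\<in>H. x - act h f) = (\<Prod>h\<in>H. - act h f + x)"
    by simp
  also have "\<dots> = (\<Sum>A\<in>Pow H. (\<Prod>h\<in>A. - act h f) * (\<Prod>h\<in>H - A. x))"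
    by (rule prod_add[OF assms])
  also have "\<dots> = (\<Sum>c\<in>{..card H}. \<Sum>A\<in>{A. A \<in> Pow H \<and> card A = c}. (\<Prod>h\<in>A. - act h f) * (\<Prod>h\<in>H - A. x))"
    by (rule sum.group[symmetric]) (use assms in \<open>auto simp: card_mono\<close>)
  also have "\<dots> = (\<Sum>c\<le>card H. x ^ (card H - c) * esym H f c)"
  proof (rule sum.cong[OF refl])
    fix c
    show "(\<Sum>A\<in>{A. A \<in> Pow H \<and> card A = c}. (\<Prod>h\<in>A. - act h f) * (\<Prod>h\<in>H - A. x)) =
        x ^ (card H - c) * esym H f c"
      unfolding esym_def sum_distrib_left
      by (rule sum.cong) (use assms in \<open>auto simp: card_Diff_subset finite_subset mult.commute\<close>)
  qed
  finally show ?thesis .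
qed

lemma left_mult_image:
  assumes "subgrp H" "h \<in> H"
  shows "(\<lambda>k. h \<circ> k) ` H = H"
proof
  show "(\<lambda>k. h \<circ> k) ` H \<subseteq> H" using subgrpD(3)[OF assms(1,2)] by auto
  show "H \<subseteq> (\<lambda>k. h \<circ> k) ` H"
  proof
    fix k assume k: "k \<in> H"
    have "h \<in> G" using assms subgrpD(1) by blast
    then have "k = h \<circ> (inv_into UNIV h \<circ> k)"
      using G_inv_comp(2) by (metis comp_assoc id_comp)
    moreover have "inv_into UNIV h \<circ> k \<in> H"
      using subgrpD(3,4)[OF assms(1)] assms(2) k by blast
    ultimately show "k \<in> (\<lambda>k. h \<circ> k) ` H" by blast
  qed
qed

lemma left_mult_inj: "h \<in> G \<Longrightarrow> inj (\<lambda>k. h \<circ> k)"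
  by (rule injI) (metis G_inv_comp(1) comp_assoc id_comp)

lemma esym_polyR: "f \<in> polyR (length bs) \<Longrightarrow> esym H f c \<in> polyR (length bs)"
  unfolding esym_def by (intro polyR_sum polyR_prod polyR_uminus act_polyR)

lemma esym_homogeneous: "homogeneous d f \<Longrightarrow> homogeneous (c * d) (esym H f c)"
  unfolding esym_def
proof (rule homogeneous_sum)
  fix A assume f: "homogeneous d f" and A: "A \<in> {A. A \<subseteq> H \<and> card A = c}"
  have "homogeneous (\<Sum>h\<in>A. d) (\<Prod>h\<in>A. - act h f)"
    by (intro homogeneous_prod homogeneous_uminus act_homogeneous f)
  then show "homogeneous (c * d) (\<Prod>h\<in>A. - act h f)" using A by simp
qed

text \<open>An element of \<open>H\<close> permutes the translates of \<open>f\<close>, hence the subsets \<open>A\<close> of \<open>H\<close> of a given size.\<close>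

lemma esym_inv_ring:
  assumes "subgrp H" "f \<in> polyR (length bs)"
  shows "esym H f c \<in> inv_ring H"
proof (rule inv_ringI[OF esym_polyR[OF assms(2)]])
  fix h assume h: "h \<in> H"
  then have hG: "h \<in> G" using assms subgrpD(1) by blast
  let ?F = "{A. A \<subseteq> H \<and> card A = c}"
  let ?T = "\<lambda>A. (\<lambda>k. h \<circ> k) ` A"
  have inj: "inj_on (\<lambda>k. h \<circ> k) A" for A
    using left_mult_inj[OF hG] inj_on_subset by blast
  have im: "?T ` ?F = ?F"
  proof
    show "?T ` ?F \<subseteq> ?F"
      using left_mult_image[OF assms(1) h] by (auto simp: card_image[OF inj])
    show "?F \<subseteq> ?T ` ?F"
    proof
      fix B assume B: "B \<in> ?F"
      then obtain A where "A \<subseteq> H" "B = ?T A"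
        using left_mult_image[OF assms(1) h] by (metis (no_types, lifting) mem_Collect_eq subset_imageE)
      with B show "B \<in> ?T ` ?F" by (auto simp: card_image[OF inj])
    qed
  qed
  have injT: "inj_on ?T ?F"
    by (rule inj_onI, erule inj_image_eq_iff[OF left_mult_inj[OF hG], THEN iffD1])
  have "act h (esym H f c) = (\<Sum>A\<in>?F. \<Prod>k\<in>?T A. - act k f)"
    unfolding esym_def act_sum act_prod
  proof (rule sum.cong[OF refl])
    fix A assume A: "A \<in> ?F"
    then have "(\<Prod>k\<in>A. act h (- act k f)) = (\<Prod>k\<in>A. - act (h \<circ> k) f)"
      using subgrpD(1)[OF assms(1)] hG assms(2) by (intro prod.cong) (auto simp: act_simps act_comp)
    also have "\<dots> = (\<Prod>k\<in>?T A. - act k f)"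
      by (simp add: prod.reindex[OF inj])
    finally show "(\<Prod>k\<in>A. act h (- act k f)) = (\<Prod>k\<in>?T A. - act k f)" .
  qed
  also have "\<dots> = (\<Sum>A\<in>?T ` ?F. \<Prod>k\<in>A. - act k f)"
    by (simp add: sum.reindex[OF injT])
  also have "\<dots> = esym H f c" unfolding im esym_def ..
  finally show "act h (esym H f c) = esym H f c" .
qed

section \<open>Inertia groups\<close>

text \<open>The elements of \<open>G\<close> that act trivially on \<open>k[V]\<close> modulo \<open>\<pi>\<close>; it suffices to test the variables.\<close>

definition inertia :: "'k mpoly \<Rightarrow> ('v \<Rightarrow> 'v) set" where
  "inertia \<pi> = {g \<in> G. \<forall>i<length bs. \<pi> dvd act g (pvar i) - pvar i}"

lemma inertia_dvd:
  assumes "g \<in> inertia \<pi>" "f \<in> polyR (length bs)"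
  shows "\<pi> dvd act g f - f"
  by (rule hom_cong_dvd[OF act_hom comm_ring_hom_id _ _ assms(2)])
     (use assms(1) in \<open>auto simp: inertia_def\<close>)

lemma inertia_subgrp:
  assumes \<pi>: "\<pi> \<in> polyR (length bs)"
  shows "subgrp (inertia \<pi>)"
  unfolding subgrp_def
proof (intro conjI ballI)
  show "inertia \<pi> \<subseteq> G" by (auto simp: inertia_def)
  show "id \<in> inertia \<pi>" using G_id by (auto simp: inertia_def act_id polyR_pvar)
next
  fix g h assume gh: "g \<in> inertia \<pi>" "h \<in> inertia \<pi>"
  then have G: "g \<in> G" "h \<in> G" by (auto simp: inertia_def)
  have "\<pi> dvd act (g \<circ> h) (pvar i) - pvar i" if i: "i < length bs" for i
  proof -
    have X: "pvar i \<in> polyR (length bs)" using i by (rule polyR_pvar)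
    have "\<pi> dvd act g (act h (pvar i)) - act h (pvar i)"
      by (rule inertia_dvd[OF gh(1) act_polyR[OF X]])
    moreover have "\<pi> dvd act h (pvar i) - pvar i" by (rule inertia_dvd[OF gh(2) X])
    ultimately have "\<pi> dvd (act g (act h (pvar i)) - act h (pvar i)) + (act h (pvar i) - pvar i)"
      by (rule dvd_add)
    then show ?thesis by (simp add: act_comp[OF G X])
  qed
  then show "g \<circ> h \<in> inertia \<pi>" using G G_comp by (auto simp: inertia_def)
next
  fix g assume g: "g \<in> inertia \<pi>"
  then have G: "g \<in> G" by (auto simp: inertia_def)
  have "\<pi> dvd act (inv_into UNIV g) (pvar i) - pvar i" if i: "i < length bs" for i
  proof -
    have X: "pvar i \<in> polyR (length bs)" using i by (rule polyR_pvar)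
    have "\<pi> dvd act g (act (inv_into UNIV g) (pvar i)) - act (inv_into UNIV g) (pvar i)"
      by (rule inertia_dvd[OF g act_polyR[OF X]])
    also have "act g (act (inv_into UNIV g) (pvar i)) = pvar i"
      using act_comp[OF G G_inv[OF G] X] G_inv_comp(2)[OF G] act_id[OF X] by simp
    finally show ?thesis by (metis dvd_minus_iff minus_diff_eq)
  qed
  then show "inv_into UNIV g \<in> inertia \<pi>" using G G_inv by (auto simp: inertia_def)
qed

lemma inertia_0: "inertia 0 = {id}"
  using act_faithful G_id by (auto simp: inertia_def act_id polyR_pvar)

text \<open>Outside the inertia group some invariant of the inertia group is moved modulo \<open>\<pi>\<close>: were
  all coefficients of the orbit polynomial of \<open>X\<^sub>i\<close> fixed by \<open>g\<close> modulo \<open>\<pi>\<close>, then \<open>g X\<^sub>i\<close> would be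
  a root of the orbit polynomial modulo \<open>\<pi>\<close>, whose only root is \<open>X\<^sub>i\<close>.\<close>

lemma inertia_separation:
  assumes \<pi>: "prime_or_zero (length bs) \<pi>" and g: "g \<in> G" "g \<notin> inertia \<pi>"
  obtains y d where "y \<in> inv_ring (inertia \<pi>)" "homogeneous d y" "\<not> \<pi> dvd y - act g y"
proof -
  define I where "I = inertia \<pi>"
  have I: "subgrp I" unfolding I_def by (rule inertia_subgrp[OF prime_or_zeroD(1)[OF \<pi>]])
  have finI: "finite I" using subgrpD(5)[OF I] .
  obtain i where i: "i < length bs" "\<not> \<pi> dvd act g (pvar i) - pvar i"
    using g by (auto simp: inertia_def)
  have X: "pvar i \<in> polyR (length bs)" using i(1) by (rule polyR_pvar)
  have "\<exists>c. \<not> \<pi> dvd esym I (pvar i) c - act g (esym I (pvar i) c)"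
  proof (rule ccontr)
    assume "\<nexists>c. \<not> \<pi> dvd esym I (pvar i) c - act g (esym I (pvar i) c)"
    then have *: "\<pi> dvd esym I (pvar i) c - act g (esym I (pvar i) c)" for c by blast
    let ?x = "act g (pvar i)"
    have "(\<Prod>h\<in>I. pvar i - act h (pvar i)) = 0"
      by (rule prod_zero[OF finI])
         (rule bexI[of _ id], use subgrpD(2)[OF I] act_id[OF X] in auto)
    then have "act g (\<Sum>c\<le>card I. pvar i ^ (card I - c) * esym I (pvar i) c) = 0"
      unfolding esym_expand[OF finI, symmetric] by (simp add: act_simps)
    then have 0: "(\<Sum>c\<le>card I. ?x ^ (card I - c) * act g (esym I (pvar i) c)) = 0"
      by (simp add: act_sum act_simps)
    have "\<pi> dvd (\<Sum>c\<le>card I. ?x ^ (card I - c) * (esym I (pvar i) c - act g (esym I (pvar i) c)))"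
      by (intro dvd_sum dvd_mult *)
    then have 1: "\<pi> dvd (\<Prod>h\<in>I. ?x - act h (pvar i))"
      unfolding esym_expand[OF finI] using 0 by (simp add: right_diff_distrib sum_subtractf)
    have "\<pi> dvd (\<Prod>h\<in>I. ?x - act h (pvar i)) - (\<Prod>h\<in>I. ?x - pvar i)"
    proof (rule dvd_diff_prod)
      fix h assume "h \<in> I"
      then have "\<pi> dvd - (act h (pvar i) - pvar i)"
        using inertia_dvd[OF _ X, of h \<pi>] I_def by (simp only: dvd_minus_iff)
      then show "\<pi> dvd ?x - act h (pvar i) - (?x - pvar i)" by (simp add: algebra_simps)
    qed
    from dvd_diff[OF 1 this] have "\<pi> dvd (?x - pvar i) ^ card I" by simp
    from prime_or_zeroD(4)[OF \<pi> _ this] have "\<pi> dvd ?x - pvar i"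
      using X by (auto intro: act_polyR)
    with i(2) show False by simp
  qed
  then obtain c where "\<not> \<pi> dvd esym I (pvar i) c - act g (esym I (pvar i) c)" ..
  moreover have "esym I (pvar i) c \<in> inv_ring (inertia \<pi>)"
    using esym_inv_ring[OF I X] by (simp add: I_def)
  ultimately show ?thesis
    using that esym_homogeneous[OF homogeneous_pvar] by blast
qed

section \<open>Relative transfer\<close>

definition cosets :: "('v \<Rightarrow> 'v) set \<Rightarrow> ('v \<Rightarrow> 'v) set set" where
  "cosets H = (\<lambda>g. (\<lambda>h. g \<circ> h) ` H) ` G"

text \<open>The choice does not matter for elements invariant under \<open>H\<close>.\<close>

definition repr :: "('v \<Rightarrow> 'v) set \<Rightarrow> 'v \<Rightarrow> 'v" where
  "repr C = (SOME r. r \<in> C)"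

lemma repr_in:
  assumes "subgrp H" "C \<in> cosets H"
  shows "repr C \<in> C" "repr C \<in> G"
proof -
  obtain g where g: "g \<in> G" "C = (\<lambda>h. g \<circ> h) ` H" using assms(2) by (auto simp: cosets_def)
  then have "\<exists>r. r \<in> C" using subgrpD(2)[OF assms(1)] by blast
  then show 1: "repr C \<in> C" unfolding repr_def by (rule someI_ex)
  then obtain h where h: "h \<in> H" "repr C = g \<circ> h" unfolding g(2) by blast
  show "repr C \<in> G" unfolding h(2) by (rule G_comp[OF g(1)]) (use h(1) subgrpD(1)[OF assms(1)] in blast)
qed

lemma tensor_act_coset:
  assumes H: "subgrp H" and C: "C \<in> cosets H" "r \<in> C" "s \<in> C" and a: "a \<in> cov H"
  shows "tensor_act r a = tensor_act s a"
proof -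
  obtain g where g: "g \<in> G" "C = (\<lambda>h. g \<circ> h) ` H" using C(1) by (auto simp: cosets_def)
  have "tensor_act (g \<circ> h) a = tensor_act g a" if "h \<in> H" for h
    using tensor_act_comp[OF g(1) _ covD(1)[OF a]] covD(2)[OF a that] subgrpD(1)[OF H] that by auto
  with g C show ?thesis by auto
qed

text \<open>The relative trace from \<open>H\<close> to \<open>G\<close>.\<close>

definition transfer :: "('v \<Rightarrow> 'v) set \<Rightarrow> (nat \<Rightarrow> 'k mpoly) \<Rightarrow> nat \<Rightarrow> 'k mpoly" where
  "transfer H a = (\<lambda>i. \<Sum>C\<in>cosets H. tensor_act (repr C) a i)"

lemma transfer_cov:
  assumes H: "subgrp H" and a: "a \<in> cov H"
  shows "transfer H a \<in> cov G"
proof -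
  have tr: "transfer H a = (\<lambda>i. \<Sum>C\<in>cosets H. 1 * tensor_act (repr C) a i)"
    by (simp add: transfer_def)
  have ts: "transfer H a \<in> tensor_space"
    unfolding tr by (rule tensor_space_sum) (auto intro: tensor_act_in covD[OF a])
  moreover have "tensor_act g (transfer H a) = transfer H a" if g: "g \<in> G" for g
  proof -
    let ?T = "\<lambda>C. (\<lambda>k. g \<circ> k) ` C"
    have inj: "inj_on ?T (cosets H)"
      by (rule inj_onI, erule inj_image_eq_iff[OF left_mult_inj[OF g], THEN iffD1])
    have TC: "?T ((\<lambda>h. k \<circ> h) ` H) = (\<lambda>h. (g \<circ> k) \<circ> h) ` H" for k
      by (auto simp: image_image comp_assoc)
    have im: "?T ` cosets H = cosets H"
    proof -
      have "?T ` cosets H = (\<lambda>k. (\<lambda>h. k \<circ> h) ` H) ` ((\<lambda>k. g \<circ> k) ` G)"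
        unfolding cosets_def image_image TC[unfolded image_image] ..
      then show ?thesis by (simp add: left_mult_image[OF subgrp_G g] cosets_def)
    qed
    have "tensor_act g (transfer H a) = (\<lambda>i. \<Sum>C\<in>cosets H. tensor_act g (tensor_act (repr C) a) i)"
      unfolding tr tensor_act_sum by (simp add: act_simps)
    also have "\<dots> = (\<lambda>i. \<Sum>C\<in>cosets H. tensor_act (repr (?T C)) a i)"
    proof (intro ext sum.cong refl)
      fix i C assume C: "C \<in> cosets H"
      have TC': "?T C \<in> cosets H" using im C by blast
      have "tensor_act g (tensor_act (repr C) a) = tensor_act (g \<circ> repr C) a"
        using tensor_act_comp[OF g repr_in(2)[OF H C] covD(1)[OF a]] by simp
      also have "\<dots> = tensor_act (repr (?T C)) a"
        by (rule tensor_act_coset[OF H TC' _ repr_in(1)[OF H TC'] a]) (use repr_in(1)[OF H C] in blast)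
      finally show "tensor_act g (tensor_act (repr C) a) i = tensor_act (repr (?T C)) a i" by simp
    qed
    also have "\<dots> = (\<lambda>i. \<Sum>C\<in>?T ` cosets H. tensor_act (repr C) a i)"
      by (simp add: sum.reindex[OF inj])
    also have "\<dots> = transfer H a" unfolding im transfer_def ..
    finally show ?thesis .
  qed
  ultimately show ?thesis by (simp add: cov_def)
qed

lemma transfer_homogeneous:
  "(\<And>i. i < length vs \<Longrightarrow> homogeneous d (a i)) \<Longrightarrow> i < length vs \<Longrightarrow> homogeneous d (transfer H a i)"
  unfolding transfer_def by (intro homogeneous_sum tensor_act_homogeneous) auto

text \<open>A Lagrange interpolation over the cosets of \<open>H\<close>: a suitable \<open>k[V]\<close>-linear combination of
  transfers of multiples of \<open>\<eta>\<close> equals \<open>\<delta> \<cdot> \<eta>\<close> with \<open>\<delta>\<close> prime to \<open>\<pi>\<close>.\<close>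

lemma covariant_transfer:
  assumes H: "subgrp H" and \<pi>: "prime_or_zero (length bs) \<pi>"
    and sep: "\<And>g. g \<in> G \<Longrightarrow> g \<notin> H \<Longrightarrow>
      \<exists>y d. y \<in> inv_ring H \<and> homogeneous d y \<and> \<not> \<pi> dvd y - act g y"
    and \<eta>: "\<And>j. j < length vs \<Longrightarrow> \<eta> j \<in> hom_cov H" and nd: "\<not> \<pi> ^ e dvd jac \<eta>"
  shows "\<exists>\<omega>. (\<forall>j<length vs. \<omega> j \<in> hom_cov G) \<and> \<not> \<pi> ^ e dvd jac \<omega>"
proof -
  define P where "P = cosets H - {H}"
  have finQ: "finite (cosets H)" unfolding cosets_def using G_finite by simp
  have finP: "finite P" unfolding P_def using finQ by simp
  have HQ: "H \<in> cosets H" unfolding cosets_def using G_id by (intro image_eqI[of _ _ id]) auto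
  have reprP: "repr C \<in> G" "repr C \<notin> H" if "C \<in> P" for C
  proof -
    have C: "C \<in> cosets H" "C \<noteq> H" using that by (auto simp: P_def)
    show "repr C \<in> G" by (rule repr_in(2)[OF H C(1)])
    show "repr C \<notin> H"
    proof
      assume rH: "repr C \<in> H"
      obtain g where g: "g \<in> G" "C = (\<lambda>h. g \<circ> h) ` H" using C(1) by (auto simp: cosets_def)
      then obtain h where h: "h \<in> H" "repr C = g \<circ> h" using repr_in(1)[OF H C(1)] by auto
      have "h \<in> G" using h(1) subgrpD(1)[OF H] by auto
      then have "g = repr C \<circ> inv_into UNIV h"
        unfolding h(2) using G_inv_comp(2) by (simp add: comp_assoc)
      then have "g \<in> H" using subgrpD(3,4)[OF H] rH h(1) by simp
      then have "C = H" using g(2) left_mult_image[OF H] by simp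
      with C(2) show False by simp
    qed
  qed
  have "\<forall>C\<in>P. \<exists>y d. y \<in> inv_ring H \<and> homogeneous d y \<and> \<not> \<pi> dvd y - act (repr C) y"
    using sep reprP by blast
  then obtain y d where y: "\<And>C. C \<in> P \<Longrightarrow> y C \<in> inv_ring H" "\<And>C. C \<in> P \<Longrightarrow> homogeneous (d C) (y C)"
    "\<And>C. C \<in> P \<Longrightarrow> \<not> \<pi> dvd y C - act (repr C) (y C)" by metis
  \<comment> \<open>For a coset \<open>D\<close> with representative \<open>r\<close>, the product of all \<open>r (y C) - repr C (y C)\<close> over \<open>C \<noteq> H\<close> is \<open>\<delta>\<close> if \<open>D = H\<close> and \<open>0\<close> otherwise; expanding it over the subsets \<open>A\<close> of \<open>P\<close> separates \<open>r\<close> from the constants.\<close>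
  define \<delta> where "\<delta> = (\<Prod>C\<in>P. y C - act (repr C) (y C))"
  have yR: "y C \<in> polyR (length bs)" "act g (y C) \<in> polyR (length bs)" if "C \<in> P" for C g
    using inv_ringD(1)[OF y(1)[OF that]] by (auto intro: act_polyR)
  have \<delta>R: "\<delta> \<in> polyR (length bs)" unfolding \<delta>_def using yR by (intro polyR_prod polyR_diff) auto
  have \<delta>: "\<not> \<pi> dvd \<delta>"
  proof
    assume "\<pi> dvd \<delta>"
    then have "\<exists>C\<in>P. \<pi> dvd y C - act (repr C) (y C)"
      unfolding \<delta>_def using yR by (intro prime_or_zero_dvd_prod[OF \<pi> _ finP] polyR_diff) auto
    with y(3) show False by blast
  qed
  define F where "F A = (\<Prod>C\<in>A. y C)" for A
  define c where "c A = (\<Prod>C\<in>P - A. - act (repr C) (y C))" for A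
  define w where "w A j = transfer H (\<lambda>i. F A * \<eta> j i)" for A j
  have F_inv: "F A \<in> inv_ring H" if "A \<in> Pow P" for A
    unfolding F_def using y(1) that by (intro inv_ring_prod) auto
  have F\<eta>: "(\<lambda>i. F A * \<eta> j i) \<in> cov H" if "A \<in> Pow P" "j < length vs" for A j
    using cov_sum[of "{()}" "\<lambda>_. F A" H "\<lambda>_. \<eta> j"] F_inv[OF that(1)] hom_cov_in[OF \<eta>[OF that(2)]] by simp
  have w: "w A j \<in> hom_cov G" if A: "A \<in> Pow P" and j: "j < length vs" for A j
  proof -
    have "homogeneous (sum d A) (F A)" unfolding F_def using y(2) A by (intro homogeneous_prod) auto
    then have "homogeneous (sum d A + cdeg (\<eta> j)) (F A * \<eta> j i)" for i
      using cov_degD(2)[OF cdeg_cov_deg[OF \<eta>[OF j]]] by (intro homogeneous_mult)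
    then have "w A j \<in> cov_deg G (sum d A + cdeg (\<eta> j))"
      unfolding w_def using transfer_cov[OF H F\<eta>[OF A j]]
      by (intro cov_degI transfer_homogeneous) auto
    then show ?thesis by (auto simp: hom_cov_def)
  qed
  have interp: "(\<Sum>A\<in>Pow P. c A * act (repr D) (F A)) = (if D = H then \<delta> else 0)"
    if D: "D \<in> cosets H" for D
  proof -
    have "(\<Sum>A\<in>Pow P. c A * act (repr D) (F A)) =
        (\<Sum>A\<in>Pow P. (\<Prod>C\<in>A. act (repr D) (y C)) * (\<Prod>C\<in>P - A. - act (repr C) (y C)))"
      by (simp add: c_def F_def act_prod mult.commute)
    also have "\<dots> = (\<Prod>C\<in>P. act (repr D) (y C) + - act (repr C) (y C))"
      by (rule prod_add[OF finP, symmetric])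
    also have "\<dots> = (if D = H then \<delta> else 0)"
    proof (cases "D = H")
      case True
      then have "repr D \<in> H" using repr_in(1)[OF H D] by simp
      then have "act (repr D) (y C) = y C" if "C \<in> P" for C using inv_ringD(2)[OF y(1)[OF that]] by simp
      then show ?thesis using True by (simp add: \<delta>_def)
    next
      case False
      then have "D \<in> P" using D by (simp add: P_def)
      then have "(\<Prod>C\<in>P. act (repr D) (y C) + - act (repr C) (y C)) = 0"
        by (intro prod_zero[OF finP] bexI[of _ D]) auto
      with False show ?thesis by simp
    qed
    finally show ?thesis .
  qed
  have lin: "(\<Sum>A\<in>Pow P. c A * w A j i) = \<delta> * \<eta> j i" if j: "j < length vs" for j i
  proof -
    have "w A j i = (\<Sum>D\<in>cosets H. act (repr D) (F A) * tensor_act (repr D) (\<eta> j) i)" for A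
      unfolding w_def transfer_def
      using tensor_act_sum[of _ "\<lambda>_. F A" "\<lambda>_. \<eta> j" "{()}"] by simp
    then have "(\<Sum>A\<in>Pow P. c A * w A j i) =
        (\<Sum>A\<in>Pow P. \<Sum>D\<in>cosets H. c A * act (repr D) (F A) * tensor_act (repr D) (\<eta> j) i)"
      by (simp add: sum_distrib_left mult.assoc)
    also have "\<dots> = (\<Sum>D\<in>cosets H. (\<Sum>A\<in>Pow P. c A * act (repr D) (F A)) * tensor_act (repr D) (\<eta> j) i)"
      by (subst sum.swap) (simp add: sum_distrib_right)
    also have "\<dots> = (\<Sum>D\<in>cosets H. if D = H then \<delta> * tensor_act (repr H) (\<eta> j) i else 0)"
      by (rule sum.cong) (auto simp: interp)
    also have "\<dots> = \<delta> * tensor_act (repr H) (\<eta> j) i" using finQ HQ by simp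
    also have "tensor_act (repr H) (\<eta> j) = \<eta> j"
      using repr_in(1)[OF H HQ] covD(2)[OF hom_cov_in[OF \<eta>[OF j]]] by blast
    finally show ?thesis .
  qed
  have "\<delta> ^ length vs * jac \<eta> = dt (length vs) (\<lambda>j i. \<Sum>A\<in>Pow P. c A * w A j i)"
    unfolding jac_eq_dt dt_scale[symmetric] by (rule dt_cong) (simp add: lin)
  also have "\<dots> = (\<Sum>\<kappa>\<in>{..<length vs} \<rightarrow>\<^sub>E Pow P. (\<Prod>j<length vs. c (\<kappa> j)) * jac (\<lambda>j. w (\<kappa> j) j))"
    unfolding jac_eq_dt using finP
    using dt_sum_columns[of "Pow P" "length vs" "\<lambda>_ A. c A" "\<lambda>j A. w A j"] by simp
  finally have eq: "\<delta> ^ length vs * jac \<eta> = \<dots>" .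
  have "\<exists>\<kappa>\<in>{..<length vs} \<rightarrow>\<^sub>E Pow P. \<not> \<pi> ^ e dvd jac (\<lambda>j. w (\<kappa> j) j)"
  proof (rule ccontr)
    assume "\<not> ?thesis"
    then have "\<pi> ^ e dvd \<delta> ^ length vs * jac \<eta>" unfolding eq by (intro dvd_sum dvd_mult) auto
    moreover have "jac \<eta> \<in> polyR (length bs)"
      by (rule jac_polyR) (use hom_cov_in[OF \<eta>] in \<open>auto intro: tensor_spaceD covD\<close>)
    moreover have "\<not> \<pi> dvd \<delta> ^ length vs" using prime_or_zeroD(4)[OF \<pi> \<delta>R] \<delta> by blast
    ultimately have "\<pi> ^ e dvd jac \<eta>"
      using prime_or_zeroD(5)[OF \<pi>] polyR_power[OF \<delta>R] by blast
    with nd show False by simp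
  qed
  then obtain \<kappa> where \<kappa>: "\<kappa> \<in> {..<length vs} \<rightarrow>\<^sub>E Pow P" "\<not> \<pi> ^ e dvd jac (\<lambda>j. w (\<kappa> j) j)" by blast
  show ?thesis
    by (rule exI[of _ "\<lambda>j. w (\<kappa> j) j"]) (use \<kappa> in \<open>auto intro!: w\<close>)
qed

end

section \<open>Linear forms and hyperplanes\<close>

context covariants
begin

lemma functional_0: "Vector_Spaces.linear scV (*) l \<Longrightarrow> l 0 = 0"
proof -
  assume "Vector_Spaces.linear scV (*) l"
  then interpret l: Vector_Spaces.linear scV "(*)" l .
  show ?thesis by (rule l.zero)
qed

lemma functional_diff: "Vector_Spaces.linear scV (*) l \<Longrightarrow> l (u - v) = l u - l v"
proof -
  assume "Vector_Spaces.linear scV (*) l"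
  then interpret l: Vector_Spaces.linear scV "(*)" l .
  show ?thesis by (rule l.diff)
qed

lemma functional_scale: "Vector_Spaces.linear scV (*) l \<Longrightarrow> l (scV c v) = c * l v"
  by (simp add: Vector_Spaces.linear_iff)

lemma functional_nonzero_basis:
  assumes "Vector_Spaces.linear scV (*) l" "l v \<noteq> 0"
  obtains i where "i < length bs" "l (bs ! i) \<noteq> 0"
proof -
  have "\<exists>i<length bs. l (bs ! i) \<noteq> 0"
  proof (rule ccontr)
    assume "\<not> ?thesis"
    then have "l v = 0" by (subst functional_expand[OF assms(1)]) simp
    with assms(2) show False by simp
  qed
  then show ?thesis using that by blast
qed

text \<open>A functional that vanishes on the kernel of \<open>l\<close> is determined by its value at one vector outside.\<close>

lemma functional_proportional:
  assumes l: "Vector_Spaces.linear scV (*) l" and l': "Vector_Spaces.linear scV (*) l'"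
    and v: "l v \<noteq> 0" and ker: "\<And>u. l u = 0 \<Longrightarrow> l' u = 0"
  shows "l' u = l' v / l v * l u"
proof -
  have "l (u - scV (l u / l v) v) = 0"
    using v by (simp add: functional_diff[OF l] functional_scale[OF l])
  from ker[OF this] have "l' u = l u / l v * l' v"
    by (simp add: functional_diff[OF l'] functional_scale[OF l'])
  then show ?thesis by simp
qed

lemma form_poly_eq_0_iff:
  assumes "Vector_Spaces.linear scV (*) l"
  shows "form_poly l = 0 \<longleftrightarrow> (\<forall>u. l u = 0)"
proof
  assume *: "form_poly l = 0"
  have "l (bs ! j) = 0" if "j < length bs" for j
    using lookup_form_poly[OF that, of l] * by simp
  then show "\<forall>u. l u = 0" using functional_nonzero_basis[OF assms] by blast
qed (simp add: form_poly_def)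

lemma kernel_hyperplane:
  assumes l: "Vector_Spaces.linear scV (*) l" and v: "l v \<noteq> 0"
  shows "hyperplane {u. l u = 0}"
proof -
  let ?U = "{u. l u = 0}"
  have sub: "V.subspace ?U"
    unfolding V.subspace_def using l functional_0[OF l] by (auto simp: Vector_Spaces.linear_iff)
  obtain B where B: "B \<subseteq> ?U" "V.independent B" "?U \<subseteq> V.span B"
    using V.maximal_independent_subset[of ?U] by blast
  have finB: "finite B"
    using V.independent_span_bound[of "set bs" B] B(2) V_basis by auto
  have spB: "V.span B = ?U"
    using V.span_subspace[OF B(1,3) sub] .
  have vB: "v \<notin> V.span B" using v spB by simp
  then have ind: "V.independent (insert v B)"
    using B(2) by (rule V.independent_insertI)
  have "u \<in> V.span (insert v B)" for u
  proof -
    have "u - scV (l u / l v) v \<in> V.span B"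
      unfolding spB using v by (simp add: functional_diff[OF l] functional_scale[OF l])
    then show ?thesis unfolding V.span_insert by blast
  qed
  then have "V.dim UNIV = card (insert v B)"
    using V.dim_unique[of "insert v B" UNIV "card (insert v B)"] ind by auto
  moreover have "v \<notin> B" using vB V.span_base by blast
  moreover have "V.dim ?U = card B" using V.dim_unique[OF B(1,3,2)] by simp
  ultimately show ?thesis unfolding hyperplane_def using sub finB by simp
qed

lemma hyperplane_formE:
  assumes "hyperplane U" "hyperplane_form U l"
  shows "\<exists>v. Vector_Spaces.linear scV (*) l \<and> l v \<noteq> 0 \<and> (\<forall>u. u \<in> U \<longleftrightarrow> l u = 0)"
proof -
  have "U \<noteq> UNIV" using assms(1) by (auto simp: hyperplane_def)
  then show ?thesis using assms(2) by (auto simp: hyperplane_form_def)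
qed

text \<open>Eliminating a variable modulo a linear form: the quotient by a linear form is again a
  polynomial ring, so the linear form is prime.\<close>

lemma form_poly_elimination:
  assumes l: "Vector_Spaces.linear scV (*) l" and i: "i < length bs" "l (bs ! i) \<noteq> 0"
  defines "s \<equiv> \<lambda>j. if j = i then pvar i - pconst (inverse (l (bs ! i))) * form_poly l else pvar j"
  shows "f \<in> polyR (length bs) \<Longrightarrow> form_poly l dvd f \<longleftrightarrow> psubst s f = 0"
proof -
  interpret s: comm_ring_hom "psubst s" by (rule psubst_hom)
  have sl: "psubst s (form_poly l) = 0"
  proof -
    have "psubst s (form_poly l) = (\<Sum>j<length bs. pconst (l (bs ! j)) * s j)"
      unfolding form_poly_def by (simp add: s.hom_sum s.hom_mult)
    also have "\<dots> = (\<Sum>j<length bs. pconst (l (bs ! j)) * pvar j -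
        (if j = i then pconst (l (bs ! i)) * pconst (inverse (l (bs ! i))) * form_poly l else 0))"
      by (rule sum.cong) (auto simp: s_def algebra_simps)
    also have "\<dots> = form_poly l - pconst (l (bs ! i)) * pconst (inverse (l (bs ! i))) * form_poly l"
      using i(1) by (simp add: sum_subtractf form_poly_def[symmetric])
    also have "\<dots> = 0"
      using i(2) by (simp flip: pconst.hom_mult)
    finally show ?thesis .
  qed
  assume f: "f \<in> polyR (length bs)"
  have "form_poly l dvd f - psubst s f"
  proof (rule hom_cong_dvd[OF comm_ring_hom_id psubst_hom _ _ f])
    fix j show "form_poly l dvd pvar j - psubst s (pvar j)" by (simp add: s_def)
  qed simp
  then show "form_poly l dvd f \<longleftrightarrow> psubst s f = 0"
    using sl s.hom_mult by (metis diff_0_right dvd_def mult_zero_left)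
qed

lemma psubst_1: "psubst s 1 = 1"
proof -
  interpret comm_ring_hom "psubst s" by (rule psubst_hom)
  show ?thesis by simp
qed

lemma form_poly_prime:
  assumes l: "Vector_Spaces.linear scV (*) l" and v: "l v \<noteq> 0"
  shows "prime_in (length bs) (form_poly l)"
proof -
  obtain i where i: "i < length bs" "l (bs ! i) \<noteq> 0" using functional_nonzero_basis[OF l v] by blast
  note elim = form_poly_elimination[OF l i]
  show ?thesis unfolding prime_in_def
  proof (intro conjI ballI impI)
    show "form_poly l \<in> polyR (length bs)" by (rule form_poly_in)
    show "form_poly l \<noteq> 0" using form_poly_eq_0_iff[OF l] v by blast
    show "\<not> form_poly l dvd 1"
      using elim[OF polyR_1] by (simp add: psubst_1)
    fix a b :: "'k mpoly" assume ab: "a \<in> polyR (length bs)" "b \<in> polyR (length bs)" "form_poly l dvd a * b"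
    then show "form_poly l dvd a \<or> form_poly l dvd b"
      using elim[OF ab(1)] elim[OF ab(2)] elim[OF polyR_mult[OF ab(1,2)]]
      by (simp add: psubst_mev pconst.mev_mult)
  qed
qed

text \<open>For degree reasons the quotient is a constant.\<close>

lemma form_poly_dvd_form_poly:
  assumes l: "Vector_Spaces.linear scV (*) l" "l v \<noteq> 0" and l': "Vector_Spaces.linear scV (*) l'"
  shows "form_poly l dvd form_poly l' \<longleftrightarrow> (\<forall>u. l u = 0 \<longrightarrow> l' u = 0)"
proof
  assume "form_poly l dvd form_poly l'"
  then obtain h where h: "form_poly l' = form_poly l * h" ..
  show "\<forall>u. l u = 0 \<longrightarrow> l' u = 0"
  proof (cases "form_poly l' = 0")
    case True
    with form_poly_eq_0_iff[OF l'] show ?thesis by blast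
  next
    case False
    then have nz: "form_poly l \<noteq> 0" "h \<noteq> 0" using h by auto
    have "degree (grade (form_poly l')) = 1" "degree (grade (form_poly l)) = 1"
      using degree_grade_homogeneous[OF form_poly_homogeneous] False nz by auto
    then have "degree (grade h) = 0" using degree_grade_mult[OF nz] h by simp
    then obtain c where "h = pconst c" using degree_grade_0_const by blast
    with h have "form_poly l' = form_poly (\<lambda>u. c * l u)" by (simp add: form_poly_scale mult.commute)
    from form_poly_eqD[OF this] have c: "l' (bs ! j) = c * l (bs ! j)" if "j < length bs" for j using that .
    have "l' u = c * l u" for u
    proof -
      have "l' u = (\<Sum>i<length bs. xV u i * l' (bs ! i))" by (rule functional_expand[OF l'])
      also have "\<dots> = c * (\<Sum>i<length bs. xV u i * l (bs ! i))"
        by (simp add: c sum_distrib_left mult.left_commute)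
      finally show ?thesis by (simp add: functional_expand[OF l(1), of u])
    qed
    then show ?thesis by simp
  qed
next
  assume ker: "\<forall>u. l u = 0 \<longrightarrow> l' u = 0"
  then have "form_poly l' = form_poly (\<lambda>u. l' v / l v * l u)"
    using functional_proportional[OF l(1) l' l(2)] by (intro form_poly_cong) blast
  then have "form_poly l' = pconst (l' v / l v) * form_poly l" unfolding form_poly_scale .
  then show "form_poly l dvd form_poly l'" by (rule dvdI[OF trans[OF _ mult.commute]])
qed

lemma act_pvar_diff:
  assumes "i < length bs"
  shows "act g (pvar i) - pvar i = form_poly (\<lambda>u. xV (inv_into UNIV g u) i - xV u i)"
  using assms by (simp add: act_pvar form_poly_diff form_poly_xV)

lemma act_pvar_diff_linear:
  assumes "g \<in> G"
  shows "Vector_Spaces.linear scV (*) (\<lambda>u. xV (inv_into UNIV g u) i - xV u i)"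
  using xV_linear[of i] inv_linear[OF assms] by (auto simp: Vector_Spaces.linear_iff algebra_simps)

text \<open>\<open>g X\<^sub>i - X\<^sub>i\<close> is the linear form \<open>u \<mapsto> x\<^sub>i(g\<inverse> u) - x\<^sub>i(u)\<close>, which \<open>l\<close> divides iff it vanishes on
  \<open>U\<close>.\<close>

lemma inertia_form_poly:
  assumes l: "Vector_Spaces.linear scV (*) l" "l v \<noteq> 0" and U: "\<And>u. u \<in> U \<longleftrightarrow> l u = 0"
  shows "inertia (form_poly l) = stab U"
proof -
  have "(\<forall>i<length bs. form_poly l dvd act g (pvar i) - pvar i) \<longleftrightarrow> (\<forall>u\<in>U. g u = u)" if g: "g \<in> G" for g
  proof -
    have "(\<forall>i<length bs. form_poly l dvd act g (pvar i) - pvar i) \<longleftrightarrow>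
        (\<forall>i<length bs. \<forall>u\<in>U. xV (inv_into UNIV g u) i = xV u i)"
      using form_poly_dvd_form_poly[OF l act_pvar_diff_linear[OF g]] by (simp add: act_pvar_diff Ball_def U)
    also have "\<dots> \<longleftrightarrow> (\<forall>u\<in>U. inv_into UNIV g u = u)"
    proof
      assume *: "\<forall>i<length bs. \<forall>u\<in>U. xV (inv_into UNIV g u) i = xV u i"
      show "\<forall>u\<in>U. inv_into UNIV g u = u"
      proof
        fix u assume "u \<in> U"
        then have "(\<Sum>i<length bs. scV (xV (inv_into UNIV g u) i) (bs ! i)) =
            (\<Sum>i<length bs. scV (xV u i) (bs ! i))" using * by simp
        then show "inv_into UNIV g u = u" by (simp add: V_expand[symmetric])
      qed
    qed simp
    also have "\<dots> \<longleftrightarrow> (\<forall>u\<in>U. g u = u)"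
      using G_bij[OF g] by (metis bij_inv_eq_iff)
    finally show ?thesis .
  qed
  then show ?thesis by (auto simp: inertia_def stab_def)
qed

text \<open>A prime with non-trivial inertia group divides a non-zero linear form \<open>g X\<^sub>i - X\<^sub>i\<close>, so it is
  itself a linear form.\<close>

lemma inertia_nontrivial:
  assumes \<pi>: "prime_in (length bs) \<pi>" and g: "g \<in> inertia \<pi>" "g \<noteq> id"
  obtains l v c where "Vector_Spaces.linear scV (*) l" "l v \<noteq> 0" "c \<noteq> 0" "form_poly l = \<pi> * pconst c"
proof -
  have gG: "g \<in> G" using g by (auto simp: inertia_def)
  obtain i where i: "i < length bs" "act g (pvar i) \<noteq> pvar i" using act_faithful[OF gG] g(2) by blast
  define l where "l = (\<lambda>u. xV (inv_into UNIV g u) i - xV u i)"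
  have l: "Vector_Spaces.linear scV (*) l" unfolding l_def by (rule act_pvar_diff_linear[OF gG])
  have fl: "form_poly l = act g (pvar i) - pvar i" unfolding l_def using act_pvar_diff[OF i(1)] by simp
  then have "form_poly l \<noteq> 0" using i(2) by simp
  then obtain v where v: "l v \<noteq> 0" using form_poly_eq_0_iff[OF l] by blast
  have "\<pi> dvd form_poly l" unfolding fl using g(1) i(1) by (auto simp: inertia_def)
  with prime_in_dvd_prime_in[OF \<pi> form_poly_prime[OF l v]] obtain c where "c \<noteq> 0" "form_poly l = \<pi> * pconst c"
    by blast
  with l v show ?thesis by (rule that)
qed

lemma inertia_associated: "c \<noteq> 0 \<Longrightarrow> inertia (\<pi> * pconst c) = inertia \<pi>"
  using pconst_dvd_1[of c] by (simp add: inertia_def mult_unit_dvd_iff)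

lemma stab_subgrp:
  assumes "hyperplane U" "hyperplane_form U l"
  shows "subgrp (stab U)"
proof -
  obtain v where "Vector_Spaces.linear scV (*) l" "l v \<noteq> 0" "\<And>u. u \<in> U \<longleftrightarrow> l u = 0"
    using hyperplane_formE[OF assms] by blast
  from inertia_form_poly[OF this] inertia_subgrp[OF form_poly_in, of l] show ?thesis by simp
qed

section \<open>The Jacobian as a criterion for bases\<close>

text \<open>Used for the projections to homogeneous components and for Taylor coefficients, which commute with the
  action.\<close>

lemma cov_equivariant_map:
  assumes add: "\<And>f (X::nat set). L (\<Sum>x\<in>X. f x) = (\<Sum>x\<in>X. L (f x))"
    and scale: "\<And>c p. L (pconst c * p) = pconst c * L p"
    and L: "\<And>p. p \<in> polyR (length bs) \<Longrightarrow> L p \<in> polyR (length bs)"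
    and equiv: "\<And>g p. g \<in> H \<Longrightarrow> p \<in> polyR (length bs) \<Longrightarrow> L (act g p) = act g (L p)"
    and a: "a \<in> cov H"
  shows "(\<lambda>i. L (a i)) \<in> cov H"
  unfolding cov_def
proof (intro CollectI conjI ballI)
  have L0: "L 0 = 0" using add[of "\<lambda>_. 0" "{}"] by simp
  show "(\<lambda>i. L (a i)) \<in> tensor_space"
    using covD(1)[OF a] by (auto simp: tensor_space_def coord_ring_polyR L0 intro: L)
  fix g assume g: "g \<in> H"
  show "tensor_act g (\<lambda>i. L (a i)) = (\<lambda>i. L (a i))"
  proof
    fix i
    show "tensor_act g (\<lambda>i. L (a i)) i = L (a i)"
    proof (cases "i < length vs")
      case True
      have "a i = (\<Sum>j<length vs. pconst (\<rho>M g i j) * act g (a j))"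
        using covD(2)[OF a g] tensor_act_eq[OF True, of g a] by simp
      then have "L (a i) = L (\<Sum>j<length vs. pconst (\<rho>M g i j) * act g (a j))" by (rule arg_cong)
      also have "\<dots> = (\<Sum>j<length vs. pconst (\<rho>M g i j) * act g (L (a j)))"
        by (simp add: add scale equiv[OF g tensor_spaceD[OF covD(1)[OF a]]])
      finally show ?thesis using True by (simp add: tensor_act_eq)
    next
      case False
      then show ?thesis using covD(1)[OF a] by (simp add: tensor_act_0 tensor_space_def L0)
    qed
  qed
qed

lemma grade_pconst: "grade (pconst c) = [:pconst c:]"
  by (simp add: grade_def pconst_poly.mev_pconst)

lemma cov_coeff_grade:
  assumes "a \<in> cov H"
  shows "(\<lambda>i. coeff (grade (a i)) d) \<in> cov_deg H d"
  by (intro cov_degI homogeneous_coeff_grade cov_equivariant_map[OF _ _ _ _ assms] coeff_grade_polyR)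
     (auto simp: grade.hom_sum coeff_sum grade.hom_mult grade_pconst coeff_grade_act)

lemma cov_homogeneous_sum:
  assumes "a \<in> cov H"
  obtains N where "a = (\<lambda>i. \<Sum>d\<le>N. coeff (grade (a i)) d)"
proof -
  define N where "N = (\<Sum>i<length vs. degree (grade (a i)))"
  have "a i = (\<Sum>d\<le>N. coeff (grade (a i)) d)" for i
  proof (cases "i < length vs")
    case True
    then have "degree (grade (a i)) \<le> N" unfolding N_def by (intro member_le_sum) auto
    then have "(\<Sum>d\<le>N. coeff (grade (a i)) d) = (\<Sum>d\<le>degree (grade (a i)). coeff (grade (a i)) d)"
      by (intro sum.mono_neutral_right) (auto simp: coeff_eq_0)
    then show ?thesis using sum_coeff_grade[of "a i"] by simp
  next
    case False
    then show ?thesis using covD(1)[OF assms] by (simp add: tensor_space_def)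
  qed
  then show ?thesis by (intro that[of N] ext)
qed

text \<open>Writing \<open>\<omega>\<close> in the basis \<open>\<eta>\<close>, the factor is the determinant of the coefficient matrix.\<close>

lemma jac_free_basis_factor:
  assumes fb: "free_basis H (length vs) \<eta>" and \<omega>: "\<And>j. j < length vs \<Longrightarrow> \<omega> j \<in> cov H"
  shows "\<exists>c\<in>inv_ring H. jac \<omega> = c * jac \<eta>"
proof -
  have "\<forall>j. \<exists>c. j < length vs \<longrightarrow> (\<forall>l<length vs. c l \<in> inv_ring H) \<and> \<omega> j = (\<lambda>i. \<Sum>l<length vs. c l * \<eta> l i)"
    using fb \<omega> unfolding free_basis_def by blast
  from choice[OF this] obtain c where "\<forall>j. j < length vs \<longrightarrow>
      (\<forall>l<length vs. c j l \<in> inv_ring H) \<and> \<omega> j = (\<lambda>i. \<Sum>l<length vs. c j l * \<eta> l i)" ..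
  then have c: "\<And>j l. j < length vs \<Longrightarrow> l < length vs \<Longrightarrow> c j l \<in> inv_ring H"
    "\<And>j. j < length vs \<Longrightarrow> \<omega> j = (\<lambda>i. \<Sum>l<length vs. c j l * \<eta> l i)" by blast+
  have "jac \<omega> = dt (length vs) (\<lambda>j i. \<Sum>l<length vs. c j l * \<eta> l i)"
    unfolding jac_eq_dt by (rule dt_cong) (simp add: c(2))
  also have "\<dots> = dt (length vs) c * jac \<eta>" unfolding jac_eq_dt by (rule dt_mult)
  finally have "jac \<omega> = dt (length vs) c * jac \<eta>" .
  moreover have "dt (length vs) c \<in> inv_ring H"
    unfolding dt_leibniz
  proof (intro inv_ring_sum inv_ring_closed(6) inv_ring_prod)
    fix p j assume "p \<in> {p. p permutes {0..<length vs}}" "j \<in> {..<length vs}"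
    then have "p j < length vs" "j < length vs" using permutes_in_image[of p "{0..<length vs}" j] by auto
    then show "c j (p j) \<in> inv_ring H" using c(1) by blast
  next
    fix p :: "nat \<Rightarrow> nat"
    have "- 1 \<in> inv_ring H" using inv_ring_closed(5)[OF inv_ring_closed(1,2)] by simp
    then show "signof p \<in> inv_ring H" by (auto simp: sign_def inv_ring_closed)
  qed
  ultimately show ?thesis by blast
qed

text \<open>By Cramer's rule \<open>a\<close> is the combination of \<open>\<eta>\<close> with coefficients \<open>jac (\<eta>(j := a)) / jac \<eta>\<close>. These
  are polynomials by assumption, and they are invariant because the coefficients of \<open>a\<close> are unique.\<close>

lemma free_basis_if_cramer_dvd:
  assumes \<eta>: "\<And>j. j < length vs \<Longrightarrow> \<eta> j \<in> hom_cov H" and nz: "jac \<eta> \<noteq> 0"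
    and dv: "\<And>j a. j < length vs \<Longrightarrow> a \<in> hom_cov H \<Longrightarrow> jac \<eta> dvd jac (\<eta>(j := a))"
  shows "free_basis H (length vs) \<eta>"
  unfolding free_basis_def
proof (intro conjI allI impI ballI)
  have \<eta>c: "\<eta> j \<in> cov H" if "j < length vs" for j using hom_cov_in[OF \<eta>[OF that]] .
  then show "\<eta> j \<in> cov H" if "j < length vs" for j using that .
  have jR: "jac \<eta> \<in> polyR (length bs)"
    by (rule jac_polyR) (use \<eta>c in \<open>auto intro: tensor_spaceD covD\<close>)
  have indep: "c j = 0" if "\<And>i. i < length vs \<Longrightarrow> (\<Sum>l<length vs. c l * \<eta> l i) = 0" "j < length vs" for c j
    by (rule dt_independent[OF nz[unfolded jac_eq_dt] that])
  show "c j = 0"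
    if "(\<forall>j<length vs. c j \<in> inv_ring H) \<and> (\<lambda>i. \<Sum>j<length vs. c j * \<eta> j i) = (\<lambda>i. 0)" "j < length vs" for c j
    using indep[of c j] that by (metis (no_types, lifting))
  have hom: "\<exists>c. (\<forall>j<length vs. c j \<in> inv_ring H) \<and> a = (\<lambda>i. \<Sum>j<length vs. c j * \<eta> j i)"
    if a: "a \<in> hom_cov H" for a
  proof -
    have ac: "a \<in> cov H" using hom_cov_in[OF a] .
    have "\<exists>c\<in>polyR (length bs). jac (\<eta>(j := a)) = jac \<eta> * c" if j: "j < length vs" for j
    proof -
      have "jac \<eta> dvd jac (\<eta>(j := a))" by (rule dv[OF j a])
      moreover have "jac (\<eta>(j := a)) \<in> polyR (length bs)"
        by (rule jac_polyR) (use \<eta>c ac in \<open>auto intro: tensor_spaceD covD\<close>)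
      ultimately show ?thesis using dvd_polyR[OF _ jR] by blast
    qed
    then obtain c where c: "\<And>j. j < length vs \<Longrightarrow> c j \<in> polyR (length bs)"
      "\<And>j. j < length vs \<Longrightarrow> jac (\<eta>(j := a)) = jac \<eta> * c j" by metis
    have a_eq: "a = (\<lambda>i. \<Sum>j<length vs. c j * \<eta> j i)"
    proof
      fix i
      show "a i = (\<Sum>j<length vs. c j * \<eta> j i)"
      proof (cases "i < length vs")
        case True
        have "jac \<eta> * a i = (\<Sum>j<length vs. jac (\<eta>(j := a)) * \<eta> j i)"
          using dt_cramer[OF nz[unfolded jac_eq_dt] True, of a] by (simp add: jac_eq_dt)
        also have "\<dots> = jac \<eta> * (\<Sum>j<length vs. c j * \<eta> j i)"
          by (simp add: c(2) sum_distrib_left mult.assoc)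
        finally show ?thesis using nz by simp
      next
        case False
        then have "\<eta> j i = 0" if "j < length vs" for j
          using covD(1)[OF \<eta>c[OF that]] by (simp add: tensor_space_def)
        moreover have "a i = 0" using covD(1)[OF ac] False by (simp add: tensor_space_def)
        ultimately show ?thesis by simp
      qed
    qed
    have "c j \<in> inv_ring H" if j: "j < length vs" for j
    proof (rule inv_ringI[OF c(1)[OF j]])
      fix g assume g: "g \<in> H"
      have "a = tensor_act g a" using covD(2)[OF ac g] by simp
      also have "\<dots> = (\<lambda>i. \<Sum>j<length vs. act g (c j) * tensor_act g (\<eta> j) i)"
        by (subst a_eq) (rule tensor_act_sum)
      also have "\<dots> = (\<lambda>i. \<Sum>j<length vs. act g (c j) * \<eta> j i)"
        using covD(2)[OF \<eta>c g] by (intro ext sum.cong) auto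
      finally have "a = (\<lambda>i. \<Sum>j<length vs. act g (c j) * \<eta> j i)" .
      then have "(\<Sum>j<length vs. act g (c j) * \<eta> j i) = (\<Sum>j<length vs. c j * \<eta> j i)" for i
        using a_eq by (metis (no_types, lifting))
      then have "(\<Sum>l<length vs. (act g (c l) - c l) * \<eta> l i) = 0" for i
        by (simp add: left_diff_distrib sum_subtractf)
      from indep[OF this j] show "act g (c j) = c j" by simp
    qed
    with a_eq show ?thesis by blast
  qed
  fix a assume a: "a \<in> cov H"
  obtain N where N: "a = (\<lambda>i. \<Sum>d\<le>N. coeff (grade (a i)) d)" using cov_homogeneous_sum[OF a] .
  have "\<forall>d. \<exists>c. (\<forall>j<length vs. c j \<in> inv_ring H) \<and>
      (\<lambda>i. coeff (grade (a i)) d) = (\<lambda>i. \<Sum>j<length vs. c j * \<eta> j i)"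
    using hom cov_coeff_grade[OF a] unfolding hom_cov_def by blast
  from choice[OF this] obtain c where "\<forall>d. (\<forall>j<length vs. c d j \<in> inv_ring H) \<and>
      (\<lambda>i. coeff (grade (a i)) d) = (\<lambda>i. \<Sum>j<length vs. c d j * \<eta> j i)" ..
  then have c: "\<And>d j. j < length vs \<Longrightarrow> c d j \<in> inv_ring H"
    "\<And>d. (\<lambda>i. coeff (grade (a i)) d) = (\<lambda>i. \<Sum>j<length vs. c d j * \<eta> j i)" by blast+
  have "a = (\<lambda>i. \<Sum>j<length vs. (\<Sum>d\<le>N. c d j) * \<eta> j i)"
  proof
    fix i
    have "a i = (\<Sum>d\<le>N. coeff (grade (a i)) d)" using N by (rule fun_cong)
    also have "\<dots> = (\<Sum>d\<le>N. \<Sum>j<length vs. c d j * \<eta> j i)"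
      using fun_cong[OF c(2), of i] by simp
    also have "\<dots> = (\<Sum>j<length vs. (\<Sum>d\<le>N. c d j) * \<eta> j i)"
      by (subst sum.swap) (simp add: sum_distrib_right)
    finally show "a i = (\<Sum>j<length vs. (\<Sum>d\<le>N. c d j) * \<eta> j i)" .
  qed
  moreover have "\<forall>j<length vs. (\<Sum>d\<le>N. c d j) \<in> inv_ring H" using c(1) by (auto intro: inv_ring_sum)
  ultimately show "\<exists>c. (\<forall>j<length vs. c j \<in> inv_ring H) \<and> a = (\<lambda>i. \<Sum>j<length vs. c j * \<eta> j i)"
    by (intro exI[of _ "\<lambda>j. \<Sum>d\<le>N. c d j"] conjI)
qed

lemma free_basis_if_jac_dvd:
  assumes \<eta>: "\<And>j. j < length vs \<Longrightarrow> \<eta> j \<in> hom_cov H" and nz: "jac \<eta> \<noteq> 0"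
    and dv: "\<And>\<omega>. (\<And>j. j < length vs \<Longrightarrow> \<omega> j \<in> hom_cov H) \<Longrightarrow> jac \<eta> dvd jac \<omega>"
  shows "free_basis H (length vs) \<eta>"
  by (rule free_basis_if_cramer_dvd[OF \<eta> nz]) (auto intro!: dv \<eta>)

section \<open>Translations along a hyperplane\<close>

text \<open>The Taylor expansion \<open>f(X + z u)\<close> as a polynomial in \<open>z\<close>.\<close>

definition taylor :: "'v \<Rightarrow> 'k mpoly \<Rightarrow> 'k mpoly poly" where
  "taylor u = mev (\<lambda>c. [:pconst c:]) (\<lambda>i. [:pvar i, pconst (xV u i):])"

lemma taylor_hom: "comm_ring_hom (taylor u)"
  unfolding taylor_def by (rule pconst_poly.mev_hom)

lemma taylor_pconst [simp]: "taylor u (pconst c) = [:pconst c:]"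
  by (simp add: taylor_def pconst_poly.mev_pconst)

lemma taylor_pvar [simp]: "taylor u (pvar i) = [:pvar i, pconst (xV u i):]"
  by (simp add: taylor_def pconst_poly.mev_pvar)

lemma taylor_form_poly:
  assumes l: "Vector_Spaces.linear scV (*) l"
  shows "taylor u (form_poly l) = [:form_poly l, pconst (l u):]"
proof -
  interpret t: comm_ring_hom "taylor u" by (rule taylor_hom)
  have "taylor u (form_poly l) = (\<Sum>i<length bs. [:pconst (l (bs ! i)) * pvar i, pconst (xV u i * l (bs ! i)):])"
    unfolding form_poly_def by (simp add: t.hom_sum t.hom_mult pconst.hom_mult mult.commute)
  also have "\<dots> = [:\<Sum>i<length bs. pconst (l (bs ! i)) * pvar i, \<Sum>i<length bs. pconst (xV u i * l (bs ! i)):]"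
    by (rule poly_eqI) (auto simp: coeff_sum coeff_pCons split: nat.splits)
  also have "(\<Sum>i<length bs. pconst (xV u i * l (bs ! i))) = pconst (l u)"
    unfolding functional_expand[OF l, of u] by (simp add: pconst.hom_sum)
  finally show ?thesis by (simp add: form_poly_def)
qed

text \<open>The substitution \<open>X \<mapsto> X + z u\<close> commutes with \<open>g\<close> because \<open>g\<close> fixes \<open>u\<close>.\<close>

lemma taylor_act:
  assumes g: "g \<in> G" "g u = u" and f: "f \<in> polyR (length bs)"
  shows "taylor u (act g f) = map_poly (act g) (taylor u f)"
proof -
  interpret a: comm_ring_hom "act g" by (rule act_hom)
  interpret ma: map_poly_comm_ring_hom "act g" ..
  have ma: "comm_ring_hom (map_poly (act g))" by unfold_locales
  show ?thesis
  proof (rule hom_eqI[OF comm_ring_hom_comp[OF taylor_hom act_hom] comm_ring_hom_comp[OF ma taylor_hom] _ _ f])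
    fix i
    have inv: "inv_into UNIV g u = u" using bij_inv_eq_iff[OF G_bij[OF g(1)], of u u] g(2) by simp
    have lin: "Vector_Spaces.linear scV (*) (\<lambda>u. xV (inv_into UNIV g u) i)"
      by (rule functional_comp[OF xV_linear inv_linear[OF g(1)]])
    show "taylor u (act g (pvar i)) = map_poly (act g) (taylor u (pvar i))"
      unfolding act_pvar taylor_form_poly[OF lin] taylor_pvar inv
      by (simp only: a.map_poly_pCons_hom map_poly_0 act_pconst act_pvar)
  qed (simp only: act_pconst taylor_pconst a.map_poly_pCons_hom map_poly_0)
qed

lemma taylor_coeff_polyR: "f \<in> polyR (length bs) \<Longrightarrow> coeff (taylor u f) k \<in> polyR (length bs)"
proof -
  define PR where "PR = {P :: 'k mpoly poly. \<forall>k. coeff P k \<in> polyR (length bs)}"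
  have mult: "P * Q \<in> PR" if "P \<in> PR" "Q \<in> PR" for P Q
    using that unfolding PR_def by (auto simp: coeff_mult intro!: polyR_sum polyR_mult)
  have one: "1 \<in> PR" unfolding PR_def by (auto simp: coeff_1)
  have pow: "P ^ k \<in> PR" if "P \<in> PR" for P k
    by (induction k) (auto simp: one mult that)
  have prd: "prod f X \<in> PR" if "\<And>x. x \<in> X \<Longrightarrow> f x \<in> PR" for f and X :: "nat set"
    using that by (induction X rule: infinite_finite_induct) (auto simp: one mult)
  have sm: "sum f X \<in> PR" if "\<And>x. x \<in> X \<Longrightarrow> f x \<in> PR" for f and X :: "(nat \<Rightarrow>\<^sub>0 nat) set"
    using that by (auto simp: PR_def coeff_sum intro: polyR_sum)
  assume f: "f \<in> polyR (length bs)"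
  have "taylor u f \<in> PR"
    unfolding taylor_def mev_def
  proof (intro sm mult prd pow)
    fix a i assume "a \<in> Poly_Mapping.keys f" "i \<in> Poly_Mapping.keys a"
    then have "i < length bs" using f polyR_lessD by blast
    then show "[:pvar i, pconst (xV u i):] \<in> PR"
      by (auto simp: PR_def coeff_pCons polyR_pvar split: nat.splits)
  qed (auto simp: PR_def coeff_pCons split: nat.splits)
  then show ?thesis by (auto simp: PR_def)
qed

end

context covariants
begin

text \<open>The expansion \<open>f(X + z u)\<close> is homogeneous of degree \<open>d\<close> in \<open>X\<close> and \<open>z\<close> together.\<close>

lemma taylor_coeff_homogeneous:
  assumes f: "homogeneous d f"
  shows "homogeneous (d - k) (coeff (taylor u f) k)" "k > d \<Longrightarrow> coeff (taylor u f) k = 0"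
proof -
  define GR where "GR d = {P :: 'k mpoly poly. \<forall>k. homogeneous (d - k) (coeff P k) \<and> (k > d \<longrightarrow> coeff P k = 0)}" for d
  have mult: "P * Q \<in> GR (a + b)" if P: "P \<in> GR a" and Q: "Q \<in> GR b" for P Q a b
  proof -
    have "homogeneous (a + b - k) (coeff P i * coeff Q (k - i)) \<and> (k > a + b \<longrightarrow> coeff P i * coeff Q (k - i) = 0)"
      if i: "i \<le> k" for i k
    proof (cases "i \<le> a \<and> k - i \<le> b")
      case True
      then have "a + b - k = (a - i) + (b - (k - i))" "\<not> k > a + b" using i by auto
      moreover have "homogeneous (a - i) (coeff P i)" "homogeneous (b - (k - i)) (coeff Q (k - i))"
        using P Q by (auto simp: GR_def)
      ultimately show ?thesis using homogeneous_mult by metis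
    next
      case False
      then have "coeff P i = 0 \<or> coeff Q (k - i) = 0" using P Q by (auto simp: GR_def not_le)
      then show ?thesis by auto
    qed
    then have "homogeneous (a + b - k) (coeff (P * Q) k) \<and> (k > a + b \<longrightarrow> coeff (P * Q) k = 0)" for k
      unfolding coeff_mult by (auto intro!: homogeneous_sum sum.neutral)
    then show ?thesis unfolding GR_def by blast
  qed
  have one: "1 \<in> GR 0" unfolding GR_def by (auto simp: coeff_1)
  have pow: "P ^ k \<in> GR (k * a)" if "P \<in> GR a" for P k a
    by (induction k) (auto simp: one intro: mult[OF that])
  have prd: "prod h X \<in> GR (sum e X)" if "finite X" "\<And>x. x \<in> X \<Longrightarrow> h x \<in> GR (e x)" for h e and X :: "nat set"
    using that by (induction X) (auto simp: one intro: mult)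
  have sm: "sum h X \<in> GR a" if "\<And>x. x \<in> X \<Longrightarrow> h x \<in> GR a" for h a and X :: "(nat \<Rightarrow>\<^sub>0 nat) set"
    using that by (auto simp: GR_def coeff_sum intro: homogeneous_sum)
  have "taylor u f \<in> GR d"
    unfolding taylor_def mev_def
  proof (rule sm)
    fix a assume a: "a \<in> Poly_Mapping.keys f"
    have lin: "[:pvar i, pconst (xV u i):] \<in> GR 1" for i
      by (auto simp: GR_def coeff_pCons homogeneous_pvar simp del: One_nat_def split: nat.splits)
    have "(\<Prod>i\<in>Poly_Mapping.keys a. [:pvar i, pconst (xV u i):] ^ Poly_Mapping.lookup a i)
       \<in> GR (\<Sum>i\<in>Poly_Mapping.keys a. Poly_Mapping.lookup a i * 1)"
      by (intro prd pow lin) auto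
    moreover have "(\<Sum>i\<in>Poly_Mapping.keys a. Poly_Mapping.lookup a i * 1) = d"
      using f a by (simp add: homogeneous_def)
    moreover have "[:pconst (Poly_Mapping.lookup f a):] \<in> GR 0"
      by (auto simp: GR_def coeff_pCons split: nat.splits)
    ultimately show "[:pconst (Poly_Mapping.lookup f a):] *
        (\<Prod>i\<in>Poly_Mapping.keys a. [:pvar i, pconst (xV u i):] ^ Poly_Mapping.lookup a i) \<in> GR d"
      by (metis (no_types, lifting) mult add_0)
  qed
  then show "homogeneous (d - k) (coeff (taylor u f) k)" "k > d \<Longrightarrow> coeff (taylor u f) k = 0"
    by (auto simp: GR_def)
qed

lemma taylor_coeff_0: "coeff (taylor u f) 0 = f"
proof -
  interpret t: comm_ring_hom "taylor u" by (rule taylor_hom)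
  have "comm_ring_hom (\<lambda>f. poly (taylor u f) 0)"
    by unfold_locales (simp_all add: t.hom_add t.hom_mult)
  from hom_eqI_all[OF this comm_ring_hom_id] have "poly (taylor u f) 0 = f" by simp
  then show ?thesis by (simp add: poly_0_coeff_0)
qed

lemma cov_taylor_coeff:
  assumes H: "H \<subseteq> G" "\<And>g. g \<in> H \<Longrightarrow> g u = u" and a: "a \<in> cov_deg H d"
  shows "(\<lambda>i. coeff (taylor u (a i)) k) \<in> cov_deg H (d - k)"
proof (rule cov_degI)
  interpret t: comm_ring_hom "taylor u" by (rule taylor_hom)
  show "(\<lambda>i. coeff (taylor u (a i)) k) \<in> cov H"
  proof (rule cov_equivariant_map[OF _ _ _ _ cov_degD(1)[OF a]])
    fix g and p :: "'k mpoly" assume g: "g \<in> H" and p: "p \<in> polyR (length bs)"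
    interpret a: comm_ring_hom "act g" by (rule act_hom)
    show "coeff (taylor u (act g p)) k = act g (coeff (taylor u p) k)"
      using taylor_act[of g u p] H g p by auto
  qed (auto simp: t.hom_sum coeff_sum t.hom_mult intro: taylor_coeff_polyR)
  show "homogeneous (d - k) (coeff (taylor u (a i)) k)" for i
    using cov_degD(2)[OF a] by (rule taylor_coeff_homogeneous)
qed

text \<open>A homogeneous polynomial of positive degree that is invariant modulo \<open>l\<close> under all
  translations along \<open>l = 0\<close> restricts to a constant on that hyperplane, so it is divisible by \<open>l\<close>.
  The translations are applied one coordinate at a time, by \<open>- X\<^sub>j\<close> in direction \<open>j\<close>, until all
  coordinates on the hyperplane have been set to zero.\<close>

lemma translation_invariant_dvd:
  assumes l: "Vector_Spaces.linear scV (*) l" and v: "l v \<noteq> 0"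
    and h: "h \<in> polyR (length bs)" "homogeneous d h" "d > 0"
    and inv: "\<And>u k. l u = 0 \<Longrightarrow> k > 0 \<Longrightarrow> form_poly l dvd coeff (taylor u h) k"
  shows "form_poly l dvd h"
proof -
  obtain i where i: "i < length bs" "l (bs ! i) \<noteq> 0" using functional_nonzero_basis[OF l v] by blast
  have "\<exists>\<tau>. comm_ring_hom \<tau> \<and> (\<forall>c. \<tau> (pconst c) = pconst c) \<and> \<tau> (form_poly l) = form_poly l \<and>
      (\<forall>j\<in>J. \<tau> (pvar j) = 0) \<and> (\<forall>j\<in>{..<length bs} - {i} - J. \<tau> (pvar j) = pvar j) \<and>
      form_poly l dvd \<tau> h - h" if "finite J" "J \<subseteq> {..<length bs} - {i}" for J
    using that
  proof (induction J)
    case empty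
    show ?case by (rule exI[of _ "\<lambda>x. x"]) (auto simp: comm_ring_hom_id)
  next
    case (insert j J)
    then obtain \<tau> where \<tau>: "comm_ring_hom \<tau>" "\<And>c. \<tau> (pconst c) = pconst c" "\<tau> (form_poly l) = form_poly l"
      "\<And>j. j \<in> J \<Longrightarrow> \<tau> (pvar j) = 0" "\<And>j. j \<in> {..<length bs} - {i} - J \<Longrightarrow> \<tau> (pvar j) = pvar j"
      "form_poly l dvd \<tau> h - h" by auto
    have j: "j < length bs" "j \<noteq> i" using insert by auto
    \<comment> \<open>The direction of \<open>X\<^sub>j\<close>, corrected in the coordinate \<open>i\<close> so as to lie in the hyperplane.\<close>
    define u where "u = bs ! j - scV (l (bs ! j) / l (bs ! i)) (bs ! i)"
    have lu: "l u = 0" unfolding u_def using i by (simp add: functional_diff[OF l] functional_scale[OF l])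
    have xu: "xV u k = (if k = j then 1 else 0)" if "k < length bs" "k \<noteq> i" for k
    proof -
      have "xV u k = xV (bs ! j) k - l (bs ! j) / l (bs ! i) * xV (bs ! i) k"
        unfolding u_def by (simp add: functional_diff[OF xV_linear] functional_scale[OF xV_linear])
      then show ?thesis using that i j by (simp add: xV_nth)
    qed
    interpret t: comm_ring_hom "taylor u" by (rule taylor_hom)
    define \<sigma> where "\<sigma> f = poly (taylor u f) (- pvar j)" for f
    have \<sigma>: "comm_ring_hom \<sigma>" unfolding \<sigma>_def
      by unfold_locales (simp_all add: t.hom_add t.hom_mult)
    interpret \<sigma>: comm_ring_hom \<sigma> by (rule \<sigma>)
    have \<sigma>c: "\<sigma> (pconst c) = pconst c" for c by (simp add: \<sigma>_def)
    have \<sigma>l: "\<sigma> (form_poly l) = form_poly l" by (simp add: \<sigma>_def taylor_form_poly[OF l] lu)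
    have \<sigma>X: "\<sigma> (pvar k) = (if k = j then 0 else pvar k)" if "k < length bs" "k \<noteq> i" for k
      using xu[OF that] by (simp add: \<sigma>_def)
    have "form_poly l dvd \<sigma> h - h"
    proof -
      have "\<sigma> h = (\<Sum>k\<le>degree (taylor u h). coeff (taylor u h) k * (- pvar j) ^ k)"
        unfolding \<sigma>_def by (rule poly_altdef)
      also have "\<dots> = h + (\<Sum>k\<in>{..degree (taylor u h)} - {0}. coeff (taylor u h) k * (- pvar j) ^ k)"
        by (subst sum.remove[of _ 0]) (auto simp: taylor_coeff_0)
      finally have "\<sigma> h - h = (\<Sum>k\<in>{..degree (taylor u h)} - {0}. coeff (taylor u h) k * (- pvar j) ^ k)"
        by simp
      also have "form_poly l dvd \<dots>" using inv[OF lu] by (intro dvd_sum dvd_mult2) auto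
      finally show ?thesis .
    qed
    moreover have "form_poly l dvd \<sigma> (\<tau> h - h)"
      using \<sigma>.hom_dvd[OF \<tau>(6)] by (simp add: \<sigma>l)
    ultimately have "form_poly l dvd \<sigma> (\<tau> h - h) + (\<sigma> h - h)" by (intro dvd_add)
    then have "form_poly l dvd \<sigma> (\<tau> h) - h" by (simp add: \<sigma>.hom_minus)
    then show ?case
      using \<tau> \<sigma>c \<sigma>l \<sigma>X insert.prems insert.hyps
      by (intro exI[of _ "\<lambda>f. \<sigma> (\<tau> f)"]) (auto intro: comm_ring_hom_comp[OF \<sigma> \<tau>(1)])
  qed
  from this[of "{..<length bs} - {i}"] obtain \<tau> where \<tau>: "comm_ring_hom \<tau>" "\<And>c. \<tau> (pconst c) = pconst c"
    "\<tau> (form_poly l) = form_poly l" "\<And>j. j \<in> {..<length bs} - {i} \<Longrightarrow> \<tau> (pvar j) = 0" "form_poly l dvd \<tau> h - h"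
    by auto
  interpret \<tau>: comm_ring_hom \<tau> by (rule \<tau>)
  have "form_poly l = \<tau> (\<Sum>j<length bs. pconst (l (bs ! j)) * pvar j)"
    using \<tau>(3) by (simp add: form_poly_def)
  also have "\<dots> = (\<Sum>j<length bs. pconst (l (bs ! j)) * \<tau> (pvar j))"
    by (simp add: \<tau>.hom_sum \<tau>.hom_mult \<tau>(2))
  also have "\<dots> = (\<Sum>j<length bs. if j = i then pconst (l (bs ! i)) * \<tau> (pvar i) else 0)"
    by (rule sum.cong) (auto simp: \<tau>(4))
  finally have li: "form_poly l = pconst (l (bs ! i)) * \<tau> (pvar i)" using i(1) by simp
  have "form_poly l dvd \<tau> (pvar j) - psubst (\<lambda>_. 0) (pvar j)" if "j < length bs" for j
  proof (cases "j = i")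
    case True
    have "\<tau> (pvar i) = form_poly l * pconst (inverse (l (bs ! i)))"
      unfolding li using i(2) by (simp add: mult_ac flip: pconst.hom_mult)
    with True show ?thesis by simp
  qed (use that \<tau>(4) in simp)
  from hom_cong_dvd[OF \<tau>(1) psubst_hom _ this h(1)] \<tau>(2)
  have "form_poly l dvd \<tau> h - psubst (\<lambda>_. 0) h" by simp
  moreover have "psubst (\<lambda>_. 0) h = 0"
    unfolding psubst_def
  proof (rule sum.neutral, rule ballI)
    fix a assume a: "a \<in> Poly_Mapping.keys h"
    then have "Poly_Mapping.keys a \<noteq> {}" using h(2,3) by (auto simp: homogeneous_def)
    then obtain k where "k \<in> Poly_Mapping.keys a" by blast
    then have "(\<Prod>i\<in>Poly_Mapping.keys a. (0 :: 'k mpoly) ^ Poly_Mapping.lookup a i) = 0"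
      by (intro prod_zero bexI[of _ k]) (auto simp: in_keys_iff)
    then show "pconst (Poly_Mapping.lookup h a) *
        (\<Prod>i\<in>Poly_Mapping.keys a. (0 :: 'k mpoly) ^ Poly_Mapping.lookup a i) = 0" by simp
  qed
  ultimately have "form_poly l dvd \<tau> h" by simp
  from dvd_diff[OF this \<tau>(5)] have "form_poly l dvd \<tau> h - (\<tau> h - h)" .
  moreover have "\<tau> h - (\<tau> h - h) = h" by simp
  ultimately show ?thesis by (simp only:)
qed

section \<open>Covariants of pointwise stabilizers of hyperplanes\<close>

text \<open>The determinant of the Taylor expansions is multilinear in its columns; the summand \<open>\<kappa>\<close> takes from the
  column \<open>j\<close> the term of order \<open>\<kappa> j\<close>.\<close>

lemma jac_taylor:
  assumes \<omega>: "\<And>j i. j < length vs \<Longrightarrow> homogeneous (ds j) (\<omega> j i)"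
  shows "coeff (taylor u (jac \<omega>)) k = (\<Sum>\<kappa>\<in>{..<length vs} \<rightarrow>\<^sub>E {..\<Sum>j<length vs. ds j}.
      if (\<Sum>j<length vs. \<kappa> j) = k then jac (\<lambda>j i. coeff (taylor u (\<omega> j i)) (\<kappa> j)) else 0)"
proof -
  define N where "N = (\<Sum>j<length vs. ds j)"
  have "taylor u (jac \<omega>) = dt (length vs) (\<lambda>j i. taylor u (\<omega> j i))"
    unfolding jac_eq_dt by (rule dt_hom[OF taylor_hom])
  also have "\<dots> = dt (length vs) (\<lambda>j i. \<Sum>\<kappa>\<le>N. monom 1 \<kappa> * [:coeff (taylor u (\<omega> j i)) \<kappa>:])"
  proof (rule dt_cong)
    fix j i assume j: "j < length vs" "i < length vs"
    have "ds j \<le> N" unfolding N_def using j by (intro member_le_sum) auto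
    then have z: "coeff (taylor u (\<omega> j i)) n = 0" if "n > N" for n
      using taylor_coeff_homogeneous(2)[OF \<omega>[OF j(1)]] that by simp
    show "taylor u (\<omega> j i) = (\<Sum>\<kappa>\<le>N. monom 1 \<kappa> * [:coeff (taylor u (\<omega> j i)) \<kappa>:])"
      by (rule poly_eqI) (use z in \<open>auto simp: coeff_sum smult_monom not_le\<close>)
  qed
  also have "\<dots> = (\<Sum>\<kappa>\<in>{..<length vs} \<rightarrow>\<^sub>E {..N}. (\<Prod>j<length vs. monom 1 (\<kappa> j)) *
      dt (length vs) (\<lambda>j i. [:coeff (taylor u (\<omega> j i)) (\<kappa> j):]))"
    by (rule dt_sum_columns) simp
  also have "\<dots> = (\<Sum>\<kappa>\<in>{..<length vs} \<rightarrow>\<^sub>E {..N}.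
      monom (jac (\<lambda>j i. coeff (taylor u (\<omega> j i)) (\<kappa> j))) (\<Sum>j<length vs. \<kappa> j))"
  proof (rule sum.cong[OF refl])
    fix \<kappa> :: "nat \<Rightarrow> nat"
    have "(\<Prod>j\<in>X. monom (1 :: 'k mpoly) (\<kappa> j)) = monom 1 (\<Sum>j\<in>X. \<kappa> j)" if "finite X" for X
      using that by (induction X) (auto simp: mult_monom)
    then show "(\<Prod>j<length vs. monom 1 (\<kappa> j)) * dt (length vs) (\<lambda>j i. [:coeff (taylor u (\<omega> j i)) (\<kappa> j):]) =
        monom (jac (\<lambda>j i. coeff (taylor u (\<omega> j i)) (\<kappa> j))) (\<Sum>j<length vs. \<kappa> j)"
      by (simp add: dt_hom[OF const_poly_hom, symmetric] jac_eq_dt smult_monom)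
  qed
  finally show ?thesis
    unfolding N_def[symmetric] by (simp add: coeff_sum)
qed

lemma unit_covariants: "\<exists>\<eta>. (\<forall>j<length vs. \<eta> j \<in> hom_cov {id}) \<and> jac \<eta> = 1"
proof -
  define \<eta> :: "nat \<Rightarrow> nat \<Rightarrow> 'k mpoly" where "\<eta> j i = (if j < length vs \<and> i = j then 1 else 0)" for j i
  have "\<eta> j \<in> hom_cov {id}" if "j < length vs" for j
  proof -
    have "\<eta> j \<in> tensor_space" using that by (auto simp: \<eta>_def tensor_space_def coord_ring_polyR)
    then have "\<eta> j \<in> cov {id}" by (simp add: cov_def tensor_act_id)
    then have "\<eta> j \<in> cov_deg {id} 0" by (rule cov_degI) (simp add: \<eta>_def)
    then show ?thesis by (auto simp: hom_cov_def)
  qed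
  moreover have "jac \<eta> = 1"
  proof -
    have "jac \<eta> = dt (length vs) (\<lambda>j i. if i = j then 1 else 0)"
      unfolding jac_eq_dt by (rule dt_cong) (simp add: \<eta>_def)
    then show ?thesis by (simp add: dt_one)
  qed
  ultimately show ?thesis by blast
qed

text \<open>The constant covariants of the trivial group are transferred to \<open>G\<close>, with the prime ideal \<open>0\<close>: its
  inertia group is trivial.\<close>

lemma exists_jac_nonzero:
  "\<exists>\<omega>. (\<forall>j<length vs. \<omega> j \<in> hom_cov G) \<and> jac \<omega> \<noteq> 0"
proof -
  have pz: "prime_or_zero (length bs) (0 :: 'k mpoly)" by (simp add: prime_or_zero_def)
  obtain \<eta> where "\<And>j. j < length vs \<Longrightarrow> \<eta> j \<in> hom_cov {id}" "jac \<eta> = 1"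
    using unit_covariants by auto
  moreover have "\<exists>y d. y \<in> inv_ring {id} \<and> homogeneous d y \<and> \<not> 0 dvd y - act g y" if "g \<in> G" "g \<notin> {id}" for g
    using inertia_separation[OF pz that(1)] that(2) unfolding inertia_0 by blast
  ultimately show ?thesis
    using covariant_transfer[OF subgrp_id pz, of \<eta> 1] by auto
qed

lemma hom_cov_mono: "H \<subseteq> K \<Longrightarrow> hom_cov K \<subseteq> hom_cov H"
  using cov_mono[of H K] unfolding hom_cov_def cov_deg_def by blast

text \<open>A tuple minimizing first the order of vanishing along \<open>U\<close> and then the total degree has as Jacobian
  a power of the linear form, because Taylor coefficients in directions of \<open>U\<close> would otherwise yield a
  tuple of the same order and smaller degree.\<close>

theorem hyperplane_basis:
  assumes U: "hyperplane U" "hyperplane_form U l"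
  shows "\<exists>\<eta> e c. (\<forall>j<length vs. \<eta> j \<in> hom_cov (stab U)) \<and> c \<noteq> 0 \<and>
    jac \<eta> = pconst c * form_poly l ^ e \<and>
    (\<forall>\<omega>. (\<forall>j<length vs. \<omega> j \<in> hom_cov (stab U)) \<longrightarrow> form_poly l ^ e dvd jac \<omega>)"
proof -
  let ?l = "form_poly l" and ?H = "stab U"
  obtain v where l: "Vector_Spaces.linear scV (*) l" and v: "l v \<noteq> 0" and Ul: "\<And>u. u \<in> U \<longleftrightarrow> l u = 0"
    using hyperplane_formE[OF U] by blast
  have HG: "?H \<subseteq> G" by (auto simp: stab_def)
  \<comment> \<open>Some tuple of total degree \<open>d\<close> has a Jacobian whose order along \<open>U\<close> is at most \<open>e\<close>.\<close>
  define good where "good e d \<longleftrightarrow> (\<exists>\<omega> ds. (\<forall>j<length vs. \<omega> j \<in> cov_deg ?H (ds j)) \<and>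
      d = (\<Sum>j<length vs. ds j) \<and> \<not> ?l ^ Suc e dvd jac \<omega>)" for e d
  have prime: "prime_in (length bs) ?l" by (rule form_poly_prime[OF l v])
  have deg_l: "degree (grade ?l) = 1"
    using degree_grade_homogeneous[OF form_poly_homogeneous prime_inD(2)[OF prime]] .
  have goodI: "good e (\<Sum>j<length vs. cdeg (\<omega> j))"
    if "\<And>j. j < length vs \<Longrightarrow> \<omega> j \<in> hom_cov ?H" "\<not> ?l ^ Suc e dvd jac \<omega>" for e \<omega>
    unfolding good_def using that cdeg_cov_deg by (intro exI[of _ \<omega>] exI[of _ "\<lambda>j. cdeg (\<omega> j)"]) auto
  have "\<exists>e d. good e d"
  proof -
    obtain \<omega> where \<omega>: "\<And>j. j < length vs \<Longrightarrow> \<omega> j \<in> hom_cov G" "jac \<omega> \<noteq> 0"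
      using exists_jac_nonzero by blast
    have "\<not> ?l ^ Suc (degree (grade (jac \<omega>))) dvd jac \<omega>"
    proof
      assume "?l ^ Suc (degree (grade (jac \<omega>))) dvd jac \<omega>"
      then obtain q where q: "jac \<omega> = ?l ^ Suc (degree (grade (jac \<omega>))) * q" ..
      have "degree (grade (?l ^ k)) = k" for k
        using degree_power_eq[of "grade ?l" k] prime_inD(2)[OF prime] deg_l by (simp add: grade.hom_power)
      moreover have "q \<noteq> 0" using q \<omega>(2) by auto
      ultimately have "degree (grade (jac \<omega>)) = Suc (degree (grade (jac \<omega>))) + degree (grade q)"
        using degree_grade_mult[of "?l ^ Suc (degree (grade (jac \<omega>)))" q] q prime_inD(2)[OF prime]
        by (metis power_not_zero)
      then show False by simp
    qed
    moreover have "\<omega> j \<in> hom_cov ?H" if "j < length vs" for j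
      using \<omega>(1)[OF that] hom_cov_mono[OF HG] by blast
    ultimately show ?thesis using goodI by blast
  qed
  define e where "e = (LEAST e. \<exists>d. good e d)"
  have e: "\<exists>d. good e d" unfolding e_def using \<open>\<exists>e d. good e d\<close> by (rule LeastI_ex)
  have e_min: "?l ^ e dvd jac \<omega>" if "\<And>j. j < length vs \<Longrightarrow> \<omega> j \<in> hom_cov ?H" for \<omega>
  proof (cases e)
    case (Suc e')
    then have "\<nexists>d. good e' d" unfolding e_def using not_less_Least by (metis lessI)
    with goodI[where e = e' and \<omega> = \<omega>, OF that] Suc show ?thesis by blast
  qed simp
  define d where "d = (LEAST d. good e d)"
  have "good e d" unfolding d_def using e by (rule LeastI_ex)
  then obtain \<omega> ds where \<omega>: "\<And>j. j < length vs \<Longrightarrow> \<omega> j \<in> cov_deg ?H (ds j)"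
      and d: "d = (\<Sum>j<length vs. ds j)" and nd: "\<not> ?l ^ Suc e dvd jac \<omega>"
    unfolding good_def by blast
  have d_min: "\<not> good e d'" if "d' < d" for d' using that unfolding d_def by (rule not_less_Least)
  have \<omega>h: "\<omega> j \<in> hom_cov ?H" if "j < length vs" for j using \<omega>[OF that] by (auto simp: hom_cov_def)
  have jR: "jac \<omega> \<in> polyR (length bs)"
    by (rule jac_polyR) (use hom_cov_in[OF \<omega>h] in \<open>auto intro: tensor_spaceD covD\<close>)
  have jhom: "homogeneous d (jac \<omega>)" unfolding d by (rule jac_homogeneous) (rule cov_degD(2)[OF \<omega>])
  have j0: "jac \<omega> \<noteq> 0" using nd by auto
  obtain h where h: "h \<in> polyR (length bs)" "jac \<omega> = ?l ^ e * h"
    using dvd_polyR[OF e_min[OF \<omega>h] _ jR] polyR_power[OF form_poly_in] by blast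
  have hhom: "homogeneous (degree (grade h)) h"
    by (rule homogeneous_factor[of d h "?l ^ e"]) (use h jhom j0 in \<open>auto simp: mult.commute\<close>)
  have nh: "\<not> ?l dvd h" using nd h(2) prime_inD(2)[OF prime] by auto
  have "degree (grade h) = 0"
  proof (rule ccontr)
    \<comment> \<open>A translation in the direction \<open>u\<close> of \<open>U\<close> fixes the linear form, so the coefficient of order \<open>k\<close> of the Jacobian still vanishes only to order \<open>e\<close>, and the same holds for one of its summands.\<close>
    assume "degree (grade h) \<noteq> 0"
    then obtain u k where uk: "l u = 0" "k > 0" "\<not> ?l dvd coeff (taylor u h) k"
      using translation_invariant_dvd[OF l v h(1) hhom] nh by blast
    interpret t: comm_ring_hom "taylor u" by (rule taylor_hom)
    have "taylor u (jac \<omega>) = [:?l:] ^ e * taylor u h"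
      unfolding h(2) by (simp add: t.hom_mult t.hom_power taylor_form_poly[OF l] uk(1))
    then have "coeff (taylor u (jac \<omega>)) k = ?l ^ e * coeff (taylor u h) k"
      by (simp add: poly_const_pow)
    then have "\<not> ?l ^ Suc e dvd coeff (taylor u (jac \<omega>)) k"
      using uk(3) prime_inD(2)[OF prime] by simp
    then have *: "\<not> ?l ^ Suc e dvd (\<Sum>\<kappa>\<in>{..<length vs} \<rightarrow>\<^sub>E {..\<Sum>j<length vs. ds j}.
      if (\<Sum>j<length vs. \<kappa> j) = k then jac (\<lambda>j i. coeff (taylor u (\<omega> j i)) (\<kappa> j)) else 0)"
      using jac_taylor[of ds \<omega> u k] cov_degD(2)[OF \<omega>] by simp
    have "\<exists>\<kappa>. \<not> ?l ^ Suc e dvd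
        (if (\<Sum>j<length vs. \<kappa> j) = k then jac (\<lambda>j i. coeff (taylor u (\<omega> j i)) (\<kappa> j)) else 0)"
    proof (rule ccontr)
      assume "\<not> ?thesis"
      then have all: "?l ^ Suc e dvd
        (if (\<Sum>j<length vs. \<kappa> j) = k then jac (\<lambda>j i. coeff (taylor u (\<omega> j i)) (\<kappa> j)) else 0)" for \<kappa>
        unfolding not_ex not_not by (rule spec)
      show False by (rule notE[OF * dvd_sum]) (rule all)
    qed
    then obtain \<kappa> :: "nat \<Rightarrow> nat" where \<kappa>0: "\<not> ?l ^ Suc e dvd
        (if (\<Sum>j<length vs. \<kappa> j) = k then jac (\<lambda>j i. coeff (taylor u (\<omega> j i)) (\<kappa> j)) else 0)" ..
    have \<kappa>1: "(\<Sum>j<length vs. \<kappa> j) = k"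
    proof (rule ccontr)
      assume "(\<Sum>j<length vs. \<kappa> j) \<noteq> k"
      with \<kappa>0 show False by simp
    qed
    with \<kappa>0 have \<kappa>: "(\<Sum>j<length vs. \<kappa> j) = k"
        "\<not> ?l ^ Suc e dvd jac (\<lambda>j i. coeff (taylor u (\<omega> j i)) (\<kappa> j))" by simp_all
    have le: "\<kappa> j \<le> ds j" if "j < length vs" for j
    proof (rule ccontr)
      assume "\<not> \<kappa> j \<le> ds j"
      then have "coeff (taylor u (\<omega> j i)) (\<kappa> j) = 0" for i
        using taylor_coeff_homogeneous(2)[OF cov_degD(2)[OF \<omega>[OF that]]] by simp
      then have "jac (\<lambda>j i. coeff (taylor u (\<omega> j i)) (\<kappa> j)) = 0"
        unfolding jac_eq_dt by (intro dt_zero_column[OF that]) auto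
      with \<kappa>(2) show False by simp
    qed
    have "good e (\<Sum>j<length vs. ds j - \<kappa> j)"
      unfolding good_def
    proof (intro exI conjI allI impI)
      show "(\<lambda>i. coeff (taylor u (\<omega> j i)) (\<kappa> j)) \<in> cov_deg ?H (ds j - \<kappa> j)" if "j < length vs" for j
        by (rule cov_taylor_coeff[OF HG _ \<omega>[OF that]]) (use uk(1) Ul in \<open>auto simp: stab_def\<close>)
    qed (use \<kappa>(2) in auto)
    moreover have "(\<Sum>j<length vs. ds j - \<kappa> j) = d - k"
      unfolding d \<kappa>(1)[symmetric] by (rule sum_subtractf_nat) (use le in simp)
    moreover have "k \<le> d" unfolding d \<kappa>(1)[symmetric] using le by (intro sum_mono) auto
    ultimately show False using d_min[of "d - k"] uk(2) by simp
  qed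
  then obtain c where "h = pconst c" using degree_grade_0_const by blast
  moreover from this have "c \<noteq> 0" using nh by auto
  ultimately show ?thesis
    by (intro exI[of _ \<omega>] exI[of _ e] exI[of _ c]) (use \<omega>h h(2) e_min in \<open>auto simp: mult.commute\<close>)
qed

end

section \<open>Dimensions\<close>

context vector_space
begin

lemma finite_dim_basis:
  assumes "subspace A" "A \<subseteq> span S" "finite S"
  obtains b where "b \<subseteq> A" "independent b" "span b = A" "finite b" "card b = dim A"
proof -
  obtain b where b: "b \<subseteq> A" "independent b" "A \<subseteq> span b" "card b = dim A"
    using basis_exists by blast
  have "finite b" using independent_span_bound[OF assms(3) b(2)] b(1) assms(2) by blast
  then show ?thesis using that[OF b(1,2) span_subspace[OF b(1,3) assms(1)]] b(4) by blast
qed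

lemma dim_0: "dim {0} = 0"
  using dim_unique[of "{}" "{0}" 0] by (simp add: independent_empty)

lemma dim_mono_finite:
  assumes "subspace A" "subspace B" "A \<subseteq> B" "B \<subseteq> span S" "finite S"
  shows "dim A \<le> dim B"
proof -
  obtain b where b: "b \<subseteq> B" "independent b" "span b = B" "finite b" "card b = dim B"
    using finite_dim_basis[OF assms(2,4,5)] by blast
  obtain a where a: "a \<subseteq> A" "independent a" "span a = A" "finite a" "card a = dim A"
    using finite_dim_basis[OF assms(1) subset_trans[OF assms(3,4)] assms(5)] by blast
  have "card a \<le> card b" using independent_span_bound[OF b(4) a(2)] a(1) assms(3) b(3) by blast
  with a b show ?thesis by simp
qed

lemma card_independent_le_dim:
  assumes "subspace B" "B \<subseteq> span S" "finite S" "independent a" "a \<subseteq> B"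
  shows "card a \<le> dim B"
proof -
  obtain b where b: "b \<subseteq> B" "independent b" "span b = B" "finite b" "card b = dim B"
    using finite_dim_basis[OF assms(1-3)] by blast
  then show ?thesis using independent_span_bound[OF b(4) assms(4)] assms(5) by simp
qed

lemma independent_Un_span:
  assumes "independent a" "span a \<inter> W \<subseteq> {0}" "subspace W" "finite b" "independent b" "b \<subseteq> W"
  shows "independent (a \<union> b) \<and> a \<inter> b = {}"
proof
  show "independent (a \<union> b)" using assms(4,5,6)
  proof (induction b)
    case (insert x b)
    then have ib: "independent b" "x \<notin> span b" by (auto simp: independent_insert)
    have "x \<notin> span (a \<union> b)"
    proof
      assume "x \<in> span (a \<union> b)"
      then obtain y z where yz: "x = y + z" "y \<in> span a" "z \<in> span b" unfolding span_Un by blast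
      have "z \<in> W" using yz(3) span_minimal[OF _ assms(3)] insert.prems(2) by blast
      then have "y \<in> W" using yz(1) insert.prems(2) subspace_diff[OF assms(3), of x z] by simp
      then have "y = 0" using yz(2) assms(2) by blast
      then show False using yz ib by simp
    qed
    then show ?case using insert ib independent_insertI by simp
  qed (use assms in simp)
  show "a \<inter> b = {}"
  proof (rule ccontr)
    assume "a \<inter> b \<noteq> {}"
    then obtain x where x: "x \<in> a" "x \<in> b" by blast
    then have "x = 0" using assms(2,6) span_base by blast
    with x(1) assms(1) dependent_zero show False by blast
  qed
qed

lemma dim_direct_sum:
  assumes A: "subspace A" "A \<subseteq> span S" "finite S" and B: "subspace B" "B \<subseteq> span T" "finite T"
    and AB: "A \<inter> B \<subseteq> {0}"
  shows "dim {x + y | x y. x \<in> A \<and> y \<in> B} = dim A + dim B"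
proof -
  obtain a where a: "a \<subseteq> A" "independent a" "span a = A" "finite a" "card a = dim A"
    using finite_dim_basis[OF A] by blast
  obtain b where b: "b \<subseteq> B" "independent b" "span b = B" "finite b" "card b = dim B"
    using finite_dim_basis[OF B] by blast
  have ind: "independent (a \<union> b)" "a \<inter> b = {}"
    using independent_Un_span[of a B b] a b AB B(1) by auto
  have "{x + y | x y. x \<in> A \<and> y \<in> B} = span (a \<union> b)" unfolding span_Un a(3) b(3) ..
  then have "dim {x + y | x y. x \<in> A \<and> y \<in> B} = card (a \<union> b)"
    by (simp add: dim_eq_card_independent[OF ind(1)])
  also have "\<dots> = dim A + dim B" using card_Un_disjoint[OF a(4) b(4) ind(2)] a(5) b(5) by simp
  finally show ?thesis .
qed

text \<open>A largest independent subset of \<open>B\<close> whose span meets \<open>W\<close> only in \<open>0\<close>.\<close>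

lemma complement_basis:
  assumes B: "subspace B" "B \<subseteq> span S" "finite S" and W: "subspace W"
  obtains b where "b \<subseteq> B" "finite b" "independent b" "span b \<inter> W \<subseteq> {0}"
    "\<And>x. x \<in> B \<Longrightarrow> \<exists>y\<in>span b. x - y \<in> W"
proof -
  define P where "P b \<longleftrightarrow> b \<subseteq> B \<and> finite b \<and> independent b \<and> span b \<inter> W \<subseteq> {0}" for b
  have "P {}" by (simp add: P_def independent_empty)
  moreover have "\<forall>b. P b \<longrightarrow> card b < Suc (card S)"
    using independent_span_bound[OF B(3)] B(2) by (auto simp: P_def less_Suc_eq_le)
  ultimately obtain b where b: "P b" and max: "\<And>b'. P b' \<Longrightarrow> card b' \<le> card b"
    using ex_has_greatest_nat[of P "{}" card "Suc (card S)"] by blast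
  have "\<exists>y\<in>span b. x - y \<in> W" if x: "x \<in> B" for x
  proof (rule ccontr)
    assume no: "\<not> (\<exists>y\<in>span b. x - y \<in> W)"
    have xs: "x \<notin> span b" using no subspace_0[OF W] by force
    have "P (insert x b)" unfolding P_def
    proof (intro conjI)
      show "independent (insert x b)" using b independent_insertI[OF xs] by (simp add: P_def)
      show "span (insert x b) \<inter> W \<subseteq> {0}"
      proof
        fix w assume w: "w \<in> span (insert x b) \<inter> W"
        then obtain k where k: "w - k *s x \<in> span b" by (auto simp: span_breakdown_eq)
        show "w \<in> {0}"
        proof (cases "k = 0")
          case True
          then show ?thesis using k w b by (auto simp: P_def)
        next
          case False
          have "- inverse k *s (w - k *s x) \<in> span b" using k by (rule span_scale)
          moreover have "x - - inverse k *s (w - k *s x) = inverse k *s w"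
            using False by (simp add: scale_right_diff_distrib)
          moreover have "inverse k *s w \<in> W" using w W by (auto intro: subspace_scale)
          ultimately show ?thesis using no by metis
        qed
      qed
    qed (use b x in \<open>auto simp: P_def\<close>)
    moreover have "x \<notin> b" using xs span_base by blast
    ultimately show False using max[of "insert x b"] b by (auto simp: P_def)
  qed
  with b show ?thesis using that by (auto simp: P_def)
qed

text \<open>The dimension of a subspace \<open>N\<close> of the span of a finite family \<open>E\<close> counts the possible
  leading indices; an index at which \<open>E\<close> itself does not leave the span of the previous vectors
  does not contribute.\<close>

lemma dim_leading_indices:
  fixes E :: "'i::linorder \<Rightarrow> 'b"
  assumes N: "subspace N" and I: "finite I"
  shows "dim (N \<inter> span (E ` I)) + card {x\<in>I. E x \<in> span (E ` {y\<in>I. y < x})} =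
    card {x\<in>I. \<exists>v\<in>N. v - E x \<in> span (E ` {y\<in>I. y < x})}"
  using I
proof (induction I rule: finite_linorder_max_induct)
  case empty
  have "N \<inter> {0} = {0}" using subspace_0[OF N] by auto
  then show ?case by (simp add: dim_0)
next
  case (insert x I)
  let ?V = "span (E ` I)"
  have lt: "{y \<in> insert x I. y < z} = {y \<in> I. y < z}" if "z \<in> I" for z
    using insert.hyps(2) that by force
  have ltx: "{y \<in> insert x I. y < x} = I" using insert.hyps(2) by auto
  have xI: "x \<notin> I" using insert.hyps(2) by auto
  have c0: "card {z \<in> insert x I. E z \<in> span (E ` {y \<in> insert x I. y < z})} =
      card {z\<in>I. E z \<in> span (E ` {y\<in>I. y < z})} + (if E x \<in> ?V then 1 else 0)"
  proof -
    have "{z \<in> insert x I. E z \<in> span (E ` {y \<in> insert x I. y < z})} =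
       {z\<in>I. E z \<in> span (E ` {y\<in>I. y < z})} \<union> (if E x \<in> ?V then {x} else {})"
      using lt ltx by auto
    then show ?thesis using xI insert.hyps(1) by simp
  qed
  have c1: "card {z \<in> insert x I. \<exists>v\<in>N. v - E z \<in> span (E ` {y \<in> insert x I. y < z})} =
      card {z\<in>I. \<exists>v\<in>N. v - E z \<in> span (E ` {y\<in>I. y < z})} + (if \<exists>v\<in>N. v - E x \<in> ?V then 1 else 0)"
  proof -
    have "{z \<in> insert x I. \<exists>v\<in>N. v - E z \<in> span (E ` {y \<in> insert x I. y < z})} =
       {z\<in>I. \<exists>v\<in>N. v - E z \<in> span (E ` {y\<in>I. y < z})} \<union> (if \<exists>v\<in>N. v - E x \<in> ?V then {x} else {})"
      using lt ltx by auto
    then show ?thesis using xI insert.hyps(1) by simp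
  qed
  have finE: "finite (E ` I)" using insert.hyps(1) by simp
  have sNV: "subspace (N \<inter> ?V)" using N by (intro subspace_inter) auto
  show ?case
  proof (cases "E x \<in> ?V")
    case True
    then have "span (E ` insert x I) = ?V" by (simp add: span_redundant)
    moreover have "\<exists>v\<in>N. v - E x \<in> ?V"
      using True subspace_0[OF N] by (intro bexI[of _ 0]) (auto intro: span_neg)
    ultimately show ?thesis using True insert.IH c0 c1 by simp
  next
    case False
    show ?thesis
    proof (cases "\<exists>v\<in>N. v - E x \<in> ?V")
      case True
      then obtain v where v: "v \<in> N" "v - E x \<in> ?V" by blast
      have vV: "v \<notin> ?V" using False v(2) span_diff[of v "E ` I" "v - E x"] by auto
      have eq: "N \<inter> span (E ` insert x I) = {a + b | a b. a \<in> N \<inter> ?V \<and> b \<in> span {v}}"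
      proof (rule equalityI; rule subsetI)
        fix w assume w: "w \<in> N \<inter> span (E ` insert x I)"
        then obtain k where k: "w - k *s E x \<in> ?V" by (auto simp: span_breakdown_eq)
        have "(w - k *s E x) - k *s (v - E x) \<in> ?V"
          by (intro span_diff span_scale k v)
        then have "w - k *s v \<in> ?V" by (simp add: scale_right_diff_distrib)
        moreover have "w - k *s v \<in> N" using w v N by (auto intro: subspace_diff subspace_scale)
        ultimately show "w \<in> {a + b | a b. a \<in> N \<inter> ?V \<and> b \<in> span {v}}"
          by (intro CollectI exI[of _ "w - k *s v"] exI[of _ "k *s v"]) (auto intro: span_scale span_base)
      next
        fix w assume "w \<in> {a + b | a b. a \<in> N \<inter> ?V \<and> b \<in> span {v}}"
        then obtain a k where a: "w = a + k *s v" "a \<in> N" "a \<in> ?V" by (auto simp: span_singleton)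
        have "a - - k *s (v - E x) \<in> ?V" by (intro span_diff span_scale a v)
        then have "w - k *s E x \<in> ?V" by (simp add: a(1) scale_right_diff_distrib algebra_simps)
        then have "w \<in> span (E ` insert x I)" by (auto simp: span_breakdown_eq)
        moreover have "w \<in> N" using a v N by (auto intro: subspace_add subspace_scale)
        ultimately show "w \<in> N \<inter> span (E ` insert x I)" by simp
      qed
      have "N \<inter> ?V \<inter> span {v} \<subseteq> {0}"
      proof
        fix w assume "w \<in> N \<inter> ?V \<inter> span {v}"
        then obtain k where k: "w = k *s v" "w \<in> ?V" by (auto simp: span_singleton)
        have "k = 0"
        proof (rule ccontr)
          assume "k \<noteq> 0"
          then have "v = inverse k *s w" using k by simp
          then show False using k(2) vV span_scale by metis
        qed
        with k show "w \<in> {0}" by simp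
      qed
      then have "dim (N \<inter> span (E ` insert x I)) = dim (N \<inter> ?V) + dim (span {v})"
        unfolding eq using finE sNV by (intro dim_direct_sum[of _ "E ` I" _ "{v}"]) auto
      also have "v \<noteq> 0" using vV span_zero by metis
      then have "dim (span {v}) = 1" by (simp add: dim_eq_card_independent independent_insert)
      finally show ?thesis using True False insert.IH c0 c1 by simp
    next
      case no: False
      have "N \<inter> span (E ` insert x I) = N \<inter> ?V"
      proof (rule equalityI; rule subsetI)
        fix w assume w: "w \<in> N \<inter> span (E ` insert x I)"
        then obtain k where k: "w - k *s E x \<in> ?V" by (auto simp: span_breakdown_eq)
        have "k = 0"
        proof (rule ccontr)
          assume k0: "k \<noteq> 0"
          have "inverse k *s (w - k *s E x) \<in> ?V" using k by (rule span_scale)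
          then have "inverse k *s w - E x \<in> ?V" using k0 by (simp add: scale_right_diff_distrib)
          moreover have "inverse k *s w \<in> N" using w N by (auto intro: subspace_scale)
          ultimately show False using no by blast
        qed
        with k w show "w \<in> N \<inter> ?V" by simp
      next
        fix w assume "w \<in> N \<inter> ?V"
        then show "w \<in> N \<inter> span (E ` insert x I)" using span_mono[of "E ` I" "E ` insert x I"] by auto
      qed
      then show ?thesis using no False insert.IH c0 c1 by simp
    qed
  qed
qed

end

lemma dim_image_inj:
  assumes "Vector_Spaces.linear s1 s2 f" and A: "module.subspace s1 A" "A \<subseteq> module.span s1 S" "finite S"
    and inj: "\<And>x. x \<in> A \<Longrightarrow> f x = 0 \<Longrightarrow> x = 0"
  shows "vector_space.dim s2 (f ` A) = vector_space.dim s1 A"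
    "module.subspace s2 (f ` A)" "f ` A \<subseteq> module.span s2 (f ` S)"
proof -
  interpret f: Vector_Spaces.linear s1 s2 f by fact
  obtain b where b: "b \<subseteq> A" "f.vs1.independent b" "f.vs1.span b = A" "finite b" "card b = f.vs1.dim A"
    using f.vs1.finite_dim_basis[OF A] by blast
  have injA: "inj_on f A"
  proof (rule inj_onI)
    fix x y assume xy: "x \<in> A" "y \<in> A" "f x = f y"
    then have "f (x - y) = 0" by (simp add: f.diff)
    then have "x - y = 0" using inj f.vs1.subspace_diff[OF A(1)] xy by blast
    then show "x = y" by simp
  qed
  have "f.vs2.independent (f ` b)" using f.independent_injective_image[OF b(2)] injA b(3) by simp
  moreover have "f.vs2.span (f ` b) = f ` A" using f.span_image[of b] b(3) by simp
  ultimately have "f.vs2.dim (f ` A) = card (f ` b)"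
    using f.vs2.dim_eq_card_independent[of "f ` b"] f.vs2.dim_span[of "f ` b"] by simp
  also have "\<dots> = card b" using card_image inj_on_subset[OF injA b(1)] by blast
  finally show "f.vs2.dim (f ` A) = f.vs1.dim A" using b(5) by simp
  show "f.vs2.subspace (f ` A)" using f.subspace_image A(1) by blast
  show "f ` A \<subseteq> f.vs2.span (f ` S)" using A(2) f.span_image[of S] by auto
qed

section \<open>Hilbert functions\<close>

lemma vector_space_pscale: "vector_space pscale"
  by unfold_locales (simp_all add: pscale_def algebra_simps pconst.hom_add pconst.hom_mult)

interpretation P: vector_space pscale
  by (rule vector_space_pscale)

definition monomials :: "nat \<Rightarrow> nat \<Rightarrow> (nat \<Rightarrow>\<^sub>0 nat) set" where
  "monomials n d = {a. Poly_Mapping.keys a \<subseteq> {..<n} \<and> mdeg a = d}"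

lemma monomials_finite: "finite (monomials n d)" and card_monomials: "card (monomials n d) \<le> (d + 1) ^ n"
proof -
  let ?r = "\<lambda>a. restrict (Poly_Mapping.lookup a) {..<n}"
  have inj: "inj_on ?r (monomials n d)"
  proof (rule inj_onI, rule poly_mapping_eqI)
    fix a b i assume ab: "a \<in> monomials n d" "b \<in> monomials n d" "?r a = ?r b"
    show "Poly_Mapping.lookup a i = Poly_Mapping.lookup b i"
    proof (cases "i < n")
      case True
      then show ?thesis using fun_cong[OF ab(3), of i] by simp
    next
      case False
      then have "i \<notin> Poly_Mapping.keys a" "i \<notin> Poly_Mapping.keys b"
        using ab by (auto simp: monomials_def)
      then show ?thesis by (simp add: in_keys_iff)
    qed
  qed
  have im: "?r ` monomials n d \<subseteq> {..<n} \<rightarrow>\<^sub>E {..d}"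
  proof -
    have "Poly_Mapping.lookup a i \<le> d" if "a \<in> monomials n d" for a i
    proof (cases "i \<in> Poly_Mapping.keys a")
      case True
      then have "Poly_Mapping.lookup a i \<le> mdeg a" unfolding mdeg_def by (intro member_le_sum) auto
      with that show ?thesis by (simp add: monomials_def)
    qed (simp add: in_keys_iff)
    then show ?thesis by (auto split: if_splits)
  qed
  have fin: "finite ({..<n} \<rightarrow>\<^sub>E {..d})" by (intro finite_PiE) auto
  show "finite (monomials n d)"
    using finite_imageD[OF finite_subset[OF im fin] inj] .
  have "card (monomials n d) \<le> card ({..<n} \<rightarrow>\<^sub>E {..d})"
    by (rule card_inj_on_le[OF inj im fin])
  also have "\<dots> = (d + 1) ^ n" by (simp add: card_PiE)
  finally show "card (monomials n d) \<le> (d + 1) ^ n" .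
qed

definition monomial_basis :: "nat \<Rightarrow> nat \<Rightarrow> 'k::field mpoly set" where
  "monomial_basis n d = (\<lambda>a. Poly_Mapping.single a 1) ` monomials n d"

lemma monomial_basis_finite: "finite (monomial_basis n d)"
  unfolding monomial_basis_def using monomials_finite by blast

lemma card_monomial_basis: "card (monomial_basis n d) \<le> (d + 1) ^ n"
  unfolding monomial_basis_def using card_image_le[OF monomials_finite] card_monomials order_trans by blast

lemma homogeneous_span:
  assumes "p \<in> polyR n" "homogeneous d p"
  shows "p \<in> P.span (monomial_basis n d)"
proof -
  have "p = (\<Sum>a\<in>Poly_Mapping.keys p. pscale (Poly_Mapping.lookup p a) (Poly_Mapping.single a 1))"
    by (subst mpoly_sum_monomials[of p]) (simp add: pscale_def pconst_def mult_single)
  also have "\<dots> \<in> P.span (monomial_basis n d)"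
  proof (intro P.span_sum P.span_scale P.span_base)
    fix a assume "a \<in> Poly_Mapping.keys p"
    then have "a \<in> monomials n d"
      using assms by (auto simp: monomials_def homogeneous_iff_mdeg dest: polyR_lessD)
    then show "Poly_Mapping.single a 1 \<in> monomial_basis n d" by (simp add: monomial_basis_def)
  qed
  finally show ?thesis .
qed

lemma coeff_grade_mult_homogeneous:
  assumes "homogeneous e q"
  shows "coeff (grade (p * q)) d = (if e \<le> d then coeff (grade p) (d - e) * q else 0)"
proof -
  have "grade (p * q) = monom q e * grade p"
    using assms by (simp add: grade.hom_mult homogeneous_iff_grade mult.commute)
  then show ?thesis unfolding coeff_monom_mult by (simp add: coeff_monom_mult mult.commute[of q])
qed

context covariants
begin

lemma vector_space_tensor_scale: "vector_space tensor_scale"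
  by unfold_locales (simp_all add: tensor_scale_def fun_eq_iff algebra_simps pconst.hom_add pconst.hom_mult)

sublocale T: vector_space tensor_scale
  by (rule vector_space_tensor_scale)

lemma tensor_scale_apply: "tensor_scale c a i = pconst c * a i"
  by (simp add: tensor_scale_def)

lemma inv_ring_degD:
  "p \<in> inv_ring_deg H d \<Longrightarrow> p \<in> inv_ring H" "p \<in> inv_ring_deg H d \<Longrightarrow> homogeneous d p"
  by (auto simp: inv_ring_deg_def)

lemma inv_ring_deg_subspace: "P.subspace (inv_ring_deg H d)"
  unfolding P.subspace_def inv_ring_deg_def pscale_def
  by (auto intro: inv_ring_closed homogeneous_add homogeneous_pconst_mult)

lemma inv_ring_deg_span: "inv_ring_deg H d \<subseteq> P.span (monomial_basis (length bs) d)"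
  by (auto simp: inv_ring_deg_def intro!: homogeneous_span dest: inv_ringD(1))

lemma cov_scale: "a \<in> cov H \<Longrightarrow> tensor_scale c a \<in> cov H"
  using cov_sum[of "{()}" "\<lambda>_. pconst c" H "\<lambda>_. a"] by (simp add: inv_ring_closed tensor_scale_def)

lemma cov_add: "a \<in> cov H \<Longrightarrow> b \<in> cov H \<Longrightarrow> a + b \<in> cov H"
  using cov_sum[of UNIV "\<lambda>_. 1" H "\<lambda>x. if x then a else b"]
  by (simp add: inv_ring_closed UNIV_bool add.commute fun_eq_iff plus_fun_def)

lemma cov_0: "(0 :: nat \<Rightarrow> 'k mpoly) \<in> cov H"
  using cov_sum[of "{}"] by (simp add: zero_fun_def)

lemma cov_deg_subspace: "T.subspace (cov_deg H d)"
  unfolding T.subspace_def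
proof (intro conjI ballI allI)
  show "0 \<in> cov_deg H d" by (rule cov_degI[OF cov_0]) simp
  fix a b assume "a \<in> cov_deg H d" "b \<in> cov_deg H d"
  then show "a + b \<in> cov_deg H d"
    by (intro cov_degI cov_add) (auto dest: cov_degD intro: homogeneous_add)
next
  fix c a assume "a \<in> cov_deg H d"
  then show "tensor_scale c a \<in> cov_deg H d"
    by (intro cov_degI cov_scale) (auto dest: cov_degD intro: homogeneous_pconst_mult simp: tensor_scale_apply)
qed

definition unit_tensor :: "nat \<Rightarrow> 'k mpoly \<Rightarrow> nat \<Rightarrow> 'k mpoly" where
  "unit_tensor l p = (\<lambda>i. if i = l then p else 0)"

lemma unit_tensor_linear: "Vector_Spaces.linear pscale tensor_scale (unit_tensor l)"
  unfolding Vector_Spaces.linear_iff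
  by (auto simp: vector_space_pscale vector_space_tensor_scale unit_tensor_def fun_eq_iff pscale_def
      tensor_scale_def)

lemma tensor_unit_sum:
  assumes "a \<in> tensor_space"
  shows "a = (\<Sum>l<length vs. unit_tensor l (a l))"
proof
  fix i
  have "(\<Sum>l<length vs. unit_tensor l (a l)) i = (\<Sum>l<length vs. unit_tensor l (a l) i)"
    by (induction rule: infinite_finite_induct[of _ "{..<length vs}"]) auto
  also have "\<dots> = (\<Sum>l<length vs. if l = i then a i else 0)"
    by (rule sum.cong) (auto simp: unit_tensor_def)
  also have "\<dots> = a i" using assms by (auto simp: tensor_space_def)
  finally show "a i = (\<Sum>l<length vs. unit_tensor l (a l)) i" ..
qed

definition tensor_basis :: "nat \<Rightarrow> (nat \<Rightarrow> 'k mpoly) set" where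
  "tensor_basis d = (\<Union>l<length vs. unit_tensor l ` monomial_basis (length bs) d)"

lemma tensor_basis_finite: "finite (tensor_basis d)"
  unfolding tensor_basis_def using monomial_basis_finite by auto

lemma cov_deg_span: "cov_deg H d \<subseteq> T.span (tensor_basis d)"
proof
  fix a assume a: "a \<in> cov_deg H d"
  then have ts: "a \<in> tensor_space" using cov_degD(1) covD(1) by blast
  have "unit_tensor l (a l) \<in> T.span (tensor_basis d)" if "l < length vs" for l
  proof -
    interpret u: Vector_Spaces.linear pscale tensor_scale "unit_tensor l" by (rule unit_tensor_linear)
    have "a l \<in> P.span (monomial_basis (length bs) d)"
      using homogeneous_span tensor_spaceD[OF ts] cov_degD(2)[OF a] by blast
    then have "unit_tensor l (a l) \<in> T.span (unit_tensor l ` monomial_basis (length bs) d)"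
      using u.span_image by blast
    then show ?thesis using T.span_mono[of "unit_tensor l ` monomial_basis (length bs) d" "tensor_basis d"] that
      by (auto simp: tensor_basis_def)
  qed
  then have "(\<Sum>l<length vs. unit_tensor l (a l)) \<in> T.span (tensor_basis d)"
    by (intro T.span_sum) auto
  then show "a \<in> T.span (tensor_basis d)" using tensor_unit_sum[OF ts] by simp
qed

section \<open>Free graded modules\<close>

definition independent_over :: "('v \<Rightarrow> 'v) set \<Rightarrow> nat \<Rightarrow> (nat \<Rightarrow> nat \<Rightarrow> 'k mpoly) \<Rightarrow> bool" where
  "independent_over H r \<omega> \<longleftrightarrow>
     (\<forall>c. (\<forall>j<r. c j \<in> inv_ring H) \<and> (\<lambda>i. \<Sum>j<r. c j * \<omega> j i) = (\<lambda>i. 0) \<longrightarrow> (\<forall>j<r. c j = 0))"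

text \<open>Coefficients of an element of degree \<open>e\<close> in degree \<open>d\<close>; the case \<open>d < e\<close> keeps the truncated
  difference from producing constants.\<close>

definition coeff_deg :: "('v \<Rightarrow> 'v) set \<Rightarrow> nat \<Rightarrow> nat \<Rightarrow> 'k mpoly set" where
  "coeff_deg H d e = (if e \<le> d then inv_ring_deg H (d - e) else {0})"

text \<open>The degree \<open>d\<close> part of the module spanned by the \<open>\<omega> j\<close> when \<open>\<omega> j\<close> is given the degree \<open>ds j\<close>.\<close>

definition span_deg :: "('v \<Rightarrow> 'v) set \<Rightarrow> nat \<Rightarrow> (nat \<Rightarrow> nat \<Rightarrow> 'k mpoly) \<Rightarrow> (nat \<Rightarrow> nat) \<Rightarrow> nat \<Rightarrow>
    (nat \<Rightarrow> 'k mpoly) set" where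
  "span_deg H r \<omega> ds d = {(\<lambda>i. \<Sum>j<r. c j * \<omega> j i) | c. \<forall>j<r. c j \<in> coeff_deg H d (ds j)}"

lemma coeff_deg_subspace: "P.subspace (coeff_deg H d e)"
  using inv_ring_deg_subspace by (simp add: coeff_deg_def)

lemma coeff_deg_inv_ring: "c \<in> coeff_deg H d e \<Longrightarrow> c \<in> inv_ring H"
  by (auto simp: coeff_deg_def inv_ring_deg_def inv_ring_closed split: if_splits)

lemma coeff_deg_span: "coeff_deg H d e \<subseteq> P.span (monomial_basis (length bs) (d - e))"
  using inv_ring_deg_span P.span_zero by (auto simp: coeff_deg_def)

text \<open>The multiples of the last generator split off as a direct summand.\<close>

lemma span_deg_dim:
  assumes "independent_over H r \<omega>"
  shows "T.subspace (span_deg H r \<omega> ds d) \<and> (\<exists>S. finite S \<and> span_deg H r \<omega> ds d \<subseteq> T.span S) \<and>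
    T.dim (span_deg H r \<omega> ds d) = (\<Sum>j<r. P.dim (coeff_deg H d (ds j)))"
  using assms
proof (induction r)
  case 0
  have "span_deg H 0 \<omega> ds d = {0}" by (auto simp: span_deg_def zero_fun_def)
  then show ?case by (auto simp: T.dim_0 intro: exI[of _ "{}"])
next
  case (Suc r)
  let ?W = "coeff_deg H d (ds r)"
  define f where "f c = (\<lambda>i. c * \<omega> r i)" for c
  have ind: "independent_over H r \<omega>" unfolding independent_over_def
  proof (intro allI impI)
    fix c j assume c: "(\<forall>j<r. c j \<in> inv_ring H) \<and> (\<lambda>i. \<Sum>j<r. c j * \<omega> j i) = (\<lambda>i. 0)" and j: "j < r"
    have "(\<lambda>i. \<Sum>j<Suc r. (c(r := 0)) j * \<omega> j i) = (\<lambda>i. 0)" using c by simp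
    moreover have "\<forall>j<Suc r. (c(r := 0)) j \<in> inv_ring H"
      using c by (auto simp: less_Suc_eq inv_ring_closed)
    ultimately have "(c(r := 0)) j = 0"
      using Suc.prems j unfolding independent_over_def by (meson less_SucI)
    with j show "c j = 0" by simp
  qed
  from Suc.IH[OF this] obtain S where IH: "T.subspace (span_deg H r \<omega> ds d)" "finite S"
    "span_deg H r \<omega> ds d \<subseteq> T.span S" "T.dim (span_deg H r \<omega> ds d) = (\<Sum>j<r. P.dim (coeff_deg H d (ds j)))"
    by blast
  have lin: "Vector_Spaces.linear pscale tensor_scale f"
    unfolding Vector_Spaces.linear_iff f_def
    by (auto simp: vector_space_pscale vector_space_tensor_scale fun_eq_iff pscale_def tensor_scale_def algebra_simps)
  have key: "b = 0 \<and> a = (0 :: nat \<Rightarrow> 'k mpoly)"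
    if "a \<in> span_deg H r \<omega> ds d" "b \<in> ?W" "a + f b = 0" for a b
  proof -
    obtain c where c: "a = (\<lambda>i. \<Sum>j<r. c j * \<omega> j i)" "\<forall>j<r. c j \<in> coeff_deg H d (ds j)"
      using \<open>a \<in> _\<close> by (auto simp: span_deg_def)
    have "(\<lambda>i. \<Sum>j<Suc r. (c(r := b)) j * \<omega> j i) = (\<lambda>i. 0)"
      using that(3) by (simp add: c(1) f_def fun_eq_iff)
    moreover have "\<forall>j<Suc r. (c(r := b)) j \<in> inv_ring H"
      using c(2) that(2) coeff_deg_inv_ring by (auto simp: less_Suc_eq)
    ultimately have "\<forall>j<Suc r. (c(r := b)) j = 0"
      using Suc.prems unfolding independent_over_def by blast
    then have b0: "b = 0" by auto
    with that(3) show ?thesis by (simp add: f_def zero_fun_def fun_eq_iff)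
  qed
  have "0 \<in> span_deg H r \<omega> ds d" using IH(1) T.subspace_0 by blast
  then have inj: "x = 0" if "x \<in> ?W" "f x = 0" for x using key[of 0 x] that by simp
  note im = dim_image_inj[OF lin coeff_deg_subspace coeff_deg_span monomial_basis_finite inj]
  have eq: "span_deg H (Suc r) \<omega> ds d = {x + y | x y. x \<in> span_deg H r \<omega> ds d \<and> y \<in> f ` ?W}"
  proof (rule equalityI; rule subsetI)
    fix a assume "a \<in> span_deg H (Suc r) \<omega> ds d"
    then obtain c where c: "a = (\<lambda>i. \<Sum>j<Suc r. c j * \<omega> j i)" "\<forall>j<Suc r. c j \<in> coeff_deg H d (ds j)"
      by (auto simp: span_deg_def)
    then have "a = (\<lambda>i. \<Sum>j<r. c j * \<omega> j i) + f (c r)" by (simp add: f_def fun_eq_iff)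
    then show "a \<in> {x + y | x y. x \<in> span_deg H r \<omega> ds d \<and> y \<in> f ` ?W}"
      using c(2) unfolding span_deg_def by (intro CollectI exI conjI) auto
  next
    fix a assume "a \<in> {x + y | x y. x \<in> span_deg H r \<omega> ds d \<and> y \<in> f ` ?W}"
    then obtain c b where c: "a = (\<lambda>i. \<Sum>j<r. c j * \<omega> j i) + f b" "\<forall>j<r. c j \<in> coeff_deg H d (ds j)" "b \<in> ?W"
      by (auto simp: span_deg_def)
    then have "a = (\<lambda>i. \<Sum>j<Suc r. (c(r := b)) j * \<omega> j i)" by (simp add: f_def fun_eq_iff)
    moreover have "\<forall>j<Suc r. (c(r := b)) j \<in> coeff_deg H d (ds j)" using c by (auto simp: less_Suc_eq)
    ultimately show "a \<in> span_deg H (Suc r) \<omega> ds d" unfolding span_deg_def by blast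
  qed
  have "span_deg H r \<omega> ds d \<inter> f ` ?W \<subseteq> {0}"
  proof
    fix a assume "a \<in> span_deg H r \<omega> ds d \<inter> f ` ?W"
    then obtain b where b: "a \<in> span_deg H r \<omega> ds d" "b \<in> ?W" "a = f b" by blast
    have "- b \<in> ?W" using b(2) P.subspace_neg coeff_deg_subspace by blast
    moreover have "a + f (- b) = 0" using b(3) by (simp add: f_def fun_eq_iff)
    ultimately show "a \<in> {0}" using key[OF b(1)] by blast
  qed
  note ds = T.dim_direct_sum[OF IH(1,3,2) im(2,3) finite_imageI[OF monomial_basis_finite] this]
  let ?S = "S \<union> f ` monomial_basis (length bs) (d - ds r)"
  show ?case
  proof (intro conjI exI[of _ ?S])
    show "T.subspace (span_deg H (Suc r) \<omega> ds d)"
      unfolding eq by (rule T.subspace_sums[OF IH(1) im(2)])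
    show "finite ?S" using IH(2) monomial_basis_finite by blast
    show "span_deg H (Suc r) \<omega> ds d \<subseteq> T.span ?S"
      unfolding eq T.span_Un using IH(3) im(3) by blast
    have "T.dim (span_deg H (Suc r) \<omega> ds d) =
        T.dim {x + y | x y. x \<in> span_deg H r \<omega> ds d \<and> y \<in> f ` ?W}"
      by (rule arg_cong[OF eq])
    also have "\<dots> = T.dim (span_deg H r \<omega> ds d) + T.dim (f ` ?W)" by (rule ds)
    also have "T.dim (f ` ?W) = P.dim ?W" by (rule im(1))
    finally show "T.dim (span_deg H (Suc r) \<omega> ds d) = (\<Sum>j<Suc r. P.dim (coeff_deg H d (ds j)))"
      by (simp only: IH(4) sum.lessThan_Suc)
  qed
qed

lemma inv_ring_coeff_grade:
  assumes "p \<in> inv_ring H"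
  shows "coeff (grade p) d \<in> inv_ring_deg H d"
  using assms by (auto simp: inv_ring_deg_def homogeneous_coeff_grade inv_ringD
      intro!: inv_ringI coeff_grade_polyR simp flip: coeff_grade_act)

text \<open>Only the homogeneous components of the coefficients in the complementary degrees contribute.\<close>

lemma cov_deg_in_span_deg:
  assumes a: "a \<in> cov_deg H d" and \<omega>: "\<And>j. j < r \<Longrightarrow> \<omega> j \<in> cov_deg H (ds j)"
    and c: "\<And>j. j < r \<Longrightarrow> c j \<in> inv_ring H" "a = (\<lambda>i. \<Sum>j<r. c j * \<omega> j i)"
  shows "a \<in> span_deg H r \<omega> ds d"
proof -
  define c' where "c' j = (if ds j \<le> d then coeff (grade (c j)) (d - ds j) else 0)" for j
  have "a i = (\<Sum>j<r. c' j * \<omega> j i)" for i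
  proof -
    have "a i = coeff (grade (a i)) d" using coeff_grade_homogeneous[OF cov_degD(2)[OF a]] by simp
    also have "\<dots> = (\<Sum>j<r. coeff (grade (c j * \<omega> j i)) d)"
      by (simp add: c(2) grade.hom_sum coeff_sum)
    also have "\<dots> = (\<Sum>j<r. c' j * \<omega> j i)"
      by (rule sum.cong) (auto simp: coeff_grade_mult_homogeneous[OF cov_degD(2)[OF \<omega>]] c'_def)
    finally show ?thesis .
  qed
  moreover have "\<forall>j<r. c' j \<in> coeff_deg H d (ds j)"
    using c(1) inv_ring_coeff_grade by (auto simp: c'_def coeff_deg_def)
  ultimately show "a \<in> span_deg H r \<omega> ds d" unfolding span_deg_def by blast
qed

lemma span_deg_in_cov_deg:
  assumes \<omega>: "\<And>j. j < r \<Longrightarrow> \<omega> j \<in> cov_deg H (ds j)"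
  shows "span_deg H r \<omega> ds d \<subseteq> cov_deg H d"
proof
  fix a assume "a \<in> span_deg H r \<omega> ds d"
  then obtain c where c: "a = (\<lambda>i. \<Sum>j<r. c j * \<omega> j i)" "\<forall>j<r. c j \<in> coeff_deg H d (ds j)"
    by (auto simp: span_deg_def)
  show "a \<in> cov_deg H d"
  proof (rule cov_degI)
    show "a \<in> cov H" unfolding c(1)
      by (rule cov_sum) (use c(2) coeff_deg_inv_ring cov_degD(1)[OF \<omega>] in auto)
    fix i
    have "homogeneous d (c j * \<omega> j i)" if j: "j < r" for j
    proof (cases "ds j \<le> d")
      case True
      then have "homogeneous (d - ds j + ds j) (c j * \<omega> j i)"
        using c(2) j cov_degD(2)[OF \<omega>[OF j]] by (intro homogeneous_mult) (auto simp: coeff_deg_def inv_ring_deg_def)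
      with True show ?thesis by simp
    next
      case False
      then show ?thesis using c(2) j by (auto simp: coeff_deg_def)
    qed
    then show "homogeneous d (a i)" unfolding c(1) by (intro homogeneous_sum) auto
  qed
qed

lemma free_basis_span_deg:
  assumes fb: "free_basis H r \<omega>" and \<omega>: "\<And>j. j < r \<Longrightarrow> \<omega> j \<in> cov_deg H (ds j)"
  shows "cov_deg H d = span_deg H r \<omega> ds d"
proof
  show "cov_deg H d \<subseteq> span_deg H r \<omega> ds d"
  proof
    fix a assume a: "a \<in> cov_deg H d"
    then obtain c where c: "\<forall>j<r. c j \<in> inv_ring H" "a = (\<lambda>i. \<Sum>j<r. c j * \<omega> j i)"
      using fb cov_degD(1) unfolding free_basis_def by blast
    show "a \<in> span_deg H r \<omega> ds d"
      by (rule cov_deg_in_span_deg[where c = c, OF a \<omega> _ c(2)]) (use c(1) in auto)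
  qed
qed (rule span_deg_in_cov_deg[OF \<omega>])

abbreviation "inv_fps H \<equiv> hilbert_fps pscale (inv_ring_deg H)"
abbreviation "cov_fps H \<equiv> hilbert_fps tensor_scale (cov_deg H)"

lemma span_deg_fps:
  assumes "independent_over H r \<omega>"
  shows "hilbert_fps tensor_scale (span_deg H r \<omega> ds) =
    fps_of_poly (\<Sum>j<r. monom 1 (ds j)) * inv_fps H"
proof (rule fps_ext)
  fix d
  have "fps_nth (fps_of_poly (\<Sum>j<r. monom 1 (ds j)) * inv_fps H) d =
      (\<Sum>j<r. fps_nth (fps_X ^ ds j * inv_fps H) d)"
    by (simp add: fps_of_poly_sum fps_of_poly_monom' sum_distrib_right fps_sum_nth)
  also have "\<dots> = (\<Sum>j<r. of_nat (P.dim (coeff_deg H d (ds j))))"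
  proof (rule sum.cong[OF refl])
    fix j
    show "fps_nth (fps_X ^ ds j * inv_fps H) d = of_nat (P.dim (coeff_deg H d (ds j)))"
      by (simp add: fps_X_power_mult_nth hilbert_fps_def coeff_deg_def P.dim_0)
  qed
  finally show "fps_nth (hilbert_fps tensor_scale (span_deg H r \<omega> ds)) d =
      fps_nth (fps_of_poly (\<Sum>j<r. monom 1 (ds j)) * inv_fps H) d"
    using span_deg_dim[OF assms, of ds d] by (simp add: hilbert_fps_def)
qed

lemma free_basis_fps:
  assumes fb: "free_basis H r \<omega>" and \<omega>: "\<And>j. j < r \<Longrightarrow> \<omega> j \<in> cov_deg H (ds j)"
  shows "cov_fps H = fps_of_poly (\<Sum>j<r. monom 1 (ds j)) * inv_fps H"
proof -
  have "independent_over H r \<omega>" using fb by (auto simp: free_basis_def independent_over_def)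
  from span_deg_fps[OF this, of ds] show ?thesis
    using free_basis_span_deg[OF fb \<omega>] by (simp add: hilbert_fps_def)
qed

lemma inv_fps_0: "fps_nth (inv_fps H) 0 \<ge> 1"
proof -
  have "1 \<in> inv_ring_deg H 0" by (simp add: inv_ring_deg_def inv_ring_closed)
  then have "card {1 :: 'k mpoly} \<le> P.dim (inv_ring_deg H 0)"
    by (intro P.card_independent_le_dim[OF inv_ring_deg_subspace inv_ring_deg_span monomial_basis_finite])
       (auto simp: P.independent_insert P.independent_empty)
  then show ?thesis by (simp add: hilbert_fps_def)
qed

lemma inv_fps_nonzero: "inv_fps H \<noteq> 0"
  using inv_fps_0[of H] by auto

text \<open>The quotient of the Hilbert series is \<open>\<Sum>\<^sub>j t ^ deg \<omega>\<^sub>j\<close>, whose derivative at \<open>1\<close> is the sum of the degrees.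
  So \<open>e_inv\<close> is well defined.\<close>

lemma free_basis_degree_unique:
  assumes "free_basis H r \<omega>" "\<And>j. j < r \<Longrightarrow> \<omega> j \<in> hom_cov H"
    and "free_basis H r' \<omega>'" "\<And>j. j < r' \<Longrightarrow> \<omega>' j \<in> hom_cov H"
  shows "(\<Sum>j<r. cdeg (\<omega> j)) = (\<Sum>j<r'. cdeg (\<omega>' j))"
proof -
  let ?p = "\<lambda>r \<omega>. (\<Sum>j<r. monom 1 (cdeg (\<omega> j))) :: rat poly"
  have "fps_of_poly (?p r \<omega>) * inv_fps H = fps_of_poly (?p r' \<omega>') * inv_fps H"
    using free_basis_fps[OF assms(1), of "\<lambda>j. cdeg (\<omega> j)"] free_basis_fps[OF assms(3), of "\<lambda>j. cdeg (\<omega>' j)"]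
      assms(2,4) cdeg_cov_deg by metis
  then have "?p r \<omega> = ?p r' \<omega>'" using inv_fps_nonzero by simp
  then have "poly (pderiv (?p r \<omega>)) 1 = poly (pderiv (?p r' \<omega>')) 1" by simp
  moreover have "poly (pderiv (?p r \<omega>)) 1 = of_nat (\<Sum>j<r. cdeg (\<omega> j))" for r \<omega>
    by (simp add: pderiv_sum poly_sum pderiv_monom poly_monom)
  ultimately show ?thesis by (metis of_nat_eq_iff)
qed

lemma e_inv_eq:
  assumes "free_basis (stab U) r \<omega>" "\<And>j. j < r \<Longrightarrow> \<omega> j \<in> hom_cov (stab U)"
  shows "e_inv U = (\<Sum>j<r. cdeg (\<omega> j))"
  unfolding e_inv_def
proof (rule the_equality)
  show "\<exists>r' \<omega>'. free_basis (stab U) r' \<omega>' \<and> (\<forall>j<r'. \<omega>' j \<in> hom_cov (stab U)) \<and>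
      (\<Sum>j<r. cdeg (\<omega> j)) = (\<Sum>j<r'. cdeg (\<omega>' j))"
    using assms by blast
  fix e assume "\<exists>r' \<omega>'. free_basis (stab U) r' \<omega>' \<and> (\<forall>j<r'. \<omega>' j \<in> hom_cov (stab U)) \<and>
      e = (\<Sum>j<r'. cdeg (\<omega>' j))"
  then show "e = (\<Sum>j<r. cdeg (\<omega> j))"
    using free_basis_degree_unique[OF assms] by metis
qed

end

section \<open>Jacobians of covariants\<close>

context covariants
begin

lemma jac_in_polyR: "(\<And>j. j < length vs \<Longrightarrow> \<omega> j \<in> cov H) \<Longrightarrow> jac \<omega> \<in> polyR (length bs)"
  by (rule jac_polyR) (auto intro: tensor_spaceD covD)

lemma jac_in_jac_module: "(\<And>j. j < length vs \<Longrightarrow> \<omega> j \<in> hom_cov H) \<Longrightarrow> c \<in> inv_ring H \<Longrightarrow> c * jac \<omega> \<in> jac_module H"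
  unfolding jac_module_def
  by (intro CollectI exI[of _ 1] exI[of _ "\<lambda>_. c"] exI[of _ "\<lambda>_. \<omega>"]) auto

lemma jac_moduleE:
  assumes "p \<in> jac_module H"
  shows "\<exists>(N::nat) c \<omega>. p = (\<Sum>j<N. c j * jac (\<omega> j)) \<and> (\<forall>j<N. c j \<in> inv_ring H) \<and>
    (\<forall>j<N. \<forall>l<length vs. \<omega> j l \<in> hom_cov H)"
  using assms unfolding jac_module_def by blast

lemma dvd_jac_module:
  assumes "\<And>\<omega>. \<forall>j<length vs. \<omega> j \<in> hom_cov H \<Longrightarrow> d dvd jac \<omega>" "p \<in> jac_module H"
  shows "d dvd p"
proof -
  obtain N :: nat and c \<omega> where p: "p = (\<Sum>j<N. c j * jac (\<omega> j))"
    and \<omega>: "\<forall>j<N. \<forall>l<length vs. \<omega> j l \<in> hom_cov H"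
    using jac_moduleE[OF assms(2)] by blast
  show "d dvd p" unfolding p by (intro dvd_sum dvd_mult assms(1)) (use \<omega> in auto)
qed

lemma jac_module_polyR:
  assumes "p \<in> jac_module H"
  shows "p \<in> polyR (length bs)"
proof -
  obtain N :: nat and c \<omega> where p: "p = (\<Sum>j<N. c j * jac (\<omega> j))" "\<forall>j<N. c j \<in> inv_ring H"
    "\<forall>j<N. \<forall>l<length vs. \<omega> j l \<in> hom_cov H"
    using jac_moduleE[OF assms] by blast
  show ?thesis unfolding p(1)
    by (intro polyR_sum polyR_mult jac_in_polyR[of _ H])
       (use p(2,3) in \<open>auto dest: inv_ringD(1) intro: hom_cov_in\<close>)
qed

lemma pconst_mult_dvd_iff: "c \<noteq> 0 \<Longrightarrow> pconst c * p dvd q \<longleftrightarrow> p dvd q"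
  using pconst_dvd_1[of c] by (simp add: mult_unit_dvd_iff')

text \<open>The exponent in \<open>hyperplane_basis\<close> is the degree of the Jacobian of a basis, hence \<open>e_inv U\<close>.\<close>

theorem hyperplane_free_basis:
  assumes U: "hyperplane U" "hyperplane_form U l"
  shows "\<exists>\<eta> c. (\<forall>j<length vs. \<eta> j \<in> hom_cov (stab U)) \<and> c \<noteq> 0 \<and>
    jac \<eta> = pconst c * form_poly l ^ e_inv U \<and> free_basis (stab U) (length vs) \<eta> \<and>
    e_inv U = (\<Sum>j<length vs. cdeg (\<eta> j)) \<and>
    (\<forall>\<omega>. (\<forall>j<length vs. \<omega> j \<in> hom_cov (stab U)) \<longrightarrow> form_poly l ^ e_inv U dvd jac \<omega>)"
proof -
  obtain \<eta> e c where \<eta>: "\<And>j. j < length vs \<Longrightarrow> \<eta> j \<in> hom_cov (stab U)" "c \<noteq> 0"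
    "jac \<eta> = pconst c * form_poly l ^ e"
    "\<And>\<omega>. \<forall>j<length vs. \<omega> j \<in> hom_cov (stab U) \<Longrightarrow> form_poly l ^ e dvd jac \<omega>"
    using hyperplane_basis[OF U] by auto
  obtain v where l: "Vector_Spaces.linear scV (*) l" "l v \<noteq> 0"
    using hyperplane_formE[OF U] by blast
  have nz: "jac \<eta> \<noteq> 0" using \<eta>(2,3) prime_inD(2)[OF form_poly_prime[OF l]] by simp
  have fb: "free_basis (stab U) (length vs) \<eta>"
  proof (rule free_basis_if_jac_dvd[OF \<eta>(1) nz])
    fix \<omega> assume "\<And>j. j < length vs \<Longrightarrow> \<omega> j \<in> hom_cov (stab U)"
    then show "jac \<eta> dvd jac \<omega>"
      unfolding \<eta>(3) pconst_mult_dvd_iff[OF \<eta>(2)] using \<eta>(4) by simp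
  qed
  have "homogeneous (\<Sum>j<length vs. cdeg (\<eta> j)) (jac \<eta>)"
    by (rule jac_homogeneous) (rule cov_degD(2)[OF cdeg_cov_deg[OF \<eta>(1)]])
  moreover have "homogeneous e (jac \<eta>)"
    unfolding \<eta>(3) using homogeneous_power[OF form_poly_homogeneous, of e l]
    by (intro homogeneous_pconst_mult) simp
  ultimately have e: "e = (\<Sum>j<length vs. cdeg (\<eta> j))" using homogeneous_degree_unique nz by blast
  with e_inv_eq[OF fb \<eta>(1)] have "e_inv U = e" by simp
  with \<eta> fb e show ?thesis by (intro exI[of _ \<eta>] exI[of _ c]) auto
qed

theorem jac_module_hyperplane:
  assumes U: "hyperplane U" "hyperplane_form U l"
  shows "jac_module (stab U) = {f * form_poly l ^ e_inv U | f. f \<in> inv_ring (stab U)}"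
proof -
  obtain \<eta> c where \<eta>: "\<And>j. j < length vs \<Longrightarrow> \<eta> j \<in> hom_cov (stab U)" "c \<noteq> 0"
    "jac \<eta> = pconst c * form_poly l ^ e_inv U" "free_basis (stab U) (length vs) \<eta>"
    using hyperplane_free_basis[OF U] by auto
  show ?thesis
  proof (rule equalityI; rule subsetI)
    fix p assume "p \<in> jac_module (stab U)"
    then obtain N :: nat and b \<omega> where p: "p = (\<Sum>j<N. b j * jac (\<omega> j))" "\<And>j. j < N \<Longrightarrow> b j \<in> inv_ring (stab U)"
      "\<And>j l. j < N \<Longrightarrow> l < length vs \<Longrightarrow> \<omega> j l \<in> hom_cov (stab U)" using jac_moduleE[of p "stab U"] by auto
    have "\<exists>d\<in>inv_ring (stab U). jac (\<omega> j) = d * jac \<eta>" if "j < N" for j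
      using jac_free_basis_factor[OF \<eta>(4), of "\<omega> j"] p(3)[OF that] hom_cov_in by blast
    then have "\<forall>j. \<exists>d. j < N \<longrightarrow> d \<in> inv_ring (stab U) \<and> jac (\<omega> j) = d * jac \<eta>" by blast
    from choice[OF this] obtain d where "\<forall>j. j < N \<longrightarrow> d j \<in> inv_ring (stab U) \<and> jac (\<omega> j) = d j * jac \<eta>" ..
    then have d: "\<And>j. j < N \<Longrightarrow> d j \<in> inv_ring (stab U)" "\<And>j. j < N \<Longrightarrow> jac (\<omega> j) = d j * jac \<eta>"
      by blast+
    have "p = (\<Sum>j<N. b j * d j * pconst c) * form_poly l ^ e_inv U"
      unfolding p(1) sum_distrib_right by (rule sum.cong) (auto simp: d(2) \<eta>(3) mult.assoc)
    moreover have "(\<Sum>j<N. b j * d j * pconst c) \<in> inv_ring (stab U)"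
      using p(2) d(1) by (intro inv_ring_sum inv_ring_closed) auto
    ultimately show "p \<in> {f * form_poly l ^ e_inv U | f. f \<in> inv_ring (stab U)}" by blast
  next
    fix p assume "p \<in> {f * form_poly l ^ e_inv U | f. f \<in> inv_ring (stab U)}"
    then obtain f where f: "f \<in> inv_ring (stab U)" "p = f * form_poly l ^ e_inv U" by blast
    have "p = (f * pconst (inverse c)) * jac \<eta>"
      unfolding \<eta>(3) f(2) using \<eta>(2)
      by (simp add: mult.assoc mult.left_commute[of "pconst (inverse c)"] flip: pconst.hom_mult mult.assoc[of "pconst (inverse c)"])
    then show "p \<in> jac_module (stab U)"
      using jac_in_jac_module[of \<eta> "stab U" "f * pconst (inverse c)"] \<eta>(1) f(1)
      by (simp add: inv_ring_closed)
  qed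
qed

abbreviation "reflecting \<equiv> {U. hyperplane U \<and> stab U \<noteq> {id}}"

text \<open>A reflecting hyperplane is the fixed space of any non-trivial element of its stabilizer, and \<open>G\<close> is
  finite.\<close>

lemma reflecting_finite:
  assumes x: "\<And>U. hyperplane U \<Longrightarrow> hyperplane_form U (x U)"
  shows "finite reflecting"
proof (rule finite_subset)
  show "reflecting \<subseteq> (\<lambda>g. {u. g u = u}) ` G"
  proof
    fix U assume "U \<in> reflecting"
    then have U: "hyperplane U" "stab U \<noteq> {id}" by auto
    have "id \<in> stab U" using G_id by (simp add: stab_def)
    with U(2) obtain g where g: "g \<in> stab U" "g \<noteq> id" by blast
    then have gG: "g \<in> G" by (simp add: stab_def)
    obtain v where l: "Vector_Spaces.linear scV (*) (x U)" "x U v \<noteq> 0" "\<And>u. u \<in> U \<longleftrightarrow> x U u = 0"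
      using hyperplane_formE[OF U(1) x[OF U(1)]] by blast
    obtain i where i: "i < length bs" "act g (pvar i) \<noteq> pvar i" using act_faithful[OF gG] g(2) by blast
    define l' where "l' = (\<lambda>u. xV (inv_into UNIV g u) i - xV u i)"
    have l': "Vector_Spaces.linear scV (*) l'" unfolding l'_def by (rule act_pvar_diff_linear[OF gG])
    have fix_iff: "inv_into UNIV g u = u \<longleftrightarrow> g u = u" for u
      using bij_inv_eq_iff[OF G_bij[OF gG]] by metis
    have vanish: "l' u = 0" if "g u = u" for u using that fix_iff[of u] by (simp add: l'_def)
    have "form_poly l' = act g (pvar i) - pvar i" unfolding l'_def by (rule act_pvar_diff[OF i(1), symmetric])
    then have "form_poly l' \<noteq> 0" using i(2) by simp
    then obtain w where w: "l' w \<noteq> 0" using form_poly_eq_0_iff[OF l'] by blast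
    have pp: "l' u = l' v / x U v * x U u" for u
      by (rule functional_proportional[OF l(1) l' l(2)])
         (use vanish g(1) l(3) in \<open>auto simp: stab_def\<close>)
    have "l' v \<noteq> 0" using pp[of w] w by auto
    then have "x U u = 0" if "g u = u" for u using pp[of u] vanish[OF that] l(2) by simp
    then have "U = {u. g u = u}" using l(3) g(1) by (auto simp: stab_def)
    then show "U \<in> (\<lambda>g. {u. g u = u}) ` G" using gG by blast
  qed
qed (use G_finite in simp)

context
  fixes x :: "'v set \<Rightarrow> 'v \<Rightarrow> 'k"
  assumes x: "\<And>U. hyperplane U \<Longrightarrow> hyperplane_form U (x U)"
begin

lemma form_prime: "hyperplane U \<Longrightarrow> prime_in (length bs) (form_poly (x U))"
  using hyperplane_formE[OF _ x] form_poly_prime by metis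

lemma form_not_dvd:
  assumes U: "hyperplane U" "hyperplane U'" "U \<noteq> U'"
  shows "\<not> form_poly (x U) dvd form_poly (x U')"
proof
  assume dv: "form_poly (x U) dvd form_poly (x U')"
  obtain v where l: "Vector_Spaces.linear scV (*) (x U)" "x U v \<noteq> 0" "\<And>u. u \<in> U \<longleftrightarrow> x U u = 0"
    using hyperplane_formE[OF U(1) x[OF U(1)]] by blast
  obtain v' where l': "Vector_Spaces.linear scV (*) (x U')" "x U' v' \<noteq> 0" "\<And>u. u \<in> U' \<longleftrightarrow> x U' u = 0"
    using hyperplane_formE[OF U(2) x[OF U(2)]] by blast
  have pp: "x U' u = x U' v / x U v * x U u" for u
    by (rule functional_proportional[OF l(1) l'(1) l(2)])
       (use form_poly_dvd_form_poly[OF l(1,2) l'(1)] dv in blast)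
  have "x U' v \<noteq> 0" using pp[of v'] l'(2) by auto
  then have "x U' u = 0 \<longleftrightarrow> x U u = 0" for u using pp[of u] l(2) by simp
  then have "U = U'" using l(3) l'(3) by blast
  with U(3) show False by simp
qed

lemma F_poly_polyR: "F_poly x \<in> polyR (length bs)"
  unfolding F_poly_def by (intro polyR_prod polyR_power form_poly_in)

lemma F_poly_nonzero: "F_poly x \<noteq> 0"
  unfolding F_poly_def using reflecting_finite[OF x] form_prime prime_inD(2) by (auto simp: prod_zero_iff)

text \<open>Covariants of \<open>G\<close> are covariants of every \<open>stab U\<close>, and the linear forms of different hyperplanes are
  non-associated primes.\<close>

lemma F_poly_dvd_jac:
  assumes \<omega>: "\<forall>j<length vs. \<omega> j \<in> hom_cov G"
  shows "F_poly x dvd jac \<omega>"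
  unfolding F_poly_def
proof (rule prod_prime_powers_dvd[OF reflecting_finite[OF x], of "length bs" "\<lambda>U. form_poly (x U)"])
  show "jac \<omega> \<in> polyR (length bs)" using jac_in_polyR[of \<omega> G] hom_cov_in \<omega> by blast
  fix U assume U: "U \<in> reflecting"
  have "\<omega> j \<in> hom_cov (stab U)" if "j < length vs" for j
    using \<omega> that hom_cov_mono[of "stab U" G] by (auto simp: stab_def)
  note \<omega>U = this
  have hU: "hyperplane U" using U by simp
  show "form_poly (x U) ^ e_inv U dvd jac \<omega>"
    using hyperplane_free_basis[OF hU x[OF hU]] \<omega>U by blast
next
  fix U U' assume "U \<in> reflecting" "U' \<in> reflecting" "U \<noteq> U'"
  then show "\<not> form_poly (x U) dvd form_poly (x U')" using form_not_dvd by blast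
qed (use form_prime in auto)

text \<open>Covariants of the inertia group \<open>I\<close> of \<open>\<pi>\<close> with Jacobian of small order at \<open>\<pi>\<close> are transferred to \<open>G\<close>.
  If \<open>I\<close> is trivial, they are the constant ones; otherwise \<open>\<pi>\<close> is associated to the form of a
  reflecting hyperplane with stabilizer \<open>I\<close>, and they are a basis for this stabilizer.\<close>

lemma jac_prime_powers:
  assumes \<pi>: "prime_in (length bs) \<pi>"
  shows "\<exists>\<omega>. (\<forall>j<length vs. \<omega> j \<in> hom_cov G) \<and> (\<forall>k. \<pi> ^ k dvd jac \<omega> \<longrightarrow> \<pi> ^ k dvd F_poly x)"
proof -
  define I where "I = inertia \<pi>"
  have pz: "prime_or_zero (length bs) \<pi>" using \<pi> by (simp add: prime_or_zero_def)
  have I: "subgrp I" unfolding I_def by (rule inertia_subgrp[OF prime_inD(1)[OF \<pi>]])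
  have "\<exists>\<eta> e. (\<forall>j<length vs. \<eta> j \<in> hom_cov I) \<and> \<not> \<pi> ^ Suc e dvd jac \<eta> \<and> \<pi> ^ e dvd F_poly x"
  proof (cases "I = {id}")
    case True
    obtain \<eta> where "\<forall>j<length vs. \<eta> j \<in> hom_cov {id}" "jac \<eta> = 1" using unit_covariants by blast
    then show ?thesis using True prime_inD(3)[OF \<pi>] by (intro exI[of _ \<eta>] exI[of _ 0]) auto
  next
    case False
    then obtain g where g: "g \<in> inertia \<pi>" "g \<noteq> id" using subgrpD(2)[OF I] by (auto simp: I_def)
    obtain l v c where l: "Vector_Spaces.linear scV (*) l" "l v \<noteq> 0" "c \<noteq> 0" "form_poly l = \<pi> * pconst c"
      using inertia_nontrivial[OF \<pi> g] by blast
    define U where "U = {u. l u = 0}"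
    have U: "hyperplane U" unfolding U_def by (rule kernel_hyperplane[OF l(1,2)])
    have Ul: "u \<in> U \<longleftrightarrow> l u = 0" for u by (simp add: U_def)
    have IU: "I = stab U"
      using inertia_form_poly[OF l(1,2) Ul] inertia_associated[OF l(3), of \<pi>] l(4) by (simp add: I_def)
    obtain w where xU: "Vector_Spaces.linear scV (*) (x U)" "x U w \<noteq> 0" "\<And>u. u \<in> U \<longleftrightarrow> x U u = 0"
      using hyperplane_formE[OF U x[OF U]] by blast
    have "form_poly l dvd form_poly (x U)"
      using form_poly_dvd_form_poly[OF l(1,2) xU(1)] xU(3) Ul by blast
    then have "\<pi> dvd form_poly (x U)" unfolding l(4) by (rule dvd_mult_left)
    then obtain b where b: "b \<noteq> 0" "form_poly (x U) = \<pi> * pconst b"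
      using prime_in_dvd_prime_in[OF \<pi> form_prime[OF U]] by blast
    obtain \<eta> a where \<eta>: "\<And>j. j < length vs \<Longrightarrow> \<eta> j \<in> hom_cov (stab U)" "a \<noteq> 0"
      "jac \<eta> = pconst a * form_poly (x U) ^ e_inv U"
      using hyperplane_free_basis[OF U x[OF U]] by auto
    have "\<not> \<pi> ^ Suc (e_inv U) dvd jac \<eta>"
    proof
      assume "\<pi> ^ Suc (e_inv U) dvd jac \<eta>"
      also have "jac \<eta> = \<pi> ^ e_inv U * pconst (a * b ^ e_inv U)"
        unfolding \<eta>(3) b(2) by (simp add: power_mult_distrib pconst.hom_mult pconst.hom_power mult_ac)
      finally have "\<pi> dvd pconst (a * b ^ e_inv U)" using prime_inD(2)[OF \<pi>] by simp
      moreover have "pconst (a * b ^ e_inv U) dvd 1" by (rule pconst_dvd_1) (use \<eta>(2) b(1) in simp)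
      ultimately show False using prime_inD(3)[OF \<pi>] dvd_trans by blast
    qed
    moreover have "\<pi> ^ e_inv U dvd F_poly x"
    proof -
      have "U \<in> reflecting" using U False IU by simp
      then have "form_poly (x U) ^ e_inv U dvd F_poly x"
        unfolding F_poly_def by (intro dvd_prodI reflecting_finite[OF x]) auto
      moreover have "\<pi> ^ e_inv U dvd form_poly (x U) ^ e_inv U"
        unfolding b(2) by (intro dvd_power_same) simp
      ultimately show ?thesis by (rule dvd_trans[rotated])
    qed
    moreover have "\<forall>j<length vs. \<eta> j \<in> hom_cov I" unfolding IU using \<eta>(1) by blast
    ultimately show ?thesis by (intro exI[of _ \<eta>] exI[of _ "e_inv U"] conjI)
  qed
  then obtain \<eta> e where \<eta>0: "\<forall>j<length vs. \<eta> j \<in> hom_cov I" and \<eta>1: "\<not> \<pi> ^ Suc e dvd jac \<eta>"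
    and \<eta>2: "\<pi> ^ e dvd F_poly x" by (elim exE conjE)
  note \<eta> = \<eta>0[rule_format] \<eta>1 \<eta>2
  have "\<exists>y d. y \<in> inv_ring I \<and> homogeneous d y \<and> \<not> \<pi> dvd y - act g y" if "g \<in> G" "g \<notin> I" for g
    using inertia_separation[OF pz that(1)] that(2) unfolding I_def by blast
  from covariant_transfer[OF I pz this \<eta>(1,2)] obtain \<omega> where
    \<omega>: "\<And>j. j < length vs \<Longrightarrow> \<omega> j \<in> hom_cov G" "\<not> \<pi> ^ Suc e dvd jac \<omega>" by blast
  have "\<pi> ^ k dvd F_poly x" if k: "\<pi> ^ k dvd jac \<omega>" for k
  proof -
    have "k \<le> e"
    proof (rule ccontr)
      assume "\<not> k \<le> e"
      then have "\<pi> ^ Suc e dvd \<pi> ^ k" by (intro le_imp_power_dvd) simp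
      with k \<omega>(2) show False using dvd_trans by blast
    qed
    then have "\<pi> ^ k dvd \<pi> ^ e" by (rule le_imp_power_dvd)
    with \<eta>(3) show ?thesis using dvd_trans by blast
  qed
  with \<omega>(1) show ?thesis by blast
qed

lemma F_poly_greatest:
  assumes d: "d \<in> polyR (length bs)"
    and dv: "\<And>\<omega>. \<forall>j<length vs. \<omega> j \<in> hom_cov G \<Longrightarrow> d dvd jac \<omega>"
  shows "d dvd F_poly x"
proof (rule dvd_if_prime_powers_dvd[OF d _ F_poly_polyR F_poly_nonzero])
  obtain \<omega> where "\<forall>j<length vs. \<omega> j \<in> hom_cov G" "jac \<omega> \<noteq> 0"
    using exists_jac_nonzero by blast
  then show "d \<noteq> 0" using dv by force
  fix \<pi> k assume \<pi>: "prime_in (length bs) \<pi>" and k: "\<pi> ^ k dvd d"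
  obtain \<omega> where \<omega>: "\<forall>j<length vs. \<omega> j \<in> hom_cov G" "\<And>k. \<pi> ^ k dvd jac \<omega> \<Longrightarrow> \<pi> ^ k dvd F_poly x"
    using jac_prime_powers[OF \<pi>] by blast
  show "\<pi> ^ k dvd F_poly x" by (rule \<omega>(2)[OF dvd_trans[OF k dv[OF \<omega>(1)]]])
qed

lemma divides_in_ring_iff:
  assumes "p \<in> polyR (length bs)" "q \<in> polyR (length bs)"
  shows "divides_in_ring p q \<longleftrightarrow> p dvd q"
proof
  assume "p dvd q"
  then show "divides_in_ring p q"
    using dvd_polyR[OF _ assms] unfolding divides_in_ring_def coord_ring_polyR by blast
qed (auto simp: divides_in_ring_def)

theorem F_poly_is_gcd: "is_gcd_of (F_poly x) (jac_module G)"
  unfolding is_gcd_of_def coord_ring_polyR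
proof (intro conjI ballI impI)
  show "F_poly x \<in> polyR (length bs)" by (rule F_poly_polyR)
  show "divides_in_ring (F_poly x) p" if "p \<in> jac_module G" for p
    using dvd_jac_module[OF F_poly_dvd_jac that] divides_in_ring_iff[OF F_poly_polyR jac_module_polyR[OF that]]
    by blast
  fix d assume d: "d \<in> polyR (length bs)" "\<forall>p\<in>jac_module G. divides_in_ring d p"
  have "d dvd F_poly x"
  proof (rule F_poly_greatest[OF d(1)])
    fix \<omega> assume "\<forall>j<length vs. \<omega> j \<in> hom_cov G"
    then have "jac \<omega> \<in> jac_module G"
      using jac_in_jac_module[of \<omega> G 1] by (simp add: inv_ring_closed)
    then have "divides_in_ring d (jac \<omega>)" using d(2) by blast
    then show "d dvd jac \<omega>" by (auto simp: divides_in_ring_def)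
  qed
  then show "divides_in_ring d (F_poly x)" using divides_in_ring_iff[OF d(1) F_poly_polyR] by blast
qed

lemma jac_module_F_poly: "jac_module G \<subseteq> {f * F_poly x | f. f \<in> coord_ring}"
proof
  fix p assume p: "p \<in> jac_module G"
  then have "F_poly x dvd p" using dvd_jac_module[OF F_poly_dvd_jac] by blast
  then obtain f where "f \<in> polyR (length bs)" "p = F_poly x * f"
    using dvd_polyR[OF _ F_poly_polyR jac_module_polyR[OF p]] by blast
  then show "p \<in> {f * F_poly x | f. f \<in> coord_ring}" by (auto simp: coord_ring_polyR mult.commute)
qed

text \<open>The Jacobian of a basis divides all Jacobians, hence their greatest common divisor \<open>F_poly x\<close>, and is
  divided by it. Conversely, a Jacobian associated to \<open>F_poly x\<close> divides all others.\<close>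

theorem jacobian_criterion_F:
  assumes \<omega>: "\<forall>j<length vs. \<omega> j \<in> hom_cov G"
  shows "free_basis G (length vs) \<omega> \<longleftrightarrow> (\<exists>c. c \<noteq> 0 \<and> jac \<omega> = pconst c * F_poly x)"
proof
  assume fb: "free_basis G (length vs) \<omega>"
  have "jac \<omega> dvd F_poly x"
  proof (rule F_poly_greatest)
    show "jac \<omega> \<in> polyR (length bs)" using jac_in_polyR[of \<omega> G] hom_cov_in \<omega> by blast
    fix \<omega>' assume "\<forall>j<length vs. \<omega>' j \<in> hom_cov G"
    then obtain c where "jac \<omega>' = c * jac \<omega>"
      using jac_free_basis_factor[OF fb, of \<omega>'] hom_cov_in by blast
    then show "jac \<omega> dvd jac \<omega>'" by simp
  qed
  then obtain u where u: "F_poly x = jac \<omega> * u" ..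
  obtain w where w: "jac \<omega> = F_poly x * w" using F_poly_dvd_jac[OF \<omega>] ..
  have "F_poly x * (w * u) = F_poly x * 1" using u w by (metis mult.assoc mult.right_neutral)
  then have "1 = w * u" using F_poly_nonzero by (metis mult_left_cancel)
  then have "w dvd 1" by (rule dvdI)
  then obtain c where "c \<noteq> 0" "w = pconst c" using unit_const by blast
  with w show "\<exists>c. c \<noteq> 0 \<and> jac \<omega> = pconst c * F_poly x" by (auto simp: mult.commute)
next
  assume "\<exists>c. c \<noteq> 0 \<and> jac \<omega> = pconst c * F_poly x"
  then obtain c where c: "c \<noteq> 0" "jac \<omega> = pconst c * F_poly x" by blast
  show "free_basis G (length vs) \<omega>"
    by (rule free_basis_if_jac_dvd)
       (use \<omega> c F_poly_nonzero F_poly_dvd_jac in \<open>auto simp: pconst_mult_dvd_iff\<close>)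
qed

end

end

section \<open>Rationality of Hilbert series\<close>

definition rational_fps :: "rat fps \<Rightarrow> bool" where
  "rational_fps A \<longleftrightarrow> (\<exists>q p. q \<noteq> 0 \<and> fps_of_poly q * A = fps_of_poly p)"

lemma rational_fps_poly: "rational_fps (fps_of_poly p)"
  unfolding rational_fps_def by (intro exI[of _ 1] exI[of _ p]) simp

lemma rational_fps_0: "rational_fps 0"
  using rational_fps_poly[of 0] by simp

lemma rational_fps_mult_poly: "rational_fps A \<Longrightarrow> rational_fps (fps_of_poly r * A)"
  unfolding rational_fps_def by (metis (no_types, lifting) fps_of_poly_mult mult.left_commute)

lemma rational_fps_X_power: "rational_fps A \<Longrightarrow> rational_fps (fps_X ^ k * A)"
  using rational_fps_mult_poly[of A "monom 1 k"] by (simp add: fps_of_poly_monom')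

lemma rational_fps_cancel: "r \<noteq> 0 \<Longrightarrow> rational_fps (fps_of_poly r * A) \<Longrightarrow> rational_fps A"
  unfolding rational_fps_def by (metis (no_types, lifting) fps_of_poly_mult mult.assoc mult_eq_0_iff)

lemma rational_fps_add:
  assumes "rational_fps A" "rational_fps B"
  shows "rational_fps (A + B)"
proof -
  obtain q p where q: "q \<noteq> 0" "fps_of_poly q * A = fps_of_poly p" using assms(1) by (auto simp: rational_fps_def)
  obtain q' p' where q': "q' \<noteq> 0" "fps_of_poly q' * B = fps_of_poly p'" using assms(2) by (auto simp: rational_fps_def)
  have "fps_of_poly (q * q') * (A + B) = fps_of_poly q' * (fps_of_poly q * A) + fps_of_poly q * (fps_of_poly q' * B)"
    by (simp add: fps_of_poly_mult algebra_simps)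
  also have "\<dots> = fps_of_poly (q' * p + q * p')" by (simp add: q q' fps_of_poly_mult fps_of_poly_add)
  finally show ?thesis unfolding rational_fps_def using q(1) q'(1) by (intro exI[of _ "q * q'"] exI conjI) auto
qed

lemma rational_fps_diff: "rational_fps A \<Longrightarrow> rational_fps B \<Longrightarrow> rational_fps (A - B)"
  using rational_fps_add[of A "fps_of_poly (- 1) * B"] rational_fps_mult_poly[of B "- 1"]
  by (simp add: fps_of_poly_uminus)

lemma rational_fps_sum: "(\<And>x. x \<in> X \<Longrightarrow> rational_fps (f x)) \<Longrightarrow> rational_fps (\<Sum>x\<in>X. f x)"
  by (induction X rule: infinite_finite_induct) (auto intro: rational_fps_add rational_fps_0)

subsection \<open>Upward closed sets of exponents\<close>

definition expo :: "nat \<Rightarrow> (nat \<Rightarrow>\<^sub>0 nat) set" where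
  "expo r = {\<beta>. Poly_Mapping.keys \<beta> \<subseteq> {..<r}}"

definition up_closed :: "nat \<Rightarrow> (nat \<Rightarrow>\<^sub>0 nat) set \<Rightarrow> bool" where
  "up_closed r M \<longleftrightarrow> M \<subseteq> expo r \<and> (\<forall>\<beta>\<in>M. \<forall>\<gamma>\<in>expo r. \<beta> + \<gamma> \<in> M)"

definition weight :: "nat \<Rightarrow> (nat \<Rightarrow> nat) \<Rightarrow> (nat \<Rightarrow>\<^sub>0 nat) \<Rightarrow> nat" where
  "weight r w \<beta> = (\<Sum>i<r. w i * Poly_Mapping.lookup \<beta> i)"

definition count_fps :: "nat \<Rightarrow> (nat \<Rightarrow> nat) \<Rightarrow> (nat \<Rightarrow>\<^sub>0 nat) set \<Rightarrow> rat fps" where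
  "count_fps r w M = Abs_fps (\<lambda>d. of_nat (card {\<beta>\<in>M. weight r w \<beta> = d}))"

text \<open>The part of \<open>M\<close> with last exponent \<open>j\<close>, regarded as a set of exponents in one variable less.\<close>

definition slice :: "nat \<Rightarrow> (nat \<Rightarrow>\<^sub>0 nat) set \<Rightarrow> nat \<Rightarrow> (nat \<Rightarrow>\<^sub>0 nat) set" where
  "slice r M j = {\<beta>\<in>expo r. \<beta> + Poly_Mapping.single r j \<in> M}"

lemma expo_add: "\<beta> \<in> expo r \<Longrightarrow> \<gamma> \<in> expo r \<Longrightarrow> \<beta> + \<gamma> \<in> expo r"
  unfolding expo_def using keys_add[of \<beta> \<gamma>] by blast

lemma expo_single: "i < r \<Longrightarrow> Poly_Mapping.single i j \<in> expo r"
  by (simp add: expo_def)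

lemma expo_Suc: "expo r \<subseteq> expo (Suc r)"
  by (auto simp: expo_def)

lemma expo_0: "expo 0 = {0}"
  by (auto simp: expo_def)

lemma expo_zero: "0 \<in> expo r"
  by (simp add: expo_def)

lemma expo_lookup: "\<beta> \<in> expo r \<Longrightarrow> r \<le> i \<Longrightarrow> Poly_Mapping.lookup \<beta> i = 0"
  by (auto simp: expo_def in_keys_iff)

lemma expo_Suc_decompose:
  assumes "\<beta> \<in> expo (Suc r)"
  obtains \<beta>' where "\<beta>' \<in> expo r" "\<beta> = \<beta>' + Poly_Mapping.single r (Poly_Mapping.lookup \<beta> r)"
proof (rule that)
  let ?b = "Poly_Mapping.update r 0 \<beta>"
  show "?b \<in> expo r" unfolding expo_def
  proof (intro CollectI subsetI)
    fix i assume "i \<in> Poly_Mapping.keys ?b"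
    then have "i \<noteq> r" "i \<in> Poly_Mapping.keys \<beta>" by (auto simp: in_keys_iff lookup_update split: if_splits)
    then show "i \<in> {..<r}" using assms by (auto simp: expo_def less_Suc_eq)
  qed
  show "\<beta> = ?b + Poly_Mapping.single r (Poly_Mapping.lookup \<beta> r)"
    by (rule poly_mapping_eqI) (auto simp: lookup_add lookup_update lookup_single when_def)
qed

lemma expo_add_single_eq:
  assumes "\<beta> \<in> expo r" "\<gamma> \<in> expo r" "\<beta> + Poly_Mapping.single r i = \<gamma> + Poly_Mapping.single r j"
  shows "i = j" "\<beta> = \<gamma>"
proof -
  show "i = j" using arg_cong[OF assms(3), of "\<lambda>p. Poly_Mapping.lookup p r"] expo_lookup[OF assms(1), of r]
      expo_lookup[OF assms(2), of r] by (simp add: lookup_add)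
  with assms(3) show "\<beta> = \<gamma>" by simp
qed

lemma weight_Suc: "\<beta> \<in> expo r \<Longrightarrow> weight (Suc r) w (\<beta> + Poly_Mapping.single r j) = weight r w \<beta> + w r * j"
  by (auto simp: weight_def lookup_add lookup_single when_def expo_lookup intro!: sum.cong)

lemma weight_add: "weight r w (\<beta> + \<gamma>) = weight r w \<beta> + weight r w \<gamma>"
  by (simp add: weight_def lookup_add distrib_left sum.distrib)

lemma weight_finite:
  assumes "\<And>i. i < r \<Longrightarrow> w i > 0"
  shows "finite {\<beta>\<in>expo r. weight r w \<beta> = d}"
proof (rule finite_subset)
  show "{\<beta>\<in>expo r. weight r w \<beta> = d} \<subseteq> (\<Union>e\<le>d. monomials r e)"
  proof
    fix \<beta> assume "\<beta> \<in> {\<beta>\<in>expo r. weight r w \<beta> = d}"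
    then have \<beta>: "\<beta> \<in> expo r" "weight r w \<beta> = d" by auto
    have "mdeg \<beta> \<le> (\<Sum>i<r. Poly_Mapping.lookup \<beta> i)"
      unfolding mdeg_def using \<beta>(1) by (intro sum_mono2) (auto simp: expo_def)
    also have "\<dots> \<le> weight r w \<beta>" unfolding weight_def
    proof (rule sum_mono)
      fix i assume "i \<in> {..<r}"
      then have "1 \<le> w i" using assms by (simp add: Suc_leI)
      then show "Poly_Mapping.lookup \<beta> i \<le> w i * Poly_Mapping.lookup \<beta> i" by simp
    qed
    finally show "\<beta> \<in> (\<Union>e\<le>d. monomials r e)" using \<beta> by (auto simp: monomials_def expo_def)
  qed
qed (use monomials_finite in auto)

lemma slice_up_closed: "up_closed (Suc r) M \<Longrightarrow> up_closed r (slice r M j)"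
  unfolding up_closed_def slice_def
proof (intro conjI ballI)
  assume M: "M \<subseteq> expo (Suc r) \<and> (\<forall>\<beta>\<in>M. \<forall>\<gamma>\<in>expo (Suc r). \<beta> + \<gamma> \<in> M)"
  fix \<beta> \<gamma> assume \<beta>: "\<beta> \<in> {\<beta> \<in> expo r. \<beta> + Poly_Mapping.single r j \<in> M}" and \<gamma>: "\<gamma> \<in> expo r"
  then have "(\<beta> + Poly_Mapping.single r j) + \<gamma> \<in> M" using M expo_Suc[of r] by auto
  then show "\<beta> + \<gamma> \<in> {\<beta> \<in> expo r. \<beta> + Poly_Mapping.single r j \<in> M}"
    using \<beta> \<gamma> by (auto simp: expo_add ac_simps)
qed auto

lemma slice_mono:
  assumes "up_closed (Suc r) M" "M \<subseteq> M'" "i \<le> j"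
  shows "slice r M i \<subseteq> slice r M' j"
proof
  fix \<beta> assume "\<beta> \<in> slice r M i"
  then have \<beta>: "\<beta> \<in> expo r" "\<beta> + Poly_Mapping.single r i \<in> M" by (auto simp: slice_def)
  have "(\<beta> + Poly_Mapping.single r i) + Poly_Mapping.single r (j - i) \<in> M"
    using assms(1) \<beta>(2) expo_single[of r "Suc r" "j - i"] by (auto simp: up_closed_def)
  then have "\<beta> + Poly_Mapping.single r j \<in> M"
    using assms(3) by (simp add: add.assoc flip: single_add)
  then show "\<beta> \<in> slice r M' j" using \<beta>(1) assms(2) by (auto simp: slice_def)
qed

lemma slices_eqI:
  assumes "up_closed (Suc r) M" "up_closed (Suc r) M'" "\<And>j. slice r M j = slice r M' j"
  shows "M = M'"
proof -
  have "\<beta> \<in> M'" if "up_closed (Suc r) M" "\<And>j. slice r M j = slice r M' j" "\<beta> \<in> M" for M M' \<beta>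
  proof -
    have "\<beta> \<in> expo (Suc r)" using that by (auto simp: up_closed_def)
    then obtain \<beta>' where b: "\<beta>' \<in> expo r" "\<beta> = \<beta>' + Poly_Mapping.single r (Poly_Mapping.lookup \<beta> r)"
      by (rule expo_Suc_decompose)
    then have "\<beta>' \<in> slice r M (Poly_Mapping.lookup \<beta> r)" using that(3) by (simp add: slice_def)
    then have "\<beta>' \<in> slice r M' (Poly_Mapping.lookup \<beta> r)" by (simp only: that(2))
    then have "\<beta>' + Poly_Mapping.single r (Poly_Mapping.lookup \<beta> r) \<in> M'" by (simp add: slice_def)
    then show ?thesis by (subst b(2))
  qed
  from this[OF assms(1,3)] this[OF assms(2) assms(3)[symmetric]] show ?thesis by blast
qed

text \<open>Dickson's lemma as an ascending chain condition. The slices of the sets form an array that ascends in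
  both indices. Its diagonal becomes stationary at some \<open>K\<close>, which settles all slices from \<open>K\<close> on, and
  each of the finitely many slices below becomes stationary as well.\<close>

lemma up_closed_acc:
  assumes "\<And>i. up_closed r (U i)" "\<And>i j. i \<le> j \<Longrightarrow> U i \<subseteq> U j"
  shows "\<exists>K::nat. \<forall>i\<ge>K. U i = U K"
  using assms
proof (induction r arbitrary: U)
  case 0
  then have sub: "U i \<subseteq> {0}" for i by (auto simp: up_closed_def expo_0)
  show ?case
  proof (cases "\<exists>K. U K \<noteq> {}")
    case True
    then obtain K where "U K \<noteq> {}" ..
    then have "U K = {0}" using sub by blast
    then have "U i = U K" if "i \<ge> K" for i using sub[of i] 0(2)[OF that] by blast
    then show ?thesis by blast
  qed auto
next
  case (Suc r)
  have up: "up_closed r (slice r (U i) j)" for i j using slice_up_closed Suc.prems(1) by blast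
  have mono: "slice r (U i) j \<subseteq> slice r (U i') j'" if "i \<le> i'" "j \<le> j'" for i i' j j'
    using slice_mono[OF Suc.prems(1) Suc.prems(2)] that by blast
  obtain K where K: "\<And>i. i \<ge> K \<Longrightarrow> slice r (U i) i = slice r (U K) K"
    using Suc.IH[of "\<lambda>i. slice r (U i) i"] up mono by blast
  have "\<forall>j. \<exists>L. \<forall>i\<ge>L. slice r (U i) j = slice r (U L) j"
    using Suc.IH[of "\<lambda>i. slice r (U i) j" for j] up mono by blast
  from choice[OF this] obtain L where L: "\<And>j i. i \<ge> L j \<Longrightarrow> slice r (U i) j = slice r (U (L j)) j" by blast
  define N where "N = K + (\<Sum>j<K. L j)"
  have NK: "K \<le> N" by (simp add: N_def)
  have NL: "L j \<le> N" if "j < K" for j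
    using member_le_sum[of j "{..<K}" L] that by (simp add: N_def)
  have high: "slice r (U i) j = slice r (U K) K" if "i \<ge> K" "j \<ge> K" for i j
  proof
    show "slice r (U K) K \<subseteq> slice r (U i) j" by (rule mono) (use that in auto)
    have "slice r (U i) j \<subseteq> slice r (U (max i j)) (max i j)" by (rule mono) auto
    also have "\<dots> = slice r (U K) K" by (rule K) (use that in auto)
    finally show "slice r (U i) j \<subseteq> slice r (U K) K" .
  qed
  have "U i = U N" if i: "i \<ge> N" for i
  proof (rule slices_eqI[OF Suc.prems(1) Suc.prems(1)])
    fix j
    show "slice r (U i) j = slice r (U N) j"
    proof (cases "j < K")
      case True
      then show ?thesis using L[of j i] L[of j N] NL[OF True] i by simp
    next
      case False
      then show ?thesis using high[of i j] high[of N j] NK i by simp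
    qed
  qed
  then show ?case by blast
qed

lemma card_weight_Suc:
  assumes M: "up_closed (Suc r) M" and w: "\<And>i. i < Suc r \<Longrightarrow> w i > 0"
  shows "card {\<beta>\<in>M. weight (Suc r) w \<beta> = d} =
    (\<Sum>j | w r * j \<le> d. card {\<beta>\<in>slice r M j. weight r w \<beta> = d - w r * j})"
proof -
  have finJ: "finite {j. w r * j \<le> d}"
  proof (rule finite_subset)
    show "{j. w r * j \<le> d} \<subseteq> {..d}"
    proof
      fix j assume j: "j \<in> {j. w r * j \<le> d}"
      have "j \<le> w r * j" using w[of r] by (cases "w r") auto
      moreover have "w r * j \<le> d" using j by simp
      ultimately show "j \<in> {..d}" unfolding atMost_iff by (rule le_trans)
    qed
  qed simp
  let ?f = "\<lambda>j \<beta>. \<beta> + Poly_Mapping.single r j"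
  let ?S = "\<lambda>j. {\<beta>\<in>slice r M j. weight r w \<beta> = d - w r * j}"
  have fin: "finite (?S j)" for j
    by (rule finite_subset[OF _ weight_finite[of r w "d - w r * j"]]) (use w in \<open>auto simp: slice_def\<close>)
  have "{\<beta>\<in>M. weight (Suc r) w \<beta> = d} = (\<Union>j\<in>{j. w r * j \<le> d}. ?f j ` ?S j)"
  proof (rule equalityI; rule subsetI)
    fix \<beta> assume "\<beta> \<in> {\<beta>\<in>M. weight (Suc r) w \<beta> = d}"
    then have \<beta>: "\<beta> \<in> M" "weight (Suc r) w \<beta> = d" by auto
    then have "\<beta> \<in> expo (Suc r)" using M by (auto simp: up_closed_def)
    then obtain \<beta>' where b: "\<beta>' \<in> expo r" "\<beta> = ?f (Poly_Mapping.lookup \<beta> r) \<beta>'"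
      by (rule expo_Suc_decompose)
    define j where "j = Poly_Mapping.lookup \<beta> r"
    have bj: "\<beta> = ?f j \<beta>'" using b(2) by (simp add: j_def)
    have wt: "d = weight r w \<beta>' + w r * j" using \<beta>(2) weight_Suc[OF b(1), of w j] bj by simp
    have "\<beta>' \<in> ?S j" using b(1) bj \<beta>(1) wt by (auto simp: slice_def)
    moreover have "j \<in> {j. w r * j \<le> d}" using wt by simp
    ultimately show "\<beta> \<in> (\<Union>j\<in>{j. w r * j \<le> d}. ?f j ` ?S j)" using bj by blast
  next
    fix \<beta> assume "\<beta> \<in> (\<Union>j\<in>{j. w r * j \<le> d}. ?f j ` ?S j)"
    then obtain j \<beta>' where "w r * j \<le> d" "\<beta>' \<in> ?S j" "\<beta> = ?f j \<beta>'" by blast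
    then show "\<beta> \<in> {\<beta>\<in>M. weight (Suc r) w \<beta> = d}" by (auto simp: slice_def weight_Suc)
  qed
  then have "card {\<beta>\<in>M. weight (Suc r) w \<beta> = d} = (\<Sum>j | w r * j \<le> d. card (?f j ` ?S j))"
  proof -
    have "\<forall>i\<in>{j. w r * j \<le> d}. \<forall>j\<in>{j. w r * j \<le> d}. i \<noteq> j \<longrightarrow> ?f i ` ?S i \<inter> ?f j ` ?S j = {}"
      using expo_add_single_eq(1)[of _ r] by (fastforce simp: slice_def)
    with \<open>_ = (\<Union>j\<in>{j. w r * j \<le> d}. ?f j ` ?S j)\<close> show ?thesis
      using card_UN_disjoint[OF finJ, of "\<lambda>j. ?f j ` ?S j"] fin by simp
  qed
  also have "\<dots> = (\<Sum>j | w r * j \<le> d. card (?S j))"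
    by (intro sum.cong refl card_image) (simp add: inj_on_def)
  finally show ?thesis .
qed

text \<open>From some index \<open>J\<close> on the slices are constant, so the series is a finite sum plus the series of the
  constant slice times a geometric series in \<open>t ^ w r\<close>.\<close>

lemma count_fps_rational:
  assumes "up_closed r M" "\<And>i. i < r \<Longrightarrow> w i > 0"
  shows "rational_fps (count_fps r w M)"
  using assms
proof (induction r arbitrary: M)
  case 0
  then have "M \<subseteq> {0}" by (auto simp: up_closed_def expo_0)
  then have "{\<beta>\<in>M. weight 0 w \<beta> = d} = (if d = 0 then M else {})" for d by (auto simp: weight_def)
  then have "count_fps 0 w M = fps_of_poly [:of_nat (card M):]"
    by (intro fps_ext) (auto simp: count_fps_def coeff_pCons split: nat.splits)
  then show ?case by (simp only: rational_fps_poly)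
next
  case (Suc r)
  define a where "a j = count_fps r w (slice r M j)" for j
  have a_rat: "rational_fps (a j)" for j
    unfolding a_def by (rule Suc.IH[OF slice_up_closed[OF Suc.prems(1)]]) (use Suc.prems(2) in auto)
  define k where "k = w r"
  have k: "k > 0" using Suc.prems(2)[of r] by (simp add: k_def)
  obtain J where J: "\<And>j. j \<ge> J \<Longrightarrow> slice r M j = slice r M J"
    using up_closed_acc[of r "slice r M"] slice_up_closed[OF Suc.prems(1)] slice_mono[OF Suc.prems(1) subset_refl]
    by blast
  have aJ: "a j = a J" if "j \<ge> J" for j unfolding a_def J[OF that] ..
  \<comment> \<open>The contribution of the slices from \<open>J\<close> on. Splitting off the slice \<open>J\<close> and shifting the others gives a linear equation for it.\<close>
  define T where "T = Abs_fps (\<lambda>d. \<Sum>j | J \<le> j \<and> k * j \<le> d. fps_nth (a J) (d - k * j))"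
  have finS: "finite {j. k * j \<le> d}" for d
  proof (rule finite_subset)
    show "{j. k * j \<le> d} \<subseteq> {..d}"
    proof
      fix j assume j: "j \<in> {j. k * j \<le> d}"
      have "j \<le> k * j" using k by (cases k) auto
      moreover have "k * j \<le> d" using j by simp
      ultimately show "j \<in> {..d}" unfolding atMost_iff by (rule le_trans)
    qed
  qed simp
  have T: "T = fps_X ^ (k * J) * a J + fps_X ^ k * T"
  proof (rule fps_ext)
    fix d
    let ?S = "\<lambda>d. {j. J \<le> j \<and> k * j \<le> d}"
    have fin: "finite (?S d)" for d by (rule finite_subset[OF _ finS[of d]]) auto
    have S: "?S d = (if k * J \<le> d then {J} else {}) \<union> (if k \<le> d then Suc ` ?S (d - k) else {})"
    proof (rule equalityI; rule subsetI)
      fix j assume j: "j \<in> ?S d"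
      show "j \<in> (if k * J \<le> d then {J} else {}) \<union> (if k \<le> d then Suc ` ?S (d - k) else {})"
      proof (cases "j = J")
        case False
        then obtain i where i: "j = Suc i" "J \<le> i" using j by (cases j) auto
        then have "k + k * i \<le> d" using j by simp
        then have "k \<le> d" "i \<in> ?S (d - k)" using i by auto
        then show ?thesis using i by auto
      qed (use j in auto)
    qed (auto split: if_splits)
    have "fps_nth T d = (\<Sum>j\<in>(if k * J \<le> d then {J} else {}) \<union> (if k \<le> d then Suc ` ?S (d - k) else {}). fps_nth (a J) (d - k * j))"
      unfolding T_def fps_nth_Abs_fps S ..
    also have "\<dots> = (\<Sum>j\<in>(if k * J \<le> d then {J} else {}). fps_nth (a J) (d - k * j)) +
        (\<Sum>j\<in>(if k \<le> d then Suc ` ?S (d - k) else {}). fps_nth (a J) (d - k * j))"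
      by (rule sum.union_disjoint) (use fin in auto)
    also have "(\<Sum>j\<in>(if k \<le> d then Suc ` ?S (d - k) else {}). fps_nth (a J) (d - k * j)) =
        (if k \<le> d then fps_nth T (d - k) else 0)"
      by (simp add: T_def sum.reindex)
    finally show "fps_nth T d = fps_nth (fps_X ^ (k * J) * a J + fps_X ^ k * T) d"
      by (auto simp: fps_X_power_mult_nth)
  qed
  have "fps_of_poly (1 - monom 1 k) * T = fps_X ^ (k * J) * a J"
    using iffD2[OF diff_eq_eq T] by (simp add: fps_of_poly_diff fps_of_poly_monom' left_diff_distrib)
  moreover have "1 - monom 1 k \<noteq> (0 :: rat poly)"
  proof
    assume "1 - monom 1 k = (0 :: rat poly)"
    then have "coeff (1 - monom 1 k :: rat poly) 0 = 0" by simp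
    with k show False by simp
  qed
  ultimately have T_rat: "rational_fps T"
    using rational_fps_cancel rational_fps_X_power[OF a_rat] by metis
  have "count_fps (Suc r) w M = (\<Sum>j<J. fps_X ^ (k * j) * a j) + T"
  proof (rule fps_ext)
    fix d
    have "fps_nth (count_fps (Suc r) w M) d = (\<Sum>j | k * j \<le> d. fps_nth (a j) (d - k * j))"
      using card_weight_Suc[of r M w d] Suc.prems by (simp add: count_fps_def a_def k_def)
    also have "\<dots> = (\<Sum>j\<in>{j. j < J \<and> k * j \<le> d} \<union> {j. J \<le> j \<and> k * j \<le> d}. fps_nth (a j) (d - k * j))"
      by (rule sum.cong) auto
    also have "\<dots> = (\<Sum>j\<in>{j. j < J \<and> k * j \<le> d}. fps_nth (a j) (d - k * j)) +
        (\<Sum>j\<in>{j. J \<le> j \<and> k * j \<le> d}. fps_nth (a j) (d - k * j))"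
      by (rule sum.union_disjoint) (auto intro: finite_subset[OF _ finS[of d]])
    also have "(\<Sum>j\<in>{j. J \<le> j \<and> k * j \<le> d}. fps_nth (a j) (d - k * j)) = fps_nth T d"
      unfolding T_def fps_nth_Abs_fps
    proof (rule sum.cong[OF refl])
      fix j assume "j \<in> {j. J \<le> j \<and> k * j \<le> d}"
      then have "a j = a J" by (intro aJ) simp
      then show "fps_nth (a j) (d - k * j) = fps_nth (a J) (d - k * j)" by (simp only:)
    qed
    also have "(\<Sum>j\<in>{j. j < J \<and> k * j \<le> d}. fps_nth (a j) (d - k * j)) =
        (\<Sum>j<J. fps_nth (fps_X ^ (k * j) * a j) d)"
      by (rule sum.mono_neutral_cong_left) (auto simp: fps_X_power_mult_nth)
    finally show "fps_nth (count_fps (Suc r) w M) d = fps_nth ((\<Sum>j<J. fps_X ^ (k * j) * a j) + T) d"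
      by (simp add: fps_sum_nth)
  qed
  then show ?case using a_rat T_rat by (auto intro: rational_fps_add rational_fps_sum rational_fps_X_power)
qed

subsection \<open>Submodules of finitely generated graded modules\<close>

text \<open>\<open>E (\<beta>, i)\<close> stands for the monomial \<open>y\<^sup>\<beta>\<close> times the \<open>i\<close>-th generator of a graded module over a
  polynomial ring in \<open>r\<close> variables \<open>y\<close> of weights \<open>w\<close>, and \<open>\<mu> \<gamma>\<close> for multiplication by \<open>y\<^sup>\<gamma>\<close>.
  The leading indices of a graded submodule form upward closed sets.\<close>

locale graded_module = vector_space sc for sc :: "'k::field \<Rightarrow> 'e::ab_group_add \<Rightarrow> 'e" +
  fixes r s :: nat and w e :: "nat \<Rightarrow> nat" and E :: "(nat \<Rightarrow>\<^sub>0 nat) \<times> nat \<Rightarrow> 'e"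
    and \<mu> :: "(nat \<Rightarrow>\<^sub>0 nat) \<Rightarrow> 'e \<Rightarrow> 'e"
  assumes w_pos: "\<And>i. i < r \<Longrightarrow> w i > 0"
    and \<mu>_linear: "\<And>\<gamma>. \<gamma> \<in> expo r \<Longrightarrow> Vector_Spaces.linear sc sc (\<mu> \<gamma>)"
    and \<mu>_E: "\<And>\<gamma> \<beta> i. \<gamma> \<in> expo r \<Longrightarrow> \<beta> \<in> expo r \<Longrightarrow> i < s \<Longrightarrow> \<mu> \<gamma> (E (\<beta>, i)) = E (\<beta> + \<gamma>, i)"
begin

definition idx :: "nat \<Rightarrow> ((nat \<Rightarrow>\<^sub>0 nat) \<times> nat) set" where
  "idx d = {(\<beta>, i). \<beta> \<in> expo r \<and> i < s \<and> weight r w \<beta> + e i = d}"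

definition lead :: "(nat \<Rightarrow> 'e set) \<Rightarrow> nat \<Rightarrow> ((nat \<Rightarrow>\<^sub>0 nat) \<times> nat) set" where
  "lead N d = {x\<in>idx d. \<exists>v\<in>N d. v - E x \<in> span (E ` {y\<in>idx d. y < x})}"

lemma idx_finite: "finite (idx d)"
proof (rule finite_subset)
  show "idx d \<subseteq> (\<Union>c\<le>d. {\<beta>\<in>expo r. weight r w \<beta> = c}) \<times> {..<s}" by (auto simp: idx_def)
qed (use weight_finite[OF w_pos] in auto)

text \<open>Multiplication by a monomial preserves the order of the indices, so the leading exponents that belong
  to one generator form an upward closed set.\<close>

lemma lead_rational:
  assumes N: "\<And>\<gamma> d v. \<gamma> \<in> expo r \<Longrightarrow> v \<in> N d \<Longrightarrow> \<mu> \<gamma> v \<in> N (d + weight r w \<gamma>)"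
  shows "rational_fps (Abs_fps (\<lambda>d. of_nat (card (lead N d))))"
proof -
  define M where "M i = {\<beta>\<in>expo r. (\<beta>, i) \<in> lead N (weight r w \<beta> + e i)}" for i
  have up: "up_closed r (M i)" if i: "i < s" for i
    unfolding up_closed_def
  proof (intro conjI ballI)
    show "M i \<subseteq> expo r" by (auto simp: M_def)
    fix \<beta> \<gamma> assume "\<beta> \<in> M i" and \<gamma>: "\<gamma> \<in> expo r"
    then have \<beta>: "\<beta> \<in> expo r" "(\<beta>, i) \<in> lead N (weight r w \<beta> + e i)" by (auto simp: M_def)
    define d where "d = weight r w \<beta> + e i"
    define d' where "d' = weight r w (\<beta> + \<gamma>) + e i"
    have d': "d' = d + weight r w \<gamma>" by (simp add: d_def d'_def weight_add)
    obtain v where v: "v \<in> N d" "v - E (\<beta>, i) \<in> span (E ` {y\<in>idx d. y < (\<beta>, i)})"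
      using \<beta>(2) by (auto simp: lead_def d_def)
    interpret m: Vector_Spaces.linear sc sc "\<mu> \<gamma>" by (rule \<mu>_linear[OF \<gamma>])
    have "\<mu> \<gamma> (v - E (\<beta>, i)) \<in> span (\<mu> \<gamma> ` E ` {y\<in>idx d. y < (\<beta>, i)})"
      using v(2) m.span_image by blast
    also have "\<dots> \<subseteq> span (E ` {y\<in>idx d'. y < (\<beta> + \<gamma>, i)})"
    proof (rule span_mono, rule subsetI)
      fix z assume "z \<in> \<mu> \<gamma> ` E ` {y\<in>idx d. y < (\<beta>, i)}"
      then obtain \<beta>' i' where y: "(\<beta>', i') \<in> idx d" "(\<beta>', i') < (\<beta>, i)" "z = \<mu> \<gamma> (E (\<beta>', i'))" by auto
      then have z: "z = E (\<beta>' + \<gamma>, i')" using \<mu>_E[OF \<gamma>] by (auto simp: idx_def)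
      have "(\<beta>' + \<gamma>, i') \<in> idx d'" using y(1) \<gamma> by (auto simp: idx_def expo_add weight_add d')
      moreover have "(\<beta>' + \<gamma>, i') < (\<beta> + \<gamma>, i)" using y(2) by (auto simp: less_prod_simp)
      ultimately show "z \<in> E ` {y\<in>idx d'. y < (\<beta> + \<gamma>, i)}" using z by blast
    qed
    finally have "\<mu> \<gamma> v - E (\<beta> + \<gamma>, i) \<in> span (E ` {y\<in>idx d'. y < (\<beta> + \<gamma>, i)})"
      using \<mu>_E[OF \<gamma> \<beta>(1) i] by (simp add: m.diff)
    moreover have "\<mu> \<gamma> v \<in> N d'" using N[OF \<gamma> v(1)] by (simp add: d')
    moreover have "(\<beta> + \<gamma>, i) \<in> idx d'" using \<beta>(1) \<gamma> i by (auto simp: idx_def expo_add d'_def)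
    ultimately have "(\<beta> + \<gamma>, i) \<in> lead N d'" by (auto simp: lead_def)
    then show "\<beta> + \<gamma> \<in> M i" using \<beta>(1) \<gamma> by (simp add: M_def expo_add d'_def)
  qed
  have "Abs_fps (\<lambda>d. of_nat (card (lead N d))) = (\<Sum>i<s. fps_X ^ e i * count_fps r w (M i))"
  proof (rule fps_ext)
    fix d
    let ?S = "\<lambda>i. {\<beta>\<in>M i. weight r w \<beta> + e i = d}"
    have "lead N d = (\<Union>i<s. (\<lambda>\<beta>. (\<beta>, i)) ` ?S i)"
      by (auto simp: lead_def M_def idx_def)
    moreover have fin: "finite (?S i)" for i
      by (rule finite_subset[OF _ finite_imageI[OF idx_finite[of d], of fst]])
         (force simp: M_def lead_def)
    ultimately have "card (lead N d) = (\<Sum>i<s. card ((\<lambda>\<beta>. (\<beta>, i)) ` ?S i))"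
      by (simp only:) (rule card_UN_disjoint, auto)
    also have "\<dots> = (\<Sum>i<s. card (?S i))" by (intro sum.cong refl card_image) (simp add: inj_on_def)
    finally have "of_nat (card (lead N d)) = (\<Sum>i<s. of_nat (card (?S i)) :: rat)" by simp
    also have "\<dots> = (\<Sum>i<s. fps_nth (fps_X ^ e i * count_fps r w (M i)) d)"
    proof (rule sum.cong[OF refl])
      fix i
      show "of_nat (card (?S i)) = fps_nth (fps_X ^ e i * count_fps r w (M i)) d"
      proof (cases "e i \<le> d")
        case True
        then have "?S i = {\<beta>\<in>M i. weight r w \<beta> = d - e i}" by auto
        with True show ?thesis by (simp add: fps_X_power_mult_nth count_fps_def)
      next
        case False
        then have "?S i = {}" by auto
        with False show ?thesis by (simp add: fps_X_power_mult_nth)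
      qed
    qed
    finally show "fps_nth (Abs_fps (\<lambda>d. of_nat (card (lead N d)))) d =
        fps_nth (\<Sum>i<s. fps_X ^ e i * count_fps r w (M i)) d" by (simp add: fps_sum_nth)
  qed
  then show ?thesis
    using count_fps_rational[OF up] w_pos by (auto intro!: rational_fps_sum rational_fps_X_power)
qed

text \<open>The leading indices of the zero submodule account for the linear relations between the \<open>E x\<close>; the
  dimension is the difference of the two counts.\<close>

theorem hilbert_fps_rational:
  assumes N: "\<And>d. subspace (N d)" "\<And>d. N d \<subseteq> span (E ` idx d)"
    and \<mu>N: "\<And>\<gamma> d v. \<gamma> \<in> expo r \<Longrightarrow> v \<in> N d \<Longrightarrow> \<mu> \<gamma> v \<in> N (d + weight r w \<gamma>)"
  shows "rational_fps (hilbert_fps sc N)"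
proof -
  have "hilbert_fps sc N = Abs_fps (\<lambda>d. of_nat (card (lead N d))) -
      Abs_fps (\<lambda>d. of_nat (card (lead (\<lambda>_. {0}) d)))"
  proof (rule fps_ext)
    fix d
    have neg: "0 - E x \<in> span X \<longleftrightarrow> E x \<in> span X" for x X
      using span_neg[of "E x" X] span_neg[of "- E x" X] by auto
    have "lead (\<lambda>_. {0}) d = {x\<in>idx d. E x \<in> span (E ` {y\<in>idx d. y < x})}"
      unfolding lead_def bex_simps neg by simp
    moreover have "N d \<inter> span (E ` idx d) = N d" using N(2) by blast
    ultimately have "dim (N d) + card (lead (\<lambda>_. {0}) d) = card (lead N d)"
      using dim_leading_indices[OF N(1)[of d] idx_finite[of d], of E] by (simp add: lead_def)
    then have "rat_of_nat (dim (N d)) + of_nat (card (lead (\<lambda>_. {0}) d)) = of_nat (card (lead N d))"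
      by (simp flip: of_nat_add)
    then show "fps_nth (hilbert_fps sc N) d = fps_nth (Abs_fps (\<lambda>d. of_nat (card (lead N d))) -
      Abs_fps (\<lambda>d. of_nat (card (lead (\<lambda>_. {0}) d)))) d"
      by (simp add: hilbert_fps_def)
  qed
  moreover have "\<mu> \<gamma> v \<in> {0}" if "\<gamma> \<in> expo r" "v \<in> {0}" for \<gamma> v
  proof -
    interpret m: Vector_Spaces.linear sc sc "\<mu> \<gamma>" by (rule \<mu>_linear[OF that(1)])
    show ?thesis using that(2) m.zero by simp
  qed
  ultimately show ?thesis
    using rational_fps_diff[OF lead_rational[of N] lead_rational[of "\<lambda>_. {0}"]] \<mu>N by simp
qed

end

section \<open>Generators over orbit polynomials\<close>

context covariants
begin

text \<open>The coefficients of the orbit polynomials of the variables, numbered consecutively: the index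
  \<open>i * card G + (c - 1)\<close> belongs to the coefficient of degree \<open>c\<close> in the orbit polynomial of \<open>X\<^sub>i\<close>,
  where \<open>1 \<le> c \<le> card G\<close>.\<close>

definition orb :: "nat \<Rightarrow> 'k mpoly" where
  "orb k = esym G (pvar (k div card G)) (k mod card G + 1)"

definition orb_deg :: "nat \<Rightarrow> nat" where
  "orb_deg k = k mod card G + 1"

abbreviation "orb_num \<equiv> length bs * card G"

definition orb_mon :: "(nat \<Rightarrow>\<^sub>0 nat) \<Rightarrow> 'k mpoly" where
  "orb_mon \<beta> = (\<Prod>k\<in>Poly_Mapping.keys \<beta>. orb k ^ Poly_Mapping.lookup \<beta> k)"

definition small_expo :: "(nat \<Rightarrow>\<^sub>0 nat) set" where
  "small_expo = {\<alpha>. Poly_Mapping.keys \<alpha> \<subseteq> {..<length bs} \<and> (\<forall>i. Poly_Mapping.lookup \<alpha> i < card G)}"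

text \<open>Some enumeration; it numbers the generators of \<open>k[V]\<close> as a module.\<close>

definition small_list :: "(nat \<Rightarrow>\<^sub>0 nat) list" where
  "small_list = (SOME xs. set xs = small_expo)"

lemma card_G_pos: "card G > 0"
  using G_finite G_id by (auto simp: card_gt_0_iff)

lemma small_expo_finite: "finite small_expo"
proof (rule finite_subset)
  show "small_expo \<subseteq> (\<Union>d\<le>length bs * card G. monomials (length bs) d)"
  proof
    fix \<alpha> assume \<alpha>: "\<alpha> \<in> small_expo"
    have "mdeg \<alpha> \<le> (\<Sum>i<length bs. Poly_Mapping.lookup \<alpha> i)"
      unfolding mdeg_def using \<alpha> by (intro sum_mono2) (auto simp: small_expo_def)
    also have "\<dots> \<le> (\<Sum>i<length bs. card G)"
      using \<alpha> by (intro sum_mono) (auto simp: small_expo_def less_imp_le)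
    finally show "\<alpha> \<in> (\<Union>d\<le>length bs * card G. monomials (length bs) d)"
      using \<alpha> by (auto simp: monomials_def small_expo_def)
  qed
qed (use monomials_finite in auto)

lemma set_small_list: "set small_list = small_expo"
  unfolding small_list_def using finite_list[OF small_expo_finite] by (rule someI_ex)

lemma orb_index: "k < orb_num \<Longrightarrow> k div card G < length bs"
  by (simp add: less_mult_imp_div_less)

lemma orb_inv_ring: "k < orb_num \<Longrightarrow> orb k \<in> inv_ring G"
  unfolding orb_def by (intro esym_inv_ring subgrp_G polyR_pvar orb_index)

lemma orb_homogeneous: "homogeneous (orb_deg k) (orb k)"
  unfolding orb_def orb_deg_def using esym_homogeneous[OF homogeneous_pvar, of "k mod card G + 1"] by simp

lemma orb_mon_add: "orb_mon (\<beta> + \<gamma>) = orb_mon \<beta> * orb_mon \<gamma>"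
  unfolding orb_mon_def by (rule monomial_value_add)

lemma orb_mon_inv_ring: "\<beta> \<in> expo orb_num \<Longrightarrow> orb_mon \<beta> \<in> inv_ring G"
  unfolding orb_mon_def by (intro inv_ring_prod inv_ring_power orb_inv_ring) (auto simp: expo_def)

lemma orb_mon_homogeneous:
  assumes "\<beta> \<in> expo orb_num"
  shows "homogeneous (weight orb_num orb_deg \<beta>) (orb_mon \<beta>)"
proof -
  have "homogeneous (\<Sum>k\<in>Poly_Mapping.keys \<beta>. Poly_Mapping.lookup \<beta> k * orb_deg k) (orb_mon \<beta>)"
    unfolding orb_mon_def by (intro homogeneous_prod homogeneous_power orb_homogeneous)
  also have "(\<Sum>k\<in>Poly_Mapping.keys \<beta>. Poly_Mapping.lookup \<beta> k * orb_deg k) = weight orb_num orb_deg \<beta>"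
    unfolding weight_def using assms
    by (intro sum.mono_neutral_cong_left) (auto simp: expo_def in_keys_iff mult.commute)
  finally show ?thesis .
qed

text \<open>The degree \<open>d\<close> part of the module generated by the small monomials over the algebra generated by
  the \<open>orb k\<close>. It turns out to be the whole degree \<open>d\<close> part of \<open>k[V]\<close>.\<close>

definition orb_span :: "nat \<Rightarrow> 'k mpoly set" where
  "orb_span d = P.span {orb_mon \<beta> * Poly_Mapping.single \<alpha> 1 | \<beta> \<alpha>.
     \<beta> \<in> expo orb_num \<and> \<alpha> \<in> small_expo \<and> weight orb_num orb_deg \<beta> + mdeg \<alpha> = d}"

lemma mult_linear: "Vector_Spaces.linear pscale pscale (\<lambda>p. q * p)"
  unfolding Vector_Spaces.linear_iff by (auto simp: vector_space_pscale pscale_def algebra_simps)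

lemma orb_span_mult:
  assumes "p \<in> orb_span d" "\<gamma> \<in> expo orb_num"
  shows "orb_mon \<gamma> * p \<in> orb_span (d + weight orb_num orb_deg \<gamma>)"
proof -
  interpret m: Vector_Spaces.linear pscale pscale "\<lambda>p. orb_mon \<gamma> * p" by (rule mult_linear)
  have "orb_mon \<gamma> * p \<in> P.span ((\<lambda>p. orb_mon \<gamma> * p) ` {orb_mon \<beta> * Poly_Mapping.single \<alpha> 1 | \<beta> \<alpha>.
     \<beta> \<in> expo orb_num \<and> \<alpha> \<in> small_expo \<and> weight orb_num orb_deg \<beta> + mdeg \<alpha> = d})"
    using assms(1) m.span_image unfolding orb_span_def by blast
  also have "\<dots> \<subseteq> orb_span (d + weight orb_num orb_deg \<gamma>)"
    unfolding orb_span_def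
  proof (rule P.span_mono, rule subsetI)
    fix z assume "z \<in> (\<lambda>p. orb_mon \<gamma> * p) ` {orb_mon \<beta> * Poly_Mapping.single \<alpha> 1 | \<beta> \<alpha>.
     \<beta> \<in> expo orb_num \<and> \<alpha> \<in> small_expo \<and> weight orb_num orb_deg \<beta> + mdeg \<alpha> = d}"
    then obtain \<beta> \<alpha> where "z = orb_mon \<gamma> * (orb_mon \<beta> * Poly_Mapping.single \<alpha> 1)" "\<beta> \<in> expo orb_num"
      "\<alpha> \<in> small_expo" "weight orb_num orb_deg \<beta> + mdeg \<alpha> = d" by blast
    then show "z \<in> {orb_mon \<beta> * Poly_Mapping.single \<alpha> 1 | \<beta> \<alpha>. \<beta> \<in> expo orb_num \<and> \<alpha> \<in> small_expo \<and>
        weight orb_num orb_deg \<beta> + mdeg \<alpha> = d + weight orb_num orb_deg \<gamma>}"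
      using assms(2) by (intro CollectI exI[of _ "\<beta> + \<gamma>"] exI[of _ \<alpha>])
        (auto simp: orb_mon_add expo_add weight_add mult_ac)
  qed
  finally show ?thesis .
qed

lemma mdeg_add_single: "mdeg (a + Poly_Mapping.single i j) = mdeg a + j"
proof -
  have "homogeneous (mdeg a) (Poly_Mapping.single a (1::rat))" "homogeneous j (Poly_Mapping.single (Poly_Mapping.single i j) (1::rat))"
    by (auto simp: homogeneous_def mdeg_def)
  from homogeneous_mult[OF this] show ?thesis
    by (simp add: mult_single homogeneous_iff_mdeg)
qed

text \<open>\<open>X\<^sub>i\<close> is a root of its orbit polynomial; the relation \<open>X\<^sub>i ^ card G = - \<Sum>\<^sub>c X\<^sub>i ^ (card G - c) * e\<^sub>c\<close> lowers
  the exponents below \<open>card G\<close>.\<close>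

lemma monomial_orb_span:
  assumes "a \<in> monomials (length bs) d"
  shows "Poly_Mapping.single a 1 \<in> orb_span d"
  using assms
proof (induction d arbitrary: a rule: less_induct)
  case (less d)
  show ?case
  proof (cases "a \<in> small_expo")
    case True
    have "Poly_Mapping.single a 1 = orb_mon 0 * Poly_Mapping.single a 1" by (simp add: orb_mon_def)
    then show ?thesis unfolding orb_span_def
      using True less.prems expo_zero by (intro P.span_base CollectI exI[of _ 0] exI[of _ a])
        (auto simp: weight_def monomials_def)
  next
    case False
    define g where "g = card G"
    have g: "g > 0" using card_G_pos by (simp add: g_def)
    obtain i where i: "Poly_Mapping.lookup a i \<ge> g"
      using False less.prems by (auto simp: small_expo_def monomials_def g_def not_less)
    then have "i \<in> Poly_Mapping.keys a" using g by (auto simp: in_keys_iff)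
    then have ib: "i < length bs" using less.prems by (auto simp: monomials_def)
    define a' where "a' = Poly_Mapping.update i (Poly_Mapping.lookup a i - g) a"
    have a: "a = a' + Poly_Mapping.single i g"
      using i by (intro poly_mapping_eqI) (auto simp: a'_def lookup_add lookup_update lookup_single when_def)
    have "Poly_Mapping.keys a' \<subseteq> insert i (Poly_Mapping.keys a)"
      by (auto simp: a'_def in_keys_iff lookup_update split: if_splits)
    then have keys: "Poly_Mapping.keys a' \<subseteq> {..<length bs}"
      using less.prems ib unfolding monomials_def by blast
    have d: "d = mdeg a' + g" using less.prems a by (simp add: monomials_def mdeg_add_single)
    let ?X = "pvar i :: 'k mpoly"
    have X: "?X \<in> polyR (length bs)" using ib by (rule polyR_pvar)
    have e0: "esym G ?X 0 = 1"
    proof -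
      have "A = {}" if "A \<subseteq> G" "card A = 0" for A
        using that finite_subset[OF that(1) G_finite] by simp
      then have "{A. A \<subseteq> G \<and> card A = 0} = {{}}" by auto
      then show ?thesis by (simp add: esym_def)
    qed
    have "(\<Prod>h\<in>G. ?X - act h ?X) = 0"
      by (rule prod_zero[OF G_finite]) (rule bexI[of _ id], use G_id act_id[OF X] in auto)
    then have "0 = (\<Sum>c\<le>g. ?X ^ (g - c) * esym G ?X c)"
      using esym_expand[OF G_finite, of ?X ?X] by (simp add: g_def)
    also have "\<dots> = ?X ^ g + (\<Sum>c\<in>{..g} - {0}. ?X ^ (g - c) * esym G ?X c)"
      by (subst sum.remove[of _ 0]) (auto simp: e0)
    finally have rel: "?X ^ g = - (\<Sum>c\<in>{..g} - {0}. ?X ^ (g - c) * esym G ?X c)"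
      by (simp add: eq_neg_iff_add_eq_0)
    have "Poly_Mapping.single a 1 = Poly_Mapping.single a' 1 * ?X ^ g"
      by (subst a) (simp add: pvar_power mult_single)
    also have "\<dots> = - (\<Sum>c\<in>{..g} - {0}. esym G ?X c * Poly_Mapping.single (a' + Poly_Mapping.single i (g - c)) 1)"
    proof -
      have "Poly_Mapping.single a' 1 * (?X ^ (g - c) * esym G ?X c) =
          esym G ?X c * Poly_Mapping.single (a' + Poly_Mapping.single i (g - c)) 1" for c
      proof -
        have "Poly_Mapping.single a' 1 * (?X ^ (g - c) * esym G ?X c) =
            esym G ?X c * (Poly_Mapping.single a' 1 * ?X ^ (g - c))" by (simp only: mult_ac)
        also have "Poly_Mapping.single a' 1 * ?X ^ (g - c) = Poly_Mapping.single (a' + Poly_Mapping.single i (g - c)) 1"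
          by (simp add: pvar_power mult_single)
        finally show ?thesis .
      qed
      then show ?thesis unfolding rel mult_minus_right sum_distrib_left by (simp only:)
    qed
    also have "\<dots> \<in> orb_span d"
      unfolding orb_span_def
    proof (intro P.span_neg P.span_sum, unfold orb_span_def[symmetric])
      fix c assume c: "c \<in> {..g} - {0}"
      let ?b = "a' + Poly_Mapping.single i (g - c)"
      have "?b \<in> monomials (length bs) (d - c)"
        using keys keys_add[of a' "Poly_Mapping.single i (g - c)"] ib c d
        by (auto simp: monomials_def mdeg_add_single split: if_splits)
      then have IH: "Poly_Mapping.single ?b 1 \<in> orb_span (d - c)"
        using c d by (intro less.IH) auto
      define k where "k = i * g + (c - 1)"
      obtain e where e: "c = Suc e" "e < g" using c by (cases c) auto
      then have "k = i * g + e" by (simp add: k_def)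
      then have km: "k div g = i" "k mod g + 1 = c" using e by simp_all
      have kn: "k < orb_num"
      proof -
        have "k < i * g + g" using c g by (auto simp: k_def)
        also have "\<dots> = Suc i * g" by simp
        also have "\<dots> \<le> length bs * g" using ib by (intro mult_le_mono1) simp
        finally show ?thesis by (simp add: g_def)
      qed
      have om: "orb_mon (Poly_Mapping.single k 1) = esym G ?X c"
        unfolding orb_mon_def orb_def using km by (simp add: g_def)
      have "weight orb_num orb_deg (Poly_Mapping.single k 1) = (\<Sum>j<orb_num. if j = k then orb_deg k else 0)"
        unfolding weight_def by (rule sum.cong) (auto simp: lookup_single when_def)
      then have "weight orb_num orb_deg (Poly_Mapping.single k 1) = c"
        using kn km by (simp add: orb_deg_def g_def)
      moreover have "Poly_Mapping.single k 1 \<in> expo orb_num" by (rule expo_single[OF kn])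
      ultimately have "esym G ?X c * Poly_Mapping.single ?b 1 \<in> orb_span (d - c + c)"
        using orb_span_mult[OF IH, of "Poly_Mapping.single k 1"] om by simp
      then show "esym G ?X c * Poly_Mapping.single ?b 1 \<in> orb_span d" using c d by simp
    qed
    finally show ?thesis .
  qed
qed

lemma homogeneous_orb_span: "p \<in> polyR (length bs) \<Longrightarrow> homogeneous d p \<Longrightarrow> p \<in> orb_span d"
proof -
  assume "p \<in> polyR (length bs)" "homogeneous d p"
  then have "p \<in> P.span (monomial_basis (length bs) d)" by (rule homogeneous_span)
  also have "\<dots> \<subseteq> orb_span d"
    unfolding orb_span_def
    by (rule P.span_minimal) (use monomial_orb_span in \<open>auto simp: monomial_basis_def orb_span_def\<close>)
  finally show ?thesis .
qed

lemma ring_graded_module: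
  "graded_module pscale orb_num (length small_list) orb_deg
     (\<lambda>(\<beta>, i). orb_mon \<beta> * Poly_Mapping.single (small_list ! i) 1) (\<lambda>\<gamma> p. orb_mon \<gamma> * p)"
proof (rule graded_module.intro[OF vector_space_pscale], rule graded_module_axioms.intro, goal_cases)
  case (1 i) show ?case by (simp add: orb_deg_def)
next
  case (2 \<gamma>) show ?case by (rule mult_linear)
next
  case (3 \<gamma> \<beta> i) show ?case by (simp add: orb_mon_add mult_ac)
qed

lemma ring_index_span:
  "orb_span d \<subseteq> P.span ((\<lambda>(\<beta>, i). orb_mon \<beta> * Poly_Mapping.single (small_list ! i) 1) `
     graded_module.idx orb_num (length small_list) orb_deg (\<lambda>i. mdeg (small_list ! i)) d)"
proof -
  interpret gm: graded_module pscale orb_num "length small_list" orb_deg "\<lambda>i. mdeg (small_list ! i)"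
     "\<lambda>(\<beta>, i). orb_mon \<beta> * Poly_Mapping.single (small_list ! i) 1" "\<lambda>\<gamma> p. orb_mon \<gamma> * p"
    by (rule ring_graded_module)
  show ?thesis unfolding orb_span_def
  proof (rule P.span_mono, rule subsetI)
    fix z assume "z \<in> {orb_mon \<beta> * Poly_Mapping.single \<alpha> (1::'k) | \<beta> \<alpha>.
     \<beta> \<in> expo orb_num \<and> \<alpha> \<in> small_expo \<and> weight orb_num orb_deg \<beta> + mdeg \<alpha> = d}"
    then obtain \<beta> \<alpha> where z: "z = orb_mon \<beta> * Poly_Mapping.single \<alpha> 1" "\<beta> \<in> expo orb_num"
      "\<alpha> \<in> set small_list" "weight orb_num orb_deg \<beta> + mdeg \<alpha> = d" by (auto simp: set_small_list)
    obtain i where "i < length small_list" "\<alpha> = small_list ! i" using z(3) by (auto simp: in_set_conv_nth)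
    with z show "z \<in> (\<lambda>(\<beta>, i). orb_mon \<beta> * Poly_Mapping.single (small_list ! i) 1) ` gm.idx d"
      by (intro image_eqI[of _ _ "(\<beta>, i)"]) (auto simp: gm.idx_def)
  qed
qed

theorem inv_fps_rational:
  assumes "H \<subseteq> G"
  shows "rational_fps (inv_fps H)"
proof -
  interpret gm: graded_module pscale orb_num "length small_list" orb_deg "\<lambda>i. mdeg (small_list ! i)"
     "\<lambda>(\<beta>, i). orb_mon \<beta> * Poly_Mapping.single (small_list ! i) 1" "\<lambda>\<gamma> p. orb_mon \<gamma> * p"
    by (rule ring_graded_module)
  show ?thesis
  proof (rule gm.hilbert_fps_rational)
    show "P.subspace (inv_ring_deg H d)" for d by (rule inv_ring_deg_subspace)
    show "inv_ring_deg H d \<subseteq> P.span ((\<lambda>(\<beta>, i). orb_mon \<beta> * Poly_Mapping.single (small_list ! i) 1) ` gm.idx d)" for d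
      using homogeneous_orb_span ring_index_span[of d] by (auto simp: inv_ring_deg_def dest!: inv_ringD(1))
    fix \<gamma> d v assume "\<gamma> \<in> expo orb_num" "v \<in> inv_ring_deg H d"
    moreover from this(1) have "orb_mon \<gamma> \<in> inv_ring H"
      using orb_mon_inv_ring assms by (auto simp: inv_ring_def)
    ultimately show "orb_mon \<gamma> * v \<in> inv_ring_deg H (d + weight orb_num orb_deg \<gamma>)"
      using homogeneous_mult[OF orb_mon_homogeneous, of \<gamma> d v]
      by (auto simp: inv_ring_deg_def inv_ring_closed add.commute)
  qed
qed

lemma scale_tensor_linear: "Vector_Spaces.linear tensor_scale tensor_scale (\<lambda>a i. q * a i)"
  unfolding Vector_Spaces.linear_iff
  by (auto simp: vector_space_tensor_scale tensor_scale_def fun_eq_iff algebra_simps)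

text \<open>\<open>k[V] \<otimes> M\<close> is generated by the small monomials in each of the \<open>m\<close> components; the generator \<open>k\<close> is the
  small monomial number \<open>k div m\<close> in the component \<open>k mod m\<close>.\<close>

theorem cov_fps_rational:
  assumes "H \<subseteq> G"
  shows "rational_fps (cov_fps H)"
proof -
  define m where "m = length vs"
  define E where "E = (\<lambda>(\<beta>, k). unit_tensor (k mod m) (orb_mon \<beta> * Poly_Mapping.single (small_list ! (k div m)) (1::'k)))"
  interpret gm: graded_module tensor_scale orb_num "length small_list * m" orb_deg "\<lambda>k. mdeg (small_list ! (k div m))"
     E "\<lambda>\<gamma> a i. orb_mon \<gamma> * a i"
  proof (rule graded_module.intro[OF vector_space_tensor_scale], rule graded_module_axioms.intro, goal_cases)
    case (1 i) show ?case by (simp add: orb_deg_def)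
  next
    case (2 \<gamma>) show ?case by (rule scale_tensor_linear)
  next
    case (3 \<gamma> \<beta> i) show ?case by (auto simp: E_def unit_tensor_def orb_mon_add fun_eq_iff mult_ac)
  qed
  interpret rm: graded_module pscale orb_num "length small_list" orb_deg "\<lambda>i. mdeg (small_list ! i)"
     "\<lambda>(\<beta>, i). orb_mon \<beta> * Poly_Mapping.single (small_list ! i) 1" "\<lambda>\<gamma> p. orb_mon \<gamma> * p"
    by (rule ring_graded_module)
  show ?thesis
  proof (rule gm.hilbert_fps_rational)
    show "T.subspace (cov_deg H d)" for d by (rule cov_deg_subspace)
    show "cov_deg H d \<subseteq> T.span (E ` gm.idx d)" for d
    proof
      fix a assume a: "a \<in> cov_deg H d"
      have ts: "a \<in> tensor_space" using covD(1)[OF cov_degD(1)[OF a]] .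
      have "unit_tensor l (a l) \<in> T.span (E ` gm.idx d)" if l: "l < m" for l
      proof -
        interpret u: Vector_Spaces.linear pscale tensor_scale "unit_tensor l" by (rule unit_tensor_linear)
        let ?R = "(\<lambda>(\<beta>, i). orb_mon \<beta> * Poly_Mapping.single (small_list ! i) (1::'k)) ` rm.idx d"
        have "a l \<in> P.span ?R"
          using homogeneous_orb_span[OF tensor_spaceD[OF ts] cov_degD(2)[OF a]] ring_index_span[of d] by blast
        then have "unit_tensor l (a l) \<in> T.span (unit_tensor l ` ?R)" using u.span_image by blast
        also have "\<dots> \<subseteq> T.span (E ` gm.idx d)"
        proof (rule T.span_mono, rule subsetI)
          fix z assume "z \<in> unit_tensor l ` ?R"
          then obtain \<beta> i where z: "z = unit_tensor l (orb_mon \<beta> * Poly_Mapping.single (small_list ! i) 1)"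
            "(\<beta>, i) \<in> rm.idx d" by auto
          have i: "i < length small_list" using z(2) by (simp add: rm.idx_def)
          have "i * m + l < Suc i * m" using l by simp
          also have "\<dots> \<le> length small_list * m" using i by (intro mult_le_mono1) simp
          finally have "(\<beta>, i * m + l) \<in> gm.idx d" using z(2) l by (simp add: rm.idx_def gm.idx_def)
          moreover have "z = E (\<beta>, i * m + l)" using z(1) l by (simp add: E_def)
          ultimately show "z \<in> E ` gm.idx d" by blast
        qed
        finally show ?thesis .
      qed
      then have "(\<Sum>l<length vs. unit_tensor l (a l)) \<in> T.span (E ` gm.idx d)"
        by (intro T.span_sum) (auto simp: m_def)
      then show "a \<in> T.span (E ` gm.idx d)" using tensor_unit_sum[OF ts] by simp
    qed
    fix \<gamma> d v assume \<gamma>: "\<gamma> \<in> expo orb_num" and v: "v \<in> cov_deg H d"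
    have "orb_mon \<gamma> \<in> inv_ring H"
      using orb_mon_inv_ring[OF \<gamma>] assms by (auto simp: inv_ring_def)
    then have "(\<lambda>i. orb_mon \<gamma> * v i) \<in> cov H"
      using cov_sum[of "{()}" "\<lambda>_. orb_mon \<gamma>" H "\<lambda>_. v"] cov_degD(1)[OF v] by simp
    moreover have "homogeneous (d + weight orb_num orb_deg \<gamma>) (orb_mon \<gamma> * v i)" for i
      using homogeneous_mult[OF orb_mon_homogeneous[OF \<gamma>] cov_degD(2)[OF v]] by (simp add: add.commute)
    ultimately show "(\<lambda>i. orb_mon \<gamma> * v i) \<in> cov_deg H (d + weight orb_num orb_deg \<gamma>)"
      by (intro cov_degI)
  qed
qed

end

section \<open>Evaluation of power series near 1\<close>

interpretation of_rat_real: comm_ring_hom "of_rat :: rat \<Rightarrow> real"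
  by unfold_locales (simp_all add: of_rat_add of_rat_mult)

interpretation of_rat_real_poly: map_poly_comm_ring_hom "of_rat :: rat \<Rightarrow> real" ..

definition ev :: "rat poly \<Rightarrow> real \<Rightarrow> real" where
  "ev p t = poly (map_poly of_rat p) t"

lemma ev_pCons: "ev (pCons a p) t = of_rat a + t * ev p t"
proof -
  have "map_poly of_rat (pCons a p) = pCons (of_rat a :: real) (map_poly of_rat p)"
    by (rule poly_eqI) (simp add: coeff_map_poly coeff_pCons split: nat.split)
  then show ?thesis by (simp add: ev_def)
qed

lemma ev_simps:
  "ev (p + q) t = ev p t + ev q t" "ev (p - q) t = ev p t - ev q t" "ev (p * q) t = ev p t * ev q t"
  "ev 1 t = 1" "ev 0 t = 0" "ev [:c:] t = of_rat c" "ev (p ^ n) t = ev p t ^ n"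
  "ev (monom c k) t = of_rat c * t ^ k" "ev [:-1, 1:] t = t - 1"
  by (simp_all add: ev_def of_rat_real_poly.hom_add of_rat_real_poly.hom_minus of_rat_real_poly.hom_mult
      of_rat_real_poly.hom_power poly_monom map_poly_monom ev_pCons[unfolded ev_def])

lemma ev_sum: "ev (\<Sum>x\<in>X. f x) t = (\<Sum>x\<in>X. ev (f x) t)"
  by (induction X rule: infinite_finite_induct) (auto simp: ev_simps)

lemma ev_1: "ev p 1 = of_rat (poly p 1)"
  by (induction p) (auto simp: ev_pCons ev_simps of_rat_add)

lemma ev_tendsto: "(ev p \<longlongrightarrow> ev p 1) (at_left 1)"
  unfolding ev_def by (intro tendsto_intros)

lemma ev_nonzero_eventually:
  assumes "p \<noteq> 0" shows "eventually (\<lambda>t. ev p t \<noteq> 0) (at_left 1)"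
proof -
  have "map_poly (of_rat :: rat \<Rightarrow> real) p \<noteq> 0" using assms by (simp add: map_poly_eq_0_iff)
  then have fin: "finite {t. ev p t = 0}" unfolding ev_def by (rule poly_roots_finite)
  have "eventually (\<lambda>t. \<forall>x\<in>{t. ev p t = 0}. t \<noteq> x) (at_left 1)"
    by (rule eventually_ball_finite[OF fin]) (auto intro: eventually_neq_at_within)
  then show ?thesis by (rule eventually_mono) auto
qed

text \<open>Convergence on the real interval between \<open>0\<close> and \<open>1\<close>, where Hilbert functions are compared.\<close>

definition rconv :: "rat fps \<Rightarrow> bool" where
  "rconv A \<longleftrightarrow> (\<forall>t::real. 0 < t \<and> t < 1 \<longrightarrow> summable (\<lambda>d. of_rat (fps_nth A d) * t ^ d))"

definition rval :: "rat fps \<Rightarrow> real \<Rightarrow> real" where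
  "rval A t = suminf (\<lambda>d. of_rat (fps_nth A d) * t ^ d)"

lemma rconv_add:
  assumes "rconv A" "rconv B"
  shows "rconv (A + B)" "0 < t \<Longrightarrow> t < 1 \<Longrightarrow> rval (A + B) t = rval A t + rval B t"
  using assms by (auto simp: rconv_def rval_def of_rat_add distrib_right summable_add suminf_add)

lemma rconv_const:
  assumes "rconv A"
  shows "rconv (fps_const c * A)" "0 < t \<Longrightarrow> t < 1 \<Longrightarrow> rval (fps_const c * A) t = of_rat c * rval A t"
  using assms by (auto simp: rconv_def rval_def of_rat_mult mult.assoc summable_mult suminf_mult)

lemma rconv_X:
  assumes "rconv A"
  shows "rconv (fps_X * A)" "0 < t \<Longrightarrow> t < 1 \<Longrightarrow> rval (fps_X * A) t = t * rval A t"
proof -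
  have eq: "of_rat (fps_nth (fps_X * A) (Suc d)) * t ^ Suc d = t * (of_rat (fps_nth A d) * t ^ d)" for d and t :: real
    by simp
  show c: "rconv (fps_X * A)" unfolding rconv_def
  proof (intro allI impI)
    fix t :: real assume "0 < t \<and> t < 1"
    then have "summable (\<lambda>d. t * (of_rat (fps_nth A d) * t ^ d))"
      using assms by (intro summable_mult) (simp add: rconv_def)
    then show "summable (\<lambda>d. of_rat (fps_nth (fps_X * A) d) * t ^ d)"
      unfolding eq[symmetric] by (rule summable_Suc_iff[THEN iffD1])
  qed
  assume t: "0 < t" "t < 1"
  have "rval (fps_X * A) t = suminf (\<lambda>d. of_rat (fps_nth (fps_X * A) (Suc d)) * t ^ Suc d) +
      of_rat (fps_nth (fps_X * A) 0) * t ^ 0"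
    unfolding rval_def using c t suminf_split_head[of "\<lambda>d. of_rat (fps_nth (fps_X * A) d) * t ^ d"]
    by (simp add: rconv_def)
  also have "\<dots> = suminf (\<lambda>d. t * (of_rat (fps_nth A d) * t ^ d))" unfolding eq by simp
  also have "\<dots> = t * rval A t" unfolding rval_def using assms t by (intro suminf_mult) (simp add: rconv_def)
  finally show "rval (fps_X * A) t = t * rval A t" .
qed

lemma rconv_poly_mult:
  assumes "rconv A"
  shows "rconv (fps_of_poly q * A) \<and> (\<forall>t. 0 < t \<and> t < 1 \<longrightarrow> rval (fps_of_poly q * A) t = ev q t * rval A t)"
proof (induction q)
  case 0
  show ?case by (simp add: rconv_def rval_def ev_simps)
next
  case (pCons a q)
  have "fps_of_poly (pCons a q) * A = fps_const a * A + fps_X * (fps_of_poly q * A)"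
    by (simp add: fps_of_poly_pCons algebra_simps)
  then show ?case
    using rconv_add[OF rconv_const(1)[OF assms] rconv_X(1)] rconv_const(2)[OF assms] rconv_X(2) pCons
    by (simp add: ev_pCons distrib_right mult.assoc)
qed

lemma rconv_X_power:
  assumes "rconv A"
  shows "rconv (fps_X ^ k * A)" "0 < t \<Longrightarrow> t < 1 \<Longrightarrow> rval (fps_X ^ k * A) t = t ^ k * rval A t"
  using rconv_poly_mult[OF assms, of "monom 1 k"] by (auto simp: fps_of_poly_monom' ev_simps)

lemma rval_1: "rval 1 t = 1" and rconv_1: "rconv 1"
proof -
  have "(\<lambda>d. of_rat (fps_nth (1 :: rat fps) d) * t ^ d) sums (of_rat (fps_nth (1 :: rat fps) 0) * t ^ 0)" for t :: real
    by (rule sums_If_finite_set[of "{0}", simplified, of "\<lambda>d. of_rat (fps_nth 1 d) * t ^ d", THEN sums_cong[THEN iffD1, rotated]])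
       (auto simp: fps_one_nth)
  then show "rval 1 t = 1" "rconv 1" by (auto simp: rval_def rconv_def sums_iff)
qed

lemma rval_of_poly: "0 < t \<Longrightarrow> t < 1 \<Longrightarrow> rval (fps_of_poly p) t = ev p t"
  using rconv_poly_mult[OF rconv_1, of p] by (simp add: rval_1)

lemma rval_mono:
  assumes "rconv A" "rconv B" "\<And>d. fps_nth A d \<le> fps_nth B d" "0 < t" "t < 1"
  shows "rval A t \<le> rval B t"
  unfolding rval_def using assms
  by (intro suminf_le mult_right_mono) (auto simp: rconv_def of_rat_less_eq)

lemma rval_ge_first:
  assumes "rconv A" "\<And>d. fps_nth A d \<ge> 0" "0 < t" "t < 1"
  shows "of_rat (fps_nth A 0) \<le> rval A t"
proof -
  have "(\<Sum>d\<in>{0}. of_rat (fps_nth A d) * t ^ d) \<le> rval A t"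
    unfolding rval_def using assms by (intro sum_le_suminf) (auto simp: rconv_def)
  then show ?thesis by simp
qed

lemma power_growth_summable:
  "norm (x::real) < 1 \<Longrightarrow> summable (\<lambda>d. of_nat (d + 1) ^ k * x ^ d)"
proof (induction k arbitrary: x)
  case 0
  then show ?case by (simp add: summable_geometric)
next
  case (Suc k)
  have "summable (\<lambda>d. of_nat d ^ k * x ^ d)" if "norm x < 1" for x :: real
  proof (rule summable_comparison_test[OF _ Suc.IH[of "norm x"]])
    show "\<exists>N. \<forall>d\<ge>N. norm (of_nat d ^ k * x ^ d) \<le> of_nat (d + 1) ^ k * norm x ^ d"
      by (auto simp: abs_mult power_abs intro!: mult_right_mono power_mono exI[of _ 0])
  qed (use that in simp)
  from termdiff_converges[OF Suc.prems this]
  show ?case by (simp add: diffs_def mult_ac)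
qed

text \<open>Hilbert functions grow polynomially.\<close>

lemma rconv_growth:
  assumes "\<And>d. 0 \<le> fps_nth A d" "\<And>d. fps_nth A d \<le> of_nat c * of_nat (d + 1) ^ k"
  shows "rconv A"
  unfolding rconv_def
proof (intro allI impI)
  fix t :: real assume t: "0 < t \<and> t < 1"
  have "summable (\<lambda>d. of_nat c * (of_nat (d + 1) ^ k * t ^ d))"
    using power_growth_summable[of t k] t by (intro summable_mult) simp
  then show "summable (\<lambda>d. of_rat (fps_nth A d) * t ^ d)"
  proof (rule summable_comparison_test[rotated])
    have "of_rat (fps_nth A d) \<le> (of_nat c * of_nat (d + 1) ^ k :: real)" for d
    proof -
      have "of_rat (fps_nth A d) \<le> (of_rat (of_nat c * of_nat (d + 1) ^ k) :: real)"
        using assms(2)[of d] by (simp only: of_rat_less_eq)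
      then show ?thesis by (simp add: of_rat_mult of_rat_power of_rat_add)
    qed
    then show "\<exists>N. \<forall>d\<ge>N. norm (of_rat (fps_nth A d) * t ^ d) \<le> of_nat c * (of_nat (d + 1) ^ k * t ^ d)"
      using t assms(1) by (auto simp: norm_mult norm_power mult.assoc[symmetric] intro!: exI[of _ 0] mult_right_mono)
  qed
qed

section \<open>Expansions at 1\<close>

lemma expansion_at_1_iff:
  "expansion_at_1 f r s \<longleftrightarrow> (\<exists>p q. poly q 1 \<noteq> 0 \<and>
     f = Fract (([:r:] + [:s:] * [:-1, 1:]) * q + [:-1, 1:] ^ 2 * p) q)"
proof -
  have "Fract [:r:] 1 + Fract [:s:] 1 * Fract [:-1, 1:] 1 + Fract [:-1, 1:] 1 ^ 2 * Fract p q =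
      Fract (([:r:] + [:s:] * [:-1, 1:]) * q + [:-1, 1:] ^ 2 * p) q" if "poly q 1 \<noteq> 0" for p q :: "rat poly"
  proof -
    have "q \<noteq> 0" using that by auto
    then show ?thesis by (simp add: power2_eq_square add.commute mult.commute del: mult_pCons_left mult_pCons_right)
  qed
  then show ?thesis unfolding expansion_at_1_def by metis
qed

text \<open>Evaluation at \<open>1\<close> gives \<open>r\<close>; after division by \<open>t - 1\<close> it gives \<open>s\<close>.\<close>

lemma expansion_at_1_unique:
  assumes "expansion_at_1 f r s" "expansion_at_1 f r' s'"
  shows "s = s'"
proof -
  let ?x = "[:-1, 1:] :: rat poly"
  obtain p q where pq: "poly q 1 \<noteq> 0" "f = Fract (([:r:] + [:s:] * ?x) * q + ?x ^ 2 * p) q"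
    using assms(1) unfolding expansion_at_1_iff by blast
  obtain p' q' where pq': "poly q' 1 \<noteq> 0" "f = Fract (([:r':] + [:s':] * ?x) * q' + ?x ^ 2 * p') q'"
    using assms(2) unfolding expansion_at_1_iff by blast
  have "q \<noteq> 0" "q' \<noteq> 0" using pq(1) pq'(1) by auto
  then have eq: "(([:r:] + [:s:] * ?x) * q + ?x ^ 2 * p) * q' = (([:r':] + [:s':] * ?x) * q' + ?x ^ 2 * p') * q"
    using trans[OF pq(2)[symmetric] pq'(2)] eq_fract(1) by blast
  have "poly ((([:r:] + [:s:] * ?x) * q + ?x ^ 2 * p) * q') 1 = poly ((([:r':] + [:s':] * ?x) * q' + ?x ^ 2 * p') * q) 1"
    using eq by (rule arg_cong)
  then have r: "r = r'" using pq(1) pq'(1) by (simp del: mult_pCons_left mult_pCons_right add_pCons)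
  have "?x * (([:s:] * q + ?x * p) * q') = ?x * (([:s':] * q' + ?x * p') * q)"
    using eq unfolding r power2_eq_square by (simp only: algebra_simps)
  then have "([:s:] * q + ?x * p) * q' = ([:s':] * q' + ?x * p') * q"
    by (subst (asm) mult_left_cancel) auto
  then have "poly (([:s:] * q + ?x * p) * q') 1 = poly (([:s':] * q' + ?x * p') * q) 1" by (rule arg_cong)
  then show ?thesis using pq(1) pq'(1) by simp
qed

lemma root_factor:
  assumes "poly p 1 = (0::rat)" obtains p' where "p = [:-1, 1:] * p'"
  using assms poly_eq_0_iff_dvd[of p 1] by (auto elim: dvdE)

lemma expansion_if_regular:
  assumes "poly v 1 \<noteq> 0"
  shows "\<exists>r s. expansion_at_1 (Fract u v) r s"
proof -
  define r where "r = poly u 1 / poly v 1"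
  obtain u1 where u1: "u - [:r:] * v = [:-1, 1:] * u1"
    by (rule root_factor[of "u - [:r:] * v"]) (use assms in \<open>simp add: r_def\<close>)
  define s where "s = poly u1 1 / poly v 1"
  obtain u2 where u2: "u1 - [:s:] * v = [:-1, 1:] * u2"
    by (rule root_factor[of "u1 - [:s:] * v"]) (use assms in \<open>simp add: s_def\<close>)
  have "u = [:r:] * v + [:-1, 1:] * u1" using u1 by (simp only: diff_eq_eq add.commute)
  also have "u1 = [:s:] * v + [:-1, 1:] * u2" using u2 by (simp only: diff_eq_eq add.commute)
  finally have "u = ([:r:] + [:s:] * [:-1, 1:]) * v + [:-1, 1:] ^ 2 * u2"
    unfolding power2_eq_square by (simp only: algebra_simps)
  with assms show ?thesis unfolding expansion_at_1_iff by blast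
qed

lemma taylor_at_1: "\<exists>p2. p = ([:poly p 1:] + [:poly (pderiv p) 1:] * [:-1, 1:]) + [:-1, 1:] ^ 2 * (p2 :: rat poly)"
proof -
  obtain p1 where p1: "p - [:poly p 1:] = [:-1, 1:] * p1" by (rule root_factor[of "p - [:poly p 1:]"]) simp
  then have p: "p = [:poly p 1:] + [:-1, 1:] * p1" by (simp only: diff_eq_eq add.commute)
  have "poly (pderiv p) 1 = poly (pderiv ([:poly p 1:] + [:-1, 1:] * p1)) 1" using p by (rule arg_cong)
  also have "\<dots> = poly p1 1" by (simp add: pderiv_add pderiv_mult pderiv_pCons del: mult_pCons_left mult_pCons_right)
  finally have d: "poly (pderiv p) 1 = poly p1 1" .
  obtain p2 where "p1 - [:poly p1 1:] = [:-1, 1:] * p2" by (rule root_factor[of "p1 - [:poly p1 1:]"]) simp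
  then have "p1 = [:poly p1 1:] + [:-1, 1:] * p2" by (simp only: diff_eq_eq add.commute)
  then have "p = [:poly p 1:] + [:-1, 1:] * ([:poly p1 1:] + [:-1, 1:] * p2)" using p by metis
  then have "p = ([:poly p 1:] + [:poly (pderiv p) 1:] * [:-1, 1:]) + [:-1, 1:] ^ 2 * p2"
    unfolding d power2_eq_square by (simp only: algebra_simps)
  then show ?thesis by blast
qed

lemma expansion_poly: "expansion_at_1 (Fract p 1) (poly p 1) (poly (pderiv p) 1)"
proof -
  obtain p2 where "p = ([:poly p 1:] + [:poly (pderiv p) 1:] * [:-1, 1:]) + [:-1, 1:] ^ 2 * p2"
    using taylor_at_1 by blast
  then show ?thesis unfolding expansion_at_1_iff by (intro exI[of _ p2] exI[of _ 1]) simp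
qed

section \<open>Comparison of Hilbert series near 1\<close>

lemma hilbert_series_eqI:
  assumes "q \<noteq> 0" "fps_of_poly q * hilbert_fps sc N = fps_of_poly p"
  shows "hilbert_series sc N = Fract p q"
  unfolding hilbert_series_def
proof (rule the_equality)
  fix f assume "\<exists>p q. q \<noteq> 0 \<and> f = Fract p q \<and> fps_of_poly q * hilbert_fps sc N = fps_of_poly p"
  then obtain p' q' where f: "q' \<noteq> 0" "f = Fract p' q'" "fps_of_poly q' * hilbert_fps sc N = fps_of_poly p'" by blast
  have "fps_of_poly (p' * q) = fps_of_poly q' * (fps_of_poly q * hilbert_fps sc N)"
    by (simp add: fps_of_poly_mult f(3)[symmetric] mult_ac)
  also have "\<dots> = fps_of_poly (p * q')" by (simp add: assms(2) fps_of_poly_mult mult.commute)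
  finally have "p' * q = p * q'" by (simp only: fps_of_poly_eq_iff)
  then show "f = Fract p q" using f assms(1) by (simp add: eq_fract)
qed (use assms in blast)

text \<open>The denominators vanish at finitely many points only, so near \<open>1\<close> the formal quotient of the series is
  the quotient of their values.\<close>

lemma ratio_link:
  assumes N: "rconv N" "qN \<noteq> 0" "fps_of_poly qN * N = fps_of_poly pN"
    and B: "rconv B" "qB \<noteq> 0" "fps_of_poly qB * B = fps_of_poly pB" "B \<noteq> 0"
    and f: "Fract pN qN / Fract pB qB = Fract u v" "v \<noteq> 0"
  shows "eventually (\<lambda>t. ev u t * rval B t = ev v t * rval N t) (at_left 1)"
proof -
  have "fps_of_poly pB \<noteq> 0" using B(2,4) by (simp flip: B(3))
  then have pB: "pB \<noteq> 0" by auto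
  have "Fract (pN * qB) (qN * pB) = Fract u v" using f(1) by simp
  then have eq: "pN * qB * v = u * (qN * pB)" using f(2) N(2) pB by (simp add: eq_fract)
  have "eventually (\<lambda>t. ev (qN * qB) t \<noteq> 0) (at_left 1)"
    by (rule ev_nonzero_eventually) (use N(2) B(2) in simp)
  moreover have "eventually (\<lambda>t::real. t \<in> {0<..<1}) (at_left 1)" by (rule eventually_at_left_real) simp
  ultimately show ?thesis
  proof eventually_elim
    case (elim t)
    then have t: "0 < t" "t < 1" by auto
    have pNt: "ev pN t = ev qN t * rval N t" using rconv_poly_mult[OF N(1), of qN] t rval_of_poly[OF t, of pN] N(3) by simp
    have pBt: "ev pB t = ev qB t * rval B t" using rconv_poly_mult[OF B(1), of qB] t rval_of_poly[OF t, of pB] B(3) by simp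
    have "ev (pN * qB * v) t = ev (u * (qN * pB)) t" using eq by simp
    then have "ev (qN * qB) t * (ev v t * rval N t) = ev (qN * qB) t * (ev u t * rval B t)"
      by (simp add: ev_simps pNt pBt mult_ac)
    then show ?case using elim(1) by simp
  qed
qed

text \<open>A rational function that is bounded near \<open>1\<close> has no pole there, and the quotient of the two series is
  bounded by \<open>D(t) / t ^ k\<close>.\<close>

lemma expansion_exists:
  assumes N: "rconv N" "qN \<noteq> 0" "fps_of_poly qN * N = fps_of_poly pN" "\<And>d. fps_nth N d \<ge> 0"
    and B: "rconv B" "qB \<noteq> 0" "fps_of_poly qB * B = fps_of_poly pB" "\<And>d. fps_nth B d \<ge> 0" "fps_nth B 0 \<ge> 1"
    and upper: "\<And>d. fps_nth (fps_X ^ k * N) d \<le> fps_nth (fps_of_poly D * B) d"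
  shows "\<exists>r s. expansion_at_1 (Fract pN qN / Fract pB qB) r s"
proof -
  have B0: "B \<noteq> 0" using B(5) by auto
  define f where "f = Fract pN qN / Fract pB qB"
  obtain u0 v0 where "f = Fract u0 v0" "v0 \<noteq> 0" by (cases f) blast
  \<comment> \<open>In a fraction with denominator of least degree, numerator and denominator do not both vanish at \<open>1\<close>.\<close>
  then have "\<exists>v. v \<noteq> 0 \<and> (\<exists>u. f = Fract u v) \<and> (\<forall>v'. v' \<noteq> 0 \<and> (\<exists>u. f = Fract u v') \<longrightarrow> degree v \<le> degree v')"
    using ex_has_least_nat[of "\<lambda>v. v \<noteq> 0 \<and> (\<exists>u. f = Fract u v)" v0 degree] by blast
  then obtain u v where uv: "v \<noteq> 0" "f = Fract u v"
    and min: "\<And>u' v'. v' \<noteq> 0 \<Longrightarrow> f = Fract u' v' \<Longrightarrow> degree v \<le> degree v'" by blast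
  have "poly v 1 \<noteq> 0"
  proof
    assume v1: "poly v 1 = 0"
    then obtain v' where v': "v = [:-1, 1:] * v'" by (rule root_factor)
    have u1: "poly u 1 \<noteq> 0"
    proof
      assume "poly u 1 = 0"
      then obtain u' where u': "u = [:-1, 1:] * u'" by (rule root_factor)
      have "v' \<noteq> 0" using v' uv(1) by auto
      moreover from this have "f = Fract u' v'" unfolding uv(2) u' v' by (intro mult_fract_cancel) simp
      ultimately have "degree v \<le> degree v'" by (rule min)
      moreover have "degree v = Suc (degree v')"
        unfolding v' using \<open>v' \<noteq> 0\<close> by (subst degree_mult_eq) auto
      ultimately show False by simp
    qed
    have "eventually (\<lambda>t. \<bar>ev u t\<bar> * t ^ k \<le> \<bar>ev v t\<bar> * ev D t) (at_left 1)"
      using ratio_link[OF N(1-3) B(1-3) B0 uv(2)[unfolded f_def] uv(1)]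
        eventually_at_left_real[of 0 "1::real", simplified]
    proof eventually_elim
      case (elim t)
      then have t: "0 < t" "t < 1" by auto
      have b: "rval B t \<ge> 1"
        using rval_ge_first[OF B(1,4) t] B(5) by (metis (no_types) of_rat_1 of_rat_less_eq order_trans)
      have "rval (fps_X ^ k * N) t \<le> rval (fps_of_poly D * B) t"
        by (rule rval_mono[OF rconv_X_power(1)[OF N(1)] _ upper t]) (use rconv_poly_mult[OF B(1)] in blast)
      then have up: "t ^ k * rval N t \<le> ev D t * rval B t"
        using rconv_X_power(2)[OF N(1) t, of k] rconv_poly_mult[OF B(1), of D] t by simp
      have "rval N t \<ge> 0" using rval_ge_first[OF N(1,4) t] N(4)[of 0]
        by (meson zero_le_of_rat_iff order_trans)
      have "(\<bar>ev u t\<bar> * t ^ k) * rval B t = t ^ k * \<bar>ev u t * rval B t\<bar>" using b by (simp add: abs_mult mult_ac)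
      also have "\<dots> = \<bar>ev v t\<bar> * (t ^ k * rval N t)"
        unfolding elim(1) using \<open>rval N t \<ge> 0\<close> by (simp add: abs_mult mult_ac)
      also have "\<dots> \<le> \<bar>ev v t\<bar> * (ev D t * rval B t)" using up by (intro mult_left_mono) auto
      finally have "(\<bar>ev u t\<bar> * t ^ k) * rval B t \<le> (\<bar>ev v t\<bar> * ev D t) * rval B t" by (simp add: mult.assoc)
      then show ?case using b by simp
    qed
    moreover have "((\<lambda>t. \<bar>ev u t\<bar> * t ^ k) \<longlongrightarrow> \<bar>ev u 1\<bar> * 1 ^ k) (at_left 1)"
      by (intro tendsto_intros ev_tendsto)
    moreover have "((\<lambda>t. \<bar>ev v t\<bar> * ev D t) \<longlongrightarrow> \<bar>ev v 1\<bar> * ev D 1) (at_left 1)"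
      by (intro tendsto_intros ev_tendsto)
    ultimately have "\<bar>ev u 1\<bar> * 1 ^ k \<le> \<bar>ev v 1\<bar> * ev D 1"
      by (intro tendsto_le[OF trivial_limit_at_left_real])
    then show False using u1 v1 by (simp add: ev_1)
  qed
  then show ?thesis using expansion_if_regular[of v u] uv(2) unfolding f_def by simp
qed

text \<open>The hypotheses \<open>gen\<close> and \<open>SB\<close> bound \<open>Q\<close> from below by \<open>(1 - t) B / P\<close>. So \<open>N / B\<close> is at least
  \<open>D + t ^ \<delta> (1 - t) / P\<close> to the left of \<open>1\<close>, while \<open>upper\<close> forces the same value \<open>D(1)\<close> at \<open>1\<close>. Hence the
  coefficient of \<open>t - 1\<close> in the expansion is strictly smaller than \<open>D'(1)\<close>, contrary to \<open>ex\<close>.\<close>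

lemma expansion_gap:
  assumes N: "rconv N" "qN \<noteq> 0" "fps_of_poly qN * N = fps_of_poly pN"
    and B: "rconv B" "qB \<noteq> 0" "fps_of_poly qB * B = fps_of_poly pB" "\<And>d. fps_nth B d \<ge> 0" "fps_nth B 0 \<ge> 1"
    and Q: "rconv Q" and S: "rconv S"
    and upper: "\<And>d. fps_nth (fps_X ^ k * N) d \<le> fps_nth (fps_of_poly D * B) d"
    and lower: "\<And>d. fps_nth (fps_of_poly D * B + fps_X ^ \<delta> * Q) d \<le> fps_nth N d"
    and gen: "\<And>d. fps_nth S d \<le> fps_nth (fps_of_poly P * Q + fps_X ^ b * S) d"
    and SB: "\<And>d. fps_nth B d \<le> fps_nth S d"
    and b: "b > 0" and P: "poly P 1 > 0" "\<And>t. 0 < t \<Longrightarrow> ev P t > 0"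
    and ex: "expansion_at_1 (Fract pN qN / Fract pB qB) r (poly (pderiv D) 1)"
  shows False
proof -
  define s where "s = poly (pderiv D) 1"
  have B0: "B \<noteq> 0" using B(5) by auto
  obtain p q where q: "poly q 1 \<noteq> 0"
    and f: "Fract pN qN / Fract pB qB = Fract (([:r:] + [:s:] * [:-1, 1:]) * q + [:-1, 1:] ^ 2 * p) q"
    using ex unfolding expansion_at_1_iff s_def by blast
  have q0: "q \<noteq> 0" using q by auto
  obtain D2 where D2: "D = ([:poly D 1:] + [:s:] * [:-1, 1:]) + [:-1, 1:] ^ 2 * D2"
    using taylor_at_1 unfolding s_def by blast
  \<comment> \<open>\<open>R\<close> is the value of \<open>N / B\<close> given by the expansion.\<close>
  define R where "R t = of_rat r + of_rat s * (t - 1) + (t - 1)\<^sup>2 * (ev p t / ev q t)" for t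
  have Dt: "ev D t = of_rat (poly D 1) + of_rat s * (t - 1) + (t - 1)\<^sup>2 * ev D2 t" for t
    by (subst D2) (simp only: ev_simps)
  have q1: "ev q 1 \<noteq> 0" using q by (simp add: ev_1)
  have main: "eventually (\<lambda>t. 0 < t \<and> t < 1 \<and> t ^ k * R t \<le> ev D t \<and> ev D t + t ^ \<delta> * ((1 - t) / ev P t) \<le> R t) (at_left 1)"
    using ratio_link[OF N B(1-3) B0 f q0] ev_nonzero_eventually[OF q0] eventually_at_left_real[of 0 "1::real", simplified]
  proof eventually_elim
    case (elim t)
    then have t: "0 < t" "t < 1" by auto
    have bt: "rval B t \<ge> 1"
      using rval_ge_first[OF B(1,4) t] B(5) by (metis (no_types) of_rat_1 of_rat_less_eq order_trans)
    have "ev (([:r:] + [:s:] * [:-1, 1:]) * q + [:-1, 1:] ^ 2 * p) t = R t * ev q t"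
      using elim(2) unfolding R_def by (simp only: ev_simps) (simp add: field_simps)
    then have "R t * rval B t * ev q t = rval N t * ev q t" using elim(1) by (simp add: mult_ac)
    then have RN: "rval N t = R t * rval B t" using elim(2) by simp
    have "rval (fps_X ^ k * N) t \<le> rval (fps_of_poly D * B) t"
      by (rule rval_mono[OF rconv_X_power(1)[OF N(1)] _ upper t]) (use rconv_poly_mult[OF B(1)] in blast)
    then have "(t ^ k * R t) * rval B t \<le> ev D t * rval B t"
      using rconv_X_power(2)[OF N(1) t, of k] rconv_poly_mult[OF B(1), of D] t RN by simp
    then have 1: "t ^ k * R t \<le> ev D t" using bt by simp
    have DB: "rconv (fps_of_poly D * B)" "rval (fps_of_poly D * B) t = ev D t * rval B t"
      using rconv_poly_mult[OF B(1)] t by blast+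
    have "rval (fps_of_poly D * B + fps_X ^ \<delta> * Q) t \<le> rval N t"
      by (rule rval_mono[OF rconv_add(1)[OF DB(1) rconv_X_power(1)[OF Q]] N(1) lower t])
    then have 2: "ev D t * rval B t + t ^ \<delta> * rval Q t \<le> R t * rval B t"
      using rconv_add(2)[OF DB(1) rconv_X_power(1)[OF Q] t] rconv_X_power(2)[OF Q t] DB(2) RN by simp
    have PQ: "rconv (fps_of_poly P * Q)" "rval (fps_of_poly P * Q) t = ev P t * rval Q t"
      using rconv_poly_mult[OF Q] t by blast+
    have "rval S t \<le> rval (fps_of_poly P * Q + fps_X ^ b * S) t"
      by (rule rval_mono[OF S rconv_add(1)[OF PQ(1) rconv_X_power(1)[OF S]] gen t])
    then have "rval S t \<le> ev P t * rval Q t + t ^ b * rval S t"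
      using rconv_add(2)[OF PQ(1) rconv_X_power(1)[OF S] t] rconv_X_power(2)[OF S t] PQ(2) by simp
    moreover have SBt: "rval B t \<le> rval S t" by (rule rval_mono[OF B(1) S SB t])
    moreover have "t ^ b \<le> t" using t b power_decreasing[of 1 b t] by simp
    ultimately have "(1 - t) * rval S t \<le> ev P t * rval Q t"
      using bt mult_right_mono[of "t ^ b" t "rval S t"] unfolding left_diff_distrib by linarith
    then have "(1 - t) * rval B t \<le> ev P t * rval Q t"
      using SBt t mult_left_mono[of "rval B t" "rval S t" "1 - t"] by linarith
    then have "(1 - t) / ev P t * rval B t \<le> rval Q t" using P(2)[OF t(1)] by (simp add: field_simps)
    then have "t ^ \<delta> * ((1 - t) / ev P t * rval B t) \<le> t ^ \<delta> * rval Q t" using t by (intro mult_left_mono) auto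
    then have "(ev D t + t ^ \<delta> * ((1 - t) / ev P t)) * rval B t \<le> R t * rval B t"
      using 2 by (simp add: algebra_simps)
    then show ?case using 1 t bt by simp
  qed
  have Rlim: "(R \<longlongrightarrow> of_rat r) (at_left 1)"
  proof -
    have "(R \<longlongrightarrow> of_rat r + of_rat s * (1 - 1) + (1 - 1)\<^sup>2 * (ev p 1 / ev q 1)) (at_left 1)"
      unfolding R_def by (intro tendsto_intros ev_tendsto q1)
    then show ?thesis by simp
  qed
  \<comment> \<open>Equal constant terms; the linear terms of \<open>R\<close> and \<open>D\<close> agree by assumption, so \<open>R - D\<close> has order two.\<close>
  have rm: "of_rat r = ev D 1"
  proof (rule antisym)
    have "((\<lambda>t. t ^ k * R t) \<longlongrightarrow> 1 ^ k * of_rat r) (at_left 1)" by (intro tendsto_intros Rlim)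
    then show "of_rat r \<le> ev D 1"
      using tendsto_le[OF trivial_limit_at_left_real ev_tendsto[of D], of "\<lambda>t. t ^ k * R t" "of_rat r"]
        eventually_mono[OF main, of "\<lambda>t. t ^ k * R t \<le> ev D t"] by simp
    have "((\<lambda>t. ev D t + t ^ \<delta> * ((1 - t) / ev P t)) \<longlongrightarrow> ev D 1 + 1 ^ \<delta> * ((1 - 1) / ev P 1)) (at_left 1)"
      using P(1) by (intro tendsto_intros ev_tendsto) (simp add: ev_1)
    then show "ev D 1 \<le> of_rat r"
      using tendsto_le[OF trivial_limit_at_left_real Rlim, of "\<lambda>t. ev D t + t ^ \<delta> * ((1 - t) / ev P t)" "ev D 1"]
        eventually_mono[OF main, of "\<lambda>t. ev D t + t ^ \<delta> * ((1 - t) / ev P t) \<le> R t"] by simp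
  qed
  have "eventually (\<lambda>t. t ^ \<delta> / ev P t \<le> (1 - t) * (ev p t / ev q t - ev D2 t)) (at_left 1)"
    using main
  proof eventually_elim
    case (elim t)
    then have "t ^ \<delta> * ((1 - t) / ev P t) \<le> R t - ev D t" by simp
    also have "R t - ev D t = (t - 1)\<^sup>2 * (ev p t / ev q t - ev D2 t)"
      unfolding R_def Dt rm by (simp add: ev_1 algebra_simps)
    also have "(t - 1)\<^sup>2 * (ev p t / ev q t - ev D2 t) = (1 - t) * ((1 - t) * (ev p t / ev q t - ev D2 t))"
      by (simp add: power2_commute[of t 1]) (simp add: power2_eq_square mult.assoc)
    finally have le: "t ^ \<delta> * ((1 - t) / ev P t) \<le> (1 - t) * ((1 - t) * (ev p t / ev q t - ev D2 t))" .
    have "(1 - t) * (t ^ \<delta> / ev P t) = t ^ \<delta> * ((1 - t) / ev P t)" by simp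
    with le have "(1 - t) * (t ^ \<delta> / ev P t) \<le> (1 - t) * ((1 - t) * (ev p t / ev q t - ev D2 t))" by (simp only:)
    then show ?case by (rule mult_left_le_imp_le) (use elim in simp)
  qed
  moreover have "((\<lambda>t. t ^ \<delta> / ev P t) \<longlongrightarrow> 1 ^ \<delta> / ev P 1) (at_left 1)"
    using P(1) by (intro tendsto_intros ev_tendsto) (simp add: ev_1)
  moreover have "((\<lambda>t. (1 - t) * (ev p t / ev q t - ev D2 t)) \<longlongrightarrow> (1 - 1) * (ev p 1 / ev q 1 - ev D2 1)) (at_left 1)"
    by (intro tendsto_intros ev_tendsto q1)
  ultimately have "1 ^ \<delta> / ev P 1 \<le> (1 - 1) * (ev p 1 / ev q 1 - ev D2 1)"
    by (intro tendsto_le[OF trivial_limit_at_left_real])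
  then show False using P(1) by (simp add: ev_1 divide_le_0_iff)
qed

context covariants
begin

section \<open>The s-invariant of a free module of covariants\<close>

lemma s_cov_eqI:
  assumes "expansion_at_1 (hilbert_series tensor_scale (cov_deg H) / hilbert_series pscale (inv_ring_deg H)) r s"
  shows "s_cov H = s"
  unfolding s_cov_def s_invariant_def
  by (rule the_equality) (use assms expansion_at_1_unique in blast)+

lemma pderiv_degree_poly: "poly (pderiv (\<Sum>j<r. monom 1 (ds j))) (1 :: rat) = of_nat (\<Sum>j<r. ds j)"
  by (simp add: pderiv_sum poly_sum pderiv_monom poly_monom)

text \<open>The quotient of the Hilbert series is the polynomial \<open>D = \<Sum>\<^sub>j t ^ deg \<omega>\<^sub>j\<close>, and \<open>D'(1)\<close> is the sum of the degrees.\<close>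

lemma s_cov_free_basis:
  assumes H: "H \<subseteq> G" and fb: "free_basis H r \<omega>" and \<omega>: "\<And>j. j < r \<Longrightarrow> \<omega> j \<in> hom_cov H"
  shows "s_cov H = of_nat (\<Sum>j<r. cdeg (\<omega> j))"
proof -
  define D :: "rat poly" where "D = (\<Sum>j<r. monom 1 (cdeg (\<omega> j)))"
  obtain q p where q: "q \<noteq> 0" "fps_of_poly q * inv_fps H = fps_of_poly p"
    using inv_fps_rational[OF H] unfolding rational_fps_def by blast
  have "fps_of_poly p \<noteq> 0" using q(1) inv_fps_nonzero[of H] by (simp flip: q(2))
  then have p: "p \<noteq> 0" by auto
  have "fps_of_poly q * cov_fps H = fps_of_poly D * (fps_of_poly q * inv_fps H)"
    using free_basis_fps[of H r \<omega> "\<lambda>j. cdeg (\<omega> j)", OF fb cdeg_cov_deg[OF \<omega>]]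
    unfolding D_def by (simp only: mult.left_commute)
  then have N: "hilbert_series tensor_scale (cov_deg H) = Fract (D * p) q"
    using q by (intro hilbert_series_eqI) (simp_all add: fps_of_poly_mult)
  have "hilbert_series pscale (inv_ring_deg H) = Fract p q" by (rule hilbert_series_eqI[OF q])
  then have "hilbert_series tensor_scale (cov_deg H) / hilbert_series pscale (inv_ring_deg H) = Fract D 1"
    unfolding N using p q(1) by (simp add: eq_fract)
  then have "s_cov H = poly (pderiv D) 1" using s_cov_eqI expansion_poly[of D] by metis
  then show ?thesis by (simp add: D_def pderiv_degree_poly)
qed

section \<open>Bounds for Hilbert functions\<close>

lemma fps_nth_degree_poly_mult:
  "fps_nth (fps_of_poly (\<Sum>x\<in>X. monom 1 (ds x)) * A) d =
    (\<Sum>x\<in>X. if ds x \<le> d then fps_nth A (d - ds x) else (0::rat))"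
  by (simp add: fps_of_poly_sum fps_of_poly_monom' sum_distrib_right fps_sum_nth fps_X_power_mult_nth)
     (rule sum.cong, auto)

lemma inv_ring_deg_dim_le: "P.dim (inv_ring_deg H d) \<le> (d + 1) ^ length bs"
  using P.dim_le_card[OF inv_ring_deg_span monomial_basis_finite] card_monomial_basis order_trans by blast

lemma cov_deg_dim_le: "T.dim (cov_deg H d) \<le> length vs * (d + 1) ^ length bs"
proof -
  have "T.dim (cov_deg H d) \<le> card (tensor_basis d)"
    by (rule T.dim_le_card[OF cov_deg_span tensor_basis_finite])
  also have "\<dots> \<le> (\<Sum>l<length vs. card (unit_tensor l ` monomial_basis (length bs) d))"
    unfolding tensor_basis_def by (rule card_UN_le) simp
  also have "\<dots> \<le> (\<Sum>l<length vs. (d + 1) ^ length bs)"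
    using card_image_le[OF monomial_basis_finite] card_monomial_basis order_trans by (intro sum_mono) blast
  finally show ?thesis by simp
qed

lemma rconv_of_nat:
  assumes "\<And>d. f d \<le> c * (d + 1) ^ k"
  shows "rconv (Abs_fps (\<lambda>d. of_nat (f d)))"
proof (rule rconv_growth)
  fix d
  have "(of_nat (f d) :: rat) \<le> of_nat (c * (d + 1) ^ k)" using assms[of d] by (simp only: of_nat_le_iff)
  then show "fps_nth (Abs_fps (\<lambda>d. of_nat (f d))) d \<le> (of_nat c * of_nat (d + 1) ^ k :: rat)" by simp
qed simp

lemma rconv_inv_fps: "rconv (inv_fps H)"
  unfolding hilbert_fps_def by (rule rconv_of_nat[where c = 1]) (use inv_ring_deg_dim_le in simp)

lemma rconv_cov_fps: "rconv (cov_fps H)"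
  unfolding hilbert_fps_def by (rule rconv_of_nat) (rule cov_deg_dim_le)

section \<open>Homogeneous covariants with non-zero Jacobian\<close>

abbreviation "degs \<omega> \<equiv> \<lambda>j. cdeg (\<omega> j)"

text \<open>Up to sign, \<open>f\<close> is the norm of the Jacobian, an invariant multiple of it. By Cramer's rule it is a
  common denominator of all covariants with respect to \<open>\<omega>\<close>.\<close>

lemma cramer_denominator:
  assumes \<omega>: "\<And>j. j < length vs \<Longrightarrow> \<omega> j \<in> hom_cov G" and nz: "jac \<omega> \<noteq> 0"
  shows "\<exists>f k. f \<noteq> 0 \<and> f \<in> inv_ring_deg G k \<and>
    (\<forall>d a. a \<in> cov_deg G d \<longrightarrow> (\<lambda>i. f * a i) \<in> span_deg G (length vs) \<omega> (degs \<omega>) (k + d))"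
proof -
  define J where "J = jac \<omega>"
  have \<omega>c: "\<omega> j \<in> cov G" if "j < length vs" for j using hom_cov_in[OF \<omega>[OF that]] .
  have J: "J \<in> polyR (length bs)" unfolding J_def by (rule jac_in_polyR[OF \<omega>c])
  define f where "f = esym G J (card G)"
  define k where "k = card G * (\<Sum>j<length vs. cdeg (\<omega> j))"
  have fi: "f \<in> inv_ring G" unfolding f_def by (rule esym_inv_ring[OF subgrp_G J])
  have "homogeneous (\<Sum>j<length vs. cdeg (\<omega> j)) J"
    unfolding J_def by (rule jac_homogeneous[OF cov_degD(2)[OF cdeg_cov_deg[OF \<omega>]]])
  then have fh: "homogeneous k f" unfolding f_def k_def by (rule esym_homogeneous)
  have "{A. A \<subseteq> G \<and> card A = card G} = {G}" using card_subset_eq[OF G_finite] by blast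
  then have f: "f = (\<Prod>h\<in>G. - act h J)" by (simp add: f_def esym_def)
  have "act h J \<noteq> 0" if "h \<in> G" for h
  proof
    assume "act h J = 0"
    then have "act (inv_into UNIV h \<circ> h) J = 0"
      using act_comp[OF G_inv[OF that] that J] by (simp add: act_simps)
    then show False using G_inv_comp(1)[OF that] act_id[OF J] nz by (simp add: J_def)
  qed
  then have f0: "f \<noteq> 0" unfolding f using G_finite by (simp add: prod_zero_iff)
  define f' where "f' = - (\<Prod>h\<in>G - {id}. - act h J)"
  have ff: "f = f' * J"
    unfolding f f'_def by (subst prod.remove[OF G_finite G_id]) (simp add: act_id[OF J] mult.commute)
  have f'R: "f' \<in> polyR (length bs)"
    unfolding f'_def by (intro polyR_uminus polyR_prod act_polyR J)
  have "(\<lambda>i. f * a i) \<in> span_deg G (length vs) \<omega> (degs \<omega>) (k + d)" if a: "a \<in> cov_deg G d" for a d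
  proof -
    have ac: "a \<in> cov G" using cov_degD(1)[OF a] .
    define c where "c j = f' * jac (\<omega>(j := a))" for j
    have cinv: "c j \<in> inv_ring G" if j: "j < length vs" for j
    proof (rule inv_ringI)
      have up: "(\<omega>(j := a)) l \<in> cov G" if "l < length vs" for l using \<omega>c ac that by simp
      show "c j \<in> polyR (length bs)" unfolding c_def by (intro polyR_mult f'R jac_in_polyR[OF up])
      fix g assume g: "g \<in> G"
      let ?r = "pconst (rdet (inv_into UNIV g))"
      have "act g f' * (?r * J) = act g (f' * J)"
        unfolding J_def using jac_semi_inv[OF \<omega>c g] by (simp add: act_simps)
      also have "\<dots> = f' * J" using inv_ringD(2)[OF fi g] by (simp only: ff)
      finally have "act g f' * ?r = f'" using nz by (simp add: J_def mult.assoc[symmetric])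
      moreover have "act g (c j) = act g f' * ?r * jac (\<omega>(j := a))"
        unfolding c_def using jac_semi_inv[of "\<omega>(j := a)", OF up g subset_refl]
        by (simp add: act_simps mult.assoc)
      ultimately show "act g (c j) = c j" by (simp add: c_def)
    qed
    have eq: "(\<lambda>i. f * a i) = (\<lambda>i. \<Sum>j<length vs. c j * \<omega> j i)"
    proof
      fix i
      show "f * a i = (\<Sum>j<length vs. c j * \<omega> j i)"
      proof (cases "i < length vs")
        case True
        have "f * a i = f' * (J * a i)" by (simp add: ff mult.assoc)
        also have "J * a i = (\<Sum>j<length vs. jac (\<omega>(j := a)) * \<omega> j i)"
          unfolding J_def jac_eq_dt by (rule dt_cramer[OF nz[unfolded jac_eq_dt] True])
        finally show ?thesis by (simp add: c_def sum_distrib_left mult.assoc)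
      next
        case False
        have "a i = 0" using covD(1)[OF ac] False by (simp add: tensor_space_def)
        moreover have "\<omega> j i = 0" if "j < length vs" for j
          using covD(1)[OF \<omega>c[OF that]] False by (simp add: tensor_space_def)
        ultimately show ?thesis by simp
      qed
    qed
    have "(\<lambda>i. f * a i) \<in> cov_deg G (k + d)"
    proof (rule cov_degI)
      show "(\<lambda>i. f * a i) \<in> cov G" using cov_sum[of "{()}" "\<lambda>_. f" G "\<lambda>_. a"] fi ac by simp
      show "homogeneous (k + d) (f * a i)" for i by (rule homogeneous_mult[OF fh cov_degD(2)[OF a]])
    qed
    then show ?thesis by (rule cov_deg_in_span_deg[OF _ cdeg_cov_deg[OF \<omega>] cinv eq])
  qed
  with f0 fi fh show ?thesis unfolding inv_ring_deg_def by blast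
qed

lemma independent_over_if_jac_nonzero:
  assumes "jac \<omega> \<noteq> 0"
  shows "independent_over H (length vs) \<omega>"
  unfolding independent_over_def
proof (intro allI impI)
  fix c j assume c: "(\<forall>j<length vs. c j \<in> inv_ring H) \<and> (\<lambda>i. \<Sum>j<length vs. c j * \<omega> j i) = (\<lambda>i. 0)"
    and j: "j < length vs"
  have "(\<Sum>l<length vs. c l * \<omega> l i) = 0" for i using c by (metis (no_types, lifting))
  then show "c j = 0" using dt_independent[OF assms[unfolded jac_eq_dt]] j by blast
qed

text \<open>Multiplication by a common denominator of degree \<open>k\<close> embeds the covariants into the span of \<open>\<omega>\<close>.\<close>

lemma cov_fps_upper_bound:
  assumes \<omega>: "\<And>j. j < length vs \<Longrightarrow> \<omega> j \<in> hom_cov G" and nz: "jac \<omega> \<noteq> 0"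
  shows "\<exists>k. \<forall>d. fps_nth (fps_X ^ k * cov_fps G) d \<le>
    fps_nth (fps_of_poly (\<Sum>j<length vs. monom 1 (degs \<omega> j)) * inv_fps G) d"
proof -
  let ?S = "span_deg G (length vs) \<omega> (degs \<omega>)"
  note ind = independent_over_if_jac_nonzero[OF nz, of G]
  obtain f k where f: "f \<noteq> 0" "f \<in> inv_ring_deg G k"
    and fS: "\<And>d a. a \<in> cov_deg G d \<Longrightarrow> (\<lambda>i. f * a i) \<in> ?S (k + d)"
    using cramer_denominator[OF \<omega> nz] by blast
  have "fps_nth (fps_X ^ k * cov_fps G) d \<le> fps_nth (hilbert_fps tensor_scale ?S) d" for d
  proof (cases "k \<le> d")
    case True
    have inj: "a = 0" if "a \<in> cov_deg G (d - k)" "(\<lambda>i. f * a i) = 0" for a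
      using that(2) f(1) by (auto simp: fun_eq_iff zero_fun_def)
    note im = dim_image_inj[OF scale_tensor_linear cov_deg_subspace cov_deg_span tensor_basis_finite inj]
    have sub: "(\<lambda>a i. f * a i) ` cov_deg G (d - k) \<subseteq> ?S d" using fS[of _ "d - k"] True by auto
    have "\<exists>S. finite S \<and> ?S d \<subseteq> T.span S" using span_deg_dim[OF ind] by blast
    then obtain S where S: "finite S" "?S d \<subseteq> T.span S" by blast
    have subsp: "T.subspace (?S d)" using span_deg_dim[OF ind] by blast
    have "T.dim (cov_deg G (d - k)) = T.dim ((\<lambda>a i. f * a i) ` cov_deg G (d - k))" by (rule im(1)[symmetric])
    also have "\<dots> \<le> T.dim (?S d)"
      by (rule T.dim_mono_finite[OF im(2) subsp sub S(2,1)])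
    finally show ?thesis using True by (simp add: fps_X_power_mult_nth hilbert_fps_def)
  qed (simp add: fps_X_power_mult_nth hilbert_fps_def)
  then show ?thesis unfolding span_deg_fps[OF ind] by blast
qed

text \<open>Multiples of \<open>a\<close> by invariants outside \<open>W\<close> lie outside the span of \<open>\<omega>\<close> and so contribute to the
  Hilbert function.\<close>

lemma cov_deg_lower_bound:
  assumes \<omega>: "\<And>j. j < length vs \<Longrightarrow> \<omega> j \<in> hom_cov G" and nz: "jac \<omega> \<noteq> 0"
    and a: "a \<in> cov_deg G e"
    and W: "\<And>p. p \<in> inv_ring G \<Longrightarrow>
      (\<lambda>i. p * a i) \<in> span_deg G (length vs) \<omega> (degs \<omega>) (d + e) \<Longrightarrow> p \<in> W"
    and b: "b \<subseteq> inv_ring_deg G d" "finite b" "P.independent b" "P.span b \<inter> W \<subseteq> {0}"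
  shows "T.dim (span_deg G (length vs) \<omega> (degs \<omega>) (d + e)) + card b \<le> T.dim (cov_deg G (d + e))"
proof -
  let ?S = "span_deg G (length vs) \<omega> (degs \<omega>) (d + e)"
  define \<phi> where "\<phi> = (\<lambda>p i. p * a i)"
  have lin: "Vector_Spaces.linear pscale tensor_scale \<phi>"
    unfolding Vector_Spaces.linear_iff \<phi>_def
    by (auto simp: vector_space_pscale vector_space_tensor_scale fun_eq_iff pscale_def tensor_scale_def algebra_simps)
  have ind: "independent_over G (length vs) \<omega>" by (rule independent_over_if_jac_nonzero[OF nz])
  have S: "T.subspace ?S" "\<exists>S. finite S \<and> ?S \<subseteq> T.span S" using span_deg_dim[OF ind] by blast+
  then obtain F where F: "finite F" "?S \<subseteq> T.span F" by blast
  have spb: "P.span b \<subseteq> inv_ring_deg G d" by (rule P.span_minimal[OF b(1) inv_ring_deg_subspace])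
  have key: "p = 0" if "p \<in> P.span b" "\<phi> p \<in> ?S" for p
    using W[of p] that spb b(4) inv_ring_degD(1) unfolding \<phi>_def by blast
  have inj: "p = 0" if "p \<in> P.span b" "\<phi> p = 0" for p
    using key[OF that(1)] that(2) T.subspace_0[OF S(1)] by simp
  note im = dim_image_inj[OF lin P.subspace_span subset_refl b(2) inj]
  have disj: "?S \<inter> \<phi> ` P.span b \<subseteq> {0}"
  proof
    fix z assume "z \<in> ?S \<inter> \<phi> ` P.span b"
    then obtain p where "z = \<phi> p" "p \<in> P.span b" "\<phi> p \<in> ?S" by blast
    with key[of p] show "z \<in> {0}" by (simp add: \<phi>_def zero_fun_def)
  qed
  have sub: "{x + y | x y. x \<in> ?S \<and> y \<in> \<phi> ` P.span b} \<subseteq> cov_deg G (d + e)"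
  proof
    fix z assume "z \<in> {x + y | x y. x \<in> ?S \<and> y \<in> \<phi> ` P.span b}"
    then obtain x p where z: "z = x + \<phi> p" "x \<in> ?S" "p \<in> P.span b" by blast
    have p: "p \<in> inv_ring G" "homogeneous d p" using z(3) spb inv_ring_degD by blast+
    have "\<phi> p \<in> cov_deg G (d + e)" unfolding \<phi>_def
    proof (rule cov_degI)
      show "(\<lambda>i. p * a i) \<in> cov G"
        using cov_sum[of "{()}" "\<lambda>_. p" G "\<lambda>_. a"] p(1) cov_degD(1)[OF a] by simp
      show "homogeneous (d + e) (p * a i)" for i by (rule homogeneous_mult[OF p(2) cov_degD(2)[OF a]])
    qed
    moreover have "x \<in> cov_deg G (d + e)" using span_deg_in_cov_deg[of "length vs" \<omega> G "degs \<omega>" "d + e"] cdeg_cov_deg[OF \<omega>] z(2) by blast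
    ultimately show "z \<in> cov_deg G (d + e)" unfolding z(1) by (intro T.subspace_add cov_deg_subspace)
  qed
  have "T.dim ?S + card b = T.dim ?S + T.dim (\<phi> ` P.span b)"
    using im(1) P.dim_eq_card_independent[OF b(3)] by simp
  also have "\<dots> = T.dim {x + y | x y. x \<in> ?S \<and> y \<in> \<phi> ` P.span b}"
    by (rule T.dim_direct_sum[symmetric, OF S(1) F(2,1) im(2,3) finite_imageI[OF b(2)] disj])
  also have "\<dots> \<le> T.dim (cov_deg G (d + e))"
    by (rule T.dim_mono_finite[OF T.subspace_sums[OF S(1) im(2)] cov_deg_subspace sub cov_deg_span tensor_basis_finite])
  finally show ?thesis .
qed

text \<open>The polynomial ring is finite over the invariants: modulo \<open>\<pi>\<close> it is spanned by the products of
  small monomials with representatives of the invariants.\<close>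

lemma coord_ring_dim_bound:
  assumes \<pi>: "\<pi> \<in> polyR (length bs)" "homogeneous c \<pi>" "\<pi> \<noteq> 0"
    and b: "\<And>e. b e \<subseteq> inv_ring_deg G e" "\<And>e. finite (b e)"
    and compl: "\<And>e x. x \<in> inv_ring_deg G e \<Longrightarrow> \<exists>y\<in>P.span (b e). \<pi> dvd x - y"
  shows "P.dim (inv_ring_deg {} d) \<le> (\<Sum>\<alpha>\<in>small_expo. if mdeg \<alpha> \<le> d then card (b (d - mdeg \<alpha>)) else 0) +
    (if c \<le> d then P.dim (inv_ring_deg {} (d - c)) else 0)"
proof -
  define A where "A \<alpha> = (if mdeg \<alpha> \<le> d then (\<lambda>y. Poly_Mapping.single \<alpha> 1 * y) ` b (d - mdeg \<alpha>) else {})" for \<alpha>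
  obtain s where s: "s \<subseteq> inv_ring_deg {} (d - c)" "P.span s = inv_ring_deg {} (d - c)" "finite s"
    "card s = P.dim (inv_ring_deg {} (d - c))"
    using P.finite_dim_basis[OF inv_ring_deg_subspace inv_ring_deg_span monomial_basis_finite] by metis
  define B where "B = (if c \<le> d then (\<lambda>h. \<pi> * h) ` s else {})"
  let ?E = "(\<Union>\<alpha>\<in>small_expo. A \<alpha>) \<union> B"
  have fin: "finite ?E" using small_expo_finite b(2) s(3) by (auto simp: A_def B_def)
  have "inv_ring_deg {} d \<subseteq> orb_span d"
    using homogeneous_orb_span by (auto simp: inv_ring_deg_def dest: inv_ringD(1))
  also have "orb_span d \<subseteq> P.span ?E"
    unfolding orb_span_def
  proof (rule P.span_minimal[OF _ P.subspace_span], rule subsetI)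
    fix z assume "z \<in> {orb_mon \<beta> * Poly_Mapping.single \<alpha> (1::'k) | \<beta> \<alpha>.
     \<beta> \<in> expo orb_num \<and> \<alpha> \<in> small_expo \<and> weight orb_num orb_deg \<beta> + mdeg \<alpha> = d}"
    then obtain \<beta> \<alpha> where z: "z = orb_mon \<beta> * Poly_Mapping.single \<alpha> 1" and \<beta>: "\<beta> \<in> expo orb_num"
      and \<alpha>: "\<alpha> \<in> small_expo" and d: "weight orb_num orb_deg \<beta> + mdeg \<alpha> = d" by blast
    define e where "e = weight orb_num orb_deg \<beta>"
    let ?\<alpha> = "Poly_Mapping.single \<alpha> (1::'k)"
    have \<alpha>R: "?\<alpha> \<in> polyR (length bs)" "homogeneous (mdeg \<alpha>) ?\<alpha>"
      using \<alpha> by (auto simp: polyR_def small_expo_def homogeneous_iff_mdeg)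
    have "orb_mon \<beta> \<in> inv_ring_deg G e"
      using orb_mon_inv_ring[OF \<beta>] orb_mon_homogeneous[OF \<beta>] by (simp add: inv_ring_deg_def e_def)
    from compl[OF this] obtain y where y: "y \<in> P.span (b e)" "\<pi> dvd orb_mon \<beta> - y" by blast
    have yi: "y \<in> inv_ring_deg G e" using y(1) P.span_minimal[OF b(1) inv_ring_deg_subspace] by blast
    define w where "w = orb_mon \<beta> - y"
    have w: "w \<in> inv_ring_deg G e"
      unfolding w_def by (rule P.subspace_diff[OF inv_ring_deg_subspace \<open>orb_mon \<beta> \<in> _\<close> yi])
    interpret m: Vector_Spaces.linear pscale pscale "\<lambda>p. ?\<alpha> * p" by (rule mult_linear)
    have "?\<alpha> * y \<in> P.span ((\<lambda>y. ?\<alpha> * y) ` b e)" using y(1) m.span_image by blast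
    moreover have "(\<lambda>y. ?\<alpha> * y) ` b e \<subseteq> ?E"
    proof -
      have "A \<alpha> = (\<lambda>y. ?\<alpha> * y) ` b e" using d by (auto simp: A_def e_def)
      then show ?thesis using \<alpha> by blast
    qed
    ultimately have 1: "?\<alpha> * y \<in> P.span ?E" using P.span_mono by blast
    obtain h0 where h0: "h0 \<in> polyR (length bs)" "w = \<pi> * h0"
      using dvd_polyR[OF y(2)[folded w_def] \<pi>(1) inv_ringD(1)[OF inv_ring_degD(1)[OF w]]] by blast
    define h where "h = h0 * ?\<alpha>"
    have hR: "h \<in> polyR (length bs)" unfolding h_def by (intro polyR_mult h0(1) \<alpha>R(1))
    have wh: "?\<alpha> * w = \<pi> * h" by (simp add: h0(2) h_def mult_ac)
    have 2: "?\<alpha> * w \<in> P.span ?E"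
    proof (cases "h = 0")
      case True
      then show ?thesis unfolding wh using P.span_zero by simp
    next
      case False
      have "homogeneous (mdeg \<alpha> + e) (?\<alpha> * w)" by (rule homogeneous_mult[OF \<alpha>R(2) inv_ring_degD(2)[OF w]])
      then have hom: "homogeneous d (h * \<pi>)" using d unfolding wh by (simp add: e_def add.commute mult.commute)
      then have hh: "homogeneous (degree (grade h)) h" by (rule homogeneous_factor) (use False \<pi>(3) in simp)
      have "degree (grade h) + c = d"
        using homogeneous_degree_unique[OF homogeneous_mult[OF hh \<pi>(2)] hom] False \<pi>(3) by simp
      then have c: "c \<le> d" "degree (grade h) = d - c" by auto
      have "h \<in> P.span s" using hR hh unfolding s(2) c(2) inv_ring_deg_def by (auto intro: inv_ringI)
      interpret n: Vector_Spaces.linear pscale pscale "\<lambda>p. \<pi> * p" by (rule mult_linear)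
      have "\<pi> * h \<in> P.span ((\<lambda>p. \<pi> * p) ` s)" using \<open>h \<in> P.span s\<close> n.span_image by blast
      moreover have "(\<lambda>p. \<pi> * p) ` s \<subseteq> ?E" using c(1) by (simp add: B_def)
      ultimately show ?thesis unfolding wh using P.span_mono by blast
    qed
    have "z = ?\<alpha> * y + ?\<alpha> * w" by (simp add: z w_def algebra_simps)
    then show "z \<in> P.span ?E" using P.span_add[OF 1 2] by simp
  qed
  finally have "P.dim (inv_ring_deg {} d) \<le> card ?E" by (rule P.dim_le_card) (rule fin)
  also have "\<dots> \<le> card (\<Union>\<alpha>\<in>small_expo. A \<alpha>) + card B" by (rule card_Un_le)
  also have "\<dots> \<le> (\<Sum>\<alpha>\<in>small_expo. card (A \<alpha>)) + card B"
    by (intro add_right_mono card_UN_le small_expo_finite)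
  also have "\<dots> \<le> (\<Sum>\<alpha>\<in>small_expo. if mdeg \<alpha> \<le> d then card (b (d - mdeg \<alpha>)) else 0) +
    (if c \<le> d then P.dim (inv_ring_deg {} (d - c)) else 0)"
    using b(2) s(3,4) by (intro add_mono sum_mono) (auto simp: A_def B_def card_image_le intro: order_trans[OF card_image_le])
  finally show ?thesis .
qed

text \<open>For some \<open>j\<close> and \<open>a\<close> the Cramer coefficient \<open>jac (\<omega>(j := a)) / jac \<omega>\<close> is not a polynomial; let \<open>\<pi>\<close> be a
  prime in its denominator. If \<open>p a\<close> is in the span of \<open>\<omega>\<close>, then \<open>p\<close> times this coefficient is a
  polynomial, so \<open>\<pi>\<close> divides \<open>p\<close>.\<close>

lemma obstruction_prime:
  assumes \<omega>: "\<And>j. j < length vs \<Longrightarrow> \<omega> j \<in> hom_cov G" and nz: "jac \<omega> \<noteq> 0"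
    and nfree: "\<not> free_basis G (length vs) \<omega>"
  shows "\<exists>\<pi> a. prime_in (length bs) \<pi> \<and> \<pi> dvd jac \<omega> \<and> a \<in> hom_cov G \<and>
    (\<forall>p\<in>inv_ring G. (\<exists>c. \<forall>i<length vs. p * a i = (\<Sum>j<length vs. c j * \<omega> j i)) \<longrightarrow> \<pi> dvd p)"
proof -
  have \<omega>c: "\<omega> j \<in> cov G" if "j < length vs" for j using hom_cov_in[OF \<omega>[OF that]] .
  have "\<not> (\<forall>j a. j < length vs \<longrightarrow> a \<in> hom_cov G \<longrightarrow> jac \<omega> dvd jac (\<omega>(j := a)))"
    using free_basis_if_cramer_dvd[OF \<omega> nz] nfree by blast
  then obtain j a where j: "j < length vs" and a: "a \<in> hom_cov G" and ndvd: "\<not> jac \<omega> dvd jac (\<omega>(j := a))"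
    by blast
  let ?J = "jac \<omega>" and ?K = "jac (\<omega>(j := a))"
  have J: "?J \<in> polyR (length bs)" by (rule jac_in_polyR[OF \<omega>c])
  have K: "?K \<in> polyR (length bs)"
    by (rule jac_in_polyR[where H = G]) (use \<omega>c hom_cov_in[OF a] in simp)
  have "?K \<noteq> 0" using ndvd by auto
  then obtain \<pi> k where \<pi>: "prime_in (length bs) \<pi>" "\<pi> ^ k dvd ?J" "\<not> \<pi> ^ k dvd ?K"
    using dvd_if_prime_powers_dvd[OF J nz K] ndvd by blast
  have "k \<noteq> 0" using \<pi>(3) by (intro notI) simp
  then have "\<pi> dvd ?J" using \<pi>(2) dvd_power[of k \<pi>] dvd_trans by blast
  moreover have "\<pi> dvd p" if p: "p \<in> inv_ring G"
    and c: "\<And>i. i < length vs \<Longrightarrow> p * a i = (\<Sum>l<length vs. c l * \<omega> l i)" for p c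
  proof (rule ccontr)
    assume np: "\<not> \<pi> dvd p"
    have "p * ?K = dt (length vs) ((\<omega>(j := a))(j := \<lambda>i. \<Sum>l<length vs. (if l = j then p else 0) * (\<omega>(j := a)) l i))"
      unfolding jac_eq_dt by (subst dt_coeff[OF j]) simp
    also have "\<dots> = dt (length vs) (\<omega>(j := (\<lambda>i. p * a i)))"
    proof (rule dt_cong)
      fix l i
      have "(\<Sum>l<length vs. (if l = j then p else 0) * (\<omega>(j := a)) l i) = (\<Sum>l<length vs. if l = j then p * a i else 0)"
        by (rule sum.cong) auto
      also have "\<dots> = p * a i" using j by simp
      finally show "((\<omega>(j := a))(j := \<lambda>i. \<Sum>l<length vs. (if l = j then p else 0) * (\<omega>(j := a)) l i)) l i =
          (\<omega>(j := (\<lambda>i. p * a i))) l i" by simp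
    qed
    also have "\<dots> = dt (length vs) (\<omega>(j := \<lambda>i. \<Sum>l<length vs. c l * \<omega> l i))"
      by (rule dt_cong) (simp add: c(1))
    also have "\<dots> = c j * ?J" unfolding jac_eq_dt by (rule dt_coeff[OF j])
    finally have "\<pi> ^ k dvd p * ?K" using \<pi>(2) by simp
    then have "\<pi> ^ k dvd ?K" using prime_in_power_dvd[OF \<pi>(1) inv_ringD(1)[OF p] K np] by blast
    with \<pi>(3) show False ..
  qed
  ultimately show ?thesis using \<pi>(1) a by blast
qed


text \<open>If \<open>\<omega>\<close> is not a basis, then some homogeneous covariant \<open>a\<close> has its conductor into the span of \<open>\<omega>\<close>
  inside a prime ideal \<open>(\<pi>)\<close>. The multiples of \<open>a\<close> by invariants modulo \<open>\<pi>\<close> enlarge the Hilbert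
  function in codimension one, which the \<open>s\<close>-invariant detects.\<close>

theorem free_basis_if_degree_sum:
  assumes \<omega>: "\<And>j. j < length vs \<Longrightarrow> \<omega> j \<in> hom_cov G" and nz: "jac \<omega> \<noteq> 0"
    and deg: "of_nat (\<Sum>j<length vs. cdeg (\<omega> j)) = s_cov G"
  shows "free_basis G (length vs) \<omega>"
proof (rule ccontr)
  assume "\<not> free_basis G (length vs) \<omega>"
  from obstruction_prime[OF \<omega> nz this] obtain \<pi> a where \<pi>: "prime_in (length bs) \<pi>" "\<pi> dvd jac \<omega>"
    and a: "a \<in> hom_cov G"
    and cond: "\<forall>p\<in>inv_ring G. (\<exists>c. \<forall>i<length vs. p * a i = (\<Sum>j<length vs. c j * \<omega> j i)) \<longrightarrow> \<pi> dvd p"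
    by blast
  have \<pi>': "\<pi> \<in> polyR (length bs)" "\<pi> \<noteq> 0" "\<not> \<pi> dvd 1" using prime_inD[OF \<pi>(1)] by blast+
  define c where "c = degree (grade \<pi>)"
  have c0: "c > 0" unfolding c_def by (rule degree_grade_nonunit[OF \<pi>'(2,3)])
  have \<pi>h: "homogeneous c \<pi>"
  proof -
    obtain h where h: "jac \<omega> = \<pi> * h" using \<pi>(2) by blast
    have "homogeneous (\<Sum>j<length vs. cdeg (\<omega> j)) (jac \<omega>)"
      by (rule jac_homogeneous[OF cov_degD(2)[OF cdeg_cov_deg[OF \<omega>]]])
    then show ?thesis unfolding c_def using nz unfolding h by (rule homogeneous_factor)
  qed
  define W where "W = {p. \<pi> dvd p}"
  have W: "P.subspace W"
    unfolding P.subspace_def W_def pscale_def by auto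
  have "\<forall>e. \<exists>b. b \<subseteq> inv_ring_deg G e \<and> finite b \<and> P.independent b \<and> P.span b \<inter> W \<subseteq> {0} \<and>
      (\<forall>x\<in>inv_ring_deg G e. \<exists>y\<in>P.span b. x - y \<in> W)"
  proof (intro allI, rule P.complement_basis[OF inv_ring_deg_subspace inv_ring_deg_span monomial_basis_finite W])
    fix e b
    assume h: "b \<subseteq> inv_ring_deg G e" "finite b" "P.independent b" "P.span b \<inter> W \<subseteq> {0}"
      "\<And>x. x \<in> inv_ring_deg G e \<Longrightarrow> \<exists>y\<in>P.span b. x - y \<in> W"
    show "\<exists>b. b \<subseteq> inv_ring_deg G e \<and> finite b \<and> P.independent b \<and> P.span b \<inter> W \<subseteq> {0} \<and>
      (\<forall>x\<in>inv_ring_deg G e. \<exists>y\<in>P.span b. x - y \<in> W)"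
      by (intro exI[of _ b] conjI ballI h)
  qed
  from choice[OF this] obtain b where b': "\<forall>e. b e \<subseteq> inv_ring_deg G e \<and> finite (b e) \<and>
      P.independent (b e) \<and> P.span (b e) \<inter> W \<subseteq> {0} \<and>
      (\<forall>x\<in>inv_ring_deg G e. \<exists>y\<in>P.span (b e). x - y \<in> W)" ..
  then have b: "\<And>e. b e \<subseteq> inv_ring_deg G e" "\<And>e. finite (b e)" "\<And>e. P.independent (b e)"
    "\<And>e. P.span (b e) \<inter> W \<subseteq> {0}" by simp_all
  have compl: "\<exists>y\<in>P.span (b e). \<pi> dvd x - y" if "x \<in> inv_ring_deg G e" for e x
    using b' that unfolding W_def by (metis mem_Collect_eq)
  define \<delta> where "\<delta> = cdeg a"
  define D :: "rat poly" where "D = (\<Sum>j<length vs. monom 1 (degs \<omega> j))"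
  define P :: "rat poly" where "P = (\<Sum>\<alpha>\<in>small_expo. monom 1 (mdeg \<alpha>))"
  \<comment> \<open>\<open>b d\<close> is a basis of the invariants of degree \<open>d\<close> modulo \<open>\<pi>\<close>, so \<open>Q\<close> is the Hilbert series of the image of the invariant ring in \<open>k[V]/(\<pi>)\<close>.\<close>
  define Q :: "rat fps" where "Q = Abs_fps (\<lambda>d. of_nat (card (b d)))"
  let ?S = "span_deg G (length vs) \<omega> (degs \<omega>)"
  have D_span: "fps_of_poly D * inv_fps G = hilbert_fps tensor_scale ?S"
    unfolding D_def by (rule span_deg_fps[OF independent_over_if_jac_nonzero[OF nz], symmetric])
  have Q: "rconv Q" unfolding Q_def
  proof (rule rconv_of_nat)
    fix d
    have "card (b d) \<le> P.dim (inv_ring_deg G d)"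
      by (rule P.card_independent_le_dim[OF inv_ring_deg_subspace inv_ring_deg_span monomial_basis_finite b(3,1)])
    also have "\<dots> \<le> (d + 1) ^ length bs" by (rule inv_ring_deg_dim_le)
    finally show "card (b d) \<le> 1 * (d + 1) ^ length bs" by simp
  qed
  have lower: "fps_nth (fps_of_poly D * inv_fps G + fps_X ^ \<delta> * Q) d \<le> fps_nth (cov_fps G) d" for d
  proof (cases "\<delta> \<le> d")
    case True
    have "T.dim (?S ((d - \<delta>) + \<delta>)) + card (b (d - \<delta>)) \<le> T.dim (cov_deg G ((d - \<delta>) + \<delta>))"
    proof (rule cov_deg_lower_bound[where W = W, OF \<omega> nz _ _ b(1-4)])
      show "a \<in> cov_deg G \<delta>" unfolding \<delta>_def by (rule cdeg_cov_deg[OF a])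
      fix p assume p: "p \<in> inv_ring G" and "(\<lambda>i. p * a i) \<in> ?S (d - \<delta> + \<delta>)"
      then obtain q where "(\<lambda>i. p * a i) = (\<lambda>i. \<Sum>j<length vs. q j * \<omega> j i)"
        unfolding span_deg_def by blast
      then have "\<forall>i<length vs. p * a i = (\<Sum>j<length vs. q j * \<omega> j i)" by (simp add: fun_eq_iff)
      with cond p show "p \<in> W" unfolding W_def by blast
    qed
    then have "T.dim (?S d) + card (b (d - \<delta>)) \<le> T.dim (cov_deg G d)" using True by simp
    then have "(of_nat (T.dim (?S d) + card (b (d - \<delta>))) :: rat) \<le> of_nat (T.dim (cov_deg G d))"
      by (simp only: of_nat_le_iff)
    with True show ?thesis unfolding D_span by (simp add: hilbert_fps_def fps_X_power_mult_nth Q_def)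
  next
    case False
    have "T.dim (?S d) \<le> T.dim (cov_deg G d)"
    proof (rule T.dim_mono_finite[OF _ cov_deg_subspace _ cov_deg_span tensor_basis_finite])
      show "T.subspace (?S d)"
        using span_deg_dim[OF independent_over_if_jac_nonzero[OF nz], of G "degs \<omega>" d] by blast
      show "?S d \<subseteq> cov_deg G d"
        using span_deg_in_cov_deg[of "length vs" \<omega> G "degs \<omega>" d] cdeg_cov_deg[OF \<omega>] by blast
    qed
    with False show ?thesis unfolding D_span by (simp add: hilbert_fps_def fps_X_power_mult_nth)
  qed
  obtain k where upper: "\<And>d. fps_nth (fps_X ^ k * cov_fps G) d \<le> fps_nth (fps_of_poly D * inv_fps G) d"
    using cov_fps_upper_bound[OF \<omega> nz] unfolding D_def by blast
  have gen: "fps_nth (inv_fps {}) d \<le> fps_nth (fps_of_poly P * Q + fps_X ^ c * inv_fps {}) d" for d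
  proof -
    have "(of_nat (P.dim (inv_ring_deg {} d)) :: rat) \<le>
      of_nat ((\<Sum>\<alpha>\<in>small_expo. if mdeg \<alpha> \<le> d then card (b (d - mdeg \<alpha>)) else 0) +
      (if c \<le> d then P.dim (inv_ring_deg {} (d - c)) else 0))"
      unfolding of_nat_le_iff by (rule coord_ring_dim_bound[OF \<pi>'(1) \<pi>h \<pi>'(2) b(1,2) compl])
    also have "\<dots> = fps_nth (fps_of_poly P * Q + fps_X ^ c * inv_fps {}) d"
      unfolding P_def fps_add_nth fps_nth_degree_poly_mult
      by (simp add: fps_X_power_mult_nth hilbert_fps_def Q_def if_distrib[of of_nat] cong: if_cong)
    finally show ?thesis by (simp add: hilbert_fps_def)
  qed
  have SB: "fps_nth (inv_fps G) d \<le> fps_nth (inv_fps {}) d" for d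
  proof -
    have "inv_ring_deg G d \<subseteq> inv_ring_deg {} d" by (auto simp: inv_ring_deg_def inv_ring_def)
    then have "P.dim (inv_ring_deg G d) \<le> P.dim (inv_ring_deg {} d)"
      by (rule P.dim_mono_finite[OF inv_ring_deg_subspace inv_ring_deg_subspace _ inv_ring_deg_span monomial_basis_finite])
    then show ?thesis by (simp add: hilbert_fps_def)
  qed
  have ne: "small_expo \<noteq> {}" using card_G_pos by (auto simp: small_expo_def intro!: exI[of _ 0])
  have P1: "poly P 1 > 0"
    using ne small_expo_finite by (simp add: P_def poly_sum poly_monom card_gt_0_iff)
  have Pt: "ev P t > 0" if "0 < t" for t
    unfolding P_def ev_sum ev_simps using ne small_expo_finite that by (intro sum_pos) simp_all
  obtain qB pB where B: "qB \<noteq> 0" "fps_of_poly qB * inv_fps G = fps_of_poly pB"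
    using inv_fps_rational[OF subset_refl] unfolding rational_fps_def by blast
  obtain qN pN where N: "qN \<noteq> 0" "fps_of_poly qN * cov_fps G = fps_of_poly pN"
    using cov_fps_rational[OF subset_refl] unfolding rational_fps_def by blast
  have nonneg: "fps_nth (inv_fps G) d \<ge> 0" "fps_nth (cov_fps G) d \<ge> 0" for d
    by (simp_all add: hilbert_fps_def)
  obtain r s where rs: "expansion_at_1 (Fract pN qN / Fract pB qB) r s"
    using expansion_exists[OF rconv_cov_fps N nonneg(2) rconv_inv_fps B nonneg(1) inv_fps_0 upper] by blast
  then have "s_cov G = s"
    using hilbert_series_eqI[OF N] hilbert_series_eqI[OF B] s_cov_eqI by simp
  then have "s = poly (pderiv D) 1" using deg by (simp add: D_def pderiv_degree_poly)
  with rs have ex: "expansion_at_1 (Fract pN qN / Fract pB qB) r (poly (pderiv D) 1)" by simp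
  show False
    by (rule expansion_gap[OF rconv_cov_fps N rconv_inv_fps B nonneg(1) inv_fps_0 Q rconv_inv_fps
          upper lower gen SB c0 P1 Pt ex])
qed

end

theorem theorem3:
  fixes scV :: "'k::field \<Rightarrow> 'v::ab_group_add \<Rightarrow> 'v"
    and scM :: "'k \<Rightarrow> 'm::ab_group_add \<Rightarrow> 'm"
    and bs :: "'v list"
    and G :: "('v \<Rightarrow> 'v) set"
    and vs :: "'m list"
    and \<rho> :: "('v \<Rightarrow> 'v) \<Rightarrow> 'm \<Rightarrow> 'm"
    and x :: "'v set \<Rightarrow> 'v \<Rightarrow> 'k"
  assumes "covariants scV scM bs G vs \<rho>"
    and "\<forall>U. covariants.hyperplane scV U \<longrightarrow> covariants.hyperplane_form scV U (x U)"
  shows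
    "(\<forall>U. covariants.hyperplane scV U \<longrightarrow>
        (let G\<^sub>U = covariants.stab G U; e\<^sub>U = covariants.e_inv scV scM bs G vs \<rho> U in
          covariants.jac_module scV scM bs vs \<rho> G\<^sub>U =
            {f * covariants.form_poly bs (x U) ^ e\<^sub>U | f. f \<in> covariants.inv_ring scV bs G\<^sub>U} \<and>
          covariants.jac_module scV scM bs vs \<rho> G\<^sub>U \<subseteq>
            covariants.semi_inv scV bs G\<^sub>U (covariants.top_char scM vs \<rho>) \<and>
          of_nat e\<^sub>U = covariants.s_cov scV scM bs vs \<rho> G\<^sub>U))
     \<and>
     (covariants.is_gcd_of bs (covariants.F_poly scV scM bs G vs \<rho> x)
        (covariants.jac_module scV scM bs vs \<rho> G) \<and>
      covariants.jac_module scV scM bs vs \<rho> G \<subseteq>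
        {f * covariants.F_poly scV scM bs G vs \<rho> x | f. f \<in> covariants.coord_ring bs})
     \<and>
     (\<forall>\<omega>. (\<forall>j<length vs. \<omega> j \<in> covariants.hom_cov scV scM bs vs \<rho> G) \<longrightarrow>
        (covariants.free_basis scV scM bs vs \<rho> G (length vs) \<omega> \<longleftrightarrow>
          (\<exists>c. c \<noteq> 0 \<and>
             covariants.jac vs \<omega> = pconst c * covariants.F_poly scV scM bs G vs \<rho> x)) \<and>
        ((\<exists>c. c \<noteq> 0 \<and>
             covariants.jac vs \<omega> = pconst c * covariants.F_poly scV scM bs G vs \<rho> x) \<longleftrightarrow>
          of_nat (\<Sum>j<length vs. covariants.cdeg vs (\<omega> j)) =
            covariants.s_cov scV scM bs vs \<rho> G \<and>
          covariants.jac vs \<omega> \<noteq> 0))"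
proof -
  interpret covariants scV scM bs G vs \<rho> by fact
  have x: "\<And>U. hyperplane U \<Longrightarrow> hyperplane_form U (x U)" using assms(2) by blast
  show ?thesis unfolding Let_def
  proof (intro conjI allI impI)
    fix U assume U: "hyperplane U"
    note U' = U x[OF U]
    show "jac_module (stab U) = {f * form_poly (x U) ^ e_inv U | f. f \<in> inv_ring (stab U)}"
      by (rule jac_module_hyperplane[OF U'])
    show "jac_module (stab U) \<subseteq> semi_inv (stab U) top_char"
      by (rule jac_module_semi_inv[OF stab_subgrp[OF U']])
    obtain \<eta> where \<eta>: "\<forall>j<length vs. \<eta> j \<in> hom_cov (stab U)" "free_basis (stab U) (length vs) \<eta>"
      "e_inv U = (\<Sum>j<length vs. cdeg (\<eta> j))"
      using hyperplane_free_basis[OF U'] by blast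
    have "s_cov (stab U) = of_nat (\<Sum>j<length vs. cdeg (\<eta> j))"
      using \<eta> by (intro s_cov_free_basis) (auto simp: stab_def)
    then show "of_nat (e_inv U) = s_cov (stab U)" by (simp only: \<eta>(3))
  next
    show "is_gcd_of (F_poly x) (jac_module G)" by (rule F_poly_is_gcd[OF x])
    show "jac_module G \<subseteq> {f * F_poly x | f. f \<in> coord_ring}" by (rule jac_module_F_poly[OF x])
  next
    fix \<omega> assume \<omega>: "\<forall>j<length vs. \<omega> j \<in> hom_cov G"
    show crit: "free_basis G (length vs) \<omega> \<longleftrightarrow> (\<exists>c. c \<noteq> 0 \<and> jac \<omega> = pconst c * F_poly x)"
      by (rule jacobian_criterion_F[OF x \<omega>])
    show "(\<exists>c. c \<noteq> 0 \<and> jac \<omega> = pconst c * F_poly x) \<longleftrightarrow>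
        of_nat (\<Sum>j<length vs. cdeg (\<omega> j)) = s_cov G \<and> jac \<omega> \<noteq> 0"
    proof
      assume c: "\<exists>c. c \<noteq> 0 \<and> jac \<omega> = pconst c * F_poly x"
      then have "free_basis G (length vs) \<omega>" using crit by blast
      then have "s_cov G = of_nat (\<Sum>j<length vs. cdeg (\<omega> j))"
        by (rule s_cov_free_basis[OF subset_refl]) (use \<omega> in blast)
      moreover have "jac \<omega> \<noteq> 0" using c F_poly_nonzero[OF x] by auto
      ultimately show "of_nat (\<Sum>j<length vs. cdeg (\<omega> j)) = s_cov G \<and> jac \<omega> \<noteq> 0" by simp
    next
      assume s: "of_nat (\<Sum>j<length vs. cdeg (\<omega> j)) = s_cov G \<and> jac \<omega> \<noteq> 0"
      have "free_basis G (length vs) \<omega>"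
        by (rule free_basis_if_degree_sum) (use s \<omega> in blast)+
      then show "\<exists>c. c \<noteq> 0 \<and> jac \<omega> = pconst c * F_poly x" using crit by blast
    qed
  qed
qed

end
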